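(* Let $m>2$ be an integer. For each integer $k\ge 0$, the operator $L_k=-\Delta-(2m+1)Q_k^{2m}$, acting on radial functions on $\Omega$ with Dirichlet boundary condition, has essential spectrum $[0,+\infty)$, has no zero energy state, and has exactly $k+1$ eigenvalues that are negative and simple.
   Context: $\mathbb B\subset\mathbb R^3$ is the unit ball centered at the origin and $\Omega=\mathbb R^3\setminus\mathbb B$. $\dot H^1_0(\Omega)$ is the completion of $C_c^\infty(\Omega)$ for the norm $\|\nabla f\|_{L^2}$. Stationary solutions (known facts): the radial solutions $Q\in\dot H^1_0(\Omega)$ of $-\Delta Q=Q^{2m+1}$ in $\Omega$, $Q_{|\partial\Omega}=0$, are exactly $0$ and $\pm Q_k$, $k\ge 0$, where $Q_k$ has exactly $k$ zeros on $(1,\infty)$ (as a function of $r=|x|$) and $\lim_{r\to\infty}rQ_k(r)>0$. $L_k$ is the self-adjoint operator on $L^2_{\rm rad}(\Omega)$ with domain $\{f\in H^1_0(\Omega): f \text{ radial},\ -\Delta f\in L^2(\Omega)\}$. A zero energy state of $L_k$ is a nonzero (radial) function $h\in H^2_{\rm loc}(\overline\Omega)$ such that $\langle x\rangle^{-1}h\in L^2(\Omega)$, $L_kh=0$ and $h_{|\partial\Omega}=0$, where $\langle x\rangle=(1+|x|^2)^{1/2}$. *)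

theory Defs
  imports "HOL-Analysis.Analysis"
begin

text \<open>
  Elements of Lebesgue and Sobolev spaces are represented by functions; two functions that agree
  almost everywhere on the domain represent the same element. Derivatives of such functions are
  taken in the sense of distributions. Directions of differentiation range over the
  standard basis \<^term>\<open>Basis\<close>.
\<close>

section \<open>Test functions and weak derivatives\<close>

definition partial_deriv ::
    "'a::euclidean_space \<Rightarrow> ('a \<Rightarrow> 'b::real_normed_vector) \<Rightarrow> 'a \<Rightarrow> 'b" where
  "partial_deriv b f = (\<lambda>x. frechet_derivative f (at x) b)"

fun Ck :: "nat \<Rightarrow> ('a::euclidean_space \<Rightarrow> 'b::real_normed_vector) \<Rightarrow> bool" where
  "Ck 0 f \<longleftrightarrow> continuous_on UNIV f"
| "Ck (Suc n) f \<longleftrightarrow> (\<forall>x. f differentiable (at x)) \<and> (\<forall>b\<in>Basis. Ck n (partial_deriv b f))"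

definition test_functions :: "'a::euclidean_space set \<Rightarrow> ('a \<Rightarrow> 'b::real_normed_vector) set" where
  "test_functions U = {\<phi>. (\<forall>n. Ck n \<phi>) \<and>
     compact (closure {x. \<phi> x \<noteq> 0}) \<and> closure {x. \<phi> x \<noteq> 0} \<subseteq> U}"

definition loc_integrable :: "'a::euclidean_space set \<Rightarrow> ('a \<Rightarrow> 'b::euclidean_space) \<Rightarrow> bool" where
  "loc_integrable U f \<longleftrightarrow> (\<forall>K. compact K \<and> K \<subseteq> U \<longrightarrow> set_integrable lebesgue K f)"

definition has_weak_partial ::
    "'a::euclidean_space set \<Rightarrow> 'a \<Rightarrow> ('a \<Rightarrow> 'b::euclidean_space) \<Rightarrow> ('a \<Rightarrow> 'b) \<Rightarrow> bool" where
  "has_weak_partial U b f g \<longleftrightarrow> loc_integrable U f \<and> loc_integrable U g \<and>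
     (\<forall>\<phi> :: 'a \<Rightarrow> real. \<phi> \<in> test_functions U \<longrightarrow>
        (LINT x:U|lebesgue. partial_deriv b \<phi> x *\<^sub>R f x) = - (LINT x:U|lebesgue. \<phi> x *\<^sub>R g x))"

definition has_weak_laplacian ::
    "'a::euclidean_space set \<Rightarrow> ('a \<Rightarrow> 'b::euclidean_space) \<Rightarrow> ('a \<Rightarrow> 'b) \<Rightarrow> bool" where
  "has_weak_laplacian U f w \<longleftrightarrow> loc_integrable U f \<and> loc_integrable U w \<and>
     (\<forall>\<phi> :: 'a \<Rightarrow> real. \<phi> \<in> test_functions U \<longrightarrow>
        (LINT x:U|lebesgue. (\<Sum>b\<in>Basis. partial_deriv b (partial_deriv b \<phi>) x) *\<^sub>R f x)
          = (LINT x:U|lebesgue. \<phi> x *\<^sub>R w x))"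

text \<open>A representative of the distributional Laplacian, unique almost everywhere on an open set
  \<open>U\<close>; meaningful only if the Laplacian is locally integrable.\<close>

definition weak_laplacian ::
    "'a::euclidean_space set \<Rightarrow> ('a \<Rightarrow> 'b::euclidean_space) \<Rightarrow> 'a \<Rightarrow> 'b" where
  "weak_laplacian U f = (SOME w. has_weak_laplacian U f w)"

section \<open>Function spaces\<close>

definition L2 :: "'a::euclidean_space set \<Rightarrow> ('a \<Rightarrow> 'b::euclidean_space) set" where
  "L2 U = {f. set_borel_measurable lebesgue U f \<and> set_integrable lebesgue U (\<lambda>x. (norm (f x))\<^sup>2)}"

definition l2norm :: "'a::euclidean_space set \<Rightarrow> ('a \<Rightarrow> 'b::euclidean_space) \<Rightarrow> real" where
  "l2norm U f = sqrt (LINT x:U|lebesgue. (norm (f x))\<^sup>2)"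

text \<open>The closure of the test functions in \<open>H\<^sup>1(U)\<close>; the limit \<open>g\<close> of the gradients is necessarily
  the weak gradient of \<open>f\<close>.\<close>

definition H10 :: "'a::euclidean_space set \<Rightarrow> ('a \<Rightarrow> 'b::euclidean_space) set" where
  "H10 U = {f \<in> L2 U. \<exists>(g :: 'a \<Rightarrow> 'a \<Rightarrow> 'b) (\<phi> :: nat \<Rightarrow> 'a \<Rightarrow> 'b).
     (\<forall>b\<in>Basis. g b \<in> L2 U) \<and> (\<forall>n. \<phi> n \<in> test_functions U) \<and>
     (\<lambda>n. l2norm U (\<lambda>x. \<phi> n x - f x)) \<longlonglongrightarrow> 0 \<and>
     (\<forall>b\<in>Basis. (\<lambda>n. l2norm U (\<lambda>x. partial_deriv b (\<phi> n) x - g b x)) \<longlonglongrightarrow> 0)}"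

text \<open>The completion of the test functions for the norm of the gradient in \<open>L\<^sup>2\<close>. In dimension three
  (the only case used below) Sobolev's inequality shows that a sequence of test functions that is
  Cauchy for this norm converges in \<open>L\<^sup>6\<close>, hence in \<open>L\<^sup>1\<close> on compact sets, and that the limit function
  determines the element of the completion. The completion is therefore identified with the space
  of these limits.\<close>

definition Hdot10 :: "'a::euclidean_space set \<Rightarrow> ('a \<Rightarrow> 'b::euclidean_space) set" where
  "Hdot10 U = {f. loc_integrable U f \<and> (\<exists>(g :: 'a \<Rightarrow> 'a \<Rightarrow> 'b) (\<phi> :: nat \<Rightarrow> 'a \<Rightarrow> 'b).
     (\<forall>b\<in>Basis. g b \<in> L2 U) \<and> (\<forall>n. \<phi> n \<in> test_functions U) \<and>
     (\<forall>K. compact K \<and> K \<subseteq> U \<longrightarrow> (\<lambda>n. LINT x:K|lebesgue. norm (\<phi> n x - f x)) \<longlonglongrightarrow> 0) \<and>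
     (\<forall>b\<in>Basis. (\<lambda>n. l2norm U (\<lambda>x. partial_deriv b (\<phi> n) x - g b x)) \<longlonglongrightarrow> 0))}"

text \<open>\<open>H\<^sup>2\<^sub>l\<^sub>o\<^sub>c\<close> up to the boundary: weak derivatives of order at most two are square integrable on
  every bounded part of \<open>U\<close>.\<close>

definition H2_loc_closure :: "'a::euclidean_space set \<Rightarrow> ('a \<Rightarrow> 'b::euclidean_space) set" where
  "H2_loc_closure U = {f. \<exists>(g :: 'a \<Rightarrow> 'a \<Rightarrow> 'b) (w :: 'a \<Rightarrow> 'a \<Rightarrow> 'a \<Rightarrow> 'b).
     (\<forall>b\<in>Basis. has_weak_partial U b f (g b)) \<and>
     (\<forall>b\<in>Basis. \<forall>c\<in>Basis. has_weak_partial U c (g b) (w b c)) \<and>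
     (\<forall>R. f \<in> L2 (U \<inter> ball 0 R) \<and> (\<forall>b\<in>Basis. g b \<in> L2 (U \<inter> ball 0 R)) \<and>
        (\<forall>b\<in>Basis. \<forall>c\<in>Basis. w b c \<in> L2 (U \<inter> ball 0 R)))}"

section \<open>The exterior of the unit ball and the stationary solutions\<close>

definition Omega :: "(real^3) set" where
  "Omega = - cball 0 1"

definition ae_eq :: "(real^3 \<Rightarrow> 'b) \<Rightarrow> (real^3 \<Rightarrow> 'b) \<Rightarrow> bool" where
  "ae_eq f g \<longleftrightarrow> (AE x in lebesgue. x \<in> Omega \<longrightarrow> f x = g x)"

definition radial :: "(real^3 \<Rightarrow> 'b) \<Rightarrow> bool" where
  "radial f \<longleftrightarrow> (\<exists>p :: real \<Rightarrow> 'b. ae_eq f (\<lambda>x. p (norm x)))"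

text \<open>Finite energy solutions of \<open>-\<Delta>Q = Q^(2m+1)\<close> in \<open>Omega\<close> with Dirichlet condition, given by their
  representative that is continuous up to the boundary.\<close>

definition stationary_solution :: "nat \<Rightarrow> (real^3 \<Rightarrow> real) \<Rightarrow> bool" where
  "stationary_solution m Q \<longleftrightarrow> Q \<in> Hdot10 Omega \<and> continuous_on (closure Omega) Q \<and>
     has_weak_laplacian Omega Q (\<lambda>x. - (Q x ^ (2 * m + 1))) \<and> (\<forall>x\<in>frontier Omega. Q x = 0)"

text \<open>The function \<open>Q\<^sub>k\<close>: by the classification of the radial stationary solutions there is, up to
  its values off the closure of \<open>Omega\<close>, exactly one \<open>Q\<close> with this property for given \<open>k\<close>.\<close>

definition is_Qk :: "nat \<Rightarrow> nat \<Rightarrow> (real^3 \<Rightarrow> real) \<Rightarrow> bool" where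
  "is_Qk m k Q \<longleftrightarrow> stationary_solution m Q \<and>
     (\<exists>q :: real \<Rightarrow> real. (\<forall>x\<in>Omega. Q x = q (norm x)) \<and>
        finite {r. r > 1 \<and> q r = 0} \<and> card {r. r > 1 \<and> q r = 0} = k \<and>
        (\<exists>l > 0. ((\<lambda>r. r * q r) \<longlongrightarrow> l) at_top))"

section \<open>Spectral notions for operators on radial functions\<close>

text \<open>An operator on the complex Hilbert space of radial square integrable functions is given by its
  domain \<open>D\<close> and a map \<open>A\<close> on functions, with values understood up to almost everywhere equality.\<close>

definition L2_rad :: "(real^3 \<Rightarrow> complex) set" where
  "L2_rad = {f \<in> L2 Omega. radial f}"

type_synonym operator = "(real^3 \<Rightarrow> complex) \<Rightarrow> (real^3 \<Rightarrow> complex)"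

text \<open>\<open>A - z\<close> maps \<open>D\<close> onto the whole space and has a bounded inverse; the estimate contains
  injectivity.\<close>

definition resolvent_set :: "(real^3 \<Rightarrow> complex) set \<Rightarrow> operator \<Rightarrow> complex set" where
  "resolvent_set D A = {z.
     (\<forall>g\<in>L2_rad. \<exists>f\<in>D. ae_eq (\<lambda>x. A f x - z * f x) g) \<and>
     (\<exists>C. \<forall>f\<in>D. l2norm Omega f \<le> C * l2norm Omega (\<lambda>x. A f x - z * f x))}"

definition spectrum :: "(real^3 \<Rightarrow> complex) set \<Rightarrow> operator \<Rightarrow> complex set" where
  "spectrum D A = - resolvent_set D A"

definition eigenspace ::
    "(real^3 \<Rightarrow> complex) set \<Rightarrow> operator \<Rightarrow> complex \<Rightarrow> (real^3 \<Rightarrow> complex) set" where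
  "eigenspace D A z = {f \<in> D. ae_eq (A f) (\<lambda>x. z * f x)}"

definition eigenvalues :: "(real^3 \<Rightarrow> complex) set \<Rightarrow> operator \<Rightarrow> complex set" where
  "eigenvalues D A = {z. \<exists>f\<in>eigenspace D A z. \<not> ae_eq f (\<lambda>x. 0)}"

text \<open>The dimension of the space, modulo almost everywhere equality, is at most \<open>n\<close>.\<close>

definition dim_at_most :: "nat \<Rightarrow> (real^3 \<Rightarrow> complex) set \<Rightarrow> bool" where
  "dim_at_most n S \<longleftrightarrow> (\<exists>b :: nat \<Rightarrow> real^3 \<Rightarrow> complex. (\<forall>i<n. b i \<in> S) \<and>
     (\<forall>f\<in>S. \<exists>c :: nat \<Rightarrow> complex. ae_eq f (\<lambda>x. \<Sum>i<n. c i * b i x)))"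

definition simple_eigenvalue :: "(real^3 \<Rightarrow> complex) set \<Rightarrow> operator \<Rightarrow> complex \<Rightarrow> bool" where
  "simple_eigenvalue D A z \<longleftrightarrow> z \<in> eigenvalues D A \<and> dim_at_most 1 (eigenspace D A z)"

text \<open>The essential spectrum of a self-adjoint operator: the spectrum without the isolated
  eigenvalues of finite multiplicity.\<close>

definition essential_spectrum :: "(real^3 \<Rightarrow> complex) set \<Rightarrow> operator \<Rightarrow> complex set" where
  "essential_spectrum D A = spectrum D A -
     {z \<in> eigenvalues D A. z isolated_in spectrum D A \<and> (\<exists>n. dim_at_most n (eigenspace D A z))}"

section \<open>The linearized operator\<close>

definition lin_domain :: "(real^3 \<Rightarrow> complex) set" where
  "lin_domain = {f \<in> H10 Omega. radial f \<and> (\<exists>w\<in>L2 Omega. has_weak_laplacian Omega f w)}"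

definition lin_op :: "nat \<Rightarrow> (real^3 \<Rightarrow> real) \<Rightarrow> operator" where
  "lin_op m Q f = (\<lambda>x. - weak_laplacian Omega f x
                       - complex_of_real (real (2 * m + 1) * Q x ^ (2 * m)) * f x)"

text \<open>The boundary value is that of the representative continuous up to the boundary, which exists
  for functions that are locally \<open>H\<^sup>2\<close> in dimension three.\<close>

definition zero_energy_state :: "nat \<Rightarrow> (real^3 \<Rightarrow> real) \<Rightarrow> (real^3 \<Rightarrow> complex) \<Rightarrow> bool" where
  "zero_energy_state m Q h \<longleftrightarrow> \<not> ae_eq h (\<lambda>x. 0) \<and> radial h \<and> h \<in> H2_loc_closure Omega \<and>
     (\<lambda>x. h x /\<^sub>R sqrt (1 + (norm x)\<^sup>2)) \<in> L2 Omega \<and>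
     ae_eq (lin_op m Q h) (\<lambda>x. 0) \<and>
     (\<exists>h'. continuous_on (closure Omega) h' \<and> ae_eq h h' \<and> (\<forall>x\<in>frontier Omega. h' x = 0))"

end

theory Submission
imports Defs
begin

text \<open>
 Writing a radial function as \<open>u(r)/r\<close> turns the operator into \<open>- u'' + V u\<close> on \<open>(1, \<infinity>)\<close> with
 \<open>u(1) = 0\<close>, where \<open>V = - (2m+1) Q^(2m)\<close> is \<open>O(r^(-2m))\<close>. The Jost solution \<open>e(k, r)\<close>, which behaves like
 \<open>exp (- k r)\<close>, together with a second solution gives a Green operator whenever \<open>e(k, 1) ~= 0\<close> and
 \<open>Re k > 0\<close>; so the spectrum off \<open>[0, \<infinity>)\<close> consists of the simple eigenvalues \<open>- k^2\<close> with \<open>e(k, 1) = 0\<close>,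
 and Weyl sequences show that \<open>[0, \<infinity>)\<close> is contained in the essential spectrum.
 The winding of \<open>(e, e')\<close>, monotone both in \<open>r\<close> at zeros and in \<open>k\<close>, identifies the number of
 zeros \<open>k > 0\<close> of \<open>e(k, 1)\<close> with the number of zeros of \<open>e(0, r)\<close> on \<open>(1, \<infinity>)\<close>, provided \<open>e(0, 1) ~= 0\<close>.
 With \<open>y = r Q\<close>, scaling invariance of the nonlinear equation shows that \<open>W = r y' - (1 - 1/m) y\<close>
 solves the linear equation at energy zero, so that \<open>e(0, r)\<close> is a multiple of \<open>W\<close>. Here
 \<open>W(1) = y'(1) ~= 0\<close>, which excludes a zero energy state, and a monotone energy shows that \<open>W\<close>
 vanishes exactly once between consecutive zeros of \<open>y\<close> and once after the last one.
\<close>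

text \<open>The operator is defined through weak derivatives in three-dimensional space, while every
  estimate concerns an ordinary differential equation; the passage between the two shapes the proof.
  No regularity is shown for elements of the domain. Green's formula makes the operator symmetric
  for the bilinear pairing, without conjugation, and the Green operator supplies enough solutions to
  test with: this duality yields the resolvent bound and the simplicity of the eigenvalues. The
  Green operator is written down for continuous data of compact support and extended by closedness.
  Only \<open>Q\<close> and a zero energy state, both continuous up to the boundary, are
  regularised, by a second order du Bois-Reymond argument. The Jost solution must be controlled down
  to \<open>k = 0\<close>, where kernels with a factor \<open>1 / k\<close> fail; it therefore comes
  from two nested integrals, one for the derivative and one for the function. The winding is that of
  a continuous angle on a rectangle in \<open>(k, r)\<close>, so large that two of its sides carry
  no zeros.\<close>

abbreviation (input) cts where "cts == continuous_on"
abbreviation (input) cx where "cx == complex_of_real"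
abbreviation (input) pd where "pd == partial_deriv"
abbreviation (input) leb where "leb == lebesgue"
abbreviation (input) bm where "bm == borel_measurable borel"
notation (input) has_vector_derivative (infix "hvd" 50)
notation (input) scaleR (infixr "*R" 75)
notation (input) tendsto (infixr "~~>" 55)
abbreviation (input) hrd :: "(real => real) => real => real filter => bool" (infix "hrd" 50)
 where "(f hrd D) F == (f has_field_derivative D) F"
abbreviation (input) seqlim (infixr "--->" 60) where "X ---> L == (X ~~> L) sequentially"

section \<open>Functions of class C^k\<close>

lemma partial_deriv_eq: "(f has_derivative f') (at x) ==> pd b f x = f' b"
 unfolding partial_deriv_def by (metis frechet_derivative_at)

lemma Ck_continuous: "Ck n f ==> cts UNIV f"
 by (cases n) (auto intro!: continuous_at_imp_continuous_on differentiable_imp_continuous_within)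

lemma Ck_SucD: "Ck (Suc n) f ==> Ck n f"
proof (induction n arbitrary: f)
 case 0
 thus ?case using Ck_continuous[OF 0] by simp
qed auto

lemma Ck_SucI:
 assumes "!!x. (f has_derivative f' x) (at x)" "!!b. b : Basis ==> Ck n (%x. f' x b)"
 shows "Ck (Suc n) f"
proof -
 have "pd b f = (%x. f' x b)" for b
  using partial_deriv_eq[OF assms(1)] by auto
 thus ?thesis using assms differentiableI[OF assms(1)] by auto
qed

lemma Ck_SucE:
 assumes "Ck (Suc n) f"
 obtains f' where "!!x. (f has_derivative f' x) (at x)" "!!b. b : Basis ==> Ck n (%x. f' x b)"
proof
 show "(f has_derivative frechet_derivative f (at x)) (at x)" for x
  using assms by (auto simp: frechet_derivative_works[symmetric])
 show "Ck n (%x. frechet_derivative f (at x) b)" if "b : Basis" for b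
  using assms that by (auto simp: partial_deriv_def[symmetric])
qed

lemma Ck_const: "Ck n (%x. c)"
proof (induction n arbitrary: c)
 case (Suc n)
 show ?case by (rule Ck_SucI[where f'="%x h. 0"]) (auto intro: Suc)
qed simp

lemma Ck_bounded_linear:
 assumes "bounded_linear h" "Ck n f"
 shows "Ck n (%x. h (f x))"
 using assms(2)
proof (induction n arbitrary: f)
 case 0
 thus ?case by (auto intro!: bounded_linear.continuous_on[OF assms(1)])
next
 case (Suc n)
 obtain f' where f: "!!x. (f has_derivative f' x) (at x)"
   "!!b. b : Basis ==> Ck n (%x. f' x b)" using Ck_SucE[OF Suc.prems] by blast
 show ?case
  by (rule Ck_SucI[OF bounded_linear.has_derivative[OF assms(1) f(1)]]) (use Suc.IH f in auto)
qed

lemma Ck_add: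
 assumes "Ck n f" "Ck n g"
 shows "Ck n (%x. f x + g x)"
 using assms
proof (induction n arbitrary: f g)
 case 0
 thus ?case by (auto intro!: continuous_intros)
next
 case (Suc n)
 obtain f' where f: "!!x. (f has_derivative f' x) (at x)"
   "!!b. b : Basis ==> Ck n (%x. f' x b)" using Ck_SucE[OF Suc.prems(1)] by blast
 obtain g' where g: "!!x. (g has_derivative g' x) (at x)"
   "!!b. b : Basis ==> Ck n (%x. g' x b)" using Ck_SucE[OF Suc.prems(2)] by blast
 show ?case
  by (rule Ck_SucI[OF has_derivative_add[OF f(1) g(1)]]) (use Suc.IH f g in auto)
qed

lemma Ck_scaleR:
 assumes "Ck n f" "Ck n g"
 shows "Ck n (%x. f x *R g x)"
 using assms
proof (induction n arbitrary: f g)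
 case 0
 thus ?case by (auto intro!: continuous_intros)
next
 case (Suc n)
 obtain f' where f: "!!x. (f has_derivative f' x) (at x)"
   "!!b. b : Basis ==> Ck n (%x. f' x b)" using Ck_SucE[OF Suc.prems(1)] by blast
 obtain g' where g: "!!x. (g has_derivative g' x) (at x)"
   "!!b. b : Basis ==> Ck n (%x. g' x b)" using Ck_SucE[OF Suc.prems(2)] by blast
 show ?case
  by (rule Ck_SucI[OF has_derivative_scaleR[OF f(1) g(1)]])
    (use Suc.IH f g Suc.prems[THEN Ck_SucD] in "auto intro!: Ck_add")
qed

lemma Ck_mult:
 fixes f g :: "'a::euclidean_space => real"
 shows "Ck n f ==> Ck n g ==> Ck n (%x. f x * g x)"
 using Ck_scaleR[of n f g] by simp

lemma Ck_inner: "Ck n (%x. x \<bullet> v)"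
proof (cases n)
 case (Suc m)
 have "((%x. x \<bullet> v) has_derivative (%h. h \<bullet> v)) (at x)" for x
  by (rule bounded_linear_imp_has_derivative) (rule bounded_linear_inner_left)
 thus ?thesis unfolding Suc by (rule Ck_SucI) (rule Ck_const)
qed (auto intro!: continuous_intros)

lemma Ck_sum:
 "finite I ==> (!!i. i : I ==> Ck n (f i)) ==> Ck n (%x. SUM i:I. f i x)"
 by (induction I rule: finite_induct) (auto intro: Ck_add Ck_const)

lemma Ck_norm_squared: "Ck n (%x::'a::euclidean_space. x \<bullet> x)"
proof -
 have "(%x::'a. x \<bullet> x) = (%x. SUM b:Basis. (x \<bullet> b) * (x \<bullet> b))"
  by (auto simp: euclidean_inner[of x x for x])
 thus ?thesis by (auto intro!: Ck_sum Ck_mult Ck_inner)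
qed

lemma Ck_compose:
 fixes F :: "real => 'b::real_normed_vector" and g :: "'a::euclidean_space => real"
 assumes "Ck n F" "Ck n g"
 shows "Ck n (%x. F (g x))"
 using assms
proof (induction n arbitrary: F)
 case 0
 thus ?case
  by (auto intro: continuous_on_compose2)
next
 case (Suc n)
 obtain F' where F: "!!x. (F has_derivative F' x) (at x)"
   "!!b. b : Basis ==> Ck n (%x. F' x b)" using Ck_SucE[OF Suc.prems(1)] by blast
 obtain g' where g: "!!x. (g has_derivative g' x) (at x)"
   "!!b. b : Basis ==> Ck n (%x. g' x b)" using Ck_SucE[OF Suc.prems(2)] by blast
 have D: "((%x. F (g x)) has_derivative (%h. F' (g x) (g' x h))) (at x)" for x
  using has_derivative_compose[OF g(1) F(1)] .
 have "F' y t = t *R F' y 1" for y t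
  using linear.scaleR[OF has_derivative_linear[OF F(1)], of y t 1] by simp
 hence *: "(%h. F' (g x) (g' x h)) = (%h. g' x h *R F' (g x) 1)" for x by metis
 show ?case
  by (rule Ck_SucI[OF D[unfolded *]])
    (use Suc.IH[of "%x. F' x 1"] F g Ck_SucD[OF Suc.prems(2)] in "auto intro!: Ck_scaleR")
qed

lemma Ck_SucI_real:
 fixes f :: "real => 'b::real_normed_vector"
 assumes "!!x. (f hvd f' x) (at x)" "Ck n f'"
 shows "Ck (Suc n) f"
 by (rule Ck_SucI[OF assms(1)[unfolded has_vector_derivative_def]]) (use assms(2) in auto)

lemma Ck_powr:
 fixes f :: "'a::euclidean_space => real"
 assumes "Ck n f" "!!x. f x > 0"
 shows "Ck n (%x. f x powr a)"
 using assms(1)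
proof (induction n arbitrary: a)
 case 0
 thus ?case using assms(2) by (auto intro!: continuous_intros simp: less_imp_neq[symmetric])
next
 case (Suc n)
 obtain f' where f: "!!x. (f has_derivative f' x) (at x)"
   "!!b. b : Basis ==> Ck n (%x. f' x b)" using Ck_SucE[OF Suc.prems(1)] by blast
 have D: "((%x. f x powr a) has_derivative (%h. a *R (f x powr (a - 1) * f' x h))) (at x)" for x
 proof -
  have "((%y. y powr a) hrd a * f x powr (a - 1)) (at (f x))"
   using assms(2) by (rule has_real_derivative_powr)
  from has_derivative_compose[OF f(1) this[unfolded has_field_derivative_def]] show ?thesis
   by (simp add: mult_ac)
 qed
 show ?case
  by (rule Ck_SucI[OF D]) (use Suc.IH f Ck_SucD[OF Suc.prems(1)] in "auto intro!: Ck_scaleR Ck_mult Ck_const simp del: real_scaleR_def")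
qed

section \<open>A smooth step function\<close>

definition flat_exp :: "nat => real => real" where
 "flat_exp j x = (if x <= 0 then 0 else (1 / x) ^ j * exp (- (1 / x)))"

lemma flat_exp_tendsto: "(flat_exp j ~~> 0) (at_right 0)"
proof -
 have "((%x. inverse x ^ j / exp (inverse x)) ~~> (0::real)) (at_right 0)"
  using filterlim_compose[OF tendsto_power_div_exp_0 filterlim_inverse_at_top_right] .
 moreover have "\<forall>\<^sub>F x in at_right 0. inverse x ^ j / exp (inverse x) = flat_exp j x"
  unfolding eventually_at_right_field
  by (intro exI[of _ 1]) (auto simp: flat_exp_def exp_minus divide_inverse)
 ultimately show ?thesis by (rule Lim_transform_eventually)
qed

text \<open>Carrying the powers of \<open>1 / x\<close> along makes the family closed under
  differentiation, so that one induction, simultaneous in \<open>j\<close>, shows all members to be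
  smooth. At \<open>0\<close> the right difference quotient of member \<open>j\<close> is member
  \<open>Suc j\<close>, which tends to zero.\<close>

lemma flat_exp_deriv:
 "(flat_exp j hrd (flat_exp (j + 2) x - j * flat_exp (j + 1) x)) (at x)"
proof -
 consider "x < 0" | "x = 0" | "x > 0" by linarith
 thus ?thesis
 proof cases
  case 1
  have "\<forall>\<^sub>F y in nhds x. y : {..<0}" using 1 by (intro eventually_nhds_in_open) auto
  hence "\<forall>\<^sub>F y in nhds x. flat_exp j y = 0"
   by eventually_elim (auto simp: flat_exp_def)
  thus ?thesis using 1
   by (subst DERIV_cong_ev[OF refl _ refl]) (auto simp: flat_exp_def)
 next
  case 2
  have "((%h. (flat_exp j (0 + h) - flat_exp j 0) / h) ~~> 0) (at 0)"
  proof (rule filterlim_split_at)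
   show "((%h. (flat_exp j (0 + h) - flat_exp j 0) / h) ~~> 0) (at_left 0)"
    by (rule tendsto_eventually) (auto simp: eventually_at_left_field flat_exp_def intro!: exI[of _ "-1"])
   have "\<forall>\<^sub>F h in at_right 0. flat_exp (Suc j) h = (flat_exp j (0 + h) - flat_exp j 0) / h"
    by (auto simp: eventually_at_right_field flat_exp_def intro!: exI[of _ 1])
   thus "((%h. (flat_exp j (0 + h) - flat_exp j 0) / h) ~~> 0) (at_right 0)"
    using flat_exp_tendsto by (rule Lim_transform_eventually[rotated])
  qed
  thus ?thesis using 2 by (simp add: DERIV_def flat_exp_def)
 next
  case 3
  have "\<forall>\<^sub>F y in nhds x. y : {0<..}" using 3 by (intro eventually_nhds_in_open) auto
  hence ev: "\<forall>\<^sub>F y in nhds x. flat_exp j y = (1 / y) ^ j * exp (- (1 / y))"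
   by eventually_elim (auto simp: flat_exp_def)
  have "((%y. (1 / y) ^ j * exp (- (1 / y))) has_real_derivative
    (flat_exp (j + 2) x - j * flat_exp (j + 1) x)) (at x)"
  proof (cases j)
   case 0
   thus ?thesis using 3
    by (auto intro!: derivative_eq_intros simp: flat_exp_def power2_eq_square)
  next
   case (Suc i)
   show ?thesis using 3 unfolding Suc
    by (auto intro!: derivative_eq_intros simp: flat_exp_def power2_eq_square divide_simps)
     (cases i; simp add: algebra_simps)
  qed
  thus ?thesis by (subst DERIV_cong_ev[OF refl ev refl])
 qed
qed

lemma Ck_flat_exp: "Ck n (flat_exp j)"
proof (induction n arbitrary: j)
 case 0
 show ?case using DERIV_isCont[OF flat_exp_deriv] by (auto intro!: continuous_at_imp_continuous_on)
next
 case (Suc n)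
 have "Ck n (%x. flat_exp (j + 2) x + (- real j) * flat_exp (j + 1) x)"
  by (intro Ck_add Ck_mult Ck_const Suc)
 thus ?case
  by (intro Ck_SucI_real[where f'="%x. flat_exp (j + 2) x - j * flat_exp (j + 1) x"])
    (use flat_exp_deriv[of j] in "auto simp: has_real_derivative_iff_has_vector_derivative[symmetric]")
qed

text \<open>The step is the normalised primitive of the bump \<open>b\<close>, a product of two flat
  exponentials that is positive exactly between \<open>1\<close> and \<open>2\<close>.\<close>

lemma smooth_step_exists:
 "EX S :: real => real. (ALL n. Ck n S) & (ALL x<=1. S x = 0) & (ALL x>=2. S x = 1) & (ALL x. 0 <= S x & S x <= 1)"
proof -
 define b where "b = (%x. flat_exp 0 (x - 1) * flat_exp 0 (2 - x))"
 have lin: "Ck n (%x::real. x + c)" "Ck n (%x::real. c - x)" for n c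
  using Ck_add[OF Ck_inner[of n "1::real"] Ck_const[of n c]] Ck_add[OF Ck_const[of n c] Ck_inner[of n "-1::real"]]
  by simp_all
 have Ckb: "Ck n b" for n
  unfolding b_def using lin(1)[of n "-1"] by (intro Ck_mult Ck_compose[OF Ck_flat_exp] lin) auto
 have contb: "cts UNIV b" using Ck_continuous Ckb by blast
 obtain F where F: "!!x. (F hvd b x) (at x)"
  using einterval_antiderivative[of "-\<infinity>" "\<infinity>" b] contb
  by (auto simp: continuous_on_eq_continuous_within einterval_eq)
 hence Fd: "(F hrd b x) (at x)" for x
  by (simp add: has_real_derivative_iff_has_vector_derivative)
 have b0: "b x >= 0" for x by (auto simp: b_def flat_exp_def)
 have mono: "F x <= F y" if "x <= y" for x y
  using DERIV_nonneg_imp_nondecreasing[OF that, of F] Fd b0 by blast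
 have pos: "F 1 < F 2"
 proof (rule DERIV_pos_imp_increasing_open[of 1 2 F])
  fix x :: real assume "1 < x" "x < 2"
  thus "EX y. (F hrd y) (at x) & 0 < y"
   by (intro exI[of _ "b x"] conjI Fd) (auto simp: b_def flat_exp_def)
 qed (auto intro!: continuous_at_imp_continuous_on DERIV_isCont[OF Fd])
 have const: "F x = F y" if "!!z. z : {x..y} ==> b z = 0" "x <= y" for x y
 proof (rule has_vector_derivative_zero_constant[of "{x..y}" F, THEN exE])
  show "(F hvd 0) (at z within {x..y})" if "z : {x..y}" for z
   using F[of z] \<open>!!z. z : {x..y} ==> b z = 0\<close>[OF that]
   by (auto intro: has_vector_derivative_at_within)
 qed (use that in auto)
 have low: "F x = F 1" if "x <= 1" for x
  using that by (intro const) (auto simp: b_def flat_exp_def)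
 have high: "F x = F 2" if "x >= 2" for x
  using that by (intro const[symmetric]) (auto simp: b_def flat_exp_def)
 define S where "S x = inverse (F 2 - F 1) * (F x - F 1)" for x
 have "(S hvd inverse (F 2 - F 1) * b x) (at x)" for x
  unfolding S_def has_real_derivative_iff_has_vector_derivative[symmetric]
  by (auto intro!: derivative_eq_intros Fd)
 hence "Ck (Suc n) S" for n
  by (rule Ck_SucI_real) (intro Ck_mult Ck_const Ckb)
 hence "Ck n S" for n using Ck_SucD by blast
 moreover have "S x >= 0 & S x <= 1" for x
  using mono[of 1 x] mono[of x 2] mono[of x 1] mono[of 2 x] low[of x] high[of x] pos
  by (cases "x <= 1"; cases "x <= 2") (auto simp: S_def field_simps)
 moreover have "S x = 0" if "x <= 1" for x using low[OF that] by (simp add: S_def)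
 moreover have "S x = 1" if "x >= 2" for x using high[OF that] pos by (simp add: S_def)
 ultimately show ?thesis by blast
qed

definition sstep :: "real => real" where
 "sstep = (SOME S. (ALL n. Ck n S) & (ALL x<=1. S x = 0) & (ALL x>=2. S x = 1) & (ALL x. 0 <= S x & S x <= 1))"

lemma Ck_sstep: "Ck n sstep" and sstep_0: "x <= 1 ==> sstep x = 0" and sstep_1: "x >= 2 ==> sstep x = 1"
 and sstep_bounds: "0 <= sstep x" "sstep x <= 1"
 using someI_ex[OF smooth_step_exists] unfolding sstep_def[symmetric] by auto

text \<open>The division by the norm is what makes profiles one-dimensional: the Laplacian of
  \<open>emb u\<close> is \<open>emb u''\<close>, and the norm of \<open>emb u\<close> in L^2 is
  \<open>sqrt (4 * pi)\<close> times that of \<open>u\<close> on the half line.\<close>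

definition emb :: "(real => 'b::real_normed_vector) => real^3 => 'b" where
 "emb u x = u (norm x) /\<^sub>R norm x"

lemma Omega_iff: "x : Omega \<longleftrightarrow> norm x > 1"
 by (auto simp: Omega_def)

lemma open_Omega: "open Omega"
 unfolding Omega_def by auto

lemma Ck_affine: "Ck n (%x::real. a * x + c)"
 using Ck_add[OF Ck_mult[OF Ck_const[of n a] Ck_inner[of n "1::real"]] Ck_const[of n c]] by simp

text \<open>The norm is not smooth at the origin; it is replaced by a positive smooth function that
 agrees with it outside the unit ball.\<close>

lemma emb_test_function:
 fixes F :: "real => 'b::real_normed_vector"
 assumes "!!n. Ck n F" "1 < a" "!!r. r ~: {a..b} ==> F r = 0"
 shows "emb F : test_functions Omega"
proof -
 \<comment> \<open>\<open>sg\<close> is smooth and positive, the identity on \<open>{1..}\<close>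
   and at most \<open>1\<close> below. Hence \<open>h x\<close> stands in for the square of the
   norm, and inside the unit ball its root stays at most \<open>1\<close>, where \<open>F\<close>
   vanishes.\<close>
 define sg where "sg s = 1/2 + (s - 1/2) * sstep (2 * s)" for s
 have Cksg: "Ck n sg" for n
  unfolding sg_def using Ck_affine[of n 1 "-1/2"] Ck_compose[OF Ck_sstep Ck_affine[of n 2 0]]
  by (auto intro!: Ck_add Ck_const Ck_mult)
 have sgpos: "sg s > 0" for s
 proof (cases "s <= 1/2")
  case False
  hence "(s - 1/2) * sstep (2 * s) >= 0" using sstep_bounds by (intro mult_nonneg_nonneg) auto
  thus ?thesis by (simp add: sg_def)
 qed (simp add: sg_def sstep_0)
 have sg1: "sg s = s" if "s >= 1" for s using that by (simp add: sg_def sstep_1)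
 have sg2: "sg s <= 1" if "s <= 1" for s
 proof (cases "s <= 1/2")
  case False
  hence "(s - 1/2) * sstep (2 * s) <= (s - 1/2) * 1"
   using sstep_bounds by (intro mult_left_mono) auto
  thus ?thesis using that by (simp add: sg_def)
 qed (simp add: sg_def sstep_0)
 define h where "h = (%x::real^3. sg (x \<bullet> x))"
 have Ckh: "Ck n h" for n unfolding h_def by (rule Ck_compose[OF Cksg Ck_norm_squared])
 have hpos: "h x > 0" for x by (simp add: h_def sgpos)
 have eq: "emb F x = (h x powr (-1/2)) *R F (h x powr (1/2))" for x
 proof (cases "norm x >= 1")
  case True
  hence "x \<bullet> x >= 1" by (simp add: power2_norm_eq_inner[symmetric] one_le_power)
  hence "h x = (norm x)^2" by (simp add: h_def sg1 power2_norm_eq_inner)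
  thus ?thesis using True
   by (simp add: emb_def powr_half_sqrt powr_minus)
 next
  case False
  hence "x \<bullet> x <= 1" by (simp add: power2_norm_eq_inner[symmetric] power_le_one)
  hence "h x <= 1" by (simp add: h_def sg2)
  hence "h x powr (1/2) <= 1" by (simp add: powr_half_sqrt hpos less_imp_le)
  thus ?thesis using False assms by (auto simp: emb_def)
 qed
 have "Ck n (emb F)" for n
 proof -
  have "Ck n (%x. (h x powr (-1/2)) *R F (h x powr (1/2)))"
   by (rule Ck_scaleR[OF Ck_powr[OF Ckh hpos] Ck_compose[OF assms(1) Ck_powr[OF Ckh hpos]]])
  thus ?thesis unfolding eq[abs_def] .
 qed
 moreover have sub: "{x. emb F x ~= 0} <= cball 0 b - ball 0 a"
  using assms(3) by (auto simp: emb_def) (metis atLeastAtMost_iff not_le not_less)+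
 have "closed (cball (0::real^3) b - ball 0 a)" by (intro closed_Diff) auto
 hence cl: "closure {x. emb F x ~= 0} <= cball 0 b - ball 0 a"
  using sub closure_minimal by blast
 moreover have "compact (closure {x. emb F x ~= 0})"
  using cl by (meson Diff_subset bounded_cball bounded_subset closed_closure compact_eq_bounded_closed)
 ultimately show ?thesis using assms(2)
  by (auto simp: test_functions_def Omega_iff subset_eq)
qed

section \<open>Square integrable functions\<close>

lemma integrable_mult_square:
 fixes f g :: "'a => real"
 assumes "f : borel_measurable M" "g : borel_measurable M"
  "integrable M (%x. (f x)^2)" "integrable M (%x. (g x)^2)"
 shows "integrable M (%x. f x * g x)"
proof (rule Bochner_Integration.integrable_bound[of M "%x. (f x)^2 + (g x)^2"])
 show "AE x in M. norm (f x * g x) <= norm ((f x)^2 + (g x)^2)"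
 proof (rule AE_I2)
  fix x
  have "0 <= (\<bar>f x\<bar> - \<bar>g x\<bar>)^2" by simp
  moreover have "0 <= \<bar>f x\<bar> * \<bar>g x\<bar>" by simp
  ultimately have "\<bar>f x\<bar> * \<bar>g x\<bar> <= (f x)^2 + (g x)^2"
   unfolding power2_diff power2_abs by linarith
  thus "norm (f x * g x) <= norm ((f x)^2 + (g x)^2)"
   by (simp add: abs_mult)
 qed
qed (use assms in auto)

lemma integral_Cauchy_Schwarz:
 fixes f g :: "'a => real"
 assumes "f : borel_measurable M" "g : borel_measurable M"
  "integrable M (%x. (f x)^2)" "integrable M (%x. (g x)^2)"
 shows "(\<integral>x. f x * g x \<partial>M) <= sqrt (\<integral>x. (f x)^2 \<partial>M) * sqrt (\<integral>x. (g x)^2 \<partial>M)"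
proof -
 define A B C where "A = (\<integral>x. (f x)^2 \<partial>M)" and "B = (\<integral>x. (g x)^2 \<partial>M)" and "C = (\<integral>x. f x * g x \<partial>M)"
 have int: "integrable M (%x. f x * g x)" using assms by (rule integrable_mult_square)
 have AB: "A >= 0" "B >= 0" by (auto simp: A_def B_def)
 have *: "2 * s * t * C <= s^2 * A + t^2 * B" for s t :: real
 proof -
  have "0 <= (\<integral>x. (s * f x - t * g x)^2 \<partial>M)" by simp
  also have "... = (\<integral>x. s^2 * (f x)^2 + t^2 * (g x)^2 - 2 * s * t * (f x * g x) \<partial>M)"
   by (simp add: power2_diff power_mult_distrib mult_ac)
  also have "... = s^2 * A + t^2 * B - 2 * s * t * C"
   using int assms by (simp add: A_def B_def C_def)
  finally show ?thesis by simp
 qed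
 show ?thesis
 proof (cases "A = 0 | B = 0")
  case True
  have "C <= 0"
  proof (rule ccontr)
   assume C: "~ C <= 0"
   show False
   proof (cases "A = 0")
    case True
    \<comment> \<open>With \<open>A = 0\<close> the inequality \<open>*\<close> bounds
      \<open>2 * s * C\<close> by \<open>B\<close> for every \<open>s\<close>; this choice of
      \<open>s\<close> violates it.\<close>
    have "2 * ((B + 1) / C) * 1 * C <= ((B + 1) / C)^2 * A + 1^2 * B" by (rule *)
    thus False using C True AB by simp
   next
    case False
    hence "B = 0" using \<open>A = 0 | B = 0\<close> by simp
    have "2 * 1 * ((A + 1) / C) * C <= 1^2 * A + ((A + 1) / C)^2 * B" by (rule *)
    thus False using C \<open>B = 0\<close> AB by simp
   qed
  qed
  with True show ?thesis unfolding A_def[symmetric] B_def[symmetric] C_def[symmetric] by auto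
 next
  case False
  hence pos: "sqrt A > 0" "sqrt B > 0" using AB by auto
  have "2 * sqrt B * sqrt A * C <= (sqrt B)^2 * A + (sqrt A)^2 * B" by (rule *)
  also have "... = 2 * sqrt B * sqrt A * (sqrt A * sqrt B)"
   using AB by (simp add: power2_eq_square algebra_simps)
  finally show ?thesis using pos unfolding A_def[symmetric] B_def[symmetric] C_def[symmetric]
   by simp
 qed
qed

text \<open>Extension by zero turns set integrals and membership in \<open>L2 U\<close> into
  statements about integrals over the whole space.\<close>

definition zext :: "'a set => ('a => 'b::real_vector) => 'a => 'b" where
 "zext U f x = indicator U x *R f x"

lemma zext_simps:
 "x : U ==> zext U f x = f x" "x ~: U ==> zext U f x = 0"
 by (simp_all add: zext_def)

lemma zext_add: "zext U (%x. f x + g x) x = zext U f x + zext U g x"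
 and zext_diff: "zext U (%x. f x - g x) x = zext U f x - zext U g x"
 by (simp_all add: zext_def scaleR_add_right scaleR_diff_right)

lemma zext_linear: "linear h ==> zext U (%x. h (f x)) x = h (zext U f x)"
 by (simp add: zext_def linear.scaleR)

lemma zext_cmult: "zext U (%x. c * f x) x = c * zext U f x" for c :: "'b::real_algebra"
 by (simp add: zext_def)

lemma zext_norm: "zext U (%x. norm (f x)) x = norm (zext U f x)"
 by (simp add: zext_def)

lemma zext_mult: "zext U (%x. f x * g x) x = zext U f x * zext U g x" for f :: "'a => 'b::real_algebra"
 by (auto simp: zext_def indicator_def)

lemma set_integral_zext: "(LINT x:U|M. f x) = (LINT x|M. zext U f x)"
 by (simp add: set_lebesgue_integral_def zext_def)

lemma set_integrable_zext: "set_integrable M U f \<longleftrightarrow> integrable M (zext U f)"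
 by (simp add: set_integrable_def zext_def[abs_def])

lemma L2_iff:
 "f : L2 U \<longleftrightarrow> zext U f : borel_measurable leb &
  integrable leb (%x. (norm (zext U f x))^2)"
proof -
 have "(norm (zext U f x))^2 = indicator U x *R (norm (f x))^2" for x
  by (simp add: indicator_def zext_def)
 thus ?thesis by (simp add: L2_def set_borel_measurable_def set_integrable_def zext_def[abs_def])
qed

lemma L2D: "f : L2 U ==> zext U f : borel_measurable leb"
 "f : L2 U ==> integrable leb (%x. (norm (zext U f x))^2)"
 by (auto simp: L2_iff)

lemma L2D_norm: "f : L2 U ==> (%x. norm (zext U f x)) : borel_measurable leb"
proof -
 assume "f : L2 U"
 hence [measurable]: "zext U f : borel_measurable leb" by (rule L2D)
 show ?thesis by measurable
qed

lemma l2norm_eq: "l2norm U f = sqrt (LINT x|leb. (norm (zext U f x))^2)"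
proof -
 have "(norm (zext U f x))^2 = indicator U x *R (norm (f x))^2" for x
  by (simp add: indicator_def zext_def)
 thus ?thesis by (simp add: l2norm_def set_lebesgue_integral_def)
qed

lemma l2norm_nonneg [simp]: "0 <= l2norm U f"
 by (simp add: l2norm_eq)

lemma l2norm_square: "(l2norm U f)^2 = (LINT x|leb. (norm (zext U f x))^2)"
 by (simp add: l2norm_eq)

lemma L2_norm_mult_integrable:
 assumes "f : L2 U" "g : L2 U"
 shows "integrable leb (%x. norm (zext U f x) * norm (zext U g x))"
 using assms by (intro integrable_mult_square) (auto simp: L2_iff)

lemma L2_norm_mult_bound:
 assumes "f : L2 U" "g : L2 U"
 shows "(LINT x|leb. norm (zext U f x) * norm (zext U g x)) <= l2norm U f * l2norm U g"
 using assms unfolding l2norm_eq by (intro integral_Cauchy_Schwarz) (auto simp: L2_iff)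

lemma L2_add:
 fixes f g :: "'a::euclidean_space => 'b::euclidean_space"
 assumes "f : L2 U" "g : L2 U"
 shows "(%x. f x + g x) : L2 U"
proof -
 have m: "zext U f : borel_measurable leb" "zext U g : borel_measurable leb"
  using assms by (auto simp: L2_iff)
 have eq: "(%x. zext U (%x. f x + g x) x) = (%x. zext U f x + zext U g x)"
  by (auto simp: zext_add)
 have "integrable leb (%x. (norm (zext U (%x. f x + g x) x))^2)"
 proof (rule Bochner_Integration.integrable_bound[of leb "%x. 2 * (norm (zext U f x))^2 + 2 * (norm (zext U g x))^2"])
  show "AE x in leb. norm ((norm (zext U (%x. f x + g x) x))^2)
    <= norm (2 * (norm (zext U f x))^2 + 2 * (norm (zext U g x))^2)"
  proof (rule AE_I2)
   fix x
   define a b where "a = norm (zext U f x)" and "b = norm (zext U g x)"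
   have "norm (zext U (%x. f x + g x) x) <= a + b"
    unfolding a_def b_def zext_add by (rule norm_triangle_ineq)
   hence "(norm (zext U (%x. f x + g x) x))^2 <= (a + b)^2" by (rule power_mono) simp
   also have "... <= 2 * a^2 + 2 * b^2"
    using sum_squares_bound[of a b] by (simp add: power2_sum)
   finally show "norm ((norm (zext U (%x. f x + g x) x))^2)
    <= norm (2 * (norm (zext U f x))^2 + 2 * (norm (zext U g x))^2)"
    by (simp add: a_def b_def)
  qed
 qed (use assms eq m in "auto simp: L2_iff")
 thus ?thesis using m eq by (auto simp: L2_iff)
qed

lemma L2_linear:
 fixes f :: "'a::euclidean_space => 'b::euclidean_space" and h :: "'b => 'c::euclidean_space"
 assumes "bounded_linear h" "f : L2 U"
 shows "(%x. h (f x)) : L2 U"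
proof -
 interpret bounded_linear h by fact
 obtain K where K: "!!x. norm (h x) <= norm x * K" using bounded by blast
 have m: "zext U f : borel_measurable leb"
  using assms by (auto simp: L2_iff)
 have eq: "(%x. zext U (%x. h (f x)) x) = (%x. h (zext U f x))"
  by (rule ext) (simp add: zext_linear linear_axioms)
 have m2: "(%x. h (zext U f x)) : borel_measurable leb"
  using borel_measurable_continuous_onI[OF linear_continuous_on[OF assms(1)]] m by measurable
 have "integrable leb (%x. (norm (h (zext U f x)))^2)"
 proof (rule Bochner_Integration.integrable_bound[of leb "%x. K^2 * (norm (zext U f x))^2"])
  have "(norm (h y))^2 <= K^2 * (norm y)^2" for y
   using power_mono[OF K[of y], of 2] by (simp add: power_mult_distrib mult.commute)
  thus "AE x in leb. norm ((norm (h (zext U f x)))^2) <= norm (K^2 * (norm (zext U f x))^2)"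
   by (intro AE_I2) (simp add: abs_mult)
 qed (use assms m2 in "auto simp: L2_iff")
 thus ?thesis using m2 by (auto simp: L2_iff eq)
qed

lemma L2_minus: "f : L2 U ==> (%x. - f x) : L2 U" for f :: "'a::euclidean_space => 'b::euclidean_space"
 by (rule L2_linear[of uminus]) (auto intro: bounded_linear_minus bounded_linear_ident)

lemma L2_diff:
 fixes f g :: "'a::euclidean_space => 'b::euclidean_space"
 assumes "f : L2 U" "g : L2 U"
 shows "(%x. f x - g x) : L2 U"
 using L2_add[OF assms(1) L2_minus[OF assms(2)]] by simp

lemma L2_cmult: "f : L2 U ==> (%x. c * f x) : L2 U" for f :: "'a::euclidean_space => complex"
 by (rule L2_linear[OF bounded_linear_mult_right])

lemma l2norm_triangle:
 fixes f g :: "'a::euclidean_space => 'b::euclidean_space"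
 assumes "f : L2 U" "g : L2 U"
 shows "l2norm U (%x. f x + g x) <= l2norm U f + l2norm U g"
proof (rule power2_le_imp_le)
 define a b where "a x = norm (zext U f x)" and "b x = norm (zext U g x)" for x
 have ia: "integrable leb (%x. (a x)^2)" "integrable leb (%x. (b x)^2)"
  using assms by (auto simp: L2_iff a_def b_def)
 have iab: "integrable leb (%x. a x * b x)"
  unfolding a_def b_def by (rule L2_norm_mult_integrable[OF assms])
 have "(l2norm U (%x. f x + g x))^2 <= (LINT x|leb. (a x)^2 + 2 * (a x * b x) + (b x)^2)"
  unfolding l2norm_square
 proof (rule integral_mono)
  show "integrable leb (%x. (norm (zext U (%x. f x + g x) x))^2)"
   using L2_add[OF assms] by (simp add: L2_iff)
  show "(norm (zext U (%x. f x + g x) x))^2 <= (a x)^2 + 2 * (a x * b x) + (b x)^2" for x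
  proof -
   have "norm (zext U (%x. f x + g x) x) <= a x + b x"
    unfolding a_def b_def zext_add by (rule norm_triangle_ineq)
   hence "(norm (zext U (%x. f x + g x) x))^2 <= (a x + b x)^2" by (rule power_mono) simp
   thus ?thesis by (simp add: power2_sum)
  qed
 qed (use ia iab in auto)
 also have "... = (l2norm U f)^2 + 2 * (LINT x|leb. a x * b x) + (l2norm U g)^2"
  using ia iab by (simp add: l2norm_square a_def[symmetric] b_def[symmetric])
 also have "... <= (l2norm U f + l2norm U g)^2"
  using L2_norm_mult_bound[OF assms] by (simp add: power2_sum a_def b_def)
 finally show "(l2norm U (%x. f x + g x))^2 <= (l2norm U f + l2norm U g)^2" .
qed simp

lemma l2norm_cong_norm: "(!!x. x : U ==> norm (f x) = norm (g x)) ==> l2norm U f = l2norm U g"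
 unfolding l2norm_eq by (intro arg_cong[where f=sqrt] Bochner_Integration.integral_cong) (auto simp: zext_def indicator_def)

lemma l2norm_cmult: "l2norm U (%x. c * f x) = norm c * l2norm U f" for c :: complex
proof -
 have "(norm (zext U (%x. c * f x) x))^2 = (norm c)^2 * (norm (zext U f x))^2" for x
  by (simp add: zext_cmult norm_mult power_mult_distrib)
 thus ?thesis by (simp add: l2norm_eq real_sqrt_mult)
qed

lemma l2norm_mono:
 fixes f :: "'a::euclidean_space => 'b::euclidean_space" and g :: "'a::euclidean_space => 'c::euclidean_space"
 assumes "f : L2 U" "g : L2 U" "!!x. x : U ==> norm (f x) <= norm (g x)"
 shows "l2norm U f <= l2norm U g"
 unfolding l2norm_eq using assms
 by (intro real_sqrt_le_mono integral_mono) (auto simp: L2_iff zext_def indicator_def intro!: power_mono)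

lemma L2_bound:
 fixes f :: "'a::euclidean_space => 'b::euclidean_space" and g :: "'a::euclidean_space => 'c::euclidean_space"
 assumes "g : L2 U" "zext U f : borel_measurable leb"
  "!!x. x : U ==> norm (f x) <= norm (g x)"
 shows "f : L2 U"
 unfolding L2_iff
proof (rule conjI)
 show "integrable leb (%x. (norm (zext U f x))^2)"
 proof (rule Bochner_Integration.integrable_bound[OF L2D(2)[OF assms(1)]])
  have [measurable]: "zext U f : borel_measurable leb" by fact
  show "(%x. (norm (zext U f x))^2) : borel_measurable leb" by measurable
  show "AE x in leb. norm ((norm (zext U f x))^2) <= norm ((norm (zext U g x))^2)"
   using assms(3) by (intro AE_I2) (auto simp: zext_def indicator_def intro!: power_mono)
 qed
qed (use assms in auto)

lemma L2_mult_integrable: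
 fixes f g :: "'a::euclidean_space => complex"
 assumes "f : L2 U" "g : L2 U"
 shows "set_integrable leb U (%x. f x * g x)"
 unfolding set_integrable_zext
proof (rule Bochner_Integration.integrable_bound[OF L2_norm_mult_integrable[OF assms]])
 show "zext U (%x. f x * g x) : borel_measurable leb"
  using borel_measurable_times[OF L2D(1)[OF assms(1)] L2D(1)[OF assms(2)]]
  by (simp add: zext_mult[abs_def])
qed (auto simp: zext_mult norm_mult)

lemma L2_mult_bound:
 fixes f g :: "'a::euclidean_space => complex"
 assumes "f : L2 U" "g : L2 U"
 shows "norm (LINT x:U|leb. f x * g x) <= l2norm U f * l2norm U g"
proof -
 have "norm (LINT x:U|leb. f x * g x) <= (LINT x|leb. norm (zext U (%x. f x * g x) x))"
  unfolding set_integral_zext by (rule integral_norm_bound)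
 also have "... = (LINT x|leb. norm (zext U f x) * norm (zext U g x))"
  by (intro Bochner_Integration.integral_cong) (auto simp: zext_def indicator_def norm_mult)
 also have "... <= l2norm U f * l2norm U g" by (rule L2_norm_mult_bound[OF assms])
 finally show ?thesis .
qed

lemma L2_mult_tendsto:
 fixes f g :: "'a::euclidean_space => complex"
 assumes "!!n. F n : L2 U" "f : L2 U" "g : L2 U" "(%n. l2norm U (%x. F n x - f x)) ---> 0"
 shows "(%n. LINT x:U|leb. F n x * g x) ---> (LINT x:U|leb. f x * g x)"
proof -
 have "norm ((LINT x:U|leb. F n x * g x) - (LINT x:U|leb. f x * g x)) <= l2norm U (%x. F n x - f x) * l2norm U g" for n
 proof -
  have "(LINT x:U|leb. F n x * g x) - (LINT x:U|leb. f x * g x) = (LINT x:U|leb. F n x * g x - f x * g x)"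
   by (rule set_integral_diff(2)[symmetric]) (auto intro: L2_mult_integrable assms)
  also have "... = (LINT x:U|leb. (F n x - f x) * g x)" by (simp add: algebra_simps)
  finally show ?thesis using L2_mult_bound[OF L2_diff[OF assms(1,2)] assms(3)] by metis
 qed
 hence ev: "\<forall>\<^sub>F n in sequentially. norm ((LINT x:U|leb. F n x * g x) - (LINT x:U|leb. f x * g x))
   <= l2norm U (%x. F n x - f x) * l2norm U g" by (intro always_eventually allI)
 have "(%n. l2norm U (%x. F n x - f x) * l2norm U g) ---> 0"
  using tendsto_mult_left_zero[OF assms(4)] by simp
 hence "(%n. (LINT x:U|leb. F n x * g x) - (LINT x:U|leb. f x * g x)) ---> 0"
  by (rule Lim_null_comparison[OF ev])
 thus ?thesis by (rule LIM_zero_cancel)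
qed

lemma l2norm_eq_0_iff:
 assumes "f : L2 U"
 shows "l2norm U f = 0 \<longleftrightarrow> (AE x in leb. x : U --> f x = 0)"
proof -
 have "l2norm U f = 0 \<longleftrightarrow> (LINT x|leb. (norm (zext U f x))^2) = 0" by (simp add: l2norm_eq)
 also have "... \<longleftrightarrow> (AE x in leb. (norm (zext U f x))^2 = 0)"
  using assms by (intro integral_nonneg_eq_0_iff_AE) (auto simp: L2_iff)
 also have "... \<longleftrightarrow> (AE x in leb. x : U --> f x = 0)"
  by (intro AE_cong) (auto simp: zext_def indicator_def)
 finally show ?thesis .
qed

lemma L2_cong_AE:
 fixes f g :: "'a::euclidean_space => 'b::euclidean_space"
 assumes "AE x in leb. x : U --> f x = g x" "f : L2 U"
 shows "g : L2 U" "l2norm U g = l2norm U f"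
proof -
 have *: "AE x in leb. zext U f x = zext U g x"
  using assms(1) by eventually_elim (auto simp: zext_def indicator_def)
 have m: "zext U f : borel_measurable leb" using assms by (auto simp: L2_iff)
 have m': "zext U g : borel_measurable leb"
  using borel_measurable_AE[OF m *] .
 show "g : L2 U" unfolding L2_iff
 proof
  show "integrable leb (%x. (norm (zext U g x))^2)"
   using assms(2) unfolding L2_iff
   by (elim conjE, subst integrable_cong_AE[where g="%x. (norm (zext U f x))^2"])
     (use * m m' in "auto elim!: eventually_mono")
 qed fact
 show "l2norm U g = l2norm U f" unfolding l2norm_eq
  by (intro arg_cong[where f=sqrt] integral_cong_AE) (use * m m' in "auto elim!: eventually_mono")
qed

section \<open>Test functions and integration by parts\<close>

lemma continuous_compact_support_integrable:
 fixes f :: "'a::euclidean_space => 'b::euclidean_space"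
 assumes "cts UNIV f" "bounded {x. f x ~= 0}"
 shows "integrable lborel f" "integrable leb f"
proof -
 obtain R where R: "{x. f x ~= 0} <= cball 0 R" using bounded_subset_ballD[OF assms(2), of 0] ball_subset_cball by (metis subset_trans)
 have "integrable lborel (%x. indicator (cball 0 R) x *R f x)"
  using borel_integrable_compact[OF compact_cball continuous_on_subset[OF assms(1)], of 0 R] by simp
 moreover have "(%x. indicator (cball 0 R) x *R f x) = f"
  using R by (intro ext) (auto simp: indicator_def subset_eq)
 ultimately show *: "integrable lborel f" by simp
 show "integrable leb f"
  using * integrable_completion[of f lborel] borel_measurable_continuous_onI[OF assms(1)] by auto
qed

lemma continuous_compact_support_bounded:
 fixes f :: "'a::euclidean_space => 'b::real_normed_vector"
 assumes "cts UNIV f" "bounded {x. f x ~= 0}"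
 obtains B where "B >= 0" "!!x. norm (f x) <= B"
proof -
 obtain R where R: "{x. f x ~= 0} <= cball 0 R" using bounded_subset_ballD[OF assms(2), of 0] ball_subset_cball by (metis subset_trans)
 have "bounded (f ` cball 0 R)"
  by (intro compact_imp_bounded compact_continuous_image continuous_on_subset[OF assms(1)]) auto
 then obtain B where B: "B > 0" "!!x. x : cball 0 R ==> norm (f x) <= B" by (auto simp: bounded_pos)
 hence "norm (f x) <= B" for x using R by (cases "f x = 0") auto
 thus ?thesis using B(1) that[of B] by auto
qed

lemma has_vector_derivative_at_iff_tendsto:
 "(f hvd D) (at x) \<longleftrightarrow> ((%h. (f (x + h) - f x) /\<^sub>R h) ~~> D) (at (0::real))"
proof -
 have "norm (f (x + h) - f x - h *R D) / norm h = norm ((f (x + h) - f x) /\<^sub>R h - D)" if "h ~= 0" for h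
 proof -
  have "f (x + h) - f x - h *R D = h *R ((f (x + h) - f x) /\<^sub>R h - D)"
   using that by (simp add: scaleR_diff_right)
  hence "norm (f (x + h) - f x - h *R D) = \<bar>h\<bar> * norm ((f (x + h) - f x) /\<^sub>R h - D)"
   by (metis norm_scaleR)
  thus ?thesis using that by simp
 qed
 hence "((%h. norm (f (x + h) - f x - h *R D) / norm h) ~~> 0) (at 0) \<longleftrightarrow>
   ((%h. norm ((f (x + h) - f x) /\<^sub>R h - D)) ~~> 0) (at 0)"
  by (intro tendsto_cong) (auto simp: eventually_at_filter)
 thus ?thesis
  unfolding has_vector_derivative_def has_derivative_at tendsto_norm_zero_iff
  by (simp add: bounded_linear_scaleR_left LIM_zero_iff[of "%h. (f (x + h) - f x) /\<^sub>R h"])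
qed

text \<open>The difference quotients have integral zero by translation invariance; they converge
 boundedly to the derivative.\<close>

lemma integral_partial_deriv_eq_0:
 fixes F :: "'a::euclidean_space => 'b::euclidean_space"
 assumes der: "!!x. (F has_derivative F' x) (at x)" and cont: "cts UNIV (%x. F' x b)"
  and bdd: "bounded {x. F x ~= 0}"
 shows "(LINT x|leb. F' x b) = 0"
proof -
 obtain R where R: "{x. F x ~= 0} <= cball 0 R" using bounded_subset_ballD[OF bdd, of 0] ball_subset_cball by (metis subset_trans)
 \<comment> \<open>The radius leaves room for points up to \<open>norm b\<close> outside the ball of
   radius \<open>R\<close> and for a further shift by at most \<open>norm b\<close>.\<close>
 define K where "K = cball (0::'a) (R + 2 * norm b)"
 have contF: "cts UNIV F"
  using der by (auto intro!: continuous_at_imp_continuous_on has_derivative_continuous)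
 have Fint: "integrable lborel F" by (rule continuous_compact_support_integrable[OF contF bdd])
 define h where "h n = inverse (real (Suc n))" for n
 have h: "0 < h n" "h n <= 1" for n by (auto simp: h_def field_simps)
 have hlim: "h ---> 0" unfolding h_def by (rule LIMSEQ_inverse_real_of_nat)
 have "bounded ((%x. F' x b) ` K)"
  unfolding K_def by (intro compact_imp_bounded compact_continuous_image continuous_on_subset[OF cont]) auto
 then obtain B where B: "B > 0" "!!x. x : K ==> norm (F' x b) <= B"
  by (auto simp: bounded_pos)
 define D where "D n x = inverse (h n) *R (F (h n *R b + x) - F x)" for n x
 have line: "((%t. F (t *R b + x)) has_derivative (%s. F' (t *R b + x) (s *R b))) (at t)" for t x
  by (rule has_derivative_compose[OF _ der, of "%t. t *R b + x"]) (auto intro!: derivative_eq_intros)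
 have Dbound: "norm (D n x) <= indicator K x * B" for n x
 proof (cases "x : cball 0 (R + norm b)")
  case True
  have "EX t:{0<..<h n}. norm (F (h n *R b + x) - F (0 *R b + x)) <= norm (F' (t *R b + x) ((h n - 0) *R b))"
   by (rule mvt_general[OF h(1), of _ "%t. F (t *R b + x)" ])
     (use line in "auto intro!: continuous_at_imp_continuous_on has_derivative_continuous")
  then obtain t where t: "0 < t" "t < h n"
   and le: "norm (F (h n *R b + x) - F x) <= norm (F' (t *R b + x) (h n *R b))" by auto
  have "norm (t *R b + x) <= norm b + norm x"
   using norm_triangle_ineq[of "t *R b" x] mult_right_mono[of t 1 "norm b"] t h(2)[of n] by simp
  hence "t *R b + x : K" using True by (auto simp: K_def)
  hence "norm (F' (t *R b + x) b) <= B" by (rule B)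
  moreover have "F' (t *R b + x) (h n *R b) = h n *R F' (t *R b + x) b"
   by (rule linear.scaleR[OF has_derivative_linear[OF der]])
  ultimately have "norm (F (h n *R b + x) - F x) <= h n * B"
   using le h(1)[of n] by (auto elim!: order_trans)
  hence "norm (D n x) <= B" using h(1)[of n] unfolding D_def norm_scaleR by (simp add: pos_divide_le_eq divide_inverse_commute[symmetric] mult.commute)
  moreover have "norm x <= R + 2 * norm b" using True norm_ge_zero[of b] unfolding mem_cball dist_0_norm by linarith
  hence "x : K" by (simp add: K_def)
  ultimately show ?thesis by simp
 next
  case False
  have "norm (h n *R b + x) >= norm x - norm b"
   using norm_triangle_ineq4[of "h n *R b + x" "h n *R b"] mult_right_mono[of "h n" 1 "norm b"] h[of n] by simp
  hence "h n *R b + x ~: cball 0 R" "x ~: cball 0 R"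
   using False norm_ge_zero[of b] unfolding mem_cball dist_0_norm by linarith+
  hence "F (h n *R b + x) = 0" "F x = 0" using R by auto
  thus ?thesis using B by (simp add: D_def)
 qed
 have DF: "(%n. D n x) ---> F' x b" for x
 proof -
  have "((%t. F (t *R b + x)) hvd F' x b) (at 0)"
   using line[of x 0] linear.scaleR[OF has_derivative_linear[OF der]]
   by (simp add: has_vector_derivative_def)
  hence "((%t. (F (t *R b + x) - F x) /\<^sub>R t) ~~> F' x b) (at 0)"
   by (simp add: has_vector_derivative_at_iff_tendsto)
  hence "(%n. (F (h n *R b + x) - F x) /\<^sub>R h n) ---> F' x b"
   by (rule filterlim_compose) (use hlim h(1)[THEN less_imp_neq] in "auto simp: filterlim_at intro!: always_eventually")
  thus ?thesis unfolding D_def .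
 qed
 have "(%n. integral\<^sup>L lborel (D n)) ---> integral\<^sup>L lborel (%x. F' x b)"
 proof (rule integral_dominated_convergence)
  show "(%x. F' x b) : borel_measurable lborel" using borel_measurable_continuous_onI[OF cont] by simp
  have "cts UNIV (D n)" for n
   unfolding D_def by (intro continuous_intros continuous_on_compose2[OF contF]) auto
  thus "D n : borel_measurable lborel" for n using borel_measurable_continuous_onI by auto
  have "integrable lborel (%x. indicator K x *R B)"
   using borel_integrable_compact[of K "%_. B"] by (simp add: K_def)
  thus "integrable lborel (%x. indicator K x * B)" by simp
 qed (use DF Dbound in auto)
 moreover have "integral\<^sup>L lborel (D n) = 0" for n
 proof -
  have "integral\<^sup>L lborel (%x. F (h n *R b + x)) = integral\<^sup>L (distr lborel borel ((+) (h n *R b))) F"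
   by (subst integral_distr) (use borel_measurable_continuous_onI[OF contF] in auto)
  moreover have "integrable lborel (%x. F (h n *R b + x))"
  proof -
   have "integrable (distr lborel borel ((+) (h n *R b))) F" using Fint by (simp add: lborel_distr_plus)
   thus ?thesis by (subst (asm) integrable_distr_eq) (use borel_measurable_continuous_onI[OF contF] in auto)
  qed
  ultimately show ?thesis using Fint by (simp add: D_def[abs_def] lborel_distr_plus)
 qed
 ultimately have "integral\<^sup>L lborel (%x. F' x b) = 0" by (simp add: LIMSEQ_const_iff)
 thus ?thesis using integral_completion[of "%x. F' x b" lborel] borel_measurable_continuous_onI[OF cont] by simp
qed

lemma test_functionD:
 assumes "ph : test_functions U"
 shows "Ck n ph" "compact (closure {x. ph x ~= 0})" "closure {x. ph x ~= 0} <= U"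
  "bounded {x. ph x ~= 0}" "cts UNIV ph" "ph differentiable (at x)"
  "x ~: U ==> ph x = 0"
proof -
 show c: "Ck n ph" "compact (closure {x. ph x ~= 0})" "closure {x. ph x ~= 0} <= U" for n
  using assms by (auto simp: test_functions_def)
 show "bounded {x. ph x ~= 0}" by (rule bounded_subset[OF compact_imp_bounded[OF c(2)] closure_subset])
 show "cts UNIV ph" using c(1) by (rule Ck_continuous)
 show "ph differentiable (at x)" using c(1)[of "Suc 0"] by simp
 show "x ~: U ==> ph x = 0" using c(3) closure_subset[of "{x. ph x ~= 0}"] by blast
qed

lemma test_has_derivative:
 "ph : test_functions U ==> (ph has_derivative (%b. pd b ph x)) (at x)"
 using test_functionD(6) by (auto simp: partial_deriv_def frechet_derivative_works)

lemma partial_deriv_cong_open: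
 assumes "open S" "x : S" "!!y. y : S ==> f y = g y"
 shows "pd b f x = pd b g x"
proof -
 have "(f has_derivative D) (at x) \<longleftrightarrow> (g has_derivative D) (at x)" for D
  using assms has_derivative_transform_within_open[OF _ assms(1,2), of f D UNIV g]
   has_derivative_transform_within_open[OF _ assms(1,2), of g D UNIV f] by metis
 thus ?thesis by (simp add: partial_deriv_def frechet_derivative_def)
qed

lemma test_partial_deriv:
 assumes "ph : test_functions U" "b : Basis"
 shows "pd b ph : test_functions U"
proof -
 let ?S = "closure {x. ph x ~= 0}"
 have "pd b ph x = 0" if "x ~: ?S" for x
 proof -
  have "pd b ph x = pd b (%_. 0) x"
   by (rule partial_deriv_cong_open[of "- ?S"]) (use that closure_subset[of "{x. ph x ~= 0}"] in auto)
  thus ?thesis using partial_deriv_eq[OF has_derivative_const] by simp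
 qed
 hence sub: "closure {x. pd b ph x ~= 0} <= ?S"
  by (intro closure_minimal) auto
 moreover have "Ck n (pd b ph)" for n
  using test_functionD(1)[OF assms(1), of "Suc n"] assms(2) by simp
 moreover have "bounded {x. pd b ph x ~= 0}"
  using sub test_functionD(2)[OF assms(1)] closure_subset by (meson bounded_subset compact_imp_bounded)
 ultimately show ?thesis using test_functionD(3)[OF assms(1)]
  by (auto simp: test_functions_def)
qed

lemma test_linear:
 assumes "bounded_linear h" "ph : test_functions U"
 shows "(%x. h (ph x)) : test_functions U"
proof -
 interpret bounded_linear h by fact
 have "closure {x. h (ph x) ~= 0} <= closure {x. ph x ~= 0}"
  by (intro closure_mono) auto
 moreover have "bounded {x. h (ph x) ~= 0}"
  by (rule bounded_subset[OF test_functionD(4)[OF assms(2)]]) auto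
 ultimately show ?thesis using test_functionD(3)[OF assms(2)] Ck_bounded_linear[OF assms(1) test_functionD(1)[OF assms(2)]]
  by (auto simp: test_functions_def)
qed

lemma partial_deriv_linear:
 assumes "bounded_linear h" "f differentiable (at x)"
 shows "pd b (%x. h (f x)) x = h (pd b f x)"
 using bounded_linear.has_derivative[OF assms(1) assms(2)[unfolded frechet_derivative_works]]
 by (subst partial_deriv_eq) (auto simp: partial_deriv_def)

definition lap :: "('a::euclidean_space => 'b::real_normed_vector) => 'a => 'b" where
 "lap f x = (SUM b:Basis. pd b (pd b f) x)"

lemma lap_linear:
 assumes "bounded_linear h" "ph : test_functions U"
 shows "lap (%x. h (ph x)) x = h (lap ph x)"
proof -
 have "pd b (pd b (%x. h (ph x))) x = h (pd b (pd b ph) x)" if "b : Basis" for b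
 proof -
  have "pd b (%x. h (ph x)) = (%x. h (pd b ph x))"
   using partial_deriv_linear[OF assms(1) test_functionD(6)[OF assms(2)]] by auto
  thus ?thesis
   using partial_deriv_linear[OF assms(1) test_functionD(6)[OF test_partial_deriv[OF assms(2) that]]] by simp
 qed
 thus ?thesis unfolding lap_def
  by (simp add: linear_sum[OF bounded_linear.linear[OF assms(1)]])
qed

lemma test_lap: "ph : test_functions U ==> cts UNIV (lap ph)"
 unfolding lap_def[abs_def] by (intro continuous_on_sum test_functionD(5)[of _ U] test_partial_deriv)

lemma lap_eq_0: "ph : test_functions U ==> x ~: U ==> lap ph x = 0"
 unfolding lap_def by (auto intro!: sum.neutral test_functionD(7) test_partial_deriv)

lemma lap_bounded_support: "ph : test_functions U ==> bounded {x. lap ph x ~= 0}"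
 by (rule bounded_subset[of "\<Union>b\<in>Basis. {x. pd b (pd b ph) x ~= 0}"])
   (auto simp: lap_def intro!: test_functionD(4) test_partial_deriv intro: sum.not_neutral_contains_not_neutral)

lemma test_scaleR_continuous:
 fixes ph :: "'a::euclidean_space => real" and h :: "'a => 'b::real_normed_vector"
 assumes "ph : test_functions U" "open U" "cts U h"
 shows "cts UNIV (%x. ph x *R h x)"
proof -
 let ?S = "closure {x. ph x ~= 0}"
 have "cts (U Un - ?S) (%x. ph x *R h x)"
 proof (rule continuous_on_open_Un)
  show "cts U (%x. ph x *R h x)"
   by (intro continuous_on_scaleR assms(3) continuous_on_subset[OF test_functionD(5)[OF assms(1)]]) auto
  have "ph x *R h x = 0" if "x : - ?S" for x using that closure_subset[of "{x. ph x ~= 0}"] by auto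
  thus "cts (- ?S) (%x. ph x *R h x)"
   by (intro continuous_on_eq[OF continuous_on_const[of "- ?S" 0]]) auto
 qed (use assms in auto)
 moreover have "U Un - ?S = UNIV" using test_functionD(3)[OF assms(1)] by auto
 ultimately show ?thesis by simp
qed

text \<open>\<open>ph\<close> vanishes in a neighbourhood of every point outside \<open>U\<close>,
  so the product with \<open>f\<close> is differentiable on the whole space, and its partial
  derivative has integral zero.\<close>

lemma integration_by_parts:
 fixes ph :: "'a::euclidean_space => real" and f :: "'a => 'b::euclidean_space"
 assumes ph: "ph : test_functions U" and U: "open U" and b: "b : Basis"
  and f: "!!x. x : U ==> (f has_derivative f' x) (at x)" "cts U (%x. f' x b)"
 shows "(LINT x|leb. pd b ph x *R f x) = - (LINT x|leb. ph x *R f' x b)"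
proof -
 let ?S = "closure {x. ph x ~= 0}"
 define D where "D x h = (if x : U then ph x *R f' x h + pd h ph x *R f x else 0)" for x h
 have contf: "cts U f"
  using f(1) U by (auto intro!: continuous_at_imp_continuous_on has_derivative_continuous)
 have c1: "cts UNIV (%x. ph x *R f' x b)" by (rule test_scaleR_continuous[OF ph U f(2)])
 have c2: "cts UNIV (%x. pd b ph x *R f x)"
  by (rule test_scaleR_continuous[OF test_partial_deriv[OF ph b] U contf])
 have Deq: "D x b = ph x *R f' x b + pd b ph x *R f x" for x
  using test_functionD(7)[OF ph] test_functionD(7)[OF test_partial_deriv[OF ph b]] by (auto simp: D_def)
 have "(LINT x|leb. D x b) = 0"
 proof (rule integral_partial_deriv_eq_0[where F="%x. ph x *R f x"])
  show "((%x. ph x *R f x) has_derivative D x) (at x)" for x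
  proof (cases "x : U")
   case True
   show ?thesis using has_derivative_scaleR[OF test_has_derivative[OF ph] f(1)[OF True]] True
    by (simp add: D_def[abs_def])
  next
   case False
   have "((%x. 0) has_derivative (%_. 0)) (at x)" by (rule has_derivative_const)
   hence "((%x. ph x *R f x) has_derivative (%_. 0)) (at x)"
    by (rule has_derivative_transform_within_open[of _ _ _ _ "- ?S"])
      (use False test_functionD(3)[OF ph] closure_subset[of "{x. ph x ~= 0}"] in auto)
   thus ?thesis using False by (simp add: D_def[abs_def])
  qed
  show "cts UNIV (%x. D x b)" unfolding Deq by (intro continuous_intros c1 c2)
  show "bounded {x. ph x *R f x ~= 0}"
   by (rule bounded_subset[OF test_functionD(4)[OF ph]]) auto
 qed
 moreover have "integrable leb (%x. ph x *R f' x b)"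
  by (rule continuous_compact_support_integrable[OF c1], rule bounded_subset[OF test_functionD(4)[OF ph]]) auto
 moreover have "integrable leb (%x. pd b ph x *R f x)"
  by (rule continuous_compact_support_integrable[OF c2],
    rule bounded_subset[OF test_functionD(4)[OF test_partial_deriv[OF ph b]]]) auto
 ultimately show ?thesis unfolding Deq
  by (simp add: eq_neg_iff_add_eq_0 add.commute)
qed

lemma continuous_support_L2:
 fixes f :: "'a::euclidean_space => 'b::euclidean_space"
 assumes "cts UNIV f" "bounded {x. f x ~= 0}" "!!x. x ~: U ==> f x = 0"
 shows "f : L2 U"
proof -
 have z: "zext U f = f" using assms(3) by (auto simp: zext_def indicator_def)
 have "cts UNIV (%x. (norm (f x))^2)" by (intro continuous_intros assms)
 moreover have "bounded {x. (norm (f x))^2 ~= 0}" using assms(2) by simp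
 ultimately have "integrable leb (%x. (norm (f x))^2)" by (rule continuous_compact_support_integrable)
 thus ?thesis using borel_measurable_continuous_onI[OF assms(1)]
  by (simp add: L2_iff z) (simp add: measurable_completion)
qed

lemma test_L2: "ph : test_functions U ==> ph : L2 U" for ph :: "'a::euclidean_space => 'b::euclidean_space"
 by (intro continuous_support_L2 test_functionD)

lemma loc_integrable_mult:
 fixes ph :: "'a::euclidean_space => real" and f :: "'a => 'b::euclidean_space"
 assumes "cts UNIV ph" "compact K" "K <= U" "!!x. x ~: K ==> ph x = 0" "loc_integrable U f"
 shows "integrable leb (%x. ph x *R f x)"
proof -
 have i: "integrable leb (zext K f)" using assms by (auto simp: loc_integrable_def set_integrable_zext)
 have "{x. ph x ~= 0} <= K" using assms(4) by auto
 hence "bounded {x. ph x ~= 0}" using assms(2) bounded_subset compact_imp_bounded by blast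
 then obtain B where B: "B >= 0" "!!x. norm (ph x) <= B"
  using continuous_compact_support_bounded[OF assms(1)] by blast
 have eq: "(%x. ph x *R f x) = (%x. ph x *R zext K f x)"
  using assms(4) by (intro ext) (auto simp: zext_def indicator_def)
 have [measurable]: "ph : borel_measurable leb"
  using borel_measurable_continuous_onI[OF assms(1)] by (simp add: measurable_completion)
 have [measurable]: "zext K f : borel_measurable leb" using i by auto
 show ?thesis unfolding eq
  by (rule Bochner_Integration.integrable_bound[of leb "%x. B *R zext K f x"])
    (use i B in "auto intro!: AE_I2 mult_right_mono")
qed

lemma test_loc_integrable:
 fixes ph :: "'a::euclidean_space => real" and f :: "'a => 'b::euclidean_space"
 assumes "ph : test_functions U" "loc_integrable U f"
 shows "integrable leb (%x. ph x *R f x)"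
 by (rule loc_integrable_mult[OF test_functionD(5)[OF assms(1)] test_functionD(2,3)[OF assms(1)] _ assms(2)])
   (use closure_subset[of "{x. ph x ~= 0}"] in auto)

lemma L2_loc_integrable:
 fixes f :: "'a::euclidean_space => 'b::euclidean_space"
 assumes "f : L2 U"
 shows "loc_integrable U f"
 unfolding loc_integrable_def
proof safe
 fix K assume K: "compact K" "K <= U"
 have [measurable]: "K : sets leb" using borel_compact[OF K(1)] by (intro sets_completionI_sets) simp
 have [measurable]: "zext U f : borel_measurable leb" using assms by (rule L2D)
 have K1: "integrable leb (%x. indicator K x :: real)"
  using borel_integrable_compact[OF K(1), of "%_. 1::real"] integrable_completion[of "%x. indicator K x :: real" lborel] borel_compact[OF K(1)]
  by simp
 have eq: "zext K f = (%x. indicator K x *R zext U f x)"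
  using K(2) by (intro ext) (auto simp: zext_def indicator_def)
 have "integrable leb (%x. (indicator K x :: real) * norm (zext U f x))"
  by (rule integrable_mult_square) (use K1 L2D(2)[OF assms] in \<open>auto simp: power2_eq_square[of "indicator K x" for x] simp flip: indicator_inter_arith\<close>)
 thus "set_integrable leb K f" unfolding set_integrable_zext eq
  by (rule Bochner_Integration.integrable_bound) auto
qed

lemma test_set_integral:
 fixes f :: "'a::euclidean_space => 'b::{banach, second_countable_topology}"
 assumes "!!x. x ~: U ==> f x = 0"
 shows "(LINT x:U|leb. f x) = (LINT x|leb. f x)"
proof -
 have "zext U f = f" using assms by (intro ext) (auto simp: zext_def indicator_def)
 thus ?thesis by (simp add: set_integral_zext)
qed

lemma lap_integrable:
 fixes ph :: "'a::euclidean_space => real" and f :: "'a => 'b::euclidean_space"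
 assumes "ph : test_functions U" "loc_integrable U f"
 shows "integrable leb (%x. lap ph x *R f x)"
 unfolding lap_def scaleR_sum_left
 by (intro Bochner_Integration.integrable_sum test_loc_integrable[OF _ assms(2)] test_partial_deriv assms(1))

lemma has_weak_laplacian_iff:
 fixes f :: "'a::euclidean_space => 'b::euclidean_space"
 shows "has_weak_laplacian U f w \<longleftrightarrow> loc_integrable U f & loc_integrable U w &
   (ALL ph :: 'a => real. ph : test_functions U -->
    (LINT x|leb. lap ph x *R f x) = (LINT x|leb. ph x *R w x))"
proof -
 have "(LINT x:U|leb. (SUM b:Basis. pd b (pd b ph) x) *R f x) = (LINT x|leb. lap ph x *R f x)"
  "(LINT x:U|leb. ph x *R w x) = (LINT x|leb. ph x *R w x)"
  if "ph : test_functions U" for ph :: "'a => real"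
  using lap_eq_0[OF that] test_functionD(7)[OF that]
  by (simp_all add: test_set_integral lap_def)
 thus ?thesis unfolding has_weak_laplacian_def by (auto)
qed

lemma complex_mult_split: "z * w = Re z *R w + \<i> * (Im z *R w)" for z w :: complex
 by (auto simp: complex_eq_iff)

lemma test_Re: "ph : test_functions U ==> (%x. Re (ph x)) : test_functions U"
 and test_Im: "ph : test_functions U ==> (%x. Im (ph x)) : test_functions U"
 by (auto intro: test_linear bounded_linear_Re bounded_linear_Im)

lemma test_of_real:
 "ph : test_functions U ==> (%x. cx (ph x)) : test_functions U"
 by (auto intro: test_linear bounded_linear_of_real)

lemma partial_Re:
 assumes "ph : test_functions U"
 shows "pd b (%x. Re (ph x)) x = Re (pd b ph x)"
  "pd b (%x. Im (ph x)) x = Im (pd b ph x)"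
 using partial_deriv_linear[OF bounded_linear_Re test_functionD(6)[OF assms]]
  partial_deriv_linear[OF bounded_linear_Im test_functionD(6)[OF assms]] by auto

lemma integral_mult_split:
 fixes ph f :: "'a => complex"
 assumes "integrable M (%x. Re (ph x) *R f x)" "integrable M (%x. Im (ph x) *R f x)"
 shows "(LINT x|M. ph x * f x) = (LINT x|M. Re (ph x) *R f x) + \<i> * (LINT x|M. Im (ph x) *R f x)"
proof -
 have "(LINT x|M. ph x * f x) = (LINT x|M. Re (ph x) *R f x + \<i> * (Im (ph x) *R f x))"
  by (intro Bochner_Integration.integral_cong refl complex_mult_split)
 thus ?thesis
  using assms by (simp only: Bochner_Integration.integral_add integrable_mult_right integral_mult_right_zero)
qed

text \<open>The definition tests with real functions. Complex ones are required because elements of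
  \<open>H10\<close> are limits of complex test functions; they are split into real and imaginary
  part.\<close>

lemma weak_laplacian_complex_test:
 fixes f :: "'a::euclidean_space => complex"
 assumes "has_weak_laplacian U f w" "ph : test_functions U"
 shows "(LINT x:U|leb. lap ph x * f x) = (LINT x:U|leb. ph x * w x)"
proof -
 have li: "loc_integrable U f" "loc_integrable U w" using assms(1) by (auto simp: has_weak_laplacian_iff)
 note R = test_Re[OF assms(2)] test_Im[OF assms(2)]
 have l: "Re (lap ph x) = lap (%x. Re (ph x)) x" "Im (lap ph x) = lap (%x. Im (ph x)) x" for x
  using lap_linear[OF bounded_linear_Re assms(2)] lap_linear[OF bounded_linear_Im assms(2)] by auto
 have "(LINT x:U|leb. lap ph x * f x) = (LINT x|leb. lap ph x * f x)"
  by (rule test_set_integral) (simp add: lap_eq_0[OF assms(2)])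
 also have "... = (LINT x|leb. lap (%x. Re (ph x)) x *R f x) + \<i> * (LINT x|leb. lap (%x. Im (ph x)) x *R f x)"
  using lap_integrable[OF R(1) li(1)] lap_integrable[OF R(2) li(1)]
  by (subst integral_mult_split) (simp_all add: l)
 also have "... = (LINT x|leb. Re (ph x) *R w x) + \<i> * (LINT x|leb. Im (ph x) *R w x)"
  using assms(1) R by (simp add: has_weak_laplacian_iff)
 also have "... = (LINT x|leb. ph x * w x)"
  by (subst integral_mult_split) (simp_all add: test_loc_integrable[OF R(1) li(2)] test_loc_integrable[OF R(2) li(2)])
 also have "... = (LINT x:U|leb. ph x * w x)"
  by (rule test_set_integral[symmetric]) (simp add: test_functionD(7)[OF assms(2)])
 finally show ?thesis .
qed

lemma integration_by_parts_test:
 fixes ph ps :: "'a::euclidean_space => complex"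
 assumes ph: "ph : test_functions U" and ps: "ps : test_functions U" and b: "b : Basis"
 shows "(LINT x:U|leb. pd b ph x * ps x) = - (LINT x:U|leb. ph x * pd b ps x)"
proof -
 note R = test_Re[OF ph] test_Im[OF ph]
 have U: "et : test_functions UNIV" if "et : test_functions U" for et :: "'a => real"
  using that by (auto simp: test_functions_def)
 have li: "loc_integrable U ps" "loc_integrable U (pd b ps)"
  by (auto intro!: L2_loc_integrable test_L2 ps test_partial_deriv b)
 have ibp: "(LINT x|leb. pd b et x *R ps x) = - (LINT x|leb. et x *R pd b ps x)"
  if "et : test_functions U" for et :: "'a => real"
  by (rule integration_by_parts[OF U[OF that] open_UNIV b test_has_derivative[OF ps]])
    (auto intro: test_functionD(5)[OF test_partial_deriv[OF ps b]])
 have "(LINT x:U|leb. pd b ph x * ps x) = (LINT x|leb. pd b ph x * ps x)"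
  by (rule test_set_integral) (simp add: test_functionD(7)[OF ps])
 also have "... = (LINT x|leb. pd b (%x. Re (ph x)) x *R ps x) + \<i> * (LINT x|leb. pd b (%x. Im (ph x)) x *R ps x)"
  using test_loc_integrable[OF test_partial_deriv[OF R(1) b] li(1)] test_loc_integrable[OF test_partial_deriv[OF R(2) b] li(1)]
  by (subst integral_mult_split) (simp_all add: partial_Re[OF ph])
 also have "... = - ((LINT x|leb. Re (ph x) *R pd b ps x) + \<i> * (LINT x|leb. Im (ph x) *R pd b ps x))"
  by (simp add: ibp R)
 also have "... = - (LINT x|leb. ph x * pd b ps x)"
  using test_loc_integrable[OF R(1) li(2)] test_loc_integrable[OF R(2) li(2)]
  by (subst integral_mult_split) simp_all
 also have "... = - (LINT x:U|leb. ph x * pd b ps x)"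
  by (subst test_set_integral) (simp_all add: test_functionD(7)[OF ph])
 finally show ?thesis .
qed

section \<open>The space \<open>H\<^sub>0\<^sup>1\<close> and Green's formula\<close>

text \<open>Names the gradient that \<open>H10\<close> hides behind an existential quantifier, so
  that Green's formula and closedness can refer to it.\<close>

definition H10_grad :: "'a::euclidean_space set => ('a => 'b::euclidean_space) => ('a => 'a => 'b) => bool" where
 "H10_grad U f g \<longleftrightarrow> f : L2 U & (ALL b:Basis. g b : L2 U) &
   (EX ph. (ALL n::nat. ph n : test_functions U) &
   (%n. l2norm U (%x. ph n x - f x)) ---> 0 &
   (ALL b:Basis. (%n. l2norm U (%x. pd b (ph n) x - g b x)) ---> 0))"

lemma H10_iff: "f : H10 U \<longleftrightarrow> (EX g. H10_grad U f g)"
 by (auto simp: H10_def H10_grad_def)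

lemma H10_grad_test:
 fixes f :: "'a::euclidean_space => complex"
 assumes "H10_grad U f g" "ph : test_functions U" "b : Basis"
 shows "(LINT x:U|leb. pd b ph x * f x) = - (LINT x:U|leb. ph x * g b x)"
proof -
 obtain ps where ps: "!!n::nat. ps n : test_functions U" "(%n. l2norm U (%x. ps n x - f x)) ---> 0"
  "(%n. l2norm U (%x. pd b (ps n) x - g b x)) ---> 0"
  and L: "f : L2 U" "g b : L2 U"
  using assms by (auto simp: H10_grad_def)
 note p = test_L2[OF ps(1)] test_L2[OF test_partial_deriv[OF ps(1) assms(3)]]
  test_L2[OF assms(2)] test_L2[OF test_partial_deriv[OF assms(2,3)]]
 have eq: "(LINT x:U|leb. ps n x * pd b ph x) = - (LINT x:U|leb. pd b (ps n) x * ph x)" for n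
  using integration_by_parts_test[OF assms(2) ps(1) assms(3)] by (simp add: mult.commute)
 have "(%n. LINT x:U|leb. ps n x * pd b ph x) ---> (LINT x:U|leb. f x * pd b ph x)"
  by (rule L2_mult_tendsto[OF p(1) L(1) p(4) ps(2)])
 moreover have "(%n. - (LINT x:U|leb. pd b (ps n) x * ph x)) ---> - (LINT x:U|leb. g b x * ph x)"
  by (rule tendsto_minus, rule L2_mult_tendsto[OF p(2) L(2) p(3) ps(3)])
 ultimately have "(LINT x:U|leb. f x * pd b ph x) = - (LINT x:U|leb. g b x * ph x)"
  unfolding eq by (rule LIMSEQ_unique)
 thus ?thesis by (simp add: mult.commute)
qed

text \<open>With a test function in place of \<open>p\<close> this is the definition of the weak
  Laplacian followed by one integration by parts against the gradient of \<open>f\<close>. Both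
  sides are continuous in \<open>p\<close>, because \<open>w\<close> and the gradients are square
  integrable.\<close>

lemma Green_formula:
 fixes f p :: "'a::euclidean_space => complex"
 assumes f: "H10_grad U f g" "has_weak_laplacian U f w" "w : L2 U" and p: "H10_grad U p h"
 shows "(LINT x:U|leb. p x * w x) = - (SUM b:Basis. LINT x:U|leb. h b x * g b x)"
proof -
 obtain ph where ph: "!!n::nat. ph n : test_functions U" "(%n. l2norm U (%x. ph n x - p x)) ---> 0"
  "!!b. b : Basis ==> (%n. l2norm U (%x. pd b (ph n) x - h b x)) ---> 0"
  and L: "p : L2 U" "!!b. b : Basis ==> h b : L2 U"
  using p by (auto simp: H10_grad_def)
 have Lf: "f : L2 U" "!!b. b : Basis ==> g b : L2 U" using f(1) by (auto simp: H10_grad_def)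
 have *: "(LINT x:U|leb. ph n x * w x) = - (SUM b:Basis. LINT x:U|leb. pd b (ph n) x * g b x)" for n
 proof -
  have "(LINT x:U|leb. ph n x * w x) = (LINT x:U|leb. lap (ph n) x * f x)"
   using weak_laplacian_complex_test[OF f(2) ph(1)] by simp
  also have "... = (SUM b:Basis. LINT x:U|leb. pd b (pd b (ph n)) x * f x)"
  proof -
   have "integrable leb (zext U (%x. pd b (pd b (ph n)) x * f x))" if "b : Basis" for b
    using L2_mult_integrable[OF test_L2[OF test_partial_deriv[OF test_partial_deriv[OF ph(1) that] that]] Lf(1)]
    by (simp add: set_integrable_zext)
   moreover have "zext U (%x. lap (ph n) x * f x) = (%x. SUM b:Basis. zext U (%x. pd b (pd b (ph n)) x * f x) x)"
    by (intro ext) (simp add: zext_def lap_def sum_distrib_right scaleR_sum_right)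
   ultimately show ?thesis unfolding set_integral_zext by (simp add: Bochner_Integration.integral_sum)
  qed
  also have "... = (SUM b:Basis. - (LINT x:U|leb. pd b (ph n) x * g b x))"
   by (intro sum.cong refl H10_grad_test[OF f(1)] test_partial_deriv ph(1))
  finally show ?thesis by (simp add: sum_negf)
 qed
 have "(%n. LINT x:U|leb. ph n x * w x) ---> (LINT x:U|leb. p x * w x)"
  by (rule L2_mult_tendsto[OF test_L2[OF ph(1)] L(1) f(3) ph(2)])
 moreover have "(%n. - (SUM b:Basis. LINT x:U|leb. pd b (ph n) x * g b x)) --->
   - (SUM b:Basis. LINT x:U|leb. h b x * g b x)"
  by (intro tendsto_minus tendsto_sum L2_mult_tendsto test_L2 test_partial_deriv ph L Lf)
 ultimately show ?thesis unfolding * by (rule LIMSEQ_unique)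
qed

lemma weak_laplacian_symmetric:
 fixes f p :: "'a::euclidean_space => complex"
 assumes "f : H10 U" "has_weak_laplacian U f w" "w : L2 U" "p : H10 U" "has_weak_laplacian U p v" "v : L2 U"
 shows "(LINT x:U|leb. p x * w x) = (LINT x:U|leb. f x * v x)"
proof -
 obtain g h where "H10_grad U f g" "H10_grad U p h" using assms by (auto simp: H10_iff)
 from Green_formula[OF this(1) assms(2,3) this(2)] Green_formula[OF this(2) assms(5,6) this(1)]
 show ?thesis by (simp add: mult.commute)
qed

text \<open>A diagonal choice: for every \<open>n\<close> a test function that is closer than
  \<open>1 / (n + 1)\<close> to \<open>F n\<close>, together with its gradient.\<close>

lemma H10_grad_closed:
 fixes f :: "'a::euclidean_space => 'b::euclidean_space"
 assumes "!!n::nat. H10_grad U (F n) (G n)" "f : L2 U" "!!b. b : Basis ==> g b : L2 U"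
  "(%n. l2norm U (%x. F n x - f x)) ---> 0"
  "!!b. b : Basis ==> (%n. l2norm U (%x. G n b x - g b x)) ---> 0"
 shows "H10_grad U f g"
proof -
 have "EX ph. ph : test_functions U & l2norm U (%x. ph x - F n x) < inverse (real (Suc n)) &
   (ALL b:Basis. l2norm U (%x. pd b ph x - G n b x) < inverse (real (Suc n)))" for n
 proof -
  obtain ph where ph: "!!k::nat. ph k : test_functions U" "(%k. l2norm U (%x. ph k x - F n x)) ---> 0"
   "!!b. b : Basis ==> (%k. l2norm U (%x. pd b (ph k) x - G n b x)) ---> 0"
   using assms(1)[of n] by (auto simp: H10_grad_def)
  have pos: "inverse (real (Suc n)) > 0" by simp
  have "\<forall>\<^sub>F k in sequentially. l2norm U (%x. ph k x - F n x) < inverse (real (Suc n)) &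
   (ALL b:Basis. l2norm U (%x. pd b (ph k) x - G n b x) < inverse (real (Suc n)))"
   using order_tendstoD(2)[OF ph(2) pos] order_tendstoD(2)[OF ph(3) pos]
   by (intro eventually_conj eventually_ball_finite) auto
  then obtain k where "l2norm U (%x. ph k x - F n x) < inverse (real (Suc n)) &
   (ALL b:Basis. l2norm U (%x. pd b (ph k) x - G n b x) < inverse (real (Suc n)))"
   by (auto dest!: eventually_happens)
  thus ?thesis using ph(1) by blast
 qed
 then obtain ph where ph: "!!n. ph n : test_functions U"
   "!!n. l2norm U (%x. ph n x - F n x) < inverse (real (Suc n))"
   "!!n b. b : Basis ==> l2norm U (%x. pd b (ph n) x - G n b x) < inverse (real (Suc n))"
  by metis
 have key: "(%n. l2norm U (%x. A n x - c x)) ---> 0"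
  if "!!n. A n : L2 U" "!!n. B n : L2 U" "c : L2 U" "!!n. l2norm U (%x. A n x - B n x) < inverse (real (Suc n))"
   "(%n. l2norm U (%x. B n x - c x)) ---> 0" for A B :: "nat => 'a => 'b" and c
 proof -
  have "l2norm U (%x. A n x - c x) <= inverse (real (Suc n)) + l2norm U (%x. B n x - c x)" for n
   using l2norm_triangle[OF L2_diff[OF that(1)[of n] that(2)[of n]] L2_diff[OF that(2)[of n] that(3)]] that(4)[of n] by simp
  hence ev: "\<forall>\<^sub>F n in sequentially. norm (l2norm U (%x. A n x - c x)) <= inverse (real (Suc n)) + l2norm U (%x. B n x - c x)"
   by (intro always_eventually) auto
  have "(%n. inverse (real (Suc n)) + l2norm U (%x. B n x - c x)) ---> 0"
   using tendsto_add[OF LIMSEQ_inverse_real_of_nat that(5)] by simp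
  thus ?thesis by (rule Lim_null_comparison[OF ev])
 qed
 have LF: "!!n. F n : L2 U" "!!n b. b : Basis ==> G n b : L2 U" using assms(1) by (auto simp: H10_grad_def)
 have "(%n. l2norm U (%x. ph n x - f x)) ---> 0"
  by (rule key[OF test_L2[OF ph(1)] LF(1) assms(2) ph(2) assms(4)])
 moreover have "(%n. l2norm U (%x. pd b (ph n) x - g b x)) ---> 0" if "b : Basis" for b
  by (rule key[OF test_L2[OF test_partial_deriv[OF ph(1) that]] LF(2) assms(3) ph(3) assms(5)]) (rule that)+
 ultimately show ?thesis unfolding H10_grad_def using assms(2,3) ph(1) by blast
qed

text \<open>Each defining identity pairs with a fixed test function and its Laplacian, both in
  \<open>L2 U\<close>, and such pairings are continuous.\<close>

lemma weak_laplacian_closed: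
 fixes f :: "'a::euclidean_space => complex"
 assumes "!!n::nat. has_weak_laplacian U (F n) (W n)" "!!n. F n : L2 U" "!!n. W n : L2 U" "f : L2 U" "w : L2 U"
  "(%n. l2norm U (%x. F n x - f x)) ---> 0"
  "(%n. l2norm U (%x. W n x - w x)) ---> 0"
 shows "has_weak_laplacian U f w"
 unfolding has_weak_laplacian_iff
proof safe
 fix ph :: "'a => real" assume ph: "ph : test_functions U"
 define ps where "ps = (%x. cx (ph x))"
 have ps: "ps : test_functions U" unfolding ps_def by (rule test_of_real[OF ph])
 have l: "lap ps x = cx (lap ph x)" for x
  unfolding ps_def by (rule lap_linear[OF bounded_linear_of_real ph])
 have l2: "lap ps : L2 U"
  by (rule continuous_support_L2[OF test_lap[OF ps] lap_bounded_support[OF ps] lap_eq_0[OF ps]])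
 have "(%n. LINT x:U|leb. F n x * lap ps x) ---> (LINT x:U|leb. f x * lap ps x)"
  by (rule L2_mult_tendsto[OF assms(2,4) l2 assms(6)])
 also have eq: "(%n. LINT x:U|leb. F n x * lap ps x) = (%n. LINT x:U|leb. W n x * ps x)"
  using weak_laplacian_complex_test[OF assms(1) ps] by (simp add: mult.commute)
 finally have "(%n. LINT x:U|leb. W n x * ps x) ---> (LINT x:U|leb. f x * lap ps x)" .
 moreover have "(%n. LINT x:U|leb. W n x * ps x) ---> (LINT x:U|leb. w x * ps x)"
  by (rule L2_mult_tendsto[OF assms(3,5) test_L2[OF ps] assms(7)])
 ultimately have "(LINT x:U|leb. f x * lap ps x) = (LINT x:U|leb. w x * ps x)"
  by (rule LIMSEQ_unique)
 moreover have "(LINT x:U|leb. f x * lap ps x) = (LINT x|leb. lap ph x *R f x)"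
  by (subst test_set_integral) (use lap_eq_0[OF ps] in "auto simp: l scaleR_conv_of_real mult.commute")
 moreover have "(LINT x:U|leb. w x * ps x) = (LINT x|leb. ph x *R w x)"
  by (subst test_set_integral) (use test_functionD(7)[OF ps] in "auto simp: ps_def scaleR_conv_of_real mult.commute")
 ultimately show "(LINT x|leb. lap ph x *R f x) = (LINT x|leb. ph x *R w x)" by simp
qed (auto intro: L2_loc_integrable assms)

lemma continuous_loc_integrable:
 fixes f :: "'a::euclidean_space => 'b::euclidean_space"
 assumes "cts U f"
 shows "loc_integrable U f"
 unfolding loc_integrable_def
proof safe
 fix K assume K: "compact K" "K <= U"
 have *: "integrable lborel (%x. indicator K x *R f x)"
  by (rule borel_integrable_compact[OF K(1) continuous_on_subset[OF assms K(2)]])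
 show "set_integrable leb K f" unfolding set_integrable_def
  using * integrable_completion[OF borel_measurable_integrable[OF *]] by (auto simp: )
qed

lemma classical_weak_laplacian:
 fixes f :: "'a::euclidean_space => 'b::euclidean_space"
 assumes U: "open U" and f: "!!x. x : U ==> (f has_derivative f' x) (at x)"
  "!!x b. x : U ==> b : Basis ==> ((%y. f' y b) has_derivative f2 b x) (at x)"
  "!!b. b : Basis ==> cts U (%x. f2 b x b)"
 shows "has_weak_laplacian U f (%x. SUM b:Basis. f2 b x b)"
 unfolding has_weak_laplacian_iff
proof safe
 have contf: "cts U f"
  using f(1) U by (auto intro!: continuous_at_imp_continuous_on has_derivative_continuous)
 have contf': "cts U (%x. f' x b)" if "b : Basis" for b
  using f(2) that U by (auto intro!: continuous_at_imp_continuous_on has_derivative_continuous)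
 show lf: "loc_integrable U f" by (rule continuous_loc_integrable[OF contf])
 show lw: "loc_integrable U (%x. SUM b:Basis. f2 b x b)"
  by (intro continuous_loc_integrable continuous_on_sum f(3))
 fix ph :: "'a => real" assume ph: "ph : test_functions U"
 have "(LINT x|leb. lap ph x *R f x) = (SUM b:Basis. LINT x|leb. pd b (pd b ph) x *R f x)"
  unfolding lap_def scaleR_sum_left
  by (intro Bochner_Integration.integral_sum test_loc_integrable[OF _ lf] test_partial_deriv ph)
 also have "... = (SUM b:Basis. LINT x|leb. ph x *R f2 b x b)"
 proof (intro sum.cong refl)
  fix b :: 'a assume b: "b : Basis"
  have "(LINT x|leb. pd b (pd b ph) x *R f x) = - (LINT x|leb. pd b ph x *R f' x b)"
   by (rule integration_by_parts[OF test_partial_deriv[OF ph b] U b f(1) contf'[OF b]])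
  also have "... = (LINT x|leb. ph x *R f2 b x b)"
   using integration_by_parts[OF ph U b f(2)[OF _ b] f(3)[OF b]] by simp
  finally show "(LINT x|leb. pd b (pd b ph) x *R f x) = (LINT x|leb. ph x *R f2 b x b)" .
 qed
 also have "... = (LINT x|leb. ph x *R (SUM b:Basis. f2 b x b))"
  unfolding scaleR_sum_right
  by (intro Bochner_Integration.integral_sum[symmetric] test_loc_integrable[OF ph] continuous_loc_integrable f(3))
 finally show "(LINT x|leb. lap ph x *R f x) = (LINT x|leb. ph x *R (SUM b:Basis. f2 b x b))" .
qed

section \<open>Cutoff functions and uniqueness of the weak Laplacian\<close>

text \<open>The first factor rises from 0 to 1 between \<open>1 + 1 / (n + 1)\<close> and
  \<open>1 + 2 / (n + 1)\<close>, the second falls back to 0 between \<open>n + 1\<close> and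
  \<open>2 * (n + 1)\<close>: one function cuts off both at the boundary and at infinity.\<close>

definition cutoff :: "nat => real => real" where
 "cutoff n r = sstep (real (Suc n) * (r - 1)) * (1 - sstep (r / real (Suc n)))"

lemma cutoff_bounds: "0 <= cutoff n r" "cutoff n r <= 1"
 using sstep_bounds by (auto simp: cutoff_def mult_le_one)

lemma Ck_cutoff: "Ck k (cutoff n)"
proof -
 have "Ck k (%r. sstep (real (Suc n) * r + - real (Suc n)) * (1 + (-1) * sstep (inverse (real (Suc n)) * r + 0)))"
  by (intro Ck_mult Ck_add Ck_const Ck_compose[OF Ck_sstep Ck_affine])
 thus ?thesis unfolding cutoff_def[abs_def] by (simp add: algebra_simps divide_inverse)
qed

lemma cutoff_eq_0:
 assumes "r ~: {1 + inverse (real (Suc n))..2 * real (Suc n)}"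
 shows "cutoff n r = 0"
proof (cases "r < 1 + inverse (real (Suc n))")
 case True
 hence "real (Suc n) * (r - 1) <= real (Suc n) * inverse (real (Suc n))" by (intro mult_left_mono) auto
 hence "real (Suc n) * (r - 1) <= 1" by simp
 thus ?thesis unfolding cutoff_def by (simp only: sstep_0 mult_zero_left)
next
 case False
 hence "r / real (Suc n) >= 2" using assms by (auto simp: field_simps)
 thus ?thesis unfolding cutoff_def by (simp only: sstep_1) simp
qed

lemma cutoff_eq_1:
 assumes "1 + 2 / real (Suc n) <= r" "r <= real (Suc n)"
 shows "cutoff n r = 1"
proof -
 have "real (Suc n) * (2 / real (Suc n)) <= real (Suc n) * (r - 1)" using assms by (intro mult_left_mono) auto
 hence "real (Suc n) * (r - 1) >= 2" by (simp del: of_nat_Suc)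
 moreover have "r / real (Suc n) <= 1" using assms by (auto simp: field_simps)
 ultimately show ?thesis unfolding cutoff_def by (simp only: sstep_0 sstep_1) simp
qed

lemma eventually_cutoff_eq_1:
 assumes "1 < a"
 shows "\<forall>\<^sub>F n in sequentially. ALL r:{a..b}. cutoff n r = 1"
proof -
 have "(%n. 1 + 2 * inverse (real (Suc n))) ---> 1 + 2 * 0"
  by (intro tendsto_intros LIMSEQ_inverse_real_of_nat)
 hence "\<forall>\<^sub>F n in sequentially. 1 + 2 * inverse (real (Suc n)) < a"
  using assms by (auto dest: order_tendstoD)
 moreover have "\<forall>\<^sub>F n in sequentially. b <= real (Suc n)"
 proof -
  obtain N :: nat where "b <= real N" using real_arch_simple by blast
  thus ?thesis by (intro eventually_sequentiallyI[of N]) auto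
 qed
 ultimately show ?thesis
  by eventually_elim (auto intro!: cutoff_eq_1 simp: divide_inverse)
qed

lemma cutoff_test: "emb (%r. cutoff n r *R r) : test_functions Omega" (is ?A)
 and cutoff_test_eq: "x : Omega ==> emb (%r. cutoff n r *R r) x = cutoff n (norm x)"
proof -
 have "Ck k (%r. cutoff n r *R r)" for k
  using Ck_scaleR[OF Ck_cutoff Ck_affine[of k 1 0]] by simp
 thus ?A
 proof (rule emb_test_function[of _ "1 + inverse (real (Suc n))" "2 * real (Suc n)"])
  have "inverse (real (Suc n)) > 0" by simp
  thus "1 < 1 + inverse (real (Suc n))" by linarith
  show "cutoff n r *R r = 0" if "r ~: {1 + inverse (real (Suc n))..2 * real (Suc n)}" for r
   using cutoff_eq_0[OF that] by simp
 qed
 show "emb (%r. cutoff n r *R r) x = cutoff n (norm x)" if "x : Omega"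
 proof -
  have "norm x ~= 0" using that by (auto simp: Omega_iff)
  thus ?thesis by (simp add: emb_def)
 qed
qed

lemma Ck_real_polynomial_function:
 "real_polynomial_function p ==> Ck n p" for p :: "'a::euclidean_space => real"
proof (induction rule: real_polynomial_function.induct)
 case (linear f)
 have "Ck n (%x::'a. x)"
 proof (cases n)
  case (Suc m)
  show ?thesis unfolding Suc by (rule Ck_SucI[OF has_derivative_ident]) (rule Ck_const)
 qed auto
 from Ck_bounded_linear[OF linear this] show ?case .
qed (auto intro: Ck_const Ck_add Ck_mult)

lemma test_mult:
 fixes ph :: "'a::euclidean_space => real" and f :: "'a::euclidean_space => 'b::real_normed_vector"
 assumes "ph : test_functions U" "!!n. Ck n f"
 shows "(%x. ph x *R f x) : test_functions U"
proof -
 have "closure {x. ph x *R f x ~= 0} <= closure {x. ph x ~= 0}" by (intro closure_mono) auto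
 moreover have "bounded {x. ph x *R f x ~= 0}"
  by (rule bounded_subset[OF test_functionD(4)[OF assms(1)]]) auto
 ultimately show ?thesis using test_functionD(3)[OF assms(1)] Ck_scaleR[OF test_functionD(1)[OF assms(1)] assms(2)]
  by (auto simp: test_functions_def simp del: scaleR_eq_0_iff)
qed

text \<open>Instead of mollifying \<open>g\<close>, polynomials are used: a cutoff times a
  polynomial is a test function, polynomials are uniformly dense in the continuous functions on the
  support of the cutoff \<open>c\<close>, and the sign of \<open>c * g\<close> is a limit of
  continuous functions almost everywhere.\<close>

lemma fundamental_lemma_real:
 fixes g :: "real^3 => real"
 assumes li: "loc_integrable Omega g"
  and zero: "!!ph. ph : test_functions Omega ==> (LINT x|leb. ph x * g x) = 0"
 shows "AE x in leb. x : Omega --> g x = 0"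
proof -
 have "AE x in leb. emb (%r. cutoff n r *R r) x * g x = 0" for n
 proof -
  define c :: "real^3 => real" where "c = emb (%r. cutoff n r *R r)"
  have c: "c : test_functions Omega" unfolding c_def by (rule cutoff_test)
  define S where "S = closure {x. c x ~= 0}"
  have S: "compact S" "x ~: S ==> c x = 0" for x
   using test_functionD(2)[OF c] closure_subset[of "{x. c x ~= 0}"] by (auto simp: S_def)
  have cg: "integrable leb (%x. c x * g x)" using test_loc_integrable[OF c li] by simp
  hence [measurable]: "(%x. c x * g x) : borel_measurable leb" by auto
  have step: "(LINT x|leb. ps x * (c x * g x)) = 0" if ps: "cts UNIV ps" for ps :: "real^3 => real"
  proof (rule ccontr)
   assume nz: "(LINT x|leb. ps x * (c x * g x)) ~= 0"
   define A where "A = (LINT x|leb. \<bar>c x * g x\<bar>)"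
   have A: "A >= 0" by (simp add: A_def)
   \<comment> \<open>Chosen so that \<open>e * A\<close> stays strictly below the modulus of the
     integral.\<close>
   define e where "e = \<bar>LINT x|leb. ps x * (c x * g x)\<bar> / (2 * (A + 1))"
   have e: "e > 0" using nz A by (auto simp: e_def)
   obtain p where p: "real_polynomial_function p" "!!x. x : S ==> \<bar>ps x - p x\<bar> < e"
    using Stone_Weierstrass_real_polynomial_function[OF S(1) continuous_on_subset[OF ps] e] by blast
   have pc: "(%x. c x *R p x) : test_functions Omega"
    by (rule test_mult[OF c Ck_real_polynomial_function[OF p(1)]])
   have contc: "cts UNIV c" by (rule test_functionD(5)[OF c])
   have i1: "integrable leb (%x. (c x * ps x) *R g x)"
   proof (rule loc_integrable_mult[OF _ S(1) _ _ li])
    show "cts UNIV (%x. c x * ps x)" by (rule continuous_on_mult[OF contc ps])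
    show "S <= Omega" unfolding S_def by (rule test_functionD(3)[OF c])
    show "c x * ps x = 0" if "x ~: S" for x using S(2)[OF that] by simp
   qed
   have i2: "integrable leb (%x. (c x * p x) * g x)" using test_loc_integrable[OF pc li] by simp
   have i1': "integrable leb (%x. ps x * (c x * g x))" using i1 by (simp add: mult_ac)
   have "(LINT x|leb. ps x * (c x * g x)) = (LINT x|leb. ps x * (c x * g x)) - (LINT x|leb. (c x * p x) * g x)"
    using zero[OF pc] by simp
   also have "... = (LINT x|leb. ps x * (c x * g x) - (c x * p x) * g x)"
    using i1' i2 by simp
   also have "\<bar>...\<bar> <= (LINT x|leb. e * \<bar>c x * g x\<bar>)"
   proof (rule order_trans[OF integral_abs_bound], rule integral_mono)
    show "integrable leb (%x. \<bar>ps x * (c x * g x) - c x * p x * g x\<bar>)" using i1' i2 by auto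
    show "integrable leb (%x. e * \<bar>c x * g x\<bar>)" using cg by auto
    fix x
    have "ps x * (c x * g x) - c x * p x * g x = (ps x - p x) * (c x * g x)" by (simp add: algebra_simps)
    moreover have "\<bar>(ps x - p x) * (c x * g x)\<bar> <= e * \<bar>c x * g x\<bar>"
     unfolding abs_mult[of "ps x - p x"] using mult_right_mono[OF less_imp_le[OF p(2)], of x "\<bar>c x * g x\<bar>"] S(2)[of x] by (cases "x : S") auto
    ultimately show "\<bar>ps x * (c x * g x) - c x * p x * g x\<bar> <= e * \<bar>c x * g x\<bar>" by simp
   qed
   also have "... = e * A" by (simp add: A_def)
   also have "... < \<bar>LINT x|leb. ps x * (c x * g x)\<bar>"
   proof -
    define J where "J = \<bar>LINT x|leb. ps x * (c x * g x)\<bar>"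
    have "J > 0" using nz by (simp add: J_def)
    hence "J * A < J * (2 * (A + 1))" using A by (intro mult_strict_left_mono) auto
    thus ?thesis unfolding e_def J_def[symmetric] using A by (simp add: field_simps)
   qed
   finally show False by simp
  qed
  define h where "h x = sgn (c x * g x)" for x
  have hm: "h : borel_measurable leb" unfolding h_def by measurable
  hence "h measurable_on UNIV" by (rule lebesgue_measurable_imp_measurable_on) simp
  then obtain N ps where N: "negligible N" and ps: "!!j::nat. cts UNIV (ps j)"
   "!!x. x ~: N ==> (%j. ps j x) ---> h x" by (auto simp: measurable_on_def)
  \<comment> \<open>Truncation to values between -1 and 1 does not change the limit, which is a
    sign, and gives the bound for dominated convergence.\<close>
  define xi where "xi j x = max (-1) (min 1 (ps j x))" for j x
  have xic: "cts UNIV (xi j)" for j unfolding xi_def by (intro continuous_intros ps)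
  have "(%j. LINT x|leb. xi j x * (c x * g x)) ---> (LINT x|leb. h x * (c x * g x))"
  proof (rule integral_dominated_convergence[where w="%x. \<bar>c x * g x\<bar>"])
   have [measurable]: "xi j : borel_measurable leb" for j
    using borel_measurable_continuous_onI[OF xic] by (simp add: measurable_completion)
   show "(%x. xi j x * (c x * g x)) : borel_measurable leb" for j by measurable
   show "(%x. h x * (c x * g x)) : borel_measurable leb" using hm by measurable
   have "AE x in leb. x ~: N" using N by (simp add: negligible_iff_null_sets AE_not_in)
   thus "AE x in leb. (%j. xi j x * (c x * g x)) ---> h x * (c x * g x)"
   proof eventually_elim
    case (elim x)
    have "(%j. xi j x) ---> max (-1) (min 1 (h x))"
     unfolding xi_def by (intro tendsto_max tendsto_min tendsto_const ps(2) elim)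
    moreover have "max (-1) (min 1 (h x)) = h x" by (auto simp: h_def sgn_if)
    ultimately show ?case by (auto intro!: tendsto_mult_right)
   qed
   show "AE x in leb. norm (xi j x * (c x * g x)) <= \<bar>c x * g x\<bar>" for j
   proof (rule AE_I2)
    fix x
    have "\<bar>xi j x\<bar> <= 1" by (auto simp: xi_def)
    hence "\<bar>xi j x\<bar> * \<bar>c x * g x\<bar> <= 1 * \<bar>c x * g x\<bar>" by (rule mult_right_mono) simp
    thus "norm (xi j x * (c x * g x)) <= \<bar>c x * g x\<bar>" by (simp add: abs_mult)
   qed
  qed (use cg in auto)
  hence "(LINT x|leb. h x * (c x * g x)) = 0" using step[OF xic] by (simp add: LIMSEQ_const_iff)
  moreover have "h x * (c x * g x) = \<bar>c x * g x\<bar>" for x unfolding h_def by (simp add: sgn_mult_abs mult.commute abs_sgn[symmetric])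
  ultimately have "(LINT x|leb. \<bar>c x * g x\<bar>) = 0" by simp
  hence "AE x in leb. \<bar>c x * g x\<bar> = 0"
   using cg by (subst (asm) integral_nonneg_eq_0_iff_AE) auto
  thus ?thesis by (auto simp: c_def)
 qed
 hence "AE x in leb. ALL n. emb (%r. cutoff n r *R r) x * g x = 0"
  unfolding AE_all_countable by blast
 thus ?thesis
 proof eventually_elim
  case (elim x)
  show ?case
  proof
   assume x: "x : Omega"
   then obtain n where "cutoff n (norm x) = 1"
    using eventually_happens[OF eventually_cutoff_eq_1[of "norm x" "norm x"]] by (auto simp: Omega_iff)
   thus "g x = 0" using elim cutoff_test_eq[OF x] by (metis mult_1)
  qed
 qed
qed

lemma loc_integrable_linear:
 assumes "bounded_linear h" "loc_integrable U f"
 shows "loc_integrable U (%x. h (f x))"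
proof -
 have "zext K (%x. h (f x)) = (%x. h (zext K f x))" for K
  by (intro ext zext_linear bounded_linear.linear assms)
 thus ?thesis using assms(2)
  by (auto simp: loc_integrable_def set_integrable_zext intro!: integrable_bounded_linear[OF assms(1)])
qed

lemma loc_integrable_diff:
 fixes f g :: "'a::euclidean_space => 'b::euclidean_space"
 assumes "loc_integrable U f" "loc_integrable U g"
 shows "loc_integrable U (%x. f x - g x)"
 using assms by (auto simp: loc_integrable_def intro: set_integral_diff)

lemma weak_laplacian_unique:
 fixes f :: "real^3 => complex"
 assumes "has_weak_laplacian Omega f w" "has_weak_laplacian Omega f v"
 shows "ae_eq w v"
proof -
 define g where "g x = w x - v x" for x
 have li: "loc_integrable Omega w" "loc_integrable Omega v" using assms by (auto simp: has_weak_laplacian_iff)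
 have lg: "loc_integrable Omega g" unfolding g_def by (rule loc_integrable_diff[OF li])
 have z: "(LINT x|leb. ph x *R g x) = 0" if ph: "ph : test_functions Omega" for ph
 proof -
  have "(LINT x|leb. ph x *R w x) = (LINT x|leb. ph x *R v x)"
   using assms ph unfolding has_weak_laplacian_iff by simp
  thus ?thesis using test_loc_integrable[OF ph li(1)] test_loc_integrable[OF ph li(2)]
   by (simp add: g_def scaleR_diff_right)
 qed
 have z': "(LINT x|leb. ph x * Re (g x)) = 0" "(LINT x|leb. ph x * Im (g x)) = 0" if ph: "ph : test_functions Omega" for ph
  using integral_Re[OF test_loc_integrable[OF ph lg]] integral_Im[OF test_loc_integrable[OF ph lg]] z[OF ph] by auto
 have "AE x in leb. x : Omega --> Re (g x) = 0"
  by (rule fundamental_lemma_real[OF loc_integrable_linear[OF bounded_linear_Re lg] z'(1)])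
 moreover have "AE x in leb. x : Omega --> Im (g x) = 0"
  by (rule fundamental_lemma_real[OF loc_integrable_linear[OF bounded_linear_Im lg] z'(2)])
 ultimately show ?thesis unfolding ae_eq_def
  by eventually_elim (auto simp: g_def complex_eq_iff)
qed

lemma weak_laplacian_eq:
 fixes f :: "real^3 => complex"
 assumes "has_weak_laplacian Omega f w"
 shows "ae_eq (weak_laplacian Omega f) w"
 unfolding weak_laplacian_def
 by (rule weak_laplacian_unique[OF someI[of "has_weak_laplacian Omega f", OF assms] assms])

section \<open>Polar coordinates and radial profiles\<close>

lemma l2norm_dominated_convergence:
 fixes F :: "nat => 'a::euclidean_space => 'b::euclidean_space" and W :: "'a => real"
 assumes "!!n. F n : L2 U" "W : L2 U" "!!n x. x : U ==> norm (F n x) <= W x"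
  "AE x in leb. x : U --> (%n. F n x) ---> 0"
 shows "(%n. l2norm U (F n)) ---> 0"
proof -
 have "(%n. LINT x|leb. (norm (zext U (F n) x))^2) ---> integral\<^sup>L (leb :: 'a measure) (%_. 0)"
 proof (rule integral_dominated_convergence[of "%_. 0" leb "%n x. (norm (zext U (F n) x))^2" "%x. (norm (zext U W x))^2"])
  show "AE x in leb. (%n. (norm (zext U (F n) x))^2) ---> 0"
   using assms(4)
  proof eventually_elim
   case (elim x)
   show ?case
   proof (cases "x : U")
    case True
    hence "(%n. (norm (F n x))^2) ---> (norm (0::'b))^2" using elim by (intro tendsto_intros) auto
    thus ?thesis using True by (simp add: zext_simps)
   qed (simp add: zext_simps)
  qed
  show "AE x in leb. norm ((norm (zext U (F n) x))^2) <= (norm (zext U W x))^2" for n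
  proof (rule AE_I2)
   fix x
   show "norm ((norm (zext U (F n) x))^2) <= (norm (zext U W x))^2"
    using assms(3)[of x n] by (cases "x : U") (auto simp: zext_simps intro!: power_mono)
  qed
 qed (use L2D(2)[OF assms(1)] L2D(2)[OF assms(2)] in "auto intro: borel_measurable_integrable")
 hence "(%n. sqrt (LINT x|leb. (norm (zext U (F n) x))^2)) ---> sqrt 0"
  by (intro tendsto_real_sqrt) simp
 thus ?thesis by (simp add: l2norm_eq)
qed

lemma real_measure_eqI_atMost:
 fixes M :: "real measure"
 assumes "sets M = sets borel" "sets N = sets borel"
  "!!a. emeasure M {..a} < \<infinity>" "!!a. emeasure M {..a} = emeasure N {..a}"
 shows "M = N"
proof (rule measure_eqI_generator_eq_countable)
 let ?E = "range (%a::real. {..a})"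
 show "Int_stable ?E" by (auto simp: Int_stable_def min_def)
 show "?E <= Pow UNIV" "sets M = sigma_sets UNIV ?E" "sets N = sigma_sets UNIV ?E"
  using assms(1,2) by (auto simp: borel_eq_atMost)
 show "!!X. X : ?E ==> emeasure M X = emeasure N X" using assms(4) by auto
 show "range (%n. {..real n}) <= ?E" "!!a. a : range (%n. {..real n}) ==> emeasure M a ~= \<infinity>"
  using assms(3) by (auto simp: less_top)
 show "(\<Union>(range (%n. {..real n}))) = UNIV"
  using real_arch_simple by auto
qed auto

text \<open>Both measures give \<open>{..a}\<close> the volume of the ball of radius
  \<open>a\<close>, and such rays determine a measure that is finite on them.\<close>

lemma distr_norm_lborel:
 "distr lborel borel (norm :: real^3 => real) = density lborel (%r. ennreal (indicator {0..} r * (4 * pi * r^2)))"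
proof (rule real_measure_eqI_atMost)
 have L: "emeasure (distr lborel borel (norm :: real^3 => real)) {..a} = (if a < 0 then 0 else ennreal (4 / 3 * pi * a ^ 3))" for a
 proof -
  have "emeasure (distr lborel borel (norm :: real^3 => real)) {..a} = emeasure lborel (norm -` {..a} :: (real^3) set)"
   by (subst emeasure_distr) auto
  also have "norm -` {..a} = cball (0::real^3) a" by auto
  finally show ?thesis by (auto simp: emeasure_cball unit_ball_vol_3)
 qed
 have R: "emeasure (density lborel (%r. ennreal (indicator {0..} r * (4 * pi * r^2)))) {..a} = (if a < 0 then 0 else ennreal (4 / 3 * pi * a ^ 3))" for a :: real
 proof -
  have "emeasure (density lborel (%r. ennreal (indicator {0..} r * (4 * pi * r^2)))) {..a} =
    (\<integral>\<^sup>+ r. ennreal (4 * pi * r^2) * indicator {0..a} r \<partial>lborel)"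
   by (subst emeasure_density) (auto intro!: nn_integral_cong simp: indicator_def)
  also have "... = (if a < 0 then 0 else ennreal (4 / 3 * pi * a ^ 3))"
  proof (cases "a < 0")
   case False
   have "(\<integral>\<^sup>+ r. ennreal (4 * pi * r^2) * indicator {0..a} r \<partial>lborel) = ennreal (4 / 3 * pi * a ^ 3 - 4 / 3 * pi * 0 ^ 3)"
    by (rule nn_integral_FTC_Icc) (use False in "auto intro!: derivative_eq_intros simp: has_real_derivative_iff_has_vector_derivative[symmetric]")
   thus ?thesis using False by simp
  qed auto
  finally show ?thesis .
 qed
 show "emeasure (distr lborel borel (norm :: real^3 => real)) {..a} < \<infinity>" for a by (simp add: L)
 show "emeasure (distr lborel borel (norm :: real^3 => real)) {..a} =
   emeasure (density lborel (%r. ennreal (indicator {0..} r * (4 * pi * r^2)))) {..a}" for a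
  unfolding L R ..
qed auto

lemma polar_integral:
 fixes F :: "real => 'b::euclidean_space"
 assumes [measurable]: "F : bm"
 shows "integrable leb (%x::real^3. F (norm x)) \<longleftrightarrow> integrable lborel (%r. (indicator {0..} r * (4 * pi * r^2)) *R F r)"
  "(LINT x|leb. F (norm (x::real^3))) = (LINT r|lborel. (indicator {0..} r * (4 * pi * r^2)) *R F r)"
proof -
 have m: "(%x::real^3. F (norm x)) : borel_measurable lborel" by measurable
 have "integrable leb (%x::real^3. F (norm x)) \<longleftrightarrow> integrable (distr lborel borel (norm :: real^3 => real)) F"
  unfolding integrable_completion[OF m] by (rule integrable_distr_eq[symmetric]) auto
 also have "... \<longleftrightarrow> integrable lborel (%r. (indicator {0..} r * (4 * pi * r^2)) *R F r)"
  unfolding distr_norm_lborel by (subst integrable_density) auto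
 finally show "integrable leb (%x::real^3. F (norm x)) \<longleftrightarrow> integrable lborel (%r. (indicator {0..} r * (4 * pi * r^2)) *R F r)" .
 have "(LINT x|leb. F (norm (x::real^3))) = integral\<^sup>L (distr lborel borel (norm :: real^3 => real)) F"
  unfolding integral_completion[OF m] by (rule integral_distr[symmetric]) auto
 also have "... = (LINT r|lborel. (indicator {0..} r * (4 * pi * r^2)) *R F r)"
  unfolding distr_norm_lborel by (subst integral_density) auto
 finally show "(LINT x|leb. F (norm (x::real^3))) = (LINT r|lborel. (indicator {0..} r * (4 * pi * r^2)) *R F r)" .
qed

abbreviation HL :: "real set" where "HL \<equiv> {1<..}"
abbreviation (input) zx where "zx == zext HL"

lemma zext_Omega_norm: "zext Omega (%x. G (norm x)) = (%x. zx G (norm x))"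
 by (intro ext) (auto simp: zext_def Omega_iff indicator_def)

lemma borel_lebesgue_1d:
 fixes F :: "real => 'b::euclidean_space"
 assumes "F : bm"
 shows "F : borel_measurable leb" "integrable leb F = integrable lborel F"
  "integral\<^sup>L leb F = integral\<^sup>L lborel F"
 using assms by (auto simp: measurable_completion integrable_completion integral_completion)

text \<open>The factor \<open>r^2\<close> of polar coordinates cancels the square of the division in
  \<open>emb\<close>.\<close>

lemma emb_L2:
 fixes u :: "real => 'b::euclidean_space"
 assumes [measurable]: "zx u : bm"
 shows "emb u : L2 Omega \<longleftrightarrow> u : L2 HL"
  "l2norm Omega (emb u) = sqrt (4 * pi) * l2norm HL u"
proof -
 define G where "G r = zx u r /\<^sub>R r" for r
 have [measurable]: "G : bm" unfolding G_def by measurable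
 have z: "zext Omega (emb u) = (%x. G (norm x))"
  by (intro ext) (auto simp: zext_def Omega_iff indicator_def emb_def G_def)
 have m: "zext Omega (emb u) : borel_measurable leb"
  unfolding z by (intro measurable_completion) measurable
 have [measurable]: "(%r. (norm (G r))^2) : bm" by measurable
 have eq: "(indicator {0..} r * (4 * pi * r^2)) *R (norm (G r))^2 = (4 * pi) * (norm (zx u r))^2" for r
  by (auto simp: G_def zext_def indicator_def power_mult_distrib power_divide field_simps)
 have m1: "zx u : borel_measurable leb" "(%r. (norm (zx u r))^2) : bm"
  by (auto intro: borel_lebesgue_1d(1)[OF assms])
 show "emb u : L2 Omega \<longleftrightarrow> u : L2 HL"
  unfolding L2_iff using m m1(1)
  unfolding z polar_integral(1)[of "%r. (norm (G r))^2", OF \<open>(%r. (norm (G r))^2) : bm\<close>] eq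
  by (simp add: borel_lebesgue_1d(2)[OF m1(2)])
 show "l2norm Omega (emb u) = sqrt (4 * pi) * l2norm HL u"
  unfolding l2norm_eq z polar_integral(2)[of "%r. (norm (G r))^2", OF \<open>(%r. (norm (G r))^2) : bm\<close>] eq
  by (simp add: borel_lebesgue_1d(3)[OF m1(2)] real_sqrt_mult)
qed

lemma emb_pairing:
 fixes u v :: "real => complex"
 assumes [measurable]: "zx u : bm" "zx v : bm"
 shows "(LINT x:Omega|leb. emb u x * emb v x) = 4 * pi * (LINT r:HL|lborel. u r * v r)"
proof -
 define G where "G r = (zx u r * zx v r) /\<^sub>R r^2" for r
 have [measurable]: "G : bm" unfolding G_def by measurable
 have z: "zext Omega (%x. emb u x * emb v x) = (%x. G (norm x))"
  by (intro ext) (auto simp: zext_def Omega_iff indicator_def emb_def G_def power2_eq_square)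
 have eq: "(indicator {0..} r * (4 * pi * r^2)) *R G r = (4 * pi) *R zx (%r. u r * v r) r" for r
  by (auto simp: G_def zext_def indicator_def)
 show ?thesis unfolding set_integral_zext z polar_integral(2)[OF \<open>G : bm\<close>] eq
  by (simp add: scaleR_conv_of_real)
qed

lemma complex_borel_representative:
 fixes f :: "'a::euclidean_space => complex"
 assumes "f : borel_measurable leb"
 obtains f' where "f' : bm" "AE x in lborel. f x = f' x"
proof -
 have "(%x. Re (f x)) : borel_measurable leb" "(%x. Im (f x)) : borel_measurable leb"
  using assms by measurable
 then obtain g h where g: "g : borel_measurable lborel" "AE x in lborel. Re (f x) = g x"
  and h: "h : borel_measurable lborel" "AE x in lborel. Im (f x) = h x"
  using completion_ex_borel_measurable_real by metis
 have [measurable]: "g : bm" "h : bm" using g h by auto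
 show ?thesis
 proof
  show "(%x. cx (g x) + \<i> * cx (h x)) : bm" by measurable
  show "AE x in lborel. f x = cx (g x) + \<i> * cx (h x)"
   using g(2) h(2) by eventually_elim (auto simp: complex_eq_iff)
 qed
qed

text \<open>The image of Lebesgue measure under the norm has a density, so null sets of radii have
  null preimages.\<close>

lemma AE_norm_lborel:
 assumes "AE r in lborel. Q r"
 shows "AE x::real^3 in lborel. Q (norm x)"
proof -
 obtain B where B: "B : null_sets lborel" "{r. ~ Q r} <= B" using assms by (auto simp: eventually_ae_filter)
 hence [measurable]: "B : sets borel" by auto
 have "AE r in density lborel (%r. ennreal (indicator {0..} r * (4 * pi * r^2))). r ~: B"
  by (subst AE_density) (use AE_not_in[OF B(1)] in auto)
 hence "AE x::real^3 in lborel. norm x ~: B"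
  unfolding distr_norm_lborel[symmetric] by (subst (asm) AE_distr_iff) auto
 thus ?thesis by eventually_elim (use B in auto)
qed

text \<open>A profile of a radial function need not be measurable a priori. By Tonelli for the dilations
 \<open>x \<mapsto> t x\<close>, almost every ray provides a Borel profile.\<close>

lemma radial_profile:
 fixes f :: "real^3 => complex"
 assumes m: "zext Omega f : borel_measurable leb" and "radial f"
 obtains u where "u : bm" "!!r. r <= 1 ==> u r = 0" "ae_eq f (emb u)"
proof -
 obtain P where P: "ae_eq f (%x. P (norm x))" using assms(2) by (auto simp: radial_def)
 obtain f' where f': "f' : bm" "AE x in lborel. zext Omega f x = f' x"
  using complex_borel_representative[OF m] by blast
 note [measurable] = f'(1)
 have P': "AE x in lborel. x : Omega --> f x = P (norm x)" using P by (simp add: ae_eq_def AE_completion_iff)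
 have "AE x in lborel. x : Omega --> f' x = P (norm x)"
  using f'(2) P' by eventually_elim (auto simp: zext_simps)
 then obtain N where N: "N : null_sets lborel" "!!x. x ~: N ==> x : Omega ==> f' x = P (norm x)"
  unfolding eventually_ae_filter subset_eq by auto
 have [measurable]: "N : sets borel" using N(1) by auto
 have negN: "negligible N" using N(1) by (simp add: negligible_iff_null_sets null_sets_completionI)
 have t: "AE x in lborel. t > 0 --> t *R x ~: N" for t :: real
 proof (cases "t > 0")
  case True
  have "negligible ((%x. inverse t *R x) ` N)" by (intro negligible_differentiable_image_negligible negN) (auto intro!: derivative_intros)
  hence "AE x in leb. x ~: (%x. inverse t *R x) ` N" by (simp add: negligible_iff_null_sets AE_not_in)
  hence "AE x in lborel. x ~: (%x. inverse t *R x) ` N" by (simp add: AE_completion_iff)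
  thus ?thesis
  proof eventually_elim
   case (elim x)
   show ?case
   proof (intro impI notI)
    assume "t *R x : N"
    hence "inverse t *R (t *R x) : (%x. inverse t *R x) ` N" by blast
    thus False using elim True by simp
   qed
  qed
 qed simp
 \<comment> \<open>Exchanging the quantifiers: for almost every \<open>x\<close> the ray through
   \<open>x\<close> meets the exceptional set \<open>N\<close> only for a null set of factors
   \<open>t\<close>.\<close>
 have "AE t::real in lborel. AE x::real^3 in lborel. t > 0 --> t *R x ~: N" using t by simp
 hence "AE x::real^3 in lborel. AE t::real in lborel. t > 0 --> t *R x ~: N"
  by (subst (asm) lborel_pair.AE_commute) measurable
 moreover have "AE x::real^3 in lborel. x ~= 0" by (rule AE_lborel_singleton)
 ultimately have "AE x::real^3 in lborel. x ~= 0 & (AE t::real in lborel. t > 0 --> t *R x ~: N)"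
  by eventually_elim auto
 moreover have "ae_filter (lborel :: (real^3) measure) ~= bot" by (simp add: ae_filter_eq_bot_iff)
 ultimately obtain x :: "real^3" where x: "x ~= 0" "AE t::real in lborel. t > 0 --> t *R x ~: N"
  using eventually_happens' by (metis (mono_tags, lifting))
 define rh where "rh = norm x"
 have rh: "rh > 0" using x by (simp add: rh_def)
 \<comment> \<open>\<open>u\<close> is Borel because it reads the Borel function \<open>f'\<close>
   along one fixed ray; the factor \<open>r\<close> undoes the division in
   \<open>emb\<close>.\<close>
 define u where "u r = (if r > 1 then r *R f' ((r / rh) *R x) else 0)" for r
 have um: "u : bm" unfolding u_def by measurable
 obtain T where T: "T : null_sets lborel" "!!t. t ~: T ==> t > 0 ==> t *R x ~: N"
  using x(2) unfolding eventually_ae_filter subset_eq by auto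
 have "negligible T" using T(1) by (simp add: negligible_iff_null_sets null_sets_completionI)
 hence "negligible ((*) rh ` T)" by (intro negligible_differentiable_image_negligible) (auto intro!: derivative_intros)
 hence "AE r in leb. r ~: (*) rh ` T" by (simp add: negligible_iff_null_sets AE_not_in)
 hence "AE r in lborel. r ~: (*) rh ` T" by (simp add: AE_completion_iff)
 hence "AE r in lborel. r > 1 --> u r = r *R P r"
 proof eventually_elim
  case (elim r)
  show ?case
  proof
   assume r: "r > 1"
   have "r / rh ~: T"
   proof
    assume "r / rh : T"
    hence "rh * (r / rh) : (*) rh ` T" by blast
    thus False using elim rh by simp
   qed
   hence "(r / rh) *R x ~: N" using T(2) r rh by simp
   moreover have "norm ((r / rh) *R x) = r" using r rh by (simp add: rh_def)
   ultimately show "u r = r *R P r" using N(2)[of "(r / rh) *R x"] r by (simp add: u_def Omega_iff)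
  qed
 qed
 hence "AE x::real^3 in lborel. norm x > 1 --> u (norm x) = norm x *R P (norm x)" by (rule AE_norm_lborel)
 hence "AE x in lborel. x : Omega --> f x = emb u x"
  using P'
 proof eventually_elim
  case (elim y)
  show ?case
  proof
   assume y: "y : Omega"
   hence "norm y ~= 0" "norm y > 1" by (auto simp: Omega_iff)
   thus "f y = emb u y" using elim y by (simp add: emb_def)
  qed
 qed
 hence "ae_eq f (emb u)" by (simp add: ae_eq_def AE_completion_iff)
 thus ?thesis using that[OF um] by (simp add: u_def)
qed

text \<open>The measurability of \<open>u\<close> provides continuous approximants only almost
  everywhere. Clipping their values and cutting off their argument bounds them uniformly on a common
  compact set, so that dominated convergence applies for fixed \<open>n\<close>; a diagonal choice
  then removes the truncation.\<close>

lemma HL_L2_approx: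
 fixes u :: "real => complex"
 assumes u: "u : L2 HL"
 obtains v where "!!n. cts UNIV (v n)" "!!n r. r ~: {1 + inverse (real (Suc n))..2 * real (Suc n)} ==> v n r = 0"
  "!!n. v n : L2 HL" "(%n. l2norm HL (%r. v n r - u r)) ---> 0"
proof -
 \<comment> \<open>The radial retraction of the plane onto the disc of radius
   \<open>k\<close>.\<close>
 define clip :: "real => complex => complex" where "clip k z = z /\<^sub>R max 1 (norm z / k)" for k z
 have clip_cont: "cts UNIV (clip k)" if "k > 0" for k
  unfolding clip_def using that by (intro continuous_intros) (auto simp: max_def)
 have clip_le: "norm (clip k z) <= norm z" if "k > 0" for k z
 proof -
  have "norm (clip k z) = norm z / max 1 (norm z / k)" by (simp add: clip_def divide_inverse mult.commute)
  also have "... <= norm z / 1" by (intro divide_left_mono) auto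
  finally show ?thesis by simp
 qed
 have clip_k: "norm (clip k z) <= k" if "k > 0" for k z
 proof -
  have "norm (clip k z) = norm z / max 1 (norm z / k)" by (simp add: clip_def divide_inverse mult.commute)
  also have "... <= k" using that by (auto simp: max_def field_simps)
  finally show ?thesis .
 qed
 have clip_eq: "clip k z = z" if "k > 0" "norm z <= k" for k z
  using that by (simp add: clip_def max_def field_simps)
 define h where "h = zx u"
 have hm: "h : borel_measurable leb" unfolding h_def by (rule L2D(1)[OF u])
 hence "h measurable_on UNIV" by (rule lebesgue_measurable_imp_measurable_on) simp
 then obtain N ps where N: "negligible N" and ps: "!!j::nat. cts UNIV (ps j)"
   "!!x. x ~: N ==> (%j. ps j x) ---> h x" by (auto simp: measurable_on_def)
 have aeN: "AE x in leb. x ~: N" using N by (simp add: negligible_iff_null_sets AE_not_in)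
 define U where "U n r = cutoff n r *R clip (real (Suc n)) (h r)" for n r
 define V where "V n j r = cutoff n r *R clip (real (Suc n)) (ps j r)" for n j r
 have cc: "cts UNIV (cutoff n)" for n by (rule Ck_continuous[OF Ck_cutoff])
 have Vc: "cts UNIV (V n j)" for n j
  unfolding V_def by (intro continuous_on_scaleR cc continuous_on_compose2[OF clip_cont ps(1)]) auto
 have V0: "V n j r = 0" if "r ~: {1 + inverse (real (Suc n))..2 * real (Suc n)}" for n j r
  using cutoff_eq_0[OF that] by (simp add: V_def)
 have Vsupp: "bounded {r. V n j r ~= 0}" for n j
 proof (rule bounded_subset)
  show "{r. V n j r ~= 0} <= {1 + inverse (real (Suc n))..2 * real (Suc n)}" using V0[of _ n j] by blast
 qed simp
 have VL: "V n j : L2 HL" for n j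
 proof (rule continuous_support_L2[OF Vc Vsupp])
  fix r assume "r ~: HL"
  moreover have "inverse (real (Suc n)) > 0" by simp
  ultimately have "r ~: {1 + inverse (real (Suc n))..2 * real (Suc n)}"
   unfolding atLeastAtMost_iff greaterThan_iff by linarith
  thus "V n j r = 0" by (rule V0)
 qed
 have Um: "U n : borel_measurable leb" for n
 proof -
  have [measurable]: "cutoff n : borel_measurable leb" "clip (real (Suc n)) : bm"
   using borel_measurable_continuous_onI[OF cc] borel_measurable_continuous_onI[OF clip_cont] by (auto simp: measurable_completion)
  show ?thesis unfolding U_def using hm by measurable
 qed
 have Uz: "zx (U n) = U n" for n
  by (intro ext) (auto simp: zext_def indicator_def U_def h_def clip_def)
 have Ule: "norm (U n r) <= norm (u r)" if "r : HL" for n r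
  using that mult_mono[OF cutoff_bounds(2)[of n r] clip_le[of "real (Suc n)" "u r"]] cutoff_bounds(1)[of n r]
  by (auto simp: U_def h_def zext_simps)
 have UL: "U n : L2 HL" for n
  by (rule L2_bound[OF u _ Ule]) (auto simp: Uz Um)
 have step1: "(%n. l2norm HL (%r. U n r - u r)) ---> 0"
 proof (rule l2norm_dominated_convergence[where W="%r. 2 * norm (u r)"])
  show "(%r. 2 * norm (u r)) : L2 HL"
  proof (rule L2_bound[OF L2_cmult[OF u, of 2]])
   have "zx (%r. 2 * norm (u r)) = (%r. 2 * norm (zx u r))"
    by (intro ext) (simp add: zext_def)
   thus "zx (%r. 2 * norm (u r)) : borel_measurable leb"
    using L2D_norm[OF u] by simp
  qed (simp add: norm_mult)
  show "norm (U n r - u r) <= 2 * norm (u r)" if "r : HL" for n r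
   using norm_triangle_ineq4[of "U n r" "u r"] Ule[OF that, of n] by simp
  show "AE x in leb. x : HL --> (%n. U n x - u x) ---> 0"
  proof (intro AE_I2 impI)
   fix x :: real assume x: "x : HL"
   have "\<forall>\<^sub>F n in sequentially. norm (u x) <= real (Suc n)"
   proof -
    obtain M :: nat where "norm (u x) <= real M" using real_arch_simple by blast
    thus ?thesis by (intro eventually_sequentiallyI[of M]) auto
   qed
   moreover have "\<forall>\<^sub>F n in sequentially. ALL r:{x..x}. cutoff n r = 1" using x by (intro eventually_cutoff_eq_1) auto
   ultimately have "\<forall>\<^sub>F n in sequentially. U n x - u x = 0"
    by eventually_elim (use x in "auto simp: U_def h_def zext_simps clip_eq")
   thus "(%n. U n x - u x) ---> 0" by (rule tendsto_eventually)
  qed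
 qed (intro L2_diff UL u)
 have step2: "(%j. l2norm HL (%r. V n j r - U n r)) ---> 0" for n
 proof (rule l2norm_dominated_convergence[where W="%r. 2 * real (Suc n) * indicator {1..2 * real (Suc n)} r"])
  have i: "integrable lborel (%r::real. indicator {1..2 * real (Suc n)} r :: real)" by simp
  have "zx (%r. 2 * real (Suc n) * indicator {1..2 * real (Suc n)} r) : bm"
   unfolding zext_def by measurable
  moreover have "integrable lborel (%r. (norm (zx (%r. 2 * real (Suc n) * indicator {1..2 * real (Suc n)} r) r))^2)"
   by (rule Bochner_Integration.integrable_bound[of _ "%r. (2 * real (Suc n))^2 * indicator {1..2 * real (Suc n)} r"])
     (use i in "auto simp: zext_def indicator_def")
  ultimately show "(%r. 2 * real (Suc n) * indicator {1..2 * real (Suc n)} r) : L2 HL"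
   unfolding L2_iff by (auto simp: borel_lebesgue_1d)
  show "norm (V n j r - U n r) <= 2 * real (Suc n) * indicator {1..2 * real (Suc n)} r" if "r : HL" for j r
  proof (cases "r : {1 + inverse (real (Suc n))..2 * real (Suc n)}")
   case True
   have "norm (V n j r) <= 1 * real (Suc n)" "norm (U n r) <= 1 * real (Suc n)"
    unfolding U_def V_def norm_scaleR using cutoff_bounds[of n r] clip_k[of "real (Suc n)"]
    by (intro mult_mono; simp)+
   hence "norm (V n j r - U n r) <= 2 * real (Suc n)" using norm_triangle_ineq4[of "V n j r" "U n r"] by linarith
   moreover have "r : {1..2 * real (Suc n)}" using True that by auto
   ultimately show ?thesis by simp
  next
   case False
   thus ?thesis using cutoff_eq_0[OF False] by (simp add: U_def V_def)
  qed
  show "AE x in leb. x : HL --> (%j. V n j x - U n x) ---> 0"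
   using aeN
  proof eventually_elim
   case (elim x)
   have "isCont (clip (real (Suc n))) (h x)" using clip_cont[of "real (Suc n)"] by (simp add: continuous_on_eq_continuous_at)
   hence "(%j. clip (real (Suc n)) (ps j x)) ---> clip (real (Suc n)) (h x)"
    using ps(2)[OF elim] by (rule isCont_tendsto_compose)
   hence "(%j. V n j x) ---> U n x" unfolding V_def U_def by (intro tendsto_scaleR tendsto_const)
   thus ?case by (simp add: LIM_zero_iff)
  qed
 qed (intro L2_diff UL VL)
 have "EX j. l2norm HL (%r. V n j r - U n r) < inverse (real (Suc n))" for n
  using order_tendstoD(2)[OF step2[of n], of "inverse (real (Suc n))"] eventually_happens by fastforce
 then obtain J where J: "!!n. l2norm HL (%r. V n (J n) r - U n r) < inverse (real (Suc n))" by metis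
 have "l2norm HL (%r. V n (J n) r - u r) <= inverse (real (Suc n)) + l2norm HL (%r. U n r - u r)" for n
  using l2norm_triangle[OF L2_diff[OF VL[of n "J n"] UL[of n]] L2_diff[OF UL[of n] u]] J[of n] by simp
 hence ev: "\<forall>\<^sub>F n in sequentially. norm (l2norm HL (%r. V n (J n) r - u r)) <= inverse (real (Suc n)) + l2norm HL (%r. U n r - u r)"
  by (intro always_eventually) auto
 have "(%n. inverse (real (Suc n)) + l2norm HL (%r. U n r - u r)) ---> 0"
  using tendsto_add[OF LIMSEQ_inverse_real_of_nat step1] by simp
 hence "(%n. l2norm HL (%r. V n (J n) r - u r)) ---> 0" by (rule Lim_null_comparison[OF ev])
 thus ?thesis using that[of "%n. V n (J n)"] Vc V0 VL by blast
qed

section \<open>Functions with a given radial profile\<close>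

lemma has_weak_laplacian_cong_AE:
 fixes f :: "'a::euclidean_space => 'b::euclidean_space"
 assumes "has_weak_laplacian U f w" "AE x in leb. x : U --> f x = f' x"
  "AE x in leb. x : U --> w x = w' x"
 shows "has_weak_laplacian U f' w'"
proof -
 have li: "loc_integrable U g'" if "loc_integrable U g" "AE x in leb. x : U --> g x = g' x" for g g' :: "'a => 'b"
  unfolding loc_integrable_def
 proof safe
  fix K assume K: "compact K" "K <= U"
  hence i: "integrable leb (zext K g)" using that(1) by (auto simp: loc_integrable_def set_integrable_zext)
  have ae: "AE x in leb. zext K g x = zext K g' x"
   using that(2) by eventually_elim (use K in "auto simp: zext_def indicator_def")
  show "set_integrable leb K g'" unfolding set_integrable_zext
   using integrable_cong_AE[OF borel_measurable_integrable[OF i] borel_measurable_AE[OF borel_measurable_integrable[OF i] ae] ae] i by simp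
 qed
 have eq: "(LINT x|leb. ph x *R g' x) = (LINT x|leb. ph x *R g x)"
  if "integrable leb (%x. ph x *R g x)" "AE x in leb. x : U --> g x = g' x" "!!x. x ~: U ==> ph x = 0"
  for ph :: "'a => real" and g g' :: "'a => 'b"
 proof -
  have ae: "AE x in leb. ph x *R g x = ph x *R g' x"
   using that(2) by eventually_elim (use that(3) in auto)
  show ?thesis
   using integral_cong_AE[OF borel_measurable_integrable[OF that(1)] borel_measurable_AE[OF borel_measurable_integrable[OF that(1)] ae] ae] by simp
 qed
 show ?thesis unfolding has_weak_laplacian_iff
 proof safe
  show "loc_integrable U f'" "loc_integrable U w'" using assms by (auto simp: has_weak_laplacian_iff intro: li)
  fix ph :: "'a => real" assume ph: "ph : test_functions U"
  have l: "loc_integrable U f" "loc_integrable U w" using assms(1) by (auto simp: has_weak_laplacian_iff)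
  have "(LINT x|leb. lap ph x *R f' x) = (LINT x|leb. lap ph x *R f x)"
   by (rule eq[OF lap_integrable[OF ph l(1)] assms(2) lap_eq_0[OF ph]])
  also have "... = (LINT x|leb. ph x *R w x)" using assms(1) ph by (simp add: has_weak_laplacian_iff)
  also have "... = (LINT x|leb. ph x *R w' x)"
   by (rule eq[OF test_loc_integrable[OF ph l(2)] assms(3) test_functionD(7)[OF ph], symmetric])
  finally show "(LINT x|leb. lap ph x *R f' x) = (LINT x|leb. ph x *R w' x)" .
 qed
qed

text \<open>The derivative of \<open>emb v\<close> in the direction \<open>b\<close>, if
  \<open>v'\<close> is the derivative of \<open>v\<close>: the component of \<open>x / r\<close>
  along \<open>b\<close> times the derivative of \<open>v / r\<close>.\<close>

definition egrad :: "(real => complex) => (real => complex) => real^3 => real^3 => complex" where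
 "egrad v v' b x = (x \<bullet> b) *R (v' (norm x) /\<^sub>R (norm x)^2 - v (norm x) /\<^sub>R (norm x) ^ 3)"

lemma norm_compose_has_derivative:
 assumes "(F hvd F') (at (norm x))" "x ~= 0"
 shows "((%y::real^3. F (norm y)) has_derivative (%h. (x \<bullet> h / norm x) *R F')) (at x)"
proof -
 have "((%y::real^3. norm y) has_derivative (%h. x \<bullet> h / norm x)) (at x)"
  using has_derivative_norm[OF assms(2)]
  by (simp add: sgn_div_norm inner_commute divide_inverse mult.commute)
 from has_derivative_compose[OF this assms(1)[unfolded has_vector_derivative_def]] show ?thesis .
qed

lemma emb_has_derivative:
 assumes "(v hvd v' (norm x)) (at (norm x))" "x ~= 0"
 shows "(emb v has_derivative (%h. egrad v v' h x)) (at x)"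
proof -
 have "((%r. inverse r *R v r) hvd (inverse (norm x) *R v' (norm x) - (inverse ((norm x)^2)) *R v (norm x))) (at (norm x))"
  using assms(2) by (auto intro!: derivative_eq_intros assms(1) simp: power2_eq_square has_real_derivative_iff_has_vector_derivative[symmetric])
 from norm_compose_has_derivative[OF this assms(2)]
 have "(emb v has_derivative (%h. (x \<bullet> h / norm x) *R (inverse (norm x) *R v' (norm x) - (inverse ((norm x)^2)) *R v (norm x)))) (at x)"
  by (simp add: emb_def[abs_def])
 moreover have "(x \<bullet> h / norm x) *R (inverse (norm x) *R v' (norm x) - (inverse ((norm x)^2)) *R v (norm x)) = egrad v v' h x" for h
  by (simp add: egrad_def scaleR_diff_right power2_eq_square power3_eq_cube divide_inverse mult_ac)
 ultimately show ?thesis by simp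
qed

text \<open>The Hessian of \<open>emb v\<close> in the directions \<open>b\<close> and
  \<open>h\<close>.\<close>

definition egrad2 :: "(real => complex) => (real => complex) => (real => complex) => real^3 => real^3 => real^3 => complex" where
 "egrad2 v v' v'' b x h = (h \<bullet> b) *R (v' (norm x) /\<^sub>R (norm x)^2 - v (norm x) /\<^sub>R (norm x) ^ 3) +
  ((x \<bullet> b) * (x \<bullet> h / norm x)) *R (v'' (norm x) /\<^sub>R (norm x)^2 - 3 *R (v' (norm x) /\<^sub>R (norm x) ^ 3) + 3 *R (v (norm x) /\<^sub>R (norm x) ^ 4))"

lemma egrad_has_derivative:
 assumes "(v hvd v' (norm x)) (at (norm x))" "(v' hvd v'' (norm x)) (at (norm x))" "x ~= 0"
 shows "(egrad v v' b has_derivative egrad2 v v' v'' b x) (at x)"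
proof -
 define r where "r = norm x"
 have r: "r > 0" using assms(3) by (simp add: r_def)
 have d: "((%r. v' r /\<^sub>R r^2 - v r /\<^sub>R r ^ 3) has_vector_derivative
   (v'' r /\<^sub>R r^2 - 3 *R (v' r /\<^sub>R r ^ 3) + 3 *R (v r /\<^sub>R r ^ 4))) (at r)"
 proof -
  have i2: "((%r. inverse (r^2)) hrd - 2 * inverse (r ^ 3)) (at r)"
   using r by (auto intro!: derivative_eq_intros simp: power2_eq_square power3_eq_cube divide_inverse)
  have i3: "((%r. inverse (r ^ 3)) hrd - 3 * inverse (r ^ 4)) (at r)"
   using r by (auto intro!: derivative_eq_intros simp: power2_eq_square power3_eq_cube power4_eq_xxxx divide_inverse)
  have "((%r. inverse (r^2) *R v' r - inverse (r ^ 3) *R v r) has_vector_derivative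
   (inverse (r^2) *R v'' r + (- 2 * inverse (r ^ 3)) *R v' r) - (inverse (r ^ 3) *R v' r + (- 3 * inverse (r ^ 4)) *R v r)) (at r)"
   by (intro has_vector_derivative_diff has_vector_derivative_scaleR i2 i3 assms(1,2)[folded r_def])
  moreover have "(inverse (r^2) *R v'' r + (- 2 * inverse (r ^ 3)) *R v' r) - (inverse (r ^ 3) *R v' r + (- 3 * inverse (r ^ 4)) *R v r)
    = v'' r /\<^sub>R r^2 - 3 *R (v' r /\<^sub>R r ^ 3) + 3 *R (v r /\<^sub>R r ^ 4)"
   by (simp add: scaleR_conv_of_real algebra_simps)
  ultimately show ?thesis by (simp only:)
 qed
 have "((%y::real^3. y \<bullet> b) has_derivative (%h. h \<bullet> b)) (at x)"
  by (rule bounded_linear_imp_has_derivative) (rule bounded_linear_inner_left)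
 from has_derivative_scaleR[OF this norm_compose_has_derivative[OF d[unfolded r_def] assms(3)]]
 show ?thesis unfolding egrad_def[abs_def] egrad2_def[abs_def]
  by (simp add: add.commute)
qed

text \<open>The trace of the Hessian. The terms in \<open>v\<close> and \<open>v'\<close> cancel
  precisely because the dimension is three.\<close>

lemma egrad2_sum:
 assumes "x ~= 0"
 shows "(SUM b:Basis. egrad2 v v' v'' b x b) = emb v'' x"
proof -
 define r where "r = norm x"
 have r: "r > 0" using assms by (simp add: r_def)
 have s: "(SUM b:Basis. (x \<bullet> b) * (x \<bullet> b)) = r^2"
  by (simp add: r_def power2_norm_eq_inner euclidean_inner[of x x])
 define A where "A = v' r /\<^sub>R r^2 - v r /\<^sub>R r ^ 3"
 define B where "B = v'' r /\<^sub>R r^2 - 3 *R (v' r /\<^sub>R r ^ 3) + 3 *R (v r /\<^sub>R r ^ 4)"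
 have "(SUM b:Basis. egrad2 v v' v'' b x b) = (SUM b:(Basis :: (real^3) set). A + ((x \<bullet> b) * (x \<bullet> b) / r) *R B)"
  by (intro sum.cong refl) (simp add: egrad2_def A_def B_def r_def inner_same_Basis)
 also have "... = 3 *R A + (r^2 / r) *R B"
  unfolding sum.distrib scaleR_sum_left[symmetric] sum_divide_distrib[symmetric] s
  by (simp add: scaleR_conv_of_real)
 also have "... = emb v'' x"
  using r unfolding A_def B_def emb_def r_def[symmetric]
  by (simp add: scaleR_conv_of_real power2_eq_square power3_eq_cube power4_eq_xxxx field_simps)
 finally show ?thesis .
qed

lemma emb_weak_laplacian:
 fixes v :: "real => complex"
 assumes v: "!!r. r > 1 ==> (v hvd v' r) (at r)" "!!r. r > 1 ==> (v' hvd v'' r) (at r)"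
  "cts HL v''"
 shows "has_weak_laplacian Omega (emb v) (emb v'')"
proof -
 have nz: "norm x > 1" "x ~= 0" if "x : Omega" for x using that by (auto simp: Omega_iff)
 have cn: "cts Omega (%x. g (norm x))" if "cts HL g" for g :: "real => complex"
  by (rule continuous_on_compose2[OF that]) (auto intro!: continuous_intros simp: Omega_iff)
 have cv: "cts HL v" "cts HL v'"
  using v by (auto intro!: continuous_at_imp_continuous_on has_vector_derivative_continuous)
 have "has_weak_laplacian Omega (emb v) (%x. SUM b:Basis. egrad2 v v' v'' b x b)"
 proof (rule classical_weak_laplacian[OF open_Omega, where f'="%x h. egrad v v' h x" and ?f2.0="egrad2 v v' v''"])
  show "(emb v has_derivative (%h. egrad v v' h x)) (at x)" if "x : Omega" for x
   by (rule emb_has_derivative[of v v' x, OF v(1)[OF nz(1)[OF that]] nz(2)[OF that]])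
  show "((%y. egrad v v' b y) has_derivative egrad2 v v' v'' b x) (at x)" if "x : Omega" for x b
   by (rule egrad_has_derivative[of v v' x v'', OF v(1,2)[OF nz(1)[OF that]] nz(2)[OF that]])
  show "cts Omega (%x. egrad2 v v' v'' b x b)" for b
   unfolding egrad2_def by (intro continuous_intros cn cv v(3)) (use nz in auto)
 qed
 thus ?thesis
  by (rule has_weak_laplacian_cong_AE) (auto intro!: AE_I2 egrad2_sum dest: nz)
qed

lemma lap_emb:
 fixes v :: "real => complex"
 assumes v: "!!r. r > 1 ==> (v hvd v' r) (at r)" "!!r. r > 1 ==> (v' hvd v'' r) (at r)"
  and x: "x : Omega"
 shows "pd b (emb v) x = egrad v v' b x" "lap (emb v) x = emb v'' x"
proof -
 have nz: "norm x > 1" "x ~= 0" if "x : Omega" for x :: "real^3" using that by (auto simp: Omega_iff)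
 have p: "pd b (emb v) x = egrad v v' b x" if "x : Omega" for x b
  by (rule partial_deriv_eq[OF emb_has_derivative[of v v' x, OF v(1)[OF nz(1)[OF that]] nz(2)[OF that]]])
 thus "pd b (emb v) x = egrad v v' b x" using x by blast
 have "pd b (pd b (emb v)) x = egrad2 v v' v'' b x b" for b
 proof -
  have "pd b (pd b (emb v)) x = pd b (egrad v v' b) x"
   by (rule partial_deriv_cong_open[OF open_Omega x p])
  also have "... = egrad2 v v' v'' b x b"
   by (rule partial_deriv_eq[OF egrad_has_derivative[of v v' x v'', OF v(1,2)[OF nz(1)[OF x]] nz(2)[OF x]]])
  finally show ?thesis .
 qed
 thus "lap (emb v) x = emb v'' x" using egrad2_sum[OF nz(2)[OF x], of v v' v''] by (simp add: lap_def)
qed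

lemma egrad_bound:
 assumes "b : Basis" "x : Omega"
 shows "norm (egrad v v' b x) <= norm (emb (%r. norm (v' r) + norm (v r)) x)"
proof -
 define r where "r = norm x"
 have r: "r > 1" using assms by (simp add: r_def Omega_iff)
 have "norm (v' r /\<^sub>R r^2 - v r /\<^sub>R r ^ 3) <= norm (v' r) / r^2 + norm (v r) / r ^ 3"
  using norm_triangle_ineq4[of "v' r /\<^sub>R r^2" "v r /\<^sub>R r ^ 3"] r by (simp add: divide_inverse mult.commute)
 also have "... <= norm (v' r) / r^2 + norm (v r) / r^2"
  using r by (intro add_left_mono divide_left_mono power_increasing) auto
 finally have *: "norm (v' r /\<^sub>R r^2 - v r /\<^sub>R r ^ 3) <= (norm (v' r) + norm (v r)) / r^2"
  by (simp add: add_divide_distrib)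
 have "norm (egrad v v' b x) = \<bar>x \<bullet> b\<bar> * norm (v' r /\<^sub>R r^2 - v r /\<^sub>R r ^ 3)"
  by (simp add: egrad_def r_def)
 also have "... <= r * ((norm (v' r) + norm (v r)) / r^2)"
  using * Basis_le_norm[OF assms(1), of x] r by (intro mult_mono) (auto simp: r_def)
 also have "... = norm (emb (%r. norm (v' r) + norm (v r)) x)"
  using r by (simp add: emb_def r_def[symmetric] power2_eq_square divide_inverse)
 finally show ?thesis .
qed

lemma borel_zext_continuous:
 fixes v :: "real => 'b::real_normed_vector"
 assumes "cts HL v"
 shows "zx v : bm"
 using borel_measurable_continuous_on_indicator[OF _ assms] by (simp add: zext_def[abs_def])

lemma egrad_measurable:
 assumes "zx v : bm" "zx v' : bm"
 shows "zext Omega (egrad v v' b) : borel_measurable leb"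
proof -
 have eq: "zext Omega (egrad v v' b) = (%x. (x \<bullet> b) *R (zx v' (norm x) /\<^sub>R (norm x)^2 - zx v (norm x) /\<^sub>R (norm x) ^ 3))"
  by (intro ext) (auto simp: zext_def egrad_def Omega_iff indicator_def)
 note [measurable] = assms
 show ?thesis unfolding eq by (intro measurable_completion) measurable
qed

lemma zext_norm_add_borel:
 assumes "zx v : bm" "zx v' : bm"
 shows "zx (%r. norm (v' r) + norm (v r) :: real) : bm"
proof -
 have eq: "zx (%r. norm (v' r) + norm (v r) :: real) = (%r. norm (zx v' r) + norm (zx v r))"
  by (intro ext) (auto simp: zext_def distrib_left)
 note [measurable] = assms
 show ?thesis unfolding eq by measurable
qed

lemma L2_norm:
 fixes f :: "'a::euclidean_space => 'b::euclidean_space"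
 assumes "f : L2 U" shows "(%x. norm (f x)) : L2 U" "l2norm U (%x. norm (f x)) = l2norm U f"
proof -
 have "zext U (%x. norm (f x)) = (%x. norm (zext U f x))" by (intro ext) (simp add: zext_norm)
 thus "(%x. norm (f x)) : L2 U" using L2D(2)[OF assms] L2D_norm[OF assms] by (simp add: L2_iff)
 show "l2norm U (%x. norm (f x)) = l2norm U f" by (rule l2norm_cong_norm) simp
qed

lemma egrad_L2:
 assumes m: "zx v : bm" "zx v' : bm"
  and L: "v : L2 HL" "v' : L2 HL" and b: "b : Basis"
 shows "egrad v v' b : L2 Omega"
  "l2norm Omega (egrad v v' b) <= sqrt (4 * pi) * (l2norm HL v' + l2norm HL v)"
proof -
 let ?u = "%r. norm (v' r) + norm (v r)"
 have uL: "?u : L2 HL" by (intro L2_add L2_norm L)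
 have eL: "emb ?u : L2 Omega" using emb_L2(1)[OF zext_norm_add_borel[OF m]] uL by simp
 show gL: "egrad v v' b : L2 Omega"
  by (rule L2_bound[OF eL egrad_measurable[OF m] egrad_bound[OF b]])
 have "l2norm Omega (egrad v v' b) <= l2norm Omega (emb ?u)" by (rule l2norm_mono[OF gL eL egrad_bound[OF b]])
 also have "... = sqrt (4 * pi) * l2norm HL ?u" by (rule emb_L2(2)[OF zext_norm_add_borel[OF m]])
 also have "... <= sqrt (4 * pi) * (l2norm HL v' + l2norm HL v)"
  using l2norm_triangle[OF L2_norm(1)[OF L(2)] L2_norm(1)[OF L(1)]] L2_norm(2)[OF L(2)] L2_norm(2)[OF L(1)]
  by (intro mult_left_mono) auto
 finally show "l2norm Omega (egrad v v' b) <= sqrt (4 * pi) * (l2norm HL v' + l2norm HL v)" .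
qed

lemma egrad_diff: "egrad (%r. u r - v r) (%r. u' r - v' r) b x = egrad u u' b x - egrad v v' b x"
 by (simp add: egrad_def algebra_simps scaleR_diff_right)

lemma emb_diff: "emb (%r. u r - v r) x = emb u x - emb v x"
 by (simp add: emb_def scaleR_diff_right)

lemma H10_grad_emb_closed:
 fixes v v' :: "real => complex" and V V' :: "nat => real => complex"
 assumes m: "zx v : bm" "zx v' : bm"
  "!!n. zx (V n) : bm" "!!n. zx (V' n) : bm"
  and L: "v : L2 HL" "v' : L2 HL" "!!n. V n : L2 HL" "!!n. V' n : L2 HL"
  and H: "!!n. H10_grad Omega (emb (V n)) (egrad (V n) (V' n))"
  and lim: "(%n. l2norm HL (%r. V n r - v r)) ---> 0" "(%n. l2norm HL (%r. V' n r - v' r)) ---> 0"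
 shows "H10_grad Omega (emb v) (egrad v v')"
proof (rule H10_grad_closed[OF H])
 have md: "zx (%r. V n r - v r) : bm" "zx (%r. V' n r - v' r) : bm" for n
  using borel_measurable_diff[OF m(3) m(1)] borel_measurable_diff[OF m(4) m(2)] by (simp_all add: zext_diff[abs_def])
 show "emb v : L2 Omega" using emb_L2(1)[OF m(1)] L(1) by simp
 show "egrad v v' b : L2 Omega" if "b : Basis" for b by (rule egrad_L2(1)[OF m(1,2) L(1,2) that])
 have "(%n. sqrt (4 * pi) * l2norm HL (%r. V n r - v r)) ---> 0"
  using tendsto_mult_right_zero[OF lim(1)] .
 thus "(%n. l2norm Omega (%x. emb (V n) x - emb v x)) ---> 0"
  using emb_L2(2)[OF md(1)] by (simp add: emb_diff[abs_def])
 fix b :: "real^3" assume b: "b : Basis"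
 have "l2norm Omega (%x. egrad (V n) (V' n) b x - egrad v v' b x) <= sqrt (4 * pi) * (l2norm HL (%r. V' n r - v' r) + l2norm HL (%r. V n r - v r))" for n
  using egrad_L2(2)[OF md L2_diff[OF L(3) L(1)] L2_diff[OF L(4) L(2)] b, of n] by (simp add: egrad_diff[abs_def])
 hence ev: "\<forall>\<^sub>F n in sequentially. norm (l2norm Omega (%x. egrad (V n) (V' n) b x - egrad v v' b x)) <= sqrt (4 * pi) * (l2norm HL (%r. V' n r - v' r) + l2norm HL (%r. V n r - v r))"
  by (intro always_eventually) auto
 have "(%n. sqrt (4 * pi) * (l2norm HL (%r. V' n r - v' r) + l2norm HL (%r. V n r - v r))) ---> 0"
  using tendsto_mult_right_zero[OF tendsto_add_zero[OF lim(2) lim(1)]] .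
 thus "(%n. l2norm Omega (%x. egrad (V n) (V' n) b x - egrad v v' b x)) ---> 0"
  by (rule Lim_null_comparison[OF ev])
qed

section \<open>Approximation of profiles by smooth functions\<close>

lemma Ck_polynomial_function:
 fixes p :: "real => complex"
 assumes "polynomial_function p"
 shows "Ck n p"
proof -
 have "real_polynomial_function (%x. Re (p x))" "real_polynomial_function (%x. Im (p x))"
  using assms bounded_linear_Re bounded_linear_Im unfolding polynomial_function_def o_def by blast+
 hence "Ck n (%x. Re (p x) *R 1 + Im (p x) *R \<i>)"
  by (intro Ck_add Ck_scaleR Ck_const Ck_real_polynomial_function)
 moreover have "(%x. Re (p x) *R 1 + Im (p x) *R \<i>) = p" by (auto simp: complex_eq_iff)
 ultimately show ?thesis by simp
qed

lemma antiderivative_exists: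
 fixes p :: "real => complex"
 assumes "cts UNIV p"
 obtains P where "!!x. (P hvd p x) (at x)" "P a = 0"
proof -
 obtain F where F: "!!x. (F hvd p x) (at x)"
  using einterval_antiderivative[of "-\<infinity>" "\<infinity>" p] assms
  by (auto simp: continuous_on_eq_continuous_within einterval_eq)
 have "((%x. F x - F a) hvd p x) (at x)" for x
  using has_vector_derivative_diff[OF F has_vector_derivative_const[of "F a"]] by simp
 thus ?thesis by (rule that) simp
qed

lemma vector_mvt_bound:
 fixes f :: "real => complex"
 assumes "!!x. x : {a..b} ==> (f hvd f' x) (at x)" "!!x. x : {a..b} ==> norm (f' x) <= B"
  and "x : {a..b}" "f a = 0" "B >= 0"
 shows "norm (f x) <= B * (b - a)"
proof -
 have "norm (f x - f a) <= B * norm (x - a)"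
 proof (rule differentiable_bound[of "{a..b}" f "%x h. h *R f' x"])
  show "(f has_derivative (%h. h *R f' x)) (at x within {a..b})" if "x : {a..b}" for x
   using assms(1)[OF that] by (auto simp: has_vector_derivative_def intro: has_derivative_at_withinI)
  show "onorm (%h. h *R f' x) <= B" if "x : {a..b}" for x
  proof (rule onorm_le)
   show "norm (h *R f' x) <= B * norm h" for h
    using mult_right_mono[OF assms(2)[OF that], of "\<bar>h\<bar>"] by (simp add: mult.commute)
  qed
 qed (use assms in auto)
 also have "... <= B * (b - a)" using assms by (intro mult_left_mono) auto
 finally show ?thesis using assms by simp
qed

lemma Ck_has_vector_derivative:
 assumes "!!n. Ck n f"
 obtains f' :: "real => 'b::real_normed_vector" where "!!x. (f hvd f' x) (at x)" "!!n. Ck n f'"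
proof
 show "(f hvd pd 1 f x) (at x)" for x
 proof -
  have d: "(f has_derivative frechet_derivative f (at x)) (at x)"
   using assms[of "Suc 0"] by (simp add: frechet_derivative_works[symmetric])
  have "frechet_derivative f (at x) h = h *R pd 1 f x" for h
   using linear.scaleR[OF has_derivative_linear[OF d], of h 1] by (simp add: partial_deriv_def)
  hence "frechet_derivative f (at x) = (%h. h *R pd 1 f x)" by blast
  thus ?thesis using d by (simp add: has_vector_derivative_def)
 qed
 show "Ck n (pd 1 f)" for n using assms[of "Suc n"] by simp
qed

lemma bounded_support_interval:
 fixes g :: "real => 'b::zero"
 assumes "!!r. r ~: {a..b} ==> g r = 0"
 shows "bounded {r. g r ~= 0}"
proof (rule bounded_subset)
 show "{r. g r ~= 0} <= {a..b}" using assms by blast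
qed simp

text \<open>Profiles with compact support inside the half line that are only twice differentiable,
  such as those obtained by integrating a continuous function twice. They do not give test
  functions, but through \<open>approx\<close> they may be used like them.\<close>

locale C2_profile =
 fixes v v' v'' :: "real => complex" and a b :: real
 assumes deriv: "!!r. (v hvd v' r) (at r)" "!!r. (v' hvd v'' r) (at r)"
  and cont: "cts UNIV v''" and ab: "1 < a" "a < b" and supp: "!!r. r ~: {a..b} ==> v r = 0"
begin

lemma deriv_zero_outside:
 assumes "r ~: {a..b}"
 shows "v' r = 0" "v'' r = 0"
proof -
 have ev: "v' s = 0" if "s ~: {a..b}" for s
 proof -
  have "((%_. 0) hvd v' s) (at s)"
   by (rule has_vector_derivative_transform_within_open[OF deriv(1), of "- {a..b}"]) (use that supp in auto)
  thus ?thesis using has_vector_derivative_const vector_derivative_unique_at by blast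
 qed
 thus "v' r = 0" using assms by blast
 have "((%_. 0) hvd v'' r) (at r)"
  by (rule has_vector_derivative_transform_within_open[OF deriv(2), of "- {a..b}"]) (use ev assms in auto)
 thus "v'' r = 0" using has_vector_derivative_const vector_derivative_unique_at by blast
qed

lemma cont_all: "cts UNIV v" "cts UNIV v'"
 using deriv by (auto intro!: continuous_at_imp_continuous_on has_vector_derivative_continuous)

text \<open>A polynomial close to \<open>v''\<close> is integrated twice, starting at
  \<open>a1\<close> to the left of the support, and so stays close to \<open>v'\<close> and
  \<open>v\<close>. Multiplication by the smooth plateau \<open>ch0\<close>, which is 1 on
  \<open>{a..b}\<close>, restores the compact support.\<close>

lemma approx:
 assumes "ep > 0"
 shows "EX F F' F''. C2_profile F F' F'' ((1 + a) / 2) (b + 1) & (ALL n. Ck n F) &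
   (ALL r. norm (F r - v r) <= ep & norm (F' r - v' r) <= ep & norm (F'' r - v'' r) <= ep)"
proof -
 define a1 b1 where "a1 = (1 + a) / 2" and "b1 = b + 1"
 have a1: "1 < a1" "a1 < a" and b1: "b < b1" "a1 < b1" using ab by (auto simp: a1_def b1_def)
 define ch0 where "ch0 r = sstep ((r - a1) / (a - a1) + 1) * (1 - sstep ((r - b) + 1))" for r
 have "Ck n (%r. sstep (inverse (a - a1) * r + (1 - a1 / (a - a1))) * (1 + (-1) * sstep (1 * r + (1 - b))))" for n
  by (intro Ck_mult Ck_add Ck_const Ck_compose[OF Ck_sstep Ck_affine])
 moreover have "(%r. sstep (inverse (a - a1) * r + (1 - a1 / (a - a1))) * (1 + (-1) * sstep (1 * r + (1 - b)))) = ch0"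
  by (intro ext) (simp add: ch0_def divide_inverse algebra_simps)
 ultimately have Ckch: "Ck n ch0" for n by simp
 obtain ch1 where ch1: "!!r. (ch0 hvd ch1 r) (at r)" "!!n. Ck n ch1"
  using Ck_has_vector_derivative[of ch0] Ckch by blast
 obtain ch2 where ch2: "!!r. (ch1 hvd ch2 r) (at r)" "!!n. Ck n ch2"
  using Ck_has_vector_derivative[of ch1] ch1(2) by blast
 have chone: "ch0 r = 1" if "r : {a..b}" for r
  using that a1 by (simp add: ch0_def sstep_0 sstep_1 divide_simps)
 have chzero: "ch0 r = 0" if "r ~: {a1..b1}" for r
 proof (cases "r < a1")
  case True
  hence "(r - a1) / (a - a1) <= 0" using a1 by (simp add: divide_le_0_iff)
  thus ?thesis by (simp add: ch0_def sstep_0)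
 next
  case False
  thus ?thesis using that by (simp add: ch0_def sstep_1 b1_def)
 qed
 have "bounded ((%r. \<bar>ch0 r\<bar> + \<bar>ch1 r\<bar> + \<bar>ch2 r\<bar>) ` {a1..b1})"
  using Ck_continuous[OF Ckch] Ck_continuous[OF ch1(2)] Ck_continuous[OF ch2(2)]
  by (intro compact_imp_bounded compact_continuous_image continuous_intros) (auto intro: continuous_on_subset)
 then obtain B where B: "B > 0" "!!r. r : {a1..b1} ==> \<bar>ch0 r\<bar> + \<bar>ch1 r\<bar> + \<bar>ch2 r\<bar> <= B"
  unfolding bounded_pos by (auto simp: abs_of_nonneg)
 define L where "L = b1 - a1 + 1"
 have L: "L > 1" using b1 by (simp add: L_def)
 \<comment> \<open>\<open>B\<close> bounds the plateau and its two derivatives, \<open>L\<close>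
   exceeds the length of the interval. The second derivative of the error has four terms, each of
   size at most \<open>B * dl * L^2 = ep / 4\<close>.\<close>
 define dl where "dl = ep / (4 * B * L^2)"
 have dl: "dl > 0" using assms B L by (simp add: dl_def)
 obtain p where p: "polynomial_function p" "!!r. r : {a1..b1} ==> norm (v'' r - p r) < dl"
  using Stone_Weierstrass_polynomial_function[of "{a1..b1}" v'' dl] dl continuous_on_subset[OF cont] by auto
 have Ckp: "Ck n p" for n by (rule Ck_polynomial_function[OF p(1)])
 obtain p1 where p1: "!!r. (p1 hvd p r) (at r)" "p1 a1 = 0"
  using antiderivative_exists[OF Ck_continuous[OF Ckp]] by blast
 have Ckp1: "Ck n p1" for n using Ck_SucI_real[OF p1(1) Ckp] Ck_SucD by blast
 obtain p0 where p0: "!!r. (p0 hvd p1 r) (at r)" "p0 a1 = 0"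
  using antiderivative_exists[OF Ck_continuous[OF Ckp1]] by blast
 have Ckp0: "Ck n p0" for n using Ck_SucI_real[OF p0(1) Ckp1] Ck_SucD by blast
 have va1: "v a1 = 0" "v' a1 = 0" using supp[of a1] deriv_zero_outside[of a1] a1 by auto
 have e2: "norm (p r - v'' r) <= dl * L^2" if "r : {a1..b1}" for r
 proof -
  have "norm (p r - v'' r) <= dl * 1" using p(2)[OF that] by (simp add: norm_minus_commute)
  also have "... <= dl * L^2" using L dl by (intro mult_left_mono) (auto simp: one_le_power)
  finally show ?thesis .
 qed
 have e1': "norm (p1 r - v' r) <= dl * (b1 - a1)" if "r : {a1..b1}" for r
  by (rule vector_mvt_bound[of a1 b1 "%r. p1 r - v' r" "%r. p r - v'' r"])
    (use p1 va1 that dl p(2) deriv(2) in "auto intro!: has_vector_derivative_diff less_imp_le simp: norm_minus_commute")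
 have e1: "norm (p1 r - v' r) <= dl * L" if "r : {a1..b1}" for r
  using order_trans[OF e1'[OF that], of "dl * L"] dl by (simp add: L_def)
 have e0': "norm (p0 r - v r) <= dl * L * (b1 - a1)" if "r : {a1..b1}" for r
  by (rule vector_mvt_bound[of a1 b1 "%r. p0 r - v r" "%r. p1 r - v' r"])
    (use p0 va1 that dl L e1 deriv(1) in "auto intro!: has_vector_derivative_diff")
 have e0: "norm (p0 r - v r) <= dl * L^2" if "r : {a1..b1}" for r
 proof -
  have "dl * L * (b1 - a1) <= dl * L * L" using dl L by (intro mult_left_mono) (auto simp: L_def)
  thus ?thesis using e0'[OF that] by (simp add: power2_eq_square mult.assoc)
 qed
 have e1'': "norm (p1 r - v' r) <= dl * L^2" if "r : {a1..b1}" for r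
 proof -
  have "dl * L * 1 <= dl * L * L" using dl L by (intro mult_left_mono) auto
  thus ?thesis using e1[OF that] by (simp add: power2_eq_square mult.assoc)
 qed
 define D where "D = dl * L^2"
 have D: "D >= 0" using dl L by (simp add: D_def)
 have "4 * (B * D) = ep" using B L by (simp add: D_def dl_def)
 note D = D this
 define G G' G'' where "G r = ch0 r *R p0 r" and "G' r = ch0 r *R p1 r + ch1 r *R p0 r"
  and "G'' r = (ch0 r *R p r + ch1 r *R p1 r) + (ch1 r *R p1 r + ch2 r *R p0 r)" for r
 note chd = ch1(1)[folded has_real_derivative_iff_has_vector_derivative] ch2(1)[folded has_real_derivative_iff_has_vector_derivative]
 have Gd: "(G hvd G' r) (at r)" for r
  unfolding G_def G'_def by (intro has_vector_derivative_scaleR chd p0)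
 have Gd': "(G' hvd G'' r) (at r)" for r
  unfolding G'_def[abs_def] G''_def by (intro has_vector_derivative_add has_vector_derivative_scaleR chd p0 p1)
 have CkG: "Ck n G" for n unfolding G_def[abs_def] by (intro Ck_scaleR Ckch Ckp0)
 have contG: "cts UNIV G''"
  unfolding G''_def[abs_def] by (intro continuous_intros Ck_continuous[OF Ckp] Ck_continuous[OF Ckp1] Ck_continuous[OF Ckp0]
   Ck_continuous[OF Ckch] Ck_continuous[OF ch1(2)] Ck_continuous[OF ch2(2)])
 interpret G: C2_profile G G' G'' a1 b1
  by unfold_locales (use Gd Gd' contG a1 b1 chzero in "auto simp: G_def")
 \<comment> \<open>Since \<open>ch0\<close> is 1 on the support, \<open>v\<close> and its
   derivatives obey the same product formulas as \<open>G\<close>, so that the errors can be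
   compared term by term.\<close>
 have veq: "v r = ch0 r *R v r" for r using chone supp by (cases "r : {a..b}") auto
 have veq': "v' r = ch0 r *R v' r + ch1 r *R v r" for r
 proof -
  have "((%r. ch0 r *R v r) hvd ch0 r *R v' r + ch1 r *R v r) (at r)"
   by (intro has_vector_derivative_scaleR chd deriv)
  hence "(v hvd ch0 r *R v' r + ch1 r *R v r) (at r)"
   unfolding veq[symmetric] .
  thus ?thesis using deriv(1) vector_derivative_unique_at by blast
 qed
 have veq'': "v'' r = (ch0 r *R v'' r + ch1 r *R v' r) + (ch1 r *R v' r + ch2 r *R v r)" for r
 proof -
  have "((%r. ch0 r *R v' r + ch1 r *R v r) hvd (ch0 r *R v'' r + ch1 r *R v' r) + (ch1 r *R v' r + ch2 r *R v r)) (at r)"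
   by (intro has_vector_derivative_add has_vector_derivative_scaleR chd deriv)
  hence "(v' hvd (ch0 r *R v'' r + ch1 r *R v' r) + (ch1 r *R v' r + ch2 r *R v r)) (at r)"
   unfolding veq'[symmetric] .
  thus ?thesis using deriv(2) vector_derivative_unique_at by blast
 qed
 have sm: "norm (c *R x) <= B * D" if "\<bar>c\<bar> <= B" "norm x <= D" for c and x :: complex
  using mult_mono[OF that] B(1) by simp
 have "norm (G r - v r) <= ep & norm (G' r - v' r) <= ep & norm (G'' r - v'' r) <= ep" for r
 proof (cases "r : {a1..b1}")
  case True
  have c: "\<bar>ch0 r\<bar> <= B" "\<bar>ch1 r\<bar> <= B" "\<bar>ch2 r\<bar> <= B" using B(2)[OF True] by auto
  have e: "norm (p0 r - v r) <= D" "norm (p1 r - v' r) <= D" "norm (p r - v'' r) <= D"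
   using e0[OF True] e1''[OF True] e2[OF True] by (auto simp: D_def)
  have BD: "B * D >= 0" using B D by simp
  have "G r - v r = ch0 r *R (p0 r - v r)" using veq[of r] by (simp add: G_def scaleR_diff_right)
  hence 1: "norm (G r - v r) <= ep" using sm[OF c(1) e(1)] D BD by simp
  have "G' r - v' r = ch0 r *R (p1 r - v' r) + ch1 r *R (p0 r - v r)"
   using veq'[of r] by (simp add: G'_def scaleR_diff_right algebra_simps)
  hence "norm (G' r - v' r) <= norm (ch0 r *R (p1 r - v' r)) + norm (ch1 r *R (p0 r - v r))"
   by (simp only: norm_triangle_ineq)
  hence 2: "norm (G' r - v' r) <= ep"
   using sm[OF c(1) e(2)] sm[OF c(2) e(1)] D BD by linarith
  have "G'' r - v'' r = (ch0 r *R (p r - v'' r) + ch1 r *R (p1 r - v' r)) + (ch1 r *R (p1 r - v' r) + ch2 r *R (p0 r - v r))"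
   using veq''[of r] by (simp add: G''_def scaleR_diff_right algebra_simps)
  hence "norm (G'' r - v'' r) <= norm (ch0 r *R (p r - v'' r)) + norm (ch1 r *R (p1 r - v' r)) + (norm (ch1 r *R (p1 r - v' r)) + norm (ch2 r *R (p0 r - v r)))"
   by (simp only:) (intro norm_triangle_le add_mono norm_triangle_ineq)
  hence 3: "norm (G'' r - v'' r) <= ep"
   using sm[OF c(1) e(3)] sm[OF c(2) e(2)] sm[OF c(3) e(1)] D BD by linarith
  show ?thesis using 1 2 3 by blast
 next
  case False
  hence "r ~: {a..b}" using a1 b1 by auto
  thus ?thesis using G.supp[OF False] G.deriv_zero_outside[OF False] supp deriv_zero_outside assms by auto
 qed
 thus ?thesis using G.C2_profile_axioms CkG unfolding a1_def b1_def by blast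
qed

lemma borel: "zx v : bm" "zx v' : bm"
  "zx v'' : bm"
 by (auto intro!: borel_zext_continuous continuous_on_subset[OF cont_all(1)] continuous_on_subset[OF cont_all(2)] continuous_on_subset[OF cont])

lemma L2: "v : L2 HL" "v' : L2 HL" "v'' : L2 HL"
proof -
 have *: "g : L2 HL" if "cts UNIV g" "!!r. r ~: {a..b} ==> g r = 0" for g :: "real => complex"
 proof (rule continuous_support_L2[OF that(1)])
  show "bounded {x. g x ~= 0}" by (rule bounded_support_interval[OF that(2)])
  show "g x = 0" if "x ~: HL" for x using that ab \<open>!!r. r ~: {a..b} ==> g r = 0\<close>[of x] by auto
 qed
 show "v : L2 HL" by (rule *[OF cont_all(1) supp])
 show "v' : L2 HL" by (rule *[OF cont_all(2) deriv_zero_outside(1)])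
 show "v'' : L2 HL" by (rule *[OF cont deriv_zero_outside(2)])
qed

lemma l2norm_le:
 assumes "g : L2 HL" "!!r. r ~: {a..b} ==> g r = 0" "!!r. norm (g r) <= ep"
 shows "l2norm HL g <= ep * sqrt (b - a)"
proof -
 have e: "ep >= 0" using assms(3)[of 0] norm_ge_zero[of "g 0"] by linarith
 have i: "integrable leb (%r. ep^2 * indicator {a..b} r)"
 proof -
  have "integrable lborel (%r. indicator {a..b} r :: real)"
   by (rule integrable_real_indicator) (auto simp: emeasure_lborel_Icc_eq)
  thus ?thesis by (subst borel_lebesgue_1d(2)) (auto simp del: integrable_mult_right_iff intro!: integrable_mult_right)
 qed
 have "(l2norm HL g)^2 <= (LINT r|leb. ep^2 * indicator {a..b} r)"
  unfolding l2norm_square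
 proof (rule integral_mono[OF L2D(2)[OF assms(1)] i])
  show "(norm (zx g r))^2 <= ep^2 * indicator {a..b} r" for r
   using power_mono[OF assms(3)[of r], of 2] assms(2)[of r] by (auto simp: zext_def indicator_def)
 qed
 also have "... = ep^2 * (b - a)" using ab by (subst borel_lebesgue_1d(3)) auto
 finally have "sqrt ((l2norm HL g)^2) <= sqrt (ep^2 * (b - a))" by (rule real_sqrt_le_mono)
 thus ?thesis using e by (simp add: real_sqrt_mult)
qed

end

lemma C2_profile_diff:
 assumes "C2_profile u u' u'' a b" "C2_profile v v' v'' a b"
 shows "C2_profile (%r. u r - v r) (%r. u' r - v' r) (%r. u'' r - v'' r) a b"
proof -
 interpret u: C2_profile u u' u'' a b by fact
 interpret v: C2_profile v v' v'' a b by fact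
 show ?thesis
  by unfold_locales (auto intro!: has_vector_derivative_diff u.deriv v.deriv continuous_on_diff u.cont v.cont u.ab u.supp simp: v.supp u.supp)
qed

lemma (in C2_profile) mono: "1 < c ==> c <= a ==> b <= d ==> C2_profile v v' v'' c d"
 using deriv cont ab supp by unfold_locales auto

lemma (in C2_profile) approx_seq:
 obtains F F' F'' where "!!n. C2_profile (F n) (F' n) (F'' n) ((1 + a) / 2) (b + 1)" "!!n k. Ck k (F n)"
  "!!n r. norm (F n r - v r) <= inverse (real (Suc n))" "!!n r. norm (F' n r - v' r) <= inverse (real (Suc n))"
  "!!n r. norm (F'' n r - v'' r) <= inverse (real (Suc n))"
proof -
 have "ALL n. EX F F' F''. C2_profile F F' F'' ((1 + a) / 2) (b + 1) & (ALL n. Ck n F) &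
   (ALL r. norm (F r - v r) <= inverse (real (Suc n)) & norm (F' r - v' r) <= inverse (real (Suc n)) & norm (F'' r - v'' r) <= inverse (real (Suc n)))"
  by (intro allI approx) simp
 then obtain F F' F'' where "ALL n. C2_profile (F n) (F' n) (F'' n) ((1 + a) / 2) (b + 1) & (ALL k. Ck k (F n)) &
   (ALL r. norm (F n r - v r) <= inverse (real (Suc n)) & norm (F' n r - v' r) <= inverse (real (Suc n)) & norm (F'' n r - v'' r) <= inverse (real (Suc n)))"
  by metis
 thus ?thesis using that by blast
qed

lemma (in C2_profile) H10_grad_emb: "H10_grad Omega (emb v) (egrad v v')"
proof -
 obtain F F' F'' where F: "!!n. C2_profile (F n) (F' n) (F'' n) ((1 + a) / 2) (b + 1)" "!!n k. Ck k (F n)"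
  "!!n r. norm (F n r - v r) <= inverse (real (Suc n))" "!!n r. norm (F' n r - v' r) <= inverse (real (Suc n))"
  "!!n r. norm (F'' n r - v'' r) <= inverse (real (Suc n))" using approx_seq by blast
 have v1: "C2_profile v v' v'' ((1 + a) / 2) (b + 1)" by (rule mono) (use ab in auto)
 note d = C2_profile_diff[OF F(1) v1]
 have lim0: "(%n. inverse (real (Suc n)) * sqrt ((b + 1) - (1 + a) / 2)) ---> 0"
  using tendsto_mult_left_zero[OF LIMSEQ_inverse_real_of_nat] .
 show ?thesis
 proof (rule H10_grad_emb_closed[where V=F and V'=F'])
  fix n
  interpret Fn: C2_profile "F n" "F' n" "F'' n" "(1 + a) / 2" "b + 1" by (rule F(1))
  show "zx (F n) : bm" "zx (F' n) : bm"
   "F n : L2 HL" "F' n : L2 HL" by (rule Fn.borel Fn.L2)+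
  have t: "emb (F n) : test_functions Omega"
   by (rule emb_test_function[OF F(2) Fn.ab(1) Fn.supp])
  show "H10_grad Omega (emb (F n)) (egrad (F n) (F' n))"
   unfolding H10_grad_def
  proof (intro conjI ballI exI[of _ "%_. emb (F n)"] allI t)
   show "emb (F n) : L2 Omega" by (rule test_L2[OF t])
   show "egrad (F n) (F' n) b : L2 Omega" if "b : Basis" for b
    by (rule egrad_L2(1)[OF Fn.borel(1,2) Fn.L2(1,2) that])
   show "(%_. l2norm Omega (%x. emb (F n) x - emb (F n) x)) ---> 0" by (simp add: l2norm_def)
   show "(%_. l2norm Omega (%x. pd b (emb (F n)) x - egrad (F n) (F' n) b x)) ---> 0" for b
   proof -
    have "l2norm Omega (%x. pd b (emb (F n)) x - egrad (F n) (F' n) b x) = l2norm Omega (%x. 0::complex)"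
     by (rule l2norm_cong_norm) (simp add: lap_emb(1)[of "F n" "F' n" "F'' n", OF Fn.deriv])
    thus ?thesis by (simp add: l2norm_def)
   qed
  qed
 next
  have "l2norm HL (%r. F n r - v r) <= inverse (real (Suc n)) * sqrt ((b + 1) - (1 + a) / 2)" for n
   by (rule C2_profile.l2norm_le[OF d C2_profile.L2(1)[OF d] C2_profile.supp[OF d] F(3)])
  hence "\<forall>\<^sub>F n in sequentially. norm (l2norm HL (%r. F n r - v r)) <= inverse (real (Suc n)) * sqrt ((b + 1) - (1 + a) / 2)"
   by (intro always_eventually) auto
  thus "(%n. l2norm HL (%r. F n r - v r)) ---> 0" by (rule Lim_null_comparison[OF _ lim0])
  have "l2norm HL (%r. F' n r - v' r) <= inverse (real (Suc n)) * sqrt ((b + 1) - (1 + a) / 2)" for n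
   by (rule C2_profile.l2norm_le[OF d C2_profile.L2(2)[OF d] C2_profile.deriv_zero_outside(1)[OF d] F(4)])
  hence "\<forall>\<^sub>F n in sequentially. norm (l2norm HL (%r. F' n r - v' r)) <= inverse (real (Suc n)) * sqrt ((b + 1) - (1 + a) / 2)"
   by (intro always_eventually) auto
  thus "(%n. l2norm HL (%r. F' n r - v' r)) ---> 0" by (rule Lim_null_comparison[OF _ lim0])
 qed (rule borel L2)+
qed

text \<open>The smooth approximants converge uniformly, together with their second derivatives, and
  are all supported in one compact shell \<open>K\<close>, on which \<open>f\<close> and
  \<open>w\<close> are integrable.\<close>

lemma (in C2_profile) weak_laplacian_radial_test:
 assumes f: "has_weak_laplacian Omega f w"
 shows "(LINT x:Omega|leb. emb v'' x * f x) = (LINT x:Omega|leb. emb v x * w x)"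
proof -
 obtain F F' F'' where F: "!!n. C2_profile (F n) (F' n) (F'' n) ((1 + a) / 2) (b + 1)" "!!n k. Ck k (F n)"
  "!!n r. norm (F n r - v r) <= inverse (real (Suc n))" "!!n r. norm (F' n r - v' r) <= inverse (real (Suc n))"
  "!!n r. norm (F'' n r - v'' r) <= inverse (real (Suc n))" using approx_seq by blast
 have v1: "C2_profile v v' v'' ((1 + a) / 2) (b + 1)" by (rule mono) (use ab in auto)
 note d = C2_profile_diff[OF F(1) v1]
 define K where "K = {x::real^3. (1 + a) / 2 <= norm x & norm x <= b + 1}"
 have K: "compact K" "K <= Omega"
 proof -
  have "K = cball 0 (b + 1) - ball 0 ((1 + a) / 2)" by (auto simp: K_def)
  thus "compact K" by (simp add: compact_diff)
  show "K <= Omega" using ab by (auto simp: K_def Omega_iff)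
 qed
 have li: "loc_integrable Omega f" "loc_integrable Omega w" using f by (auto simp: has_weak_laplacian_iff)
 have key: "(%n. LINT x:Omega|leb. emb (G n) x * g x) ---> (LINT x:Omega|leb. emb h x * g x)"
  if g: "loc_integrable Omega g" and G: "!!n. cts UNIV (G n)" "cts UNIV h"
   "!!n r. norm (G n r - h r) <= inverse (real (Suc n))" "!!n r. r ~: {(1 + a) / 2..b + 1} ==> G n r = 0"
   "!!r. r ~: {(1 + a) / 2..b + 1} ==> h r = 0" for G :: "nat => real => complex" and h g
 proof -
  have gi: "integrable leb (zext K g)" using g K by (auto simp: loc_integrable_def set_integrable_zext)
  have nz: "norm x > 1" if "x : K" for x using that K(2) by (auto simp: Omega_iff)
  have em: "emb u : bm" if "cts UNIV u" for u :: "real => complex"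
  proof -
   have [measurable]: "u : bm" by (rule borel_measurable_continuous_onI[OF that])
   show ?thesis unfolding emb_def[abs_def] by measurable
  qed
  have z: "zext Omega (%x. emb u x * g x) = (%x. emb u x * zext K g x)"
   if "!!r. r ~: {(1 + a) / 2..b + 1} ==> u r = 0" for u :: "real => complex"
   using that K(2) by (intro ext) (auto simp: zext_def indicator_def emb_def K_def)
  have emL: "emb u : borel_measurable leb" if "cts UNIV u" for u :: "real => complex"
   using em[OF that] by (simp add: measurable_completion)
  have "(%n. LINT x|leb. emb (G n) x * zext K g x) ---> (LINT x|leb. emb h x * zext K g x)"
  proof (rule integral_dominated_convergence[where w="%x. norm (emb h x * zext K g x) + norm (zext K g x)"])
   have B: "bounded {r. h r ~= 0}" by (rule bounded_support_interval[OF G(5)])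
   obtain C where C: "C >= 0" "!!r. norm (h r) <= C" using continuous_compact_support_bounded[OF G(2) B] by blast
   have "integrable leb (%x. emb h x * zext K g x)"
   proof (rule Bochner_Integration.integrable_bound[of leb "%x. C *R zext K g x"])
    show "(%x. emb h x * zext K g x) : borel_measurable leb"
     by (intro borel_measurable_times emL G(2) borel_measurable_integrable[OF gi])
    show "AE x in leb. norm (emb h x * zext K g x) <= norm (C *R zext K g x)"
    proof (rule AE_I2)
     fix x
     show "norm (emb h x * zext K g x) <= norm (C *R zext K g x)"
     proof (cases "x : K")
      case True
      have "norm (emb h x) <= norm (h (norm x)) / 1" unfolding emb_def norm_scaleR using nz[OF True]
       by (simp add: divide_inverse_commute[symmetric] divide_le_eq mult_left_le_one_le mult_le_cancel_left1)
      hence "norm (emb h x) <= C" using C(2)[of "norm x"] by simp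
      thus ?thesis using C(1) by (auto simp: norm_mult intro!: mult_right_mono)
     qed (simp add: zext_simps)
    qed
   qed (use gi in auto)
   thus "integrable leb (%x. norm (emb h x * zext K g x) + norm (zext K g x))" using gi by auto
   show "AE x in leb. (%n. emb (G n) x * zext K g x) ---> emb h x * zext K g x"
   proof (rule AE_I2)
    fix x :: "real^3"
    have "(%n. G n (norm x) - h (norm x)) ---> 0"
     by (rule Lim_null_comparison[OF _ LIMSEQ_inverse_real_of_nat]) (intro always_eventually allI G(3))
    hence "(%n. G n (norm x)) ---> h (norm x)" by (simp add: LIM_zero_iff)
    thus "(%n. emb (G n) x * zext K g x) ---> emb h x * zext K g x"
     unfolding emb_def by (intro tendsto_intros)
   qed
   show "AE x in leb. norm (emb (G n) x * zext K g x) <= norm (emb h x * zext K g x) + norm (zext K g x)" for n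
   proof (rule AE_I2)
    fix x
    show "norm (emb (G n) x * zext K g x) <= norm (emb h x * zext K g x) + norm (zext K g x)"
    proof (cases "x : K")
     case True
     have "norm (G n (norm x) - h (norm x)) <= 1" by (rule order_trans[OF G(3)]) (simp add: field_simps)
     hence "norm (G n (norm x) - h (norm x)) * inverse (norm x) <= 1 * 1"
      using nz[OF True] by (intro mult_mono) (auto simp: inverse_le_1_iff)
     hence "norm (emb (G n) x - emb h x) <= 1"
      by (simp add: emb_def scaleR_diff_right[symmetric] mult.commute)
     hence "norm (emb (G n) x) <= norm (emb h x) + 1" using norm_triangle_ineq2[of "emb (G n) x" "emb h x"] by linarith
     hence "norm (emb (G n) x) * norm (zext K g x) <= (norm (emb h x) + 1) * norm (zext K g x)"
      by (rule mult_right_mono) simp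
     thus ?thesis by (simp add: norm_mult distrib_right)
    qed (simp add: zext_simps)
   qed
  qed (intro borel_measurable_times emL G borel_measurable_integrable[OF gi])+
  moreover have "zext Omega (%x. emb (G n) x * g x) = (%x. emb (G n) x * zext K g x)" for n by (rule z) (rule G(4))
  moreover have "zext Omega (%x. emb h x * g x) = (%x. emb h x * zext K g x)" by (rule z) (rule G(5))
  ultimately show ?thesis unfolding set_integral_zext by simp
 qed
 have eq: "(LINT x:Omega|leb. emb (F'' n) x * f x) = (LINT x:Omega|leb. emb (F n) x * w x)" for n
 proof -
  interpret Fn: C2_profile "F n" "F' n" "F'' n" "(1 + a) / 2" "b + 1" by (rule F(1))
  have t: "emb (F n) : test_functions Omega"
   by (rule emb_test_function[OF F(2) Fn.ab(1) Fn.supp])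
  have "(LINT x:Omega|leb. emb (F'' n) x * f x) = (LINT x:Omega|leb. lap (emb (F n)) x * f x)"
   by (rule set_lebesgue_integral_cong)
     (use lap_emb(2)[of "F n" "F' n" "F'' n", OF Fn.deriv] open_Omega in auto)
  thus ?thesis using weak_laplacian_complex_test[OF f t] by simp
 qed
 have "(%n. LINT x:Omega|leb. emb (F'' n) x * f x) ---> (LINT x:Omega|leb. emb v'' x * f x)"
  by (rule key[OF li(1) C2_profile.cont[OF F(1)] cont F(5) C2_profile.deriv_zero_outside(2)[OF F(1)] C2_profile.deriv_zero_outside(2)[OF v1]])
 moreover have "(%n. LINT x:Omega|leb. emb (F n) x * w x) ---> (LINT x:Omega|leb. emb v x * w x)"
  by (rule key[OF li(2) C2_profile.cont_all(1)[OF F(1)] cont_all(1) F(3) C2_profile.supp[OF F(1)] C2_profile.supp[OF v1]])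
 ultimately show ?thesis unfolding eq by (rule LIMSEQ_unique)
qed

section \<open>Cutting off profiles that satisfy the Dirichlet condition\<close>

definition cut1 :: "nat => real => real" where "cut1 n r = deriv (cutoff n) r"
definition cut2 :: "nat => real => real" where "cut2 n r = deriv (cut1 n) r"

lemma DERIV_locally_constant:
 fixes f :: "real => real"
 assumes "(f hrd D) (at x)" "open S" "x : S" "!!y. y : S ==> f y = c"
 shows "D = 0"
proof -
 have "((%_. c) hrd D) (at x)"
  by (rule has_field_derivative_transform_within_open[OF assms(1-3)]) (use assms(4) in simp)
 thus ?thesis using DERIV_unique DERIV_const by blast
qed

lemma cut_derivatives:
 "(cutoff n hrd cut1 n r) (at r)" "(cut1 n hrd cut2 n r) (at r)" "cts UNIV (cut2 n)"
 "r < 1 + inverse (real (Suc n)) ==> cut1 n r = 0" "r < 1 + inverse (real (Suc n)) ==> cut2 n r = 0"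
 "1 + 2 / real (Suc n) < r ==> r < real (Suc n) ==> cut1 n r = 0"
proof -
 obtain f' where f': "!!x. (cutoff n hvd f' x) (at x)" "!!k. Ck k f'"
  using Ck_has_vector_derivative[of "cutoff n"] Ck_cutoff by blast
 obtain f'' where f'': "!!x. (f' hvd f'' x) (at x)" "!!k. Ck k f''"
  using Ck_has_vector_derivative[of f'] f'(2) by blast
 note rv = has_real_derivative_iff_has_vector_derivative[symmetric]
 have e1: "cut1 n = f'" using DERIV_imp_deriv[OF f'(1)[unfolded rv]] by (intro ext) (simp add: cut1_def)
 have e2: "cut2 n = f''" using DERIV_imp_deriv[OF f''(1)[unfolded rv]] by (intro ext) (simp add: cut2_def e1)
 show d1: "(cutoff n hrd cut1 n r) (at r)" and d2: "(cut1 n hrd cut2 n r) (at r)" for r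
  using f'(1) f''(1) by (simp_all add: e1 e2 rv)
 show "cts UNIV (cut2 n)" unfolding e2 by (rule Ck_continuous[OF f''(2)])
 have low: "cut1 n r = 0" if "r : {..<1 + inverse (real (Suc n))}" for r
  by (rule DERIV_locally_constant[OF d1 open_lessThan that, of 0]) (auto intro: cutoff_eq_0)
 thus "cut1 n r = 0" if "r < 1 + inverse (real (Suc n))" using that by simp
 show "cut2 n r = 0" if "r < 1 + inverse (real (Suc n))"
  by (rule DERIV_locally_constant[OF d2 open_lessThan _ low]) (use that in auto)
 show "cut1 n r = 0" if "1 + 2 / real (Suc n) < r" "r < real (Suc n)"
  by (rule DERIV_locally_constant[OF d1 open_greaterThanLessThan, of _ "1 + 2 / real (Suc n)" "real (Suc n)" 1])
    (use that in "auto intro: cutoff_eq_1")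
qed

text \<open>The derivative is of order \<open>n\<close> only in a boundary layer of width
  \<open>2 / (n + 1)\<close> and of order \<open>1 / n\<close> beyond. The large values in the layer
  are later compensated by profiles that vanish linearly at \<open>1\<close>.\<close>

lemma cut_bounds:
 "EX B>=0. ALL n r. \<bar>cut1 n r\<bar> <= B * real (Suc n) & (r > 1 + 2 / real (Suc n) --> \<bar>cut1 n r\<bar> <= B / real (Suc n))"
proof -
 obtain S where S: "!!x. (sstep hvd S x) (at x)" "!!n. Ck n S"
  using Ck_has_vector_derivative[of sstep] Ck_sstep by blast
 have sd: "(sstep hrd S x) (at x)" for x using S(1) by (simp add: has_real_derivative_iff_has_vector_derivative)
 have z: "S x = 0" if "x ~: {1..2}" for x
 proof (cases "x < 1")
  case True
  show ?thesis by (rule DERIV_locally_constant[OF sd open_lessThan, of x 1 0]) (use True in "auto simp: sstep_0")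
 next
  case False
  show ?thesis by (rule DERIV_locally_constant[OF sd open_greaterThan, of x 2 1]) (use False that in "auto simp: sstep_1")
 qed
 obtain B where B: "B >= 0" "!!x. \<bar>S x\<bar> <= B"
  using continuous_compact_support_bounded[OF Ck_continuous[OF S(2)] bounded_support_interval[OF z]] by auto
 have s: "\<bar>sstep x\<bar> <= 1" "\<bar>1 - sstep x\<bar> <= 1" for x using sstep_bounds[of x] by auto
 have "\<bar>cut1 n r\<bar> <= 2 * B * N & (r > 1 + 2 / N --> \<bar>cut1 n r\<bar> <= 2 * B / N)" if N: "N = real (Suc n)" for n r N
 proof -
  have N1: "N >= 1" using N by simp
  define X Y where "X = N * S (N * (r - 1)) * (1 - sstep (r / N))" and "Y = sstep (N * (r - 1)) * (S (r / N) / N)"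
  have "((%r. sstep (N * (r - 1))) hrd S (N * (r - 1)) * N) (at r)"
   by (rule DERIV_chain2[OF sd]) (auto intro!: derivative_eq_intros)
  moreover have "((%r. 1 - sstep (r / N)) hrd 0 - S (r / N) * (1 / N)) (at r)"
   by (intro DERIV_diff DERIV_const DERIV_chain2[OF sd]) (use N1 in "auto intro!: derivative_eq_intros")
  ultimately have "(cutoff n hrd X - Y) (at r)"
   unfolding cutoff_def[abs_def] N[symmetric] by (rule DERIV_cong[OF DERIV_mult]) (simp add: X_def Y_def)
  hence c: "cut1 n r = X - Y" using DERIV_unique cut_derivatives(1) by blast
  have "\<bar>X\<bar> <= N * B * 1" unfolding X_def abs_mult using N1 B s by (intro mult_mono) auto
  moreover have Y: "\<bar>Y\<bar> <= 1 * (B / N)" unfolding Y_def abs_mult using N1 B s by (intro mult_mono) (auto simp: divide_right_mono)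
  moreover have "B / N <= B / 1" "B * 1 <= B * N" using N1 B(1) by (intro divide_left_mono mult_left_mono; simp)+
  ultimately have 1: "\<bar>cut1 n r\<bar> <= 2 * B * N" unfolding c using abs_triangle_ineq4[of X Y] by (simp add: mult_ac)
  have "\<bar>cut1 n r\<bar> <= 2 * B / N" if "r > 1 + 2 / N"
  proof -
   have "N * (2 / N) < N * (r - 1)" using that N1 by (intro mult_strict_left_mono) auto
   hence "S (N * (r - 1)) = 0" using z[of "N * (r - 1)"] N1 by simp
   moreover have "B / N >= 0" using B N1 by simp
   ultimately show ?thesis using Y unfolding c X_def by simp
  qed
  with 1 show ?thesis by blast
 qed
 thus ?thesis using B(1) by (intro exI[of _ "2 * B"]) auto
qed

text \<open>The two branches fit together at \<open>1\<close> because the cutoff and its derivatives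
  vanish up to \<open>1 + 1 / (n + 1)\<close>.\<close>

lemma C2_profile_cutoff:
 fixes v v' v'' :: "real => complex"
 assumes v: "!!r. r > 1 ==> (v hvd v' r) (at r)" "!!r. r > 1 ==> (v' hvd v'' r) (at r)"
  "cts HL v''"
 shows "C2_profile (%r. if r > 1 then cutoff n r *R v r else 0) (%r. if r > 1 then cutoff n r *R v' r + cut1 n r *R v r else 0)
  (%r. if r > 1 then cutoff n r *R v'' r + (2 * cut1 n r) *R v' r + cut2 n r *R v r else 0)
  (1 + inverse (real (Suc n))) (2 * real (Suc n) + 1)" (is "C2_profile ?w ?w' ?w'' ?a ?b")
proof
 have a: "1 < ?a" by simp
 show "1 < ?a" by (rule a)
 define N where "N = real (Suc n)"
 have "N >= 1" by (simp add: N_def)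
 moreover from this have "inverse N <= 1" by (simp add: field_simps)
 ultimately have "1 + inverse N < 2 * N + 1" by linarith
 thus "?a < ?b" by (simp only: N_def)
 have low: "r < ?a ==> cutoff n r = 0 & cut1 n r = 0 & cut2 n r = 0" for r
  using cut_derivatives(4,5)[of r n] cutoff_eq_0[of r n] by (auto simp del: of_nat_Suc)
 have w1: "(?w hvd ?w' r) (at r)" for r
 proof (cases "r > 1")
  case True
  have "((%r. cutoff n r *R v r) hvd ?w' r) (at r)"
   using has_vector_derivative_scaleR[OF cut_derivatives(1) v(1)[OF True], of n] True by simp
  thus ?thesis
   by (rule has_vector_derivative_transform_within_open[of _ _ _ "{1<..}"]) (use True in auto)
 next
  case False
  have "((%_. 0) hvd ?w' r) (at r)" using False by simp
  thus ?thesis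
   by (rule has_vector_derivative_transform_within_open[of _ _ _ "{..< ?a}"]) (use le_less_trans[OF _ a, of r] False low in "auto simp del: of_nat_Suc")
 qed
 show "(?w hvd ?w' r) (at r)" for r by (rule w1)
 show "(?w' hvd ?w'' r) (at r)" for r
 proof (cases "r > 1")
  case True
  have "((%r. cutoff n r *R v' r + cut1 n r *R v r) has_vector_derivative
    (cutoff n r *R v'' r + cut1 n r *R v' r) + (cut1 n r *R v' r + cut2 n r *R v r)) (at r)"
   by (intro has_vector_derivative_add has_vector_derivative_scaleR cut_derivatives v True)
  moreover have "(cutoff n r *R v'' r + cut1 n r *R v' r) + (cut1 n r *R v' r + cut2 n r *R v r) = ?w'' r"
   using True by (simp add: scaleR_conv_of_real algebra_simps)
  ultimately have "((%r. cutoff n r *R v' r + cut1 n r *R v r) hvd ?w'' r) (at r)" by (simp only:)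
  thus ?thesis
   by (rule has_vector_derivative_transform_within_open[of _ _ _ "{1<..}"]) (use True in auto)
 next
  case False
  have "((%_. 0) hvd ?w'' r) (at r)" using False by simp
  thus ?thesis
   by (rule has_vector_derivative_transform_within_open[of _ _ _ "{..< ?a}"]) (use le_less_trans[OF _ a, of r] False low in "auto simp del: of_nat_Suc")
 qed
 have cv: "cts HL v" "cts HL v'"
  using v by (auto intro!: continuous_at_imp_continuous_on has_vector_derivative_continuous)
 have c1: "cts UNIV (cut1 n)" "cts UNIV (cutoff n)"
  using cut_derivatives(1,2) by (auto intro!: continuous_at_imp_continuous_on DERIV_isCont)
 have "cts ({1<..} Un {..<?a}) ?w''"
 proof (rule continuous_on_open_Un)
  have "cts {1<..} (%r. cutoff n r *R v'' r + (2 * cut1 n r) *R v' r + cut2 n r *R v r)"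
   by (intro continuous_intros v(3) cv continuous_on_subset[OF c1(1)] continuous_on_subset[OF c1(2)] continuous_on_subset[OF cut_derivatives(3)]) auto
  thus "cts {1<..} ?w''" by (rule continuous_on_eq) auto
  show "cts {..<?a} ?w''"
   by (rule continuous_on_eq[OF continuous_on_const[of _ 0]]) (use low in "auto simp del: of_nat_Suc")
 qed auto
 moreover have "{1<..} Un {..<?a} = UNIV" using le_less_trans[OF _ a] by (auto simp del: of_nat_Suc simp: not_less)
 ultimately show "cts UNIV ?w''" by simp
 show "?w r = 0" if "r ~: {?a..?b}" for r
  using cutoff_eq_0[of r n] that by (auto simp del: of_nat_Suc)
qed

lemma L2_const_interval: "(%r::real. c * indicator {a..b} r :: real) : L2 HL"
proof -
 have m: "zx (%r. c * indicator {a..b} r) : bm"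
  unfolding zext_def by measurable
 have i: "integrable lborel (%r. indicator {a..b} r :: real)"
  by (rule integrable_real_indicator) (auto simp: emeasure_lborel_Icc_eq)
 have "integrable lborel (%r. (norm (zx (%r. c * indicator {a..b} r) r))^2)"
  by (rule Bochner_Integration.integrable_bound[of _ "%r. c^2 * indicator {a..b} r"])
    (use i m in "auto simp: zext_def indicator_def")
 thus ?thesis unfolding L2_iff using m by (auto simp: borel_lebesgue_1d)
qed

lemma L2_mult_const: "f : L2 U ==> (%x. c * f x) : L2 U" for f :: "'a::euclidean_space => real"
 by (rule L2_linear[OF bounded_linear_mult_right])

text \<open>The condition on \<open>v\<close> near \<open>1\<close> encodes the Dirichlet condition.\<close>

lemma H10_grad_emb:
 fixes v v' v'' :: "real => complex"
 assumes v: "!!r. r > 1 ==> (v hvd v' r) (at r)" "!!r. r > 1 ==> (v' hvd v'' r) (at r)"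
  "cts HL v''" and L: "v : L2 HL" "v' : L2 HL"
  and bd: "!!r. 1 < r ==> r <= 3 ==> norm (v r) <= C * (r - 1)"
 shows "H10_grad Omega (emb v) (egrad v v')"
proof -
 define w w' where "w n r = (if r > 1 then cutoff n r *R v r else 0)" and
  "w' n r = (if r > 1 then cutoff n r *R v' r + cut1 n r *R v r else 0)" for n r
 note P = C2_profile_cutoff[OF v, folded w_def w'_def]
 have cv: "cts HL v" "cts HL v'"
  using v by (auto intro!: continuous_at_imp_continuous_on has_vector_derivative_continuous)
 obtain B where B: "B >= 0" "!!n r. \<bar>cut1 n r\<bar> <= B * real (Suc n)"
   "!!n r. r > 1 + 2 / real (Suc n) ==> \<bar>cut1 n r\<bar> <= B / real (Suc n)" using cut_bounds by blast
 have C: "C >= 0" using order_trans[OF norm_ge_zero bd[of 2]] by simp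
 have ev1: "\<forall>\<^sub>F n in sequentially. cutoff n r = 1 & cut1 n r = 0" if r: "r > 1" for r
 proof -
  have "(%n. 1 + 2 * inverse (real (Suc n))) ---> 1 + 2 * 0"
   by (intro tendsto_intros LIMSEQ_inverse_real_of_nat)
  hence "\<forall>\<^sub>F n in sequentially. 1 + 2 * inverse (real (Suc n)) < r"
   using r by (auto dest: order_tendstoD)
  moreover have "\<forall>\<^sub>F n in sequentially. r < real (Suc n)"
  proof -
   obtain M :: nat where "r <= real M" using real_arch_simple by blast
   thus ?thesis by (intro eventually_sequentiallyI[of M]) auto
  qed
  ultimately show ?thesis
  proof eventually_elim
   case (elim n)
   thus ?case by (intro conjI cutoff_eq_1 cut_derivatives(6)) (auto simp: divide_inverse simp del: of_nat_Suc)
  qed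
 qed
 show ?thesis
 proof (rule H10_grad_emb_closed[where V=w and V'=w'])
  show "zx v : bm" "zx v' : bm"
   by (intro borel_zext_continuous cv)+
  show "zx (w n) : bm" "zx (w' n) : bm"
   "w n : L2 HL" "w' n : L2 HL" "H10_grad Omega (emb (w n)) (egrad (w n) (w' n))" for n
   using C2_profile.borel[OF P] C2_profile.L2[OF P] C2_profile.H10_grad_emb[OF P] by auto
  show "(%n. l2norm HL (%r. w n r - v r)) ---> 0"
  proof (rule l2norm_dominated_convergence[where W="%r. norm (v r)"])
   show "(%r. w n r - v r) : L2 HL" for n by (intro L2_diff C2_profile.L2(1)[OF P] L)
   show "(%r. norm (v r)) : L2 HL" by (rule L2_norm[OF L(1)])
   show "norm (w n r - v r) <= norm (v r)" if "r : HL" for n r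
   proof -
    have "w n r - v r = (cutoff n r - 1) *R v r" using that by (simp add: w_def scaleR_diff_left)
    thus ?thesis using cutoff_bounds[of n r] by (simp add: mult_left_le_one_le)
   qed
   show "AE r in leb. r : HL --> (%n. w n r - v r) ---> 0"
   proof (intro AE_I2 impI tendsto_eventually)
    fix r :: real assume r: "r : HL"
    thus "\<forall>\<^sub>F n in sequentially. w n r - v r = 0"
     using ev1[of r] by (auto elim!: eventually_mono simp: w_def)
   qed
  qed
  show "(%n. l2norm HL (%r. w' n r - v' r)) ---> 0"
  \<comment> \<open>In the boundary layer the factor \<open>B * (n + 1)\<close> from
    \<open>cut1\<close> meets \<open>norm (v r) <= 2 * C / (n + 1)\<close>; the product is at most
    \<open>2 * B * C\<close>, and all layers lie in \<open>{1..3}\<close>.\<close>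
  proof (rule l2norm_dominated_convergence[where W="%r. norm (v' r) + (B * norm (v r) + (2 * B * C) * indicator {1..3} r)"])
   show "(%r. w' n r - v' r) : L2 HL" for n by (intro L2_diff C2_profile.L2(2)[OF P] L)
   show "(%r. norm (v' r) + (B * norm (v r) + (2 * B * C) * indicator {1..3} r)) : L2 HL"
    by (intro L2_add L2_norm L L2_mult_const L2_const_interval)
   show "norm (w' n r - v' r) <= norm (v' r) + (B * norm (v r) + (2 * B * C) * indicator {1..3} r)" if "r : HL" for n r
   proof -
    have r: "r > 1" using that by simp
    have eq: "w' n r - v' r = (cutoff n r - 1) *R v' r + cut1 n r *R v r" using that by (simp add: w'_def scaleR_diff_left)
    have 1: "norm ((cutoff n r - 1) *R v' r) <= norm (v' r)" using cutoff_bounds[of n r] by (simp add: mult_left_le_one_le)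
    have 2: "norm (cut1 n r *R v r) <= B * norm (v r) + (2 * B * C) * indicator {1..3} r"
    proof (cases "r > 1 + 2 / real (Suc n)")
     case True
     have "B / real (Suc n) <= B / 1" using B(1) by (intro divide_left_mono) auto
     hence "\<bar>cut1 n r\<bar> <= B" using B(3)[OF True] by simp
     hence "norm (cut1 n r *R v r) <= B * norm (v r)" by (simp add: mult_right_mono)
     moreover have "(2 * B * C) * indicator {1..3} r >= 0" using B C by simp
     ultimately show ?thesis by linarith
    next
     case False
     have le: "2 / real (Suc n) <= 2 / 1" by (intro divide_left_mono) auto
     hence r3: "r <= 3" using False by simp
     have "norm (cut1 n r *R v r) <= (B * real (Suc n)) * (C * (r - 1))"
      unfolding norm_scaleR using B C r by (intro mult_mono B(2) bd r3) auto
     also have "... <= (B * real (Suc n)) * (C * (2 / real (Suc n)))"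
      using False B C by (intro mult_left_mono) auto
     also have "... = 2 * B * C" by (simp del: of_nat_Suc)
     finally show ?thesis using r r3 B by (simp add: add_increasing)
    qed
    show ?thesis unfolding eq using norm_triangle_ineq[of "(cutoff n r - 1) *R v' r" "cut1 n r *R v r"] 1 2 by linarith
   qed
   show "AE r in leb. r : HL --> (%n. w' n r - v' r) ---> 0"
   proof (intro AE_I2 impI tendsto_eventually)
    fix r :: real assume r: "r : HL"
    thus "\<forall>\<^sub>F n in sequentially. w' n r - v' r = 0"
     using ev1[of r] by (auto elim!: eventually_mono simp: w'_def)
   qed
  qed
 qed (rule L)+
qed

section \<open>Weighted fixed points and improper integrals\<close>

definition wbounded :: "(real => real) => (real => complex) => bool" where
 "wbounded rh u \<longleftrightarrow> cts {1..} u & (EX A. ALL t>=1. norm (u t) <= A * rh t)"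

lemma wbounded_diff:
 assumes "wbounded rh u" "wbounded rh v"
 shows "wbounded rh (%t. u t - v t)"
proof -
 obtain A B where "ALL t>=1. norm (u t) <= A * rh t" "ALL t>=1. norm (v t) <= B * rh t"
  using assms by (auto simp: wbounded_def)
 hence "norm (u t - v t) <= (A + B) * rh t" if "t >= 1" for t
  using norm_triangle_ineq4[of "u t" "v t"] that by (fastforce simp: distrib_right)
 thus ?thesis using assms by (auto simp: wbounded_def intro: continuous_on_diff)
qed

text \<open>The best constant \<open>S\<close> is finite by \<open>wbounded\<close> and satisfies
  \<open>S <= S / 2 + dl\<close>. With \<open>dl = 0\<close> this is uniqueness for a contraction,
  otherwise an a priori bound.\<close>

lemma weighted_bound:
 assumes u: "wbounded rh u" and rh: "!!t. t >= 1 ==> rh t > 0"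
  and imp: "!!A. A >= 0 ==> (!!t. t >= 1 ==> norm (u t) <= A * rh t) ==> (!!t. t >= 1 ==> norm (u t) <= (A / 2 + dl) * rh t)"
  and t: "t >= 1"
 shows "norm (u t) <= 2 * dl * rh t"
proof -
 define S where "S = (SUP t\<in>{1..}. norm (u t) / rh t)"
 obtain A where A: "!!t. t >= 1 ==> norm (u t) <= A * rh t" using u by (auto simp: wbounded_def)
 have bd: "bdd_above ((%t. norm (u t) / rh t) ` {1..})"
  using A rh by (intro bdd_aboveI[of _ A]) (auto simp: pos_divide_le_eq)
 have le: "norm (u t) <= S * rh t" if "t >= 1" for t
 proof -
  have "norm (u t) / rh t <= S" unfolding S_def by (rule cSUP_upper[OF _ bd]) (use that in auto)
  thus ?thesis using rh[OF that] by (simp add: pos_divide_le_eq)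
 qed
 have S0: "S >= 0"
 proof -
  have "0 <= S * rh 1" using le[of 1] norm_ge_zero[of "u 1"] by linarith
  thus ?thesis using rh[of 1] by (simp add: zero_le_mult_iff)
 qed
 have "S <= S / 2 + dl"
  unfolding S_def by (rule cSUP_least) (use imp[OF S0 le] rh in "auto simp: pos_divide_le_eq S_def[symmetric]")
 hence "S <= 2 * dl" by simp
 hence "S * rh t <= 2 * dl * rh t" using rh[OF t] by (intro mult_right_mono) auto
 thus ?thesis using le[OF t] by linarith
qed

text \<open>Banach's theorem in the space of bounded continuous functions, to which the weighted
  functions are carried over by dividing by \<open>rh\<close>. Evaluating at \<open>max 1 t\<close>
  turns a function on the half line into one on the whole line.\<close>

lemma weighted_fixpoint:
 fixes T :: "(real => complex) => (real => complex)"
 assumes rh: "cts {1..} rh" "!!t. t >= 1 ==> rh t > 0"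
  and T: "!!u. wbounded rh u ==> wbounded rh (T u)"
  and loc: "!!u v t. (!!t. t >= 1 ==> u t = v t) ==> t >= 1 ==> T u t = T v t"
  and contr: "!!u v A t. wbounded rh u ==> wbounded rh v ==> A >= 0 ==> (!!t. t >= 1 ==> norm (u t - v t) <= A * rh t) ==>
    t >= 1 ==> norm (T u t - T v t) <= (A / 2) * rh t"
 obtains u where "wbounded rh u" "!!t. t >= 1 ==> T u t = u t"
proof -
 define E where "E w = (%t. rh t *R apply_bcontfun w (t::real))" for w :: "real \<Rightarrow>\<^sub>C complex"
 have E: "wbounded rh (E w)" for w
 proof -
  obtain B where B: "!!t. norm (apply_bcontfun w t) <= B"
   using apply_bcontfun[of w] by (auto simp: bcontfun_def bounded_iff)
  have "norm (E w t) <= B * rh t" if "t >= 1" for t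
   using mult_right_mono[OF B[of t], of "rh t"] rh(2)[OF that] by (simp add: E_def mult.commute)
  thus ?thesis using rh(1) by (auto simp: wbounded_def E_def intro!: continuous_intros)
 qed
 define Ph0 where "Ph0 u = (%t::real. T u (max 1 t) /\<^sub>R rh (max 1 t))" for u
 have Ph0: "Ph0 u : bcontfun" if wu: "wbounded rh u" for u
 proof -
  obtain A where A: "cts {1..} (T u)" "!!t. t >= 1 ==> norm (T u t) <= A * rh t"
   using T[OF wu] by (auto simp: wbounded_def)
  have nz: "rh (max 1 t) ~= 0" for t using rh(2)[of "max 1 t"] by auto
  have "cts UNIV (Ph0 u)"
   unfolding Ph0_def
   by (intro continuous_on_scaleR continuous_on_inverse continuous_on_compose2[OF A(1)] continuous_on_compose2[OF rh(1)])
     (auto intro!: continuous_intros simp: nz)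
  moreover have "norm (Ph0 u t) <= A" for t
   using A(2)[of "max 1 t"] rh(2)[of "max 1 t"] by (simp add: Ph0_def pos_divide_le_eq divide_inverse_commute[symmetric])
  ultimately show ?thesis by (rule bcontfun_normI)
 qed
 define Ph where "Ph w = Bcontfun (Ph0 (E w))" for w
 have Ph: "apply_bcontfun (Ph w) = Ph0 (E w)" for w
  unfolding Ph_def by (rule Bcontfun_inverse[OF Ph0[OF E]])
 have "dist (Ph w) (Ph z) <= (1/2) * dist w z" for w z
 proof (rule dist_bound)
  fix t :: real
  define s where "s = max 1 t"
  have s: "s >= 1" by (simp add: s_def)
  have "norm (E w t - E z t) <= dist w z * rh t" if "t >= 1" for t
   using mult_right_mono[OF dist_bounded[of w t z], of "rh t"] rh(2)[OF that]
   by (simp add: E_def dist_norm mult.commute flip: scaleR_diff_right)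
  hence "norm (T (E w) s - T (E z) s) <= dist w z / 2 * rh s"
   by (intro contr E s) auto
  hence "norm (T (E w) s - T (E z) s) / rh s <= dist w z / 2"
   using rh(2)[OF s] by (simp add: pos_divide_le_eq)
  moreover have "norm (T (E w) s /\<^sub>R rh s - T (E z) s /\<^sub>R rh s) = norm (T (E w) s - T (E z) s) / rh s"
   using rh(2)[OF s] unfolding scaleR_diff_right[symmetric] norm_scaleR by (simp add: divide_inverse mult.commute)
  ultimately show "dist (apply_bcontfun (Ph w) t) (apply_bcontfun (Ph z) t) <= 1/2 * dist w z"
   unfolding Ph Ph0_def s_def[symmetric] dist_norm by linarith
 qed
 hence "EX! w. Ph w = w" by (intro banach_fix_type[of "1/2"]) auto
 then obtain w where w: "Ph w = w" by blast
 show ?thesis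
 proof (rule that[OF E[of w]])
  fix t :: real assume t: "t >= 1"
  have "apply_bcontfun w t = Ph0 (E w) t" using Ph[of w] w by simp
  thus "T (E w) t = E w t" using t rh(2)[OF t] by (simp add: E_def Ph0_def max_def)
 qed
qed

lemma continuous_on_HLI:
 fixes f :: "real => 'b::topological_space"
 assumes "!!R. cts {a..R} f"
 shows "cts {a..} f"
 unfolding continuous_on_eq_continuous_within
proof
 fix r assume r: "r : {a..}"
 have "continuous (at r within {a..r+1}) f"
  using assms[of "r + 1"] r by (simp add: continuous_on_eq_continuous_within)
 moreover have "at r within {a..r+1} = at r within {a..}"
  by (rule at_within_nhd[of _ "{..<r+1}"]) auto
 ultimately show "continuous (at r within {a..}) f" by simp
qed

text \<open>The majorant comes with a primitive, so that its tail is evaluated exactly; the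
  contraction estimates depend on these exact values.\<close>

lemma tail_integral:
 fixes F :: "real => complex" and G g :: "real => real"
 assumes F: "cts {1..} F" and g: "g : bm"
  and r: "r >= 1" and le: "!!t. t >= r ==> norm (F t) <= g t" and G: "!!t. t >= r ==> (G hrd g t) (at t)"
  and lim: "(G ~~> L) at_top"
 shows "set_integrable lborel {r..} F" "norm (LINT t:{r..}|lborel. F t) <= L - G r"
proof -
 have g0: "g t >= 0" if "t >= r" for t using order_trans[OF norm_ge_zero le[OF that]] .
 have nn: "(\<integral>\<^sup>+t. ennreal (g t) * indicator {r..} t \<partial>lborel) = ennreal (L - G r)"
  by (rule nn_integral_FTC_atLeast[OF g G g0 lim])
 have Fm: "(%t. indicator {r..} t *R F t) : bm"
  by (rule borel_measurable_continuous_on_indicator) (use r in "auto intro: continuous_on_subset[OF F]")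
 have gm: "(%t. indicator {r..} t * g t) : bm" using g by measurable
 have mono: "G r <= G t" if "t >= r" for t
  using DERIV_nonneg_imp_nondecreasing[OF that, of G] G g0 by fastforce
 have LG: "G r <= L"
  by (rule tendsto_lowerbound[OF lim]) (auto simp: eventually_at_top_linorder mono intro!: exI[of _ r])
 have nn': "(\<integral>\<^sup>+t. ennreal (indicator {r..} t * g t) \<partial>lborel) = ennreal (L - G r)"
  unfolding nn[symmetric] by (intro nn_integral_cong) (auto simp: indicator_def)
 have gi: "integrable lborel (%t. indicator {r..} t * g t)"
  by (rule integrableI_nonneg) (use gm nn' g0 in "auto simp: indicator_def")
 have gI: "(LINT t|lborel. indicator {r..} t * g t) = L - G r"
  by (rule integral_eq_nn_integral[THEN trans]) (use gm g0 nn' LG in "auto simp: indicator_def")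
 have bound: "norm (indicator {r..} t *R F t) <= indicator {r..} t * g t" for t
  using le[of t] by (auto simp: indicator_def)
 show i: "set_integrable lborel {r..} F"
  unfolding set_integrable_def
  by (rule Bochner_Integration.integrable_bound[OF gi]) (use Fm order_trans[OF bound abs_ge_self] in "auto intro!: AE_I2")
 have "norm (LINT t:{r..}|lborel. F t) <= (LINT t|lborel. norm (indicator {r..} t *R F t))"
  unfolding set_lebesgue_integral_def by (rule integral_norm_bound)
 also have "... <= (LINT t|lborel. indicator {r..} t * g t)"
  by (rule integral_mono[OF integrable_norm[OF i[unfolded set_integrable_def]] gi bound])
 finally show "norm (LINT t:{r..}|lborel. F t) <= L - G r" using gI by simp
qed

lemma tail_integral_FTC:
 fixes F :: "real => complex"
 assumes F: "cts {1..} F" and i: "set_integrable lborel {1..} F"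
 shows "cts {1..} (%r. LINT t:{r..}|lborel. F t)"
  "r > 1 ==> ((%r. LINT t:{r..}|lborel. F t) hvd - F r) (at r)"
proof -
 have split: "(LINT t:{r..}|lborel. F t) = (LINT t:{1..}|lborel. F t) - integral {1..r} F" if "r >= 1" for r
 proof -
  have i1: "set_integrable lborel {1..r} F" by (rule set_integrable_subset[OF i]) auto
  have i2: "set_integrable lborel {r..} F" by (rule set_integrable_subset[OF i]) (use that in auto)
  have "(LINT t:{1..r}|lborel. F t) = integral {1..r} F"
   by (rule set_borel_integral_eq_integral(2)[OF i1])
  moreover have "(LINT t:{1..}|lborel. F t) = (LINT t:{1..r} Un {r..}|lborel. F t)"
   using that by (intro arg_cong2[where f="%A f. set_lebesgue_integral lborel A f"]) auto
  moreover have "(LINT t:{1..r} Un {r..}|lborel. F t) = (LINT t:{1..r}|lborel. F t) + (LINT t:{r..}|lborel. F t)"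
  proof (rule set_integral_Un_AE[OF _ _ _ i1 i2])
   have "AE t in lborel. t ~= r" by (rule AE_lborel_singleton)
   thus "AE t in lborel. ~ (t : {1..r} & t : {r..})" by eventually_elim auto
  qed auto
  ultimately show ?thesis by simp
 qed
 have d: "((%u. integral {1..u} F) hvd F r) (at r within {1..R})" if "r : {1..R}" for r R
  by (rule integral_has_vector_derivative[OF _ that]) (auto intro: continuous_on_subset[OF F])
 have dt: "((%r. (LINT t:{1..}|lborel. F t) - integral {1..r} F) hvd - F r) (at r within {1..R})" if "r : {1..R}" for r R
  using has_vector_derivative_diff[OF has_vector_derivative_const d[OF that]] by simp
 show "((%r. LINT t:{r..}|lborel. F t) hvd - F r) (at r)" if "r > 1" for r
 proof -
  have "((%r. (LINT t:{1..}|lborel. F t) - integral {1..r} F) hvd - F r) (at r)"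
   using dt[of r "r + 1"] that at_within_interior[of r "{1..r+1}"] by simp
  thus ?thesis
   by (rule has_vector_derivative_transform_within_open[of _ _ _ "{1<..}"]) (use that in "auto intro!: split[symmetric]")
 qed
 have "cts {1..R} (%r. LINT t:{r..}|lborel. F t)" for R
 proof (rule continuous_on_eq)
  show "cts {1..R} (%r. (LINT t:{1..}|lborel. F t) - integral {1..r} F)"
   unfolding continuous_on_eq_continuous_within
   by (intro ballI has_vector_derivative_continuous[OF dt])
 qed (rule split[symmetric], simp)
 thus "cts {1..} (%r. LINT t:{r..}|lborel. F t)"
  by (rule continuous_on_HLI)
qed

section \<open>The radial equation\<close>

lemma norm_square_has_derivative:
 fixes f :: "real => complex"
 assumes "(f hvd f') (at x)"
 shows "((%x. (norm (f x))^2) hrd 2 * (f x \<bullet> f')) (at x)"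
proof -
 have "((%x. f x \<bullet> f x) has_derivative (%h. f x \<bullet> (h *R f') + (h *R f') \<bullet> f x)) (at x)"
  using assms unfolding has_vector_derivative_def by (intro has_derivative_inner)
 moreover have "(%h. f x \<bullet> (h *R f') + (h *R f') \<bullet> f x) = (*) (2 * (f x \<bullet> f'))"
  by (auto simp: inner_commute)
 ultimately show ?thesis by (simp add: has_field_derivative_def power2_norm_eq_inner)
qed

text \<open>Gronwall's inequality in differential form, with \<open>exp (- w)\<close> as integrating
  factor. Applied to \<open>- E\<close> and \<open>- w\<close> it runs backwards.\<close>

lemma energy_monotone:
 fixes E w :: "real => real"
 assumes "a <= x" "x <= y" "y <= b" "cts {a..b} E" "cts {a..b} w"
  "!!r. a < r ==> r < b ==> (E hrd E' r) (at r)" "!!r. a < r ==> r < b ==> (w hrd w' r) (at r)"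
  "!!r. a < r ==> r < b ==> E' r <= w' r * E r"
 shows "E y * exp (- w y) <= E x * exp (- w x)"
proof (cases "x = y")
 case False
 hence "x < y" using assms by simp
 thus ?thesis
 proof (rule DERIV_nonpos_imp_decreasing_open[OF less_imp_le])
  fix r assume r: "x < r" "r < y"
  hence r': "a < r" "r < b" using assms by auto
  have "((%r. E r * exp (- w r)) hrd E' r * exp (- w r) - w' r * E r * exp (- w r)) (at r)"
   by (auto intro!: derivative_eq_intros assms(6,7) r')
  moreover have "E' r * exp (- w r) - w' r * E r * exp (- w r) <= 0"
   using mult_right_mono[OF assms(8)[OF r'], of "exp (- w r)"] by simp
  ultimately show "EX d. ((%r. E r * exp (- w r)) hrd d) (at r) & d <= 0" by blast
 next
  show "cts {x..y} (%r. E r * exp (- w r))"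
   using assms by (intro continuous_intros continuous_on_subset[OF assms(4)] continuous_on_subset[OF assms(5)]) auto
 qed
qed auto

text \<open>Gronwall for the energy \<open>|v|^2 + |v'|^2\<close>, forwards and backwards from
  \<open>r0\<close>. Derivatives are taken in the open interval only, so that data may be prescribed
  at an end point.\<close>

lemma linear_ode_unique:
 fixes v v' :: "real => complex" and c :: "real => complex"
 assumes cont: "cts {a..b} v" "cts {a..b} v'"
  and d: "!!r. a < r ==> r < b ==> (v hvd v' r) (at r)"
   "!!r. a < r ==> r < b ==> (v' hvd c r * v r) (at r)"
  and c: "!!r. a < r ==> r < b ==> norm (c r) <= B"
  and z: "r0 : {a..b}" "v r0 = 0" "v' r0 = 0" and r: "r : {a..b}"
 shows "v r = 0" "v' r = 0"
proof -
 define E where "E r = (norm (v r))^2 + (norm (v' r))^2" for r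
 define E' where "E' r = 2 * (v r \<bullet> v' r) + 2 * (v' r \<bullet> (c r * v r))" for r
 have contE: "cts {a..b} E" unfolding E_def by (intro continuous_intros cont)
 have dE: "(E hrd E' r) (at r)" if "a < r" "r < b" for r
  unfolding E_def[abs_def] E'_def using that by (intro DERIV_add norm_square_has_derivative d)
 have bd: "\<bar>E' r\<bar> <= (1 + B) * E r" if "a < r" "r < b" for r
 proof -
  have "\<bar>v r \<bullet> v' r\<bar> <= norm (v r) * norm (v' r)" by (rule Cauchy_Schwarz_ineq2)
  moreover have "\<bar>v' r \<bullet> (c r * v r)\<bar> <= B * (norm (v r) * norm (v' r))"
  proof -
   have "\<bar>v' r \<bullet> (c r * v r)\<bar> <= norm (v' r) * (norm (c r) * norm (v r))"
    using Cauchy_Schwarz_ineq2[of "v' r" "c r * v r"] by (simp add: norm_mult)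
   also have "... <= norm (v' r) * (B * norm (v r))" by (intro mult_left_mono mult_right_mono c that) auto
   finally show ?thesis by (simp add: mult_ac)
  qed
  ultimately have "\<bar>E' r\<bar> <= 2 * (norm (v r) * norm (v' r)) + 2 * (B * (norm (v r) * norm (v' r)))"
   unfolding E'_def by linarith
  also have "... = (1 + B) * (2 * (norm (v r) * norm (v' r)))" by (simp add: algebra_simps)
  also have "... <= (1 + B) * E r"
  proof (intro mult_left_mono)
   show "2 * (norm (v r) * norm (v' r)) <= E r"
    using sum_squares_bound[of "norm (v r)" "norm (v' r)"] by (simp add: E_def)
   show "0 <= 1 + B" using order_trans[OF norm_ge_zero c[OF that]] by simp
  qed
  finally show ?thesis .
 qed
 have E0: "E r0 = 0" using z by (simp add: E_def)
 have "E r <= 0"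
 proof (cases "r0 <= r")
  case True
  have "E r * exp (- ((1 + B) * r)) <= E r0 * exp (- ((1 + B) * r0))"
  proof (rule energy_monotone[of a r0 r b E _ E' "%_. 1 + B"])
   show "E' r <= (1 + B) * E r" if "a < r" "r < b" for r using bd[OF that] by linarith
  qed (use True z r dE contE in "auto intro!: continuous_intros derivative_eq_intros")
  hence "E r * exp (- ((1 + B) * r)) <= 0" using E0 by simp
  thus ?thesis by (simp add: mult_le_0_iff)
 next
  case False
  have "(- E r0) * exp (- (- ((1 + B) * r0))) <= (- E r) * exp (- (- ((1 + B) * r)))"
  proof (rule energy_monotone[of a r r0 b "%r. - E r" _ "%r. - E' r" "%_. - (1 + B)"])
   show "- E' r <= - (1 + B) * - E r" if "a < r" "r < b" for r using bd[OF that] by linarith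
  qed (use False z r dE contE in "auto intro!: continuous_intros derivative_eq_intros DERIV_minus")
  hence "E r * exp ((1 + B) * r) <= 0" using E0 by simp
  thus ?thesis by (simp add: mult_le_0_iff)
 qed
 hence "(norm (v r))^2 + (norm (v' r))^2 <= 0" by (simp add: E_def)
 hence "(norm (v r))^2 = 0 & (norm (v' r))^2 = 0" by (simp add: sum_power2_le_zero_iff)
 thus "v r = 0" "v' r = 0" by simp_all
qed

lemma HL_constant:
 fixes f :: "real => complex"
 assumes "cts {1..} f" "!!r. r > 1 ==> (f hvd 0) (at r)" "r >= 1"
 shows "f r = f 1"
proof (cases "r = 1")
 case False
 have "f r = f 1"
 proof (rule has_derivative_zero_unique_strong_interval[of "{1, r}" 1 r f])
  show "cts {1..r} f" using assms(1) by (rule continuous_on_subset) auto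
  show "(f has_derivative (%h. 0)) (at x within {1..r})" if "x : {1..r} - {1, r}" for x
   using assms(2)[of x] that by (auto simp: has_vector_derivative_def intro: has_derivative_at_withinI)
 qed (use assms in auto)
 thus ?thesis .
qed simp

text \<open>The sixth power is what \<open>m >= 3\<close> provides. The lower bound on
  \<open>M\<close> makes the integral operator \<open>jT\<close> a contraction with factor
  \<open>1/2\<close> in the weight \<open>wt\<close>.\<close>

locale potential =
 fixes V :: "real => real" and M :: real
 assumes contV: "cts {1..} V" and V_le: "!!t. t >= 1 ==> \<bar>V t\<bar> <= M / t ^ 6" and M2: "M >= 2"
begin

lemma V_bound: "t >= 1 ==> \<bar>V t\<bar> <= M"
proof -
 assume t: "t >= 1"
 have "M / t ^ 6 <= M / 1" using t M2 by (intro divide_left_mono) (auto simp: one_le_power)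
 thus ?thesis using V_le[OF t] by simp
qed

text \<open>The equation \<open>- v'' - V * v = - ka^2 * v\<close>. Note the sign: \<open>V\<close>
  is the negative of the potential of the operator, hence nonnegative in the application.\<close>

definition solution :: "complex => (real => complex) => (real => complex) => bool" where
 "solution ka v v' \<longleftrightarrow> cts {1..} v & cts {1..} v' &
   (ALL r>1. (v hvd v' r) (at r) & (v' hvd (ka^2 - V r) * v r) (at r))"

lemma solution_unique:
 assumes "solution ka v v'" "r0 >= 1" "v r0 = 0" "v' r0 = 0" "r >= 1"
 shows "v r = 0" "v' r = 0"
proof -
 define b where "b = max r r0 + 1"
 have *: "cts {1..b} v" "cts {1..b} v'"
  using assms(1) by (auto simp: solution_def intro: continuous_on_subset)
 have c: "norm (ka^2 - V r) <= norm (ka^2) + M" if "1 < r" "r < b" for r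
  using norm_triangle_ineq4[of "ka^2" "cx (V r)"] V_bound[of r] that by simp
 show "v r = 0" "v' r = 0"
  using linear_ode_unique[where v=v and v'=v' and ?r0.0=r0 and r=r and c="%r. ka^2 - V r" and B="norm (ka^2) + M", OF * _ _ c] assms
  by (auto simp: solution_def b_def)
qed

lemma solution_wronskian:
 assumes "solution ka v v'" "solution ka w w'" "r >= 1"
 shows "v r * w' r - v' r * w r = v 1 * w' 1 - v' 1 * w 1"
proof (rule HL_constant[OF _ _ assms(3)])
 show "cts {1..} (%r. v r * w' r - v' r * w r)"
  using assms by (auto simp: solution_def intro!: continuous_intros)
 show "((%r. v r * w' r - v' r * w r) hvd 0) (at r)" if "r > 1" for r
 proof -
  have "((%r. v r * w' r - v' r * w r) has_vector_derivative
    (v r * ((ka^2 - V r) * w r) + v' r * w' r) - (v' r * w' r + ((ka^2 - V r) * v r) * w r)) (at r)"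
   using assms that by (intro has_vector_derivative_diff has_vector_derivative_mult) (auto simp: solution_def)
  thus ?thesis by (simp add: algebra_simps)
 qed
qed

text \<open>Variation of constants turns the equation for \<open>n = exp (- ka r) d\<close> into a Volterra equation
 whose kernel is bounded by \<open>\<bar>V\<bar> / \<bar>ka\<bar>\<close>; the weight makes it a contraction.\<close>

lemma solution_exists:
 fixes ka a b :: complex
 assumes ka: "Re ka > 0"
 obtains d d' B where "solution ka d d'" "d 1 = a" "d' 1 = b"
  "!!r. r >= 1 ==> norm (d r) <= B * exp (Re ka * r)" "!!r. r >= 1 ==> norm (d' r) <= B * exp (Re ka * r)"
proof -
 have k0: "ka ~= 0" "norm ka > 0" using ka by auto
 \<comment> \<open>The derivative of \<open>rh\<close> is \<open>K / t^2 * rh t\<close>, so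
   integrating \<open>M / t^2 * rh t\<close> costs the factor \<open>M / K = norm ka / 2\<close>.
   The two integrals in \<open>S\<close> are divided by \<open>2 * ka\<close>, which leaves the
   contraction factor \<open>1/2\<close>.\<close>
 define K where "K = 2 * M / norm ka"
 have K: "K > 0" "M / K = norm ka / 2" using k0 M2 by (auto simp: K_def)
 define rh where "rh t = exp (- (K / t))" for t :: real
 have rh: "rh t > 0" "t >= 1 ==> exp (- K) <= rh t" "t >= 1 ==> rh t <= 1" for t
  using K(1) divide_left_mono[of 1 t K] by (auto simp: rh_def)
 define E Ei where "E t = exp (ka * cx t)" and "Ei t = exp (- ka * cx t)" for t
 have EE: "E t * Ei t = 1" "norm (E t) = exp (Re ka * t)" "norm (Ei t) = exp (- (Re ka * t))" for t
  by (simp_all add: E_def Ei_def exp_add[symmetric])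
 have Ei1: "norm (Ei t) <= 1" if "t >= 1" for t using ka that by (simp add: EE)
 have dE: "(E hvd ka * E t) (at t)" "(Ei hvd - ka * Ei t) (at t)" for t
  unfolding E_def[abs_def] Ei_def[abs_def]
  by (rule has_vector_derivative_eq_rhs, rule has_vector_derivative_real_field, (auto intro!: derivative_eq_intros)[2])+
 have cE: "cts S E" "cts S Ei" for S unfolding E_def[abs_def] Ei_def[abs_def] by (intro continuous_intros)+
 define P where "P u r = integral {1..r} (%t. V t * u t)" for u :: "real => complex" and r
 define Q where "Q u r = integral {1..r} (%t. (E t)^2 * (V t * u t))" for u :: "real => complex" and r
 \<comment> \<open>The coefficients of the two exponentials, after division by \<open>E\<close>, in
   the free solution with data \<open>a\<close> and \<open>b\<close> at \<open>1\<close>.\<close>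
 define A0 where "A0 = (a + b / ka) * Ei 1 / 2"
 define B0 where "B0 = (a - b / ka) * E 1 / 2"
 define S where "S u r = (P u r - (Ei r)\<^sup>2 * Q u r) / (2 * ka)" for u r
 define T where "T u r = A0 + B0 * (Ei r)^2 - S u r" for u r
 have cu: "cts {1..} (%t. V t * u t)" "cts {1..} (%t. (E t)^2 * (V t * u t))" if "cts {1..} u" for u :: "real => complex"
  by (intro continuous_intros contV cE that)+
 have FTC: "((%r. integral {1..r} f) hvd f r) (at r)" if "cts {1..} f" "r > 1" for f :: "real => complex" and r
  using integral_has_vector_derivative[OF continuous_on_subset[OF that(1)], of 1 "r + 1" r] that at_within_interior[of r "{1..r+1}"]
  by auto
 have contI: "cts {1..} (%r. integral {1..r} f)" if "cts {1..} f" for f :: "real => complex"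
 proof (rule continuous_on_HLI)
  show "cts {1..R} (%r. integral {1..r} f)" for R
   by (rule indefinite_integral_continuous_1) (auto intro!: integrable_continuous_real continuous_on_subset[OF that])
 qed
 have ci: "f integrable_on {1..s}" if "cts {1..} f" for f :: "real => complex" and s
  by (intro integrable_continuous_real continuous_on_subset[OF that]) auto
 have int: "norm (integral {1..r} F) <= A * (norm ka / 2) * rh r"
  if "cts {1..} F" "!!t. 1 <= t ==> t <= r ==> norm (F t) <= \<bar>V t\<bar> * (A * rh t)" "r >= 1" "A >= 0" for F :: "real => complex" and A r
 proof -
  have g: "((%t. M / t^2 * (A * rh t)) has_integral (A * (M / K) * rh r - A * (M / K) * rh 1)) {1..r}"
  proof (rule fundamental_theorem_of_calculus[OF that(3)])
   fix t assume "t : {1..r}"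
   hence "((%t. A * (M / K) * rh t) hrd M / t^2 * (A * rh t)) (at t within {1..r})"
    unfolding rh_def using K(1) by (auto intro!: derivative_eq_intros simp: power2_eq_square)
   thus "((%t. A * (M / K) * rh t) hvd M / t^2 * (A * rh t)) (at t within {1..r})"
    by (simp add: has_real_derivative_iff_has_vector_derivative)
  qed
  have "norm (integral {1..r} F) <= integral {1..r} (%t. M / t^2 * (A * rh t))"
  proof (rule integral_norm_bound_integral[OF ci[OF that(1)] has_integral_integrable[OF g]])
   fix t assume t: "t : {1..r}"
   hence "t ^ 2 <= t ^ 6" by (intro power_increasing) auto
   hence "M / t ^ 6 <= M / t^2" using t M2 by (intro divide_left_mono) auto
   hence "\<bar>V t\<bar> * (A * rh t) <= M / t^2 * (A * rh t)"
    using V_le[of t] t that(4) rh(1)[of t] by (intro mult_right_mono) auto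
   thus "norm (F t) <= M / t^2 * (A * rh t)" using that(2)[of t] t by auto
  qed
  moreover have "A * (M / K) * rh 1 >= 0" unfolding K(2) using that(4) rh(1)[of 1] by simp
  ultimately show ?thesis using integral_unique[OF g] unfolding K(2) by linarith
 qed
 have PQ: "norm (P u r) <= A * (norm ka / 2) * rh r" "norm ((Ei r)^2 * Q u r) <= A * (norm ka / 2) * rh r" "norm (S u r) <= A / 2 * rh r"
  if u: "cts {1..} u" "!!t. t >= 1 ==> norm (u t) <= A * rh t" and A: "A >= 0" "r >= 1" for u A r
 proof -
  have Vu: "norm (V t * u t) <= \<bar>V t\<bar> * (A * rh t)" if "1 <= t" for t using mult_left_mono[OF u(2)[OF that], of "\<bar>V t\<bar>"] by (simp add: norm_mult)
  show 1: "norm (P u r) <= A * (norm ka / 2) * rh r" unfolding P_def by (rule int[OF cu(1)[OF u(1)] Vu A(2,1)])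
  have "(Ei r)^2 * Q u r = integral {1..r} (%t. (Ei r)^2 * ((E t)^2 * (V t * u t)))" by (simp add: Q_def)
  also have "norm ... <= A * (norm ka / 2) * rh r"
  proof (rule int[OF _ _ A(2,1)])
   fix t assume t: "1 <= t" "t <= r"
   have "norm (Ei r) * norm (E t) <= 1" using t ka by (simp add: EE exp_add[symmetric])
   hence "(norm (Ei r) * norm (E t))^2 <= 1" by (simp add: power_le_one)
   hence "(norm (Ei r) * norm (E t))^2 * norm (V t * u t) <= 1 * (\<bar>V t\<bar> * (A * rh t))" by (intro mult_mono Vu t) auto
   thus "norm ((Ei r)^2 * ((E t)^2 * (V t * u t))) <= \<bar>V t\<bar> * (A * rh t)" by (simp add: norm_mult norm_power power_mult_distrib mult_ac)
  qed (intro continuous_intros cu u(1))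
  finally show 2: "norm ((Ei r)^2 * Q u r) <= A * (norm ka / 2) * rh r" .
  have "norm (P u r - (Ei r)\<^sup>2 * Q u r) <= (A / 2 * rh r) * (2 * norm ka)" using norm_triangle_ineq4[of "P u r" "(Ei r)^2 * Q u r"] 1 2 by (simp add: algebra_simps)
  thus "norm (S u r) <= A / 2 * rh r" unfolding S_def norm_divide using k0 by (simp add: norm_mult pos_divide_le_eq)
 qed
 have cPQ: "cts {1..} (P u)" "cts {1..} (Q u)" if "cts {1..} u" for u
  unfolding P_def[abs_def] Q_def[abs_def] by (intro contI cu that)+
 have cT: "cts {1..} (T u)" if "cts {1..} u" for u
  unfolding T_def[abs_def] S_def using k0 by (intro continuous_intros cPQ cE that) auto
 have T_bound: "norm (A0 + B0 * (Ei r)^2) <= (norm A0 + norm B0) * exp K * rh r" if "r >= 1" for r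
 proof -
  have "norm (B0 * (Ei r)^2) <= norm B0" using Ei1[OF that] by (simp add: norm_mult norm_power mult_left_le power_le_one)
  hence "norm (A0 + B0 * (Ei r)^2) <= (norm A0 + norm B0) * 1" using norm_triangle_ineq[of A0 "B0 * (Ei r)^2"] by simp
  also have "... <= (norm A0 + norm B0) * (exp K * rh r)"
   using mult_left_mono[OF rh(2)[OF that], of "exp K"] by (intro mult_left_mono) (auto simp: exp_add[symmetric])
  finally show ?thesis by (simp only: mult.assoc)
 qed
 obtain n where n: "wbounded rh n" "!!t. t >= 1 ==> T n t = n t"
 proof (rule weighted_fixpoint[of rh T])
  show "cts {1..} rh" unfolding rh_def[abs_def] by (intro continuous_intros) auto
  show "T u t = T v t" if "!!t. t >= 1 ==> u t = v t" "t >= 1" for u v t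
  proof -
   have "P u = P v" "Q u = Q v" unfolding P_def Q_def using that(1) by (auto intro!: ext integral_cong)
   thus ?thesis by (simp add: T_def S_def)
  qed
  show "wbounded rh (T u)" if uw: "wbounded rh u" for u
  proof -
   obtain A where A: "cts {1..} u" "!!t. t >= 1 ==> norm (u t) <= A * rh t" using uw by (auto simp: wbounded_def)
   have A0: "A >= 0" using order_trans[OF norm_ge_zero A(2)[of 1]] rh(1)[of 1] by (simp add: zero_le_mult_iff)
   have "norm (T u t) <= ((norm A0 + norm B0) * exp K + A / 2) * rh t" if "t >= 1" for t
    using norm_triangle_ineq4[of "A0 + B0 * (Ei t)^2" "S u t"] T_bound[OF that] PQ(3)[OF A A0 that] by (simp add: T_def distrib_right)
   thus ?thesis using cT[OF A(1)] by (auto simp: wbounded_def)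
  qed
  show "norm (T u t - T v t) <= A / 2 * rh t"
   if uv: "wbounded rh u" "wbounded rh v" and A: "A >= 0" "!!t. t >= 1 ==> norm (u t - v t) <= A * rh t" "t >= 1" for u v A t
  proof -
   have c: "cts {1..} u" "cts {1..} v" using uv by (simp_all add: wbounded_def)
   have PQd: "P (%t. u t - v t) t = P u t - P v t" "Q (%t. u t - v t) t = Q u t - Q v t"
    unfolding P_def Q_def right_diff_distrib by (intro integral_diff ci cu c)+
   have "T u t - T v t = - S (%t. u t - v t) t"
    unfolding T_def S_def PQd by (simp add: diff_divide_distrib add_divide_distrib algebra_simps)
   thus ?thesis using PQ(3)[OF continuous_on_diff[OF c] A(2,1,3)] by simp
  qed
 qed (use rh in auto)
 obtain A where cn: "cts {1..} n" and A: "!!t. t >= 1 ==> norm (n t) <= A * rh t" using n(1) by (auto simp: wbounded_def)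
 have A0: "A >= 0" using order_trans[OF norm_ge_zero A[of 1]] rh(1)[of 1] by (simp add: zero_le_mult_iff)
 \<comment> \<open>The varying constants: the derivatives of \<open>p\<close> and \<open>q\<close>
   cancel in the derivative of \<open>d\<close>, which is why \<open>d'\<close> has the form of a
   free derivative.\<close>
 define p q where "p r = A0 - P n r / (2 * ka)" and "q r = B0 + Q n r / (2 * ka)" for r
 define d d' where "d r = E r * p r + Ei r * q r" and "d' r = ka * (E r * p r - Ei r * q r)" for r
 have nd: "d r = E r * n r" if "r >= 1" for r
 proof -
  have "E r * n r = E r * p r + (E r * Ei r) * (Ei r * q r)"
   unfolding n(2)[OF that, symmetric] T_def S_def p_def q_def using k0 by (simp add: field_simps power2_eq_square)
  thus ?thesis by (simp add: EE d_def)
 qed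
 have dpq: "(p hvd 0 - V r * n r / (2 * ka)) (at r)" "(q hvd 0 + (E r)^2 * (V r * n r) / (2 * ka)) (at r)" if "r > 1" for r
  unfolding p_def[abs_def] q_def[abs_def] P_def[abs_def] Q_def[abs_def]
  by (intro has_vector_derivative_diff has_vector_derivative_add has_vector_derivative_const has_vector_derivative_divide FTC cu cn that)+
 have EiE: "Ei r * (E r)^2 = E r" for r using EE(1)[of r] by (simp add: power2_eq_square mult_ac)
 have s: "solution ka d d'"
  unfolding solution_def
 proof (intro conjI allI impI)
  show "cts {1..} d" "cts {1..} d'"
   unfolding d_def[abs_def] d'_def[abs_def] p_def q_def using k0 by (auto intro!: continuous_intros cE cPQ cn)
  fix r :: real assume r: "r > 1"
  let ?w = "V r * n r / (2 * ka)"
  have q': "Ei r * (0 + (E r)^2 * (V r * n r) / (2 * ka)) = E r * ?w" using EiE[of r] by (simp add: mult.assoc[symmetric])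
  have dp: "((%r. E r * p r) hvd E r * (0 - ?w) + ka * E r * p r) (at r)"
   and dq: "((%r. Ei r * q r) hvd E r * ?w + - ka * Ei r * q r) (at r)"
   unfolding q'[symmetric] by (rule has_vector_derivative_mult dE dpq r)+
  show "(d hvd d' r) (at r)"
   unfolding d_def[abs_def] by (rule has_vector_derivative_eq_rhs[OF has_vector_derivative_add[OF dp dq]]) (simp add: d'_def algebra_simps)
  have w: "ka * (2 * (E r * ?w)) = V r * d r" unfolding nd[OF less_imp_le[OF r]] using k0 by simp
  have "ka * ((E r * (0 - ?w) + ka * E r * p r) - (E r * ?w + - ka * Ei r * q r)) = ka^2 * d r - ka * (2 * (E r * ?w))"
   by (simp add: d_def power2_eq_square algebra_simps)
  thus "(d' hvd (ka^2 - V r) * d r) (at r)"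
   unfolding d'_def[abs_def] w left_diff_distrib
   using has_vector_derivative_mult_right[OF has_vector_derivative_diff[OF dp dq], of ka] by (simp only:)
 qed
 have d1: "d 1 = a" "d' 1 = b"
 proof -
  have "E 1 * p 1 = (a + b / ka) / 2" "Ei 1 * q 1 = (a - b / ka) / 2"
   using EE(1)[of 1] by (simp_all add: p_def q_def P_def Q_def A0_def B0_def mult_ac)
  note e = this
  show "d 1 = a" "d' 1 = b" unfolding d_def d'_def e using k0 by (simp_all add: field_simps)
 qed
 define B where "B = A + norm ka * (norm A0 + norm B0 + A)"
 have b: "norm (d r) <= B * exp (Re ka * r)" "norm (d' r) <= B * exp (Re ka * r)" if r: "r >= 1" for r
 proof -
  have Arh: "A * rh r <= A" using rh(3)[OF r] A0 by (simp add: mult_left_le)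
  have nn: "0 <= norm ka * (norm A0 + norm B0 + A)" using A0 by simp
  have "norm (d r) <= exp (Re ka * r) * A" unfolding nd[OF r] norm_mult EE using order_trans[OF A[OF r] Arh] by (intro mult_left_mono) auto
  also have "... <= exp (Re ka * r) * B" using nn by (intro mult_left_mono) (auto simp: B_def)
  finally show "norm (d r) <= B * exp (Re ka * r)" by (simp only: mult.commute)
  have z: "norm (x / (2 * ka)) <= A / 2" if "norm x <= A * (norm ka / 2) * rh r" for x
  proof -
   have "norm x <= norm ka / 2 * A" using that mult_left_mono[OF Arh, of "norm ka / 2"] by (simp add: mult_ac)
   thus ?thesis using k0 mult_nonneg_nonneg[OF A0 norm_ge_zero[of ka]] by (simp add: norm_divide norm_mult field_simps)
  qed
  have "d' r = ka * (E r * (A0 - P n r / (2 * ka) - (Ei r)\<^sup>2 * B0 - (Ei r)\<^sup>2 * Q n r / (2 * ka)))"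
  proof -
   have e: "E r * (Ei r * x) = x" for x using EE(1)[of r] by (simp flip: mult.assoc)
   show ?thesis by (simp add: d'_def p_def q_def power2_eq_square algebra_simps e EE(1))
  qed
  moreover have "norm (A0 - P n r / (2 * ka) - (Ei r)\<^sup>2 * B0 - (Ei r)\<^sup>2 * Q n r / (2 * ka)) <= norm A0 + A / 2 + norm B0 + A / 2"
  proof (intro order_trans[OF norm_triangle_ineq4] add_mono z PQ cn A A0 r order_refl)
   show "norm ((Ei r)^2 * B0) <= norm B0" using Ei1[OF r] by (simp add: norm_mult norm_power mult_left_le_one_le power_le_one)
  qed
  ultimately have "norm (d' r) <= norm ka * (exp (Re ka * r) * (norm A0 + A / 2 + norm B0 + A / 2))"
   unfolding norm_mult EE by (simp only: norm_mult EE) (intro mult_left_mono, auto)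
  also have "... = (norm ka * (norm A0 + norm B0 + A)) * exp (Re ka * r)" by (simp add: algebra_simps)
  also have "... <= B * exp (Re ka * r)" using A0 by (intro mult_right_mono) (auto simp: B_def)
  finally show "norm (d' r) <= B * exp (Re ka * r)" .
 qed
 show ?thesis by (rule that[OF s d1 b])
qed

end

section \<open>Jost solutions\<close>

context potential
begin

text \<open>The weight tends to 1 and has derivative \<open>- M / t^2 * wt t\<close>, so that the
  integral of \<open>M / t^2 * wt t\<close> over \<open>{r..}\<close> is exactly
  \<open>wt r - 1\<close>.\<close>

definition wt :: "real => real" where "wt t = exp (M / t)"

text \<open>If \<open>e\<close> solves the equation, then \<open>u = exp (ka * r) * e\<close>
  satisfies \<open>u'' - 2 * ka * u' = - V * u\<close>. \<open>jP\<close> is the solution for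
  \<open>u'\<close> obtained by integrating from infinity, and \<open>jT\<close> integrates once
  more, with limit 1. In contrast to a kernel containing \<open>1 / ka\<close>, this form includes
  \<open>ka = 0\<close>.\<close>

definition jP :: "complex => (real => complex) => real => complex" where
 "jP ka u sg = exp (2 * ka * cx sg) *
   (LINT t:{sg..}|lborel. exp (- 2 * ka * cx t) * (cx (V t) * u t))"

definition jT :: "complex => (real => complex) => real => complex" where
 "jT ka u r = 1 - (LINT sg:{r..}|lborel. jP ka u sg)"

lemma wt_pos: "wt t > 0" and wt_ge_1: "t >= 1 ==> wt t >= 1" and wt_le: "t >= 1 ==> wt t <= exp M"
 using M2 by (auto simp: wt_def divide_le_eq mult_le_cancel_left1)

lemma wt_tendsto: "(wt ~~> 1) at_top"
proof -
 have "((%t. exp (M / t)) ~~> exp 0) at_top"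
  by (intro tendsto_exp tendsto_divide_0[OF tendsto_const] filterlim_at_top_imp_at_infinity filterlim_ident)
 thus ?thesis by (simp add: wt_def[abs_def])
qed

lemma wt_deriv: "t >= 1 ==> (wt hrd - (M / t^2 * wt t)) (at t)"
 unfolding wt_def by (auto intro!: derivative_eq_intros simp: power2_eq_square)

lemma wt_continuous: "cts {1..} wt"
 unfolding wt_def by (intro continuous_intros) auto

lemma exp_decay: "Re ka >= 0 ==> sg <= t ==> norm (exp (2 * ka * cx sg) * exp (- 2 * ka * cx t)) <= 1"
proof -
 assume "Re ka >= 0" "sg <= t"
 hence "Re ka * sg <= Re ka * t" by (intro mult_left_mono)
 thus ?thesis by (simp add: mult_exp_exp)
qed

text \<open>The decay of \<open>V\<close> is shared out: two powers of \<open>t\<close> pay for the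
  integration over \<open>t\<close>, and four powers of \<open>sg\<close> are left for the outer
  integral over \<open>sg\<close>.\<close>

lemma V_wt_bound:
 assumes "norm u <= A * wt t" "1 <= sg" "sg <= t" "A >= 0"
 shows "norm (cx (V t) * u) <= A / sg ^ 4 * (M / t^2 * wt t)"
proof -
 have "sg ^ 4 * t^2 <= t ^ 4 * t^2" using assms by (intro mult_right_mono power_mono) auto
 hence "sg ^ 4 * t^2 <= t ^ 6" by (simp add: power_add[symmetric])
 moreover have "0 < sg ^ 4 * t^2" using assms by simp
 ultimately have "M / t ^ 6 <= M / (sg ^ 4 * t^2)" using M2 assms by (intro divide_left_mono) auto
 hence "\<bar>V t\<bar> <= M / (sg ^ 4 * t^2)" using V_le[of t] assms by linarith
 hence "\<bar>V t\<bar> * norm u <= M / (sg ^ 4 * t^2) * (A * wt t)"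
  using assms M2 by (intro mult_mono) auto
 thus ?thesis by (simp add: norm_mult field_simps)
qed

lemma jP_integrand:
 fixes ka :: complex and u :: "real => complex"
 assumes ka: "Re ka >= 0" and u: "cts {1..} u" "ALL t>=1. norm (u t) <= A * wt t" "A >= 0" and sg: "sg >= 1"
 shows "set_integrable lborel {sg..} (%t. exp (2 * ka * sg) * exp (- 2 * ka * t) * (V t * u t))"
  "norm (LINT t:{sg..}|lborel. exp (2 * ka * sg) * exp (- 2 * ka * t) * (V t * u t)) <= A / sg ^ 4 * (wt sg - 1)"
proof -
 let ?F = "%t::real. exp (2 * ka * sg) * exp (- 2 * ka * t) * (V t * u t)"
 let ?g = "%t. A / sg ^ 4 * (M / t^2 * wt t)"
 let ?G = "%t. - (A / sg ^ 4 * wt t)"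
 have c: "cts {1..} ?F" by (intro continuous_intros u contV)
 have g: "?g : bm" unfolding wt_def by measurable
 have le: "norm (?F t) <= ?g t" if "t >= sg" for t
 proof -
  have "norm (?F t) <= 1 * norm (V t * u t)"
   unfolding norm_mult[of "exp (2 * ka * sg) * exp (- 2 * ka * t)"] by (intro mult_right_mono exp_decay ka that) auto
  also have "... <= ?g t" using V_wt_bound[OF u(2)[rule_format] sg that u(3)] sg that by simp
  finally show ?thesis .
 qed
 have G: "(?G hrd ?g t) (at t)" if "t >= sg" for t
  by (rule DERIV_cong[OF DERIV_minus[OF DERIV_cmult[OF wt_deriv]]]) (use sg that in auto)
 have lim: "(?G ~~> - (A / sg ^ 4 * 1)) at_top" by (intro tendsto_intros wt_tendsto)
 note t = tail_integral[OF c g sg le G lim]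
 show "set_integrable lborel {sg..} ?F" by (rule t(1)) auto
 have "norm (LINT t:{sg..}|lborel. ?F t) <= - (A / sg ^ 4 * 1) - ?G sg" by (rule t(2))
 also have "... = A / sg ^ 4 * (wt sg - 1)" by (simp add: right_diff_distrib)
 finally show "norm (LINT t:{sg..}|lborel. ?F t) <= A / sg ^ 4 * (wt sg - 1)" .
qed

lemma jP_eq:
 fixes ka :: complex and u :: "real => complex"
 shows "jP ka u sg = (LINT t:{sg..}|lborel. exp (2 * ka * sg) * exp (- 2 * ka * t) * (V t * u t))"
 by (simp only: jP_def set_integral_mult_right mult.assoc)

lemma jP_bound:
 fixes ka :: complex and u :: "real => complex"
 assumes ka: "Re ka >= 0" and u: "cts {1..} u" "ALL t>=1. norm (u t) <= A * wt t" "A >= 0"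
 shows "ALL t>=1. norm (jP ka u t) <= A / t^2 * wt t"
proof (intro allI impI)
 fix t :: real assume t: "t >= 1"
 have "norm (jP ka u t) <= A / t ^ 4 * (wt t - 1)"
  unfolding jP_eq by (rule jP_integrand(2)[OF assms t])
 also have "... <= A / t^2 * wt t"
  using t u(3) wt_pos[of t] wt_ge_1[OF t] by (intro mult_mono divide_left_mono power_increasing) auto
 finally show "norm (jP ka u t) <= A / t^2 * wt t" .
qed

lemma jP_deriv:
 fixes ka :: complex and u :: "real => complex"
 assumes ka: "Re ka >= 0" and u: "cts {1..} u" "ALL t>=1. norm (u t) <= A * wt t" "A >= 0"
 shows "cts {1..} (jP ka u)"
  "sg > 1 ==> (jP ka u hvd 2 * ka * jP ka u sg - V sg * u sg) (at sg)"
proof -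
 let ?F = "%t::real. exp (- 2 * ka * t) * (V t * u t)"
 have c: "cts {1..} ?F" by (intro continuous_intros u contV)
 have i1: "set_integrable lborel {1..} (%t. exp (2 * ka * (1::real)) * ?F t)"
  using jP_integrand(1)[OF assms order_refl] by (simp only: mult.assoc)
 have "set_integrable lborel {1..} (%t. inverse (exp (2 * ka * (1::real))) * (exp (2 * ka * (1::real)) * ?F t))"
  by (rule set_integrable_mult_right) (rule i1)
 moreover have "inverse (exp (2 * ka * (1::real))) * (exp (2 * ka * (1::real)) * ?F t) = ?F t" for t
  by (simp add: mult.assoc[symmetric])
 ultimately have i: "set_integrable lborel {1..} ?F" by (simp only:)
 note F = tail_integral_FTC[OF c i]
 show "cts {1..} (jP ka u)" unfolding jP_def[abs_def] by (intro continuous_intros F(1))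
 show "(jP ka u hvd 2 * ka * jP ka u sg - V sg * u sg) (at sg)" if "sg > 1"
 proof -
  have e: "((%sg::real. exp (2 * ka * sg)) hvd 2 * ka * exp (2 * ka * sg)) (at sg)"
   by (auto intro!: derivative_eq_intros has_vector_derivative_real_field)
  have "(jP ka u hvd exp (2 * ka * sg) * (- ?F sg) + 2 * ka * exp (2 * ka * sg) * (LINT t:{sg..}|lborel. ?F t)) (at sg)"
   unfolding jP_def[abs_def] by (rule has_vector_derivative_mult[OF e F(2)[OF that]])
  moreover have "exp (2 * ka * sg) * (- ?F sg) = - (V sg * u sg)"
   by (simp add: mult.assoc[symmetric] mult_exp_exp)
  moreover have "2 * ka * exp (2 * ka * sg) * (LINT t:{sg..}|lborel. ?F t) = 2 * ka * jP ka u sg"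
   by (simp only: jP_def mult.assoc)
  ultimately have "(jP ka u hvd - (V sg * u sg) + 2 * ka * jP ka u sg) (at sg)" by (simp only:)
  thus ?thesis by (simp only: uminus_add_conv_diff)
 qed
qed

lemma jP_diff:
 fixes ka :: complex and u v :: "real => complex"
 assumes ka: "Re ka >= 0" and u: "cts {1..} u" "ALL t>=1. norm (u t) <= A * wt t" "A >= 0"
  and v: "cts {1..} v" "ALL t>=1. norm (v t) <= B * wt t" "B >= 0" and sg: "sg >= 1"
 shows "jP ka u sg - jP ka v sg = jP ka (%t. u t - v t) sg"
 unfolding jP_eq
 by (subst set_integral_diff(2)[symmetric, OF jP_integrand(1)[OF ka u sg] jP_integrand(1)[OF ka v sg]])
   (simp add: algebra_simps)

lemma tail_wt:
 fixes F :: "real => complex"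
 assumes "cts {1..} F" "ALL t>=1. norm (F t) <= A / t^2 * wt t" "A >= 0" "r >= 1"
 shows "set_integrable lborel {r..} F" "norm (LINT t:{r..}|lborel. F t) <= A / M * (wt r - 1)"
proof -
 let ?g = "%t. A / t^2 * wt t"
 let ?G = "%t. - (A / M * wt t)"
 have g: "?g : bm" unfolding wt_def by measurable
 have G: "(?G hrd ?g t) (at t)" if "t >= r" for t
  by (rule DERIV_cong[OF DERIV_minus[OF DERIV_cmult[OF wt_deriv]]]) (use assms(4) that M2 in "auto simp: field_simps")
 have lim: "(?G ~~> - (A / M * 1)) at_top" by (intro tendsto_intros wt_tendsto)
 have le: "norm (F t) <= ?g t" if "t >= r" for t using assms(2) assms(4) that by simp
 note t = tail_integral[OF assms(1) g assms(4) le G lim]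
 show "set_integrable lborel {r..} F" by (rule t(1)) auto
 show "norm (LINT t:{r..}|lborel. F t) <= A / M * (wt r - 1)"
  using t(2) by (simp add: algebra_simps)
qed

lemma jost_exists:
 assumes ka: "Re ka >= 0"
 shows "EX u. wbounded wt u & (ALL t>=1. jT ka u t = u t)"
proof -
 have W: "EX A>=0. cts {1..} u & (ALL t>=1. norm (u t) <= A * wt t)" if wb: "wbounded wt u" for u
 proof -
  obtain A where A: "cts {1..} u" "ALL t>=1. norm (u t) <= A * wt t" using wb by (auto simp: wbounded_def)
  have "0 <= A * wt 1" using A(2) norm_ge_zero order_trans by blast
  hence "A >= 0" using wt_pos[of 1] by (simp add: zero_le_mult_iff)
  thus ?thesis using A by blast
 qed
 obtain u where "wbounded wt u" "!!t. t >= 1 ==> jT ka u t = u t"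
 proof (rule weighted_fixpoint[OF wt_continuous wt_pos, of "jT ka"])
  fix u assume "wbounded wt u"
  then obtain A where A: "A >= 0" "cts {1..} u" "ALL t>=1. norm (u t) <= A * wt t" using W by blast
  note P = jP_deriv(1)[OF ka A(2,3,1)] jP_bound[OF ka A(2,3,1)]
  have c: "cts {1..} (jT ka u)"
   unfolding jT_def[abs_def] by (intro continuous_intros tail_integral_FTC(1)[OF P(1)] tail_wt(1)[OF P A(1) order_refl])
  have "norm (jT ka u t) <= (1 + A / M) * wt t" if "t >= 1" for t
  proof -
   have "norm (jT ka u t) <= 1 + A / M * (wt t - 1)"
    unfolding jT_def using norm_triangle_ineq4[of 1 "LINT sg:{t..}|lborel. jP ka u sg"] tail_wt(2)[OF P A(1) that] by simp
   also have "... <= 1 * wt t + A / M * wt t"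
    using wt_ge_1[OF that] A M2 by (intro add_mono mult_left_mono) auto
   finally show ?thesis by (simp add: distrib_right)
  qed
  thus "wbounded wt (jT ka u)" using c by (auto simp: wbounded_def)
 next
  fix u v :: "real => complex" and t :: real
  assume eq: "!!t. t >= 1 ==> u t = v t" and t: "t >= 1"
  have "jP ka u sg = jP ka v sg" if "sg >= 1" for sg
   unfolding jP_def by (intro arg_cong[where f="%x. _ * x"] set_lebesgue_integral_cong) (use that eq in auto)
  thus "jT ka u t = jT ka v t"
   unfolding jT_def by (intro arg_cong[where f="%x. 1 - x"] set_lebesgue_integral_cong) (use t in auto)
 next
  fix u v :: "real => complex" and A t :: real
  assume uv: "wbounded wt u" "wbounded wt v" and A: "A >= 0" and le: "!!t. t >= 1 ==> norm (u t - v t) <= A * wt t" and t: "t >= 1"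
  obtain B where B: "B >= 0" "cts {1..} u" "ALL t>=1. norm (u t) <= B * wt t" using W[OF uv(1)] by blast
  obtain C where C: "C >= 0" "cts {1..} v" "ALL t>=1. norm (v t) <= C * wt t" using W[OF uv(2)] by blast
  have c: "cts {1..} (%t. u t - v t)" by (intro continuous_intros B C)
  have le: "ALL t>=1. norm (u t - v t) <= A * wt t" using le by blast
  note Pu = jP_deriv(1)[OF ka B(2,3,1)] jP_bound[OF ka B(2,3,1)]
  note Pv = jP_deriv(1)[OF ka C(2,3,1)] jP_bound[OF ka C(2,3,1)]
  note P = jP_deriv(1)[OF ka c le A] jP_bound[OF ka c le A]
  have "jT ka u t - jT ka v t = - (LINT sg:{t..}|lborel. jP ka u sg - jP ka v sg)"
   unfolding jT_def by (simp add: set_integral_diff(2)[OF tail_wt(1)[OF Pu B(1) t] tail_wt(1)[OF Pv C(1) t]])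
  also have "(LINT sg:{t..}|lborel. jP ka u sg - jP ka v sg) = (LINT sg:{t..}|lborel. jP ka (%t. u t - v t) sg)"
   by (intro set_lebesgue_integral_cong) (use t jP_diff[OF ka B(2,3,1) C(2,3,1)] in auto)
  finally have "norm (jT ka u t - jT ka v t) <= A / M * (wt t - 1)" using tail_wt(2)[OF P A t] by simp
  also have "... <= A / 2 * wt t" using A M2 wt_ge_1[OF t] by (intro mult_mono divide_left_mono) auto
  finally show "norm (jT ka u t - jT ka v t) <= A / 2 * wt t" .
 qed blast
 thus ?thesis by blast
qed

text \<open>The Jost solution without its factor \<open>exp (- ka * r)\<close>; it tends to 1 at
  infinity.\<close>

definition jm :: "complex => real => complex" where
 "jm ka = (SOME u. wbounded wt u & (ALL t>=1. jT ka u t = u t))"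

definition jp :: "complex => real => complex" where
 "jp ka = jP ka (jm ka)"

lemma jm:
 assumes "Re ka >= 0"
 shows "wbounded wt (jm ka)" "t >= 1 ==> jT ka (jm ka) t = jm ka t"
 using someI_ex[OF jost_exists[OF assms]] unfolding jm_def[symmetric] by auto

lemma jm_bound:
 assumes ka: "Re ka >= 0"
 shows "cts {1..} (jm ka)" "ALL t>=1. norm (jm ka t) <= 2 * wt t"
proof -
 show c: "cts {1..} (jm ka)" using jm(1)[OF ka] by (simp add: wbounded_def)
 show "ALL t>=1. norm (jm ka t) <= 2 * wt t"
 proof (intro allI impI)
  fix t :: real assume "t >= 1"
  have "norm (jm ka t) <= (A / 2 + 1) * wt t" if "A >= 0" and A0: "!!t. t >= 1 ==> norm (jm ka t) <= A * wt t" and t: "t >= 1" for A t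
  proof -
   have A: "ALL t>=1. norm (jm ka t) <= A * wt t" using A0 by blast
   note P = jP_deriv(1)[OF ka c A that(1)] jP_bound[OF ka c A that(1)]
   have "norm (jT ka (jm ka) t) <= 1 + A / M * (wt t - 1)"
    unfolding jT_def using norm_triangle_ineq4[of 1 "LINT sg:{t..}|lborel. jP ka (jm ka) sg"] tail_wt(2)[OF P that(1) t] by simp
   also have "A / M * (wt t - 1) <= A / 2 * wt t" using that(1) M2 wt_ge_1[OF t] by (intro mult_mono divide_left_mono) auto
   also have "1 + A / 2 * wt t <= (A / 2 + 1) * wt t" using wt_ge_1[OF t] by (simp add: distrib_right)
   finally show ?thesis using jm(2)[OF ka t] by simp
  qed
  from weighted_bound[OF jm(1)[OF ka] wt_pos this \<open>t >= 1\<close>] show "norm (jm ka t) <= 2 * wt t" by simp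
 qed
qed

lemma jp_facts:
 assumes ka: "Re ka >= 0"
 shows "cts {1..} (jp ka)" "t >= 1 ==> norm (jp ka t) <= 2 / t^2 * wt t"
  "r > 1 ==> (jp ka hvd 2 * ka * jp ka r - V r * jm ka r) (at r)"
  "r > 1 ==> (jm ka hvd jp ka r) (at r)"
  "r >= 1 ==> norm (jm ka r - 1) <= wt r - 1"
proof -
 have two: "(0::real) <= 2" by simp
 note P = jP_deriv[OF ka jm_bound[OF ka] two] jP_bound[OF ka jm_bound[OF ka] two]
 show c: "cts {1..} (jp ka)" unfolding jp_def by (rule P(1))
 have b: "ALL t>=1. norm (jp ka t) <= 2 / t^2 * wt t" unfolding jp_def by (rule P(3))
 thus "norm (jp ka t) <= 2 / t^2 * wt t" if "t >= 1" using that by blast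
 show "r > 1 ==> (jp ka hvd 2 * ka * jp ka r - V r * jm ka r) (at r)" unfolding jp_def by (rule P(2))
 have eq: "jm ka r = 1 - (LINT sg:{r..}|lborel. jp ka sg)" if "r >= 1" for r
  using jm(2)[OF ka that] by (simp add: jT_def jp_def)
 show "(jm ka hvd jp ka r) (at r)" if "r > 1"
 proof -
  have "((%r. 1 - (LINT sg:{r..}|lborel. jp ka sg)) hvd jp ka r) (at r)"
   using has_vector_derivative_diff[OF has_vector_derivative_const tail_integral_FTC(2)[OF c tail_wt(1)[OF c b two order_refl] that]] by simp
  thus ?thesis
   by (rule has_vector_derivative_transform_within_open[of _ _ _ "{1<..}"]) (use that eq in auto)
 qed
 show "norm (jm ka r - 1) <= wt r - 1" if "r >= 1"
 proof -
  have "norm (jm ka r - 1) <= 2 / M * (wt r - 1)" using tail_wt(2)[OF c b two that] eq[OF that] by (simp add: norm_minus_commute)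
  also have "... <= 1 * (wt r - 1)" using M2 wt_ge_1[OF that] by (intro mult_right_mono) auto
  finally show ?thesis by simp
 qed
qed

lemma jm_tendsto: "Re ka >= 0 ==> (jm ka ~~> 1) at_top"
proof -
 assume ka: "Re ka >= 0"
 have "((%r. wt r - 1) ~~> 0) at_top" using tendsto_diff[OF wt_tendsto tendsto_const[of 1]] by simp
 hence "((%r. jm ka r - 1) ~~> 0) at_top"
  by (rule Lim_null_comparison[rotated])
    (use jp_facts(5)[OF ka] in "auto simp: eventually_at_top_linorder intro!: exI[of _ 1]")
 thus ?thesis by (simp add: LIM_zero_iff)
qed

definition jost :: "complex => real => complex" where "jost ka r = exp (- ka * r) * jm ka r"
definition jost' :: "complex => real => complex" where "jost' ka r = exp (- ka * r) * (jp ka r - ka * jm ka r)"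

lemma jost_solution:
 assumes ka: "Re ka >= 0"
 shows "solution ka (jost ka) (jost' ka)"
 unfolding solution_def
proof (intro conjI allI impI)
 note c = jm_bound(1)[OF ka] jp_facts(1)[OF ka]
 show "cts {1..} (jost ka)" "cts {1..} (jost' ka)"
  unfolding jost_def[abs_def] jost'_def[abs_def] by (intro continuous_intros c)+
 fix r :: real assume r: "r > 1"
 have e: "((%r::real. exp (- ka * r)) hvd - ka * exp (- ka * r)) (at r)"
  by (auto intro!: derivative_eq_intros has_vector_derivative_real_field)
 have "(jost ka hvd exp (- ka * r) * jp ka r + - ka * exp (- ka * r) * jm ka r) (at r)"
  unfolding jost_def[abs_def] by (rule has_vector_derivative_mult[OF e jp_facts(4)[OF ka r]])
 thus "(jost ka hvd jost' ka r) (at r)" by (simp add: jost'_def algebra_simps)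
 have "(jost' ka hvd exp (- ka * r) * ((2 * ka * jp ka r - V r * jm ka r) - ka * jp ka r) + - ka * exp (- ka * r) * (jp ka r - ka * jm ka r)) (at r)"
  unfolding jost'_def[abs_def]
  by (intro has_vector_derivative_mult[OF e] has_vector_derivative_diff has_vector_derivative_mult_right jp_facts(3,4) ka r)
 thus "(jost' ka hvd (ka^2 - V r) * jost ka r) (at r)"
  by (simp add: jost_def algebra_simps power2_eq_square)
qed

lemma jost_decay:
 assumes ka: "Re ka >= 0" and r: "r >= 1"
 shows "norm (jost ka r) <= (2 * exp M) * exp (- Re ka * r)"
  "norm (jost' ka r) <= (2 * exp M * (1 + norm ka)) * exp (- Re ka * r)"
proof -
 have m: "norm (jm ka r) <= 2 * exp M" using jm_bound(2)[OF ka, rule_format, OF r] wt_le[OF r] by simp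
 have "2 / r^2 * wt r <= 2 / 1 * exp M" using r wt_le[OF r] wt_pos[of r]
  by (intro mult_mono divide_left_mono) (auto simp: one_le_power)
 hence p: "norm (jp ka r) <= 2 * exp M" using jp_facts(2)[OF ka r] by simp
 show "norm (jost ka r) <= (2 * exp M) * exp (- Re ka * r)"
  using mult_right_mono[OF m, of "exp (- Re ka * r)"] by (simp add: jost_def norm_mult mult.commute)
 have "norm (jp ka r - ka * jm ka r) <= 2 * exp M + norm ka * (2 * exp M)"
  using norm_triangle_ineq4[of "jp ka r" "ka * jm ka r"] p mult_left_mono[OF m, of "norm ka"] by (simp add: norm_mult)
 from mult_right_mono[OF this, of "exp (- Re ka * r)"]
 have "norm (jp ka r - ka * jm ka r) * exp (- Re ka * r) <= (2 * exp M * (1 + norm ka)) * exp (- Re ka * r)"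
  by (simp add: algebra_simps)
 moreover have "norm (jost' ka r) = norm (jp ka r - ka * jm ka r) * exp (- Re ka * r)"
  by (simp add: jost'_def norm_mult)
 ultimately show "norm (jost' ka r) <= (2 * exp M * (1 + norm ka)) * exp (- Re ka * r)" by simp
qed

text \<open>For real \<open>k\<close> the conjugate of \<open>jm\<close> satisfies the same fixed
  point equation, and the contraction forces the two to agree.\<close>

lemma jm_real:
 assumes k: "k >= 0" and t: "t >= 1"
 shows "jm (cx k) t : \<real>" "jp (cx k) t : \<real>"
proof -
 let ?k = "cx k"
 have ka: "Re ?k >= 0" using k by simp
 have two: "(0::real) <= 2" by simp
 note B = jm_bound[OF ka]
 define w where "w t = cnj (jm ?k t)" for t
 have cw: "cts {1..} w" unfolding w_def by (intro continuous_intros B)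
 have bw: "ALL t>=1. norm (w t) <= 2 * wt t" using B(2) by (simp add: w_def)
 have Pc: "jP ?k w sg = cnj (jP ?k (jm ?k) sg)" for sg
 proof -
  have "(LINT t:{sg..}|lborel. exp (- 2 * ?k * t) * (V t * w t)) = cnj (LINT t:{sg..}|lborel. exp (- 2 * ?k * t) * (V t * jm ?k t))"
   unfolding set_lebesgue_integral_def
   by (subst Bochner_Integration.integral_cnj[symmetric], intro Bochner_Integration.integral_cong refl) (simp add: w_def exp_cnj)
  thus ?thesis by (simp add: jP_def exp_cnj)
 qed
 have Tw: "jT ?k w t = w t" if "t >= 1" for t
 proof -
  have "(LINT sg:{t..}|lborel. jP ?k w sg) = cnj (LINT sg:{t..}|lborel. jP ?k (jm ?k) sg)"
   unfolding set_lebesgue_integral_def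
   by (subst Bochner_Integration.integral_cnj[symmetric], intro Bochner_Integration.integral_cong refl) (simp add: Pc)
  hence "jT ?k w t = cnj (jT ?k (jm ?k) t)" by (simp add: jT_def)
  thus ?thesis using jm(2)[OF ka that] by (simp add: w_def)
 qed
 have wb: "wbounded wt (%t. jm ?k t - w t)"
  by (rule wbounded_diff[OF jm(1)[OF ka]]) (use cw bw in "auto simp: wbounded_def")
 have "norm (jm ?k t - w t) <= (A / 2 + 0) * wt t" if A: "A >= 0" and le0: "!!t. t >= 1 ==> norm (jm ?k t - w t) <= A * wt t" and t: "t >= 1" for A t
 proof -
  have le: "ALL t>=1. norm (jm ?k t - w t) <= A * wt t" using le0 by blast
  have c: "cts {1..} (%t. jm ?k t - w t)" by (intro continuous_intros B cw)
  note Pu = jP_deriv(1)[OF ka B two] jP_bound[OF ka B two]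
  note Pv = jP_deriv(1)[OF ka cw bw two] jP_bound[OF ka cw bw two]
  note P = jP_deriv(1)[OF ka c le A] jP_bound[OF ka c le A]
  have "jm ?k t - w t = jT ?k (jm ?k) t - jT ?k w t" using jm(2)[OF ka t] Tw[OF t] by simp
  also have "... = - (LINT sg:{t..}|lborel. jP ?k (jm ?k) sg - jP ?k w sg)"
   unfolding jT_def by (simp add: set_integral_diff(2)[OF tail_wt(1)[OF Pu two t] tail_wt(1)[OF Pv two t]])
  also have "(LINT sg:{t..}|lborel. jP ?k (jm ?k) sg - jP ?k w sg) = (LINT sg:{t..}|lborel. jP ?k (%t. jm ?k t - w t) sg)"
   by (intro set_lebesgue_integral_cong) (use t jP_diff[OF ka B two cw bw two] in auto)
  finally have "norm (jm ?k t - w t) <= A / M * (wt t - 1)" using tail_wt(2)[OF P A t] by simp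
  also have "... <= A / 2 * wt t" using A M2 wt_ge_1[OF t] by (intro mult_mono divide_left_mono) auto
  finally show ?thesis by simp
 qed
 from weighted_bound[OF wb wt_pos this] have eq: "jm ?k t = w t" if "t >= 1" for t using that by fastforce
 thus "jm ?k t : \<real>" using t by (simp add: w_def Reals_cnj_iff)
 have "jP ?k w t = jP ?k (jm ?k) t"
  unfolding jP_def by (intro arg_cong[where f="%x. _ * x"] set_lebesgue_integral_cong) (use t eq in auto)
 thus "jp ?k t : \<real>" using Pc[of t] by (simp add: jp_def Reals_cnj_iff)
qed

text \<open>Continuity in the spectral parameter down to zero, for the winding argument. Varying
  \<open>k\<close> in the kernel costs one power of \<open>t\<close>, which the decay of
  \<open>V\<close> can afford; the contraction absorbs the difference of the solutions
  themselves.\<close>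

lemma jm_lipschitz:
 assumes k: "k >= 0" "l >= 0" and t: "t >= 1"
 shows "norm (jm (cx k) t - jm (cx l) t) <= 4 * exp M * \<bar>k - l\<bar>"
  "norm (jp (cx k) t - jp (cx l) t) <= 8 * exp M * \<bar>k - l\<bar>"
proof -
 let ?k = "cx k" and ?l = "cx l"
 define dl where "dl = \<bar>k - l\<bar>"
 have dl: "dl >= 0" by (simp add: dl_def)
 have ka: "Re ?k >= 0" "Re ?l >= 0" using k by auto
 have two: "(0::real) <= 2" by simp
 note B = jm_bound[OF ka(1)] and C = jm_bound[OF ka(2)]
 have elip: "\<bar>exp (- x) - exp (- y)\<bar> <= \<bar>x - y\<bar>" if "x >= 0" "y >= 0" for x y :: real
 proof -
  have *: "exp (- x) - exp (- y) <= y - x" if "0 <= x" "x <= y" for x y :: real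
  proof -
   have "1 - (y - x) <= exp (- (y - x))" using exp_ge_add_one_self[of "- (y - x)"] by linarith
   hence "exp (- x) * (1 - exp (- (y - x))) <= 1 * (y - x)" using that by (intro mult_mono) auto
   thus ?thesis by (simp add: algebra_simps mult_exp_exp)
  qed
  show ?thesis using *[of x y] *[of y x] that by (cases "x <= y") auto
 qed
 have Pd: "norm (jP ?k (jm ?l) sg - jP ?l (jm ?l) sg) <= (4 * dl) / sg^2 * wt sg" if sg: "sg >= 1" for sg
 proof -
  let ?F = "%t::real. exp (2 * ?k * sg) * exp (- 2 * ?k * t) * (V t * jm ?l t) - exp (2 * ?l * sg) * exp (- 2 * ?l * t) * (V t * jm ?l t)"
  let ?g = "%t. 4 * dl / sg^2 * (M / t^2 * wt t)"
  let ?G = "%t. - (4 * dl / sg^2 * wt t)"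
  have c: "cts {1..} ?F" by (intro continuous_intros C contV)
  have g: "?g : bm" unfolding wt_def by measurable
  have G: "(?G hrd ?g t) (at t)" if "t >= sg" for t
   by (rule DERIV_cong[OF DERIV_minus[OF DERIV_cmult[OF wt_deriv]]]) (use sg that in auto)
  have lim: "(?G ~~> - (4 * dl / sg^2 * 1)) at_top" by (intro tendsto_intros wt_tendsto)
  have le: "norm (?F t) <= ?g t" if ts: "t >= sg" for t
  proof -
   have ex: "exp (2 * cx q * sg) * exp (- 2 * cx q * t) = cx (exp (- (2 * q * (t - sg))))" for q
    by (simp add: mult_exp_exp exp_of_real[symmetric] algebra_simps)
   have "?F t = cx (exp (- (2 * k * (t - sg))) - exp (- (2 * l * (t - sg)))) * (V t * jm ?l t)"
    unfolding ex by (simp add: algebra_simps)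
   hence "norm (?F t) = \<bar>exp (- (2 * k * (t - sg))) - exp (- (2 * l * (t - sg)))\<bar> * norm (V t * jm ?l t)"
    by (simp only: norm_mult norm_of_real)
   also have "... <= (2 * dl * t) * (2 * wt t * (M / t ^ 6))"
   proof (rule mult_mono)
    have "\<bar>exp (- (2 * k * (t - sg))) - exp (- (2 * l * (t - sg)))\<bar> <= \<bar>2 * k * (t - sg) - 2 * l * (t - sg)\<bar>"
     using k ts by (intro elip) auto
    also have "2 * k * (t - sg) - 2 * l * (t - sg) = 2 * (k - l) * (t - sg)" by (simp add: algebra_simps)
    also have "\<bar>...\<bar> = 2 * dl * (t - sg)" using ts unfolding abs_mult dl_def by simp
    also have "... <= 2 * dl * t" using dl sg by (intro mult_left_mono) auto
    finally show "\<bar>exp (- (2 * k * (t - sg))) - exp (- (2 * l * (t - sg)))\<bar> <= 2 * dl * t" .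
    have "norm (V t * jm ?l t) = norm (jm ?l t) * \<bar>V t\<bar>" by (simp add: norm_mult)
    also have "... <= 2 * wt t * (M / t ^ 6)" using C(2) V_le[of t] sg ts wt_pos[of t] by (intro mult_mono) auto
    finally show "norm (V t * jm ?l t) <= 2 * wt t * (M / t ^ 6)" .
   qed (use dl sg ts in auto)
   also have "... = 4 * dl * (M * wt t) * (t / t ^ 6)" by simp
   also have "... <= 4 * dl * (M * wt t) * (1 / (sg^2 * t^2))"
   proof (rule mult_left_mono)
    have "sg^2 * t^2 <= t^2 * t^2" using sg ts by (intro mult_right_mono power_mono) auto
    also have "... = t ^ 4" by (simp add: power_add[symmetric])
    also have "... <= t ^ 5" using sg ts by (intro power_increasing) auto
    finally have "1 / t ^ 5 <= 1 / (sg^2 * t^2)" using sg ts by (intro divide_left_mono) auto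
    moreover have "t / t ^ 6 = 1 / t ^ 5" using sg ts by (simp add: power_eq_if)
    ultimately show "t / t ^ 6 <= 1 / (sg^2 * t^2)" by simp
   qed (use dl M2 wt_pos[of t] in auto)
   also have "... = ?g t" by (simp add: field_simps)
   finally show ?thesis .
  qed
  have "jP ?k (jm ?l) sg - jP ?l (jm ?l) sg = (LINT t:{sg..}|lborel. ?F t)"
   unfolding jP_eq by (rule set_integral_diff(2)[symmetric, OF jP_integrand(1)[OF ka(1) C two sg] jP_integrand(1)[OF ka(2) C two sg]])
  hence "norm (jP ?k (jm ?l) sg - jP ?l (jm ?l) sg) <= - (4 * dl / sg^2 * 1) - ?G sg"
   using tail_integral(2)[OF c g sg le G lim] by simp
  also have "... <= (4 * dl) / sg^2 * wt sg" using dl by simp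
  finally show ?thesis .
 qed
 have P: "jP ?k (jm ?k) sg - jP ?k (jm ?l) sg = jP ?k (%t. jm ?k t - jm ?l t) sg" if "sg >= 1" for sg
  by (rule jP_diff[OF ka(1) B two C two that])
 have c: "cts {1..} (%t. jm ?k t - jm ?l t)" by (intro continuous_intros B C)
 have D: "norm (jm ?k t - jm ?l t) <= (A / 2 + 2 * dl) * wt t"
  if A: "A >= 0" and le0: "!!t. t >= 1 ==> norm (jm ?k t - jm ?l t) <= A * wt t" and t: "t >= 1" for A t
 proof -
  have le: "ALL t>=1. norm (jm ?k t - jm ?l t) <= A * wt t" using le0 by blast
  note Pu = jP_deriv(1)[OF ka(1) B two] jP_bound[OF ka(1) B two]
  note Pv = jP_deriv(1)[OF ka(2) C two] jP_bound[OF ka(2) C two]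
  have "jm ?k t - jm ?l t = jT ?k (jm ?k) t - jT ?l (jm ?l) t" using jm(2)[OF ka(1) t] jm(2)[OF ka(2) t] by simp
  also have "... = - (LINT sg:{t..}|lborel. jP ?k (jm ?k) sg - jP ?l (jm ?l) sg)"
   unfolding jT_def by (simp add: set_integral_diff(2)[OF tail_wt(1)[OF Pu two t] tail_wt(1)[OF Pv two t]])
  finally have "norm (jm ?k t - jm ?l t) = norm (LINT sg:{t..}|lborel. jP ?k (jm ?k) sg - jP ?l (jm ?l) sg)" by simp
  also have "... <= (A + 4 * dl) / M * (wt t - 1)"
  proof (rule tail_wt(2))
   show "cts {1..} (%sg. jP ?k (jm ?k) sg - jP ?l (jm ?l) sg)" by (intro continuous_intros Pu(1) Pv(1))
   show "ALL sg>=1. norm (jP ?k (jm ?k) sg - jP ?l (jm ?l) sg) <= (A + 4 * dl) / sg^2 * wt sg"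
   proof (intro allI impI)
    fix sg :: real assume sg: "sg >= 1"
    have "jP ?k (jm ?k) sg - jP ?l (jm ?l) sg = jP ?k (%t. jm ?k t - jm ?l t) sg + (jP ?k (jm ?l) sg - jP ?l (jm ?l) sg)"
     unfolding P[OF sg, symmetric] by simp
    hence "norm (jP ?k (jm ?k) sg - jP ?l (jm ?l) sg) <= norm (jP ?k (%t. jm ?k t - jm ?l t) sg) + norm (jP ?k (jm ?l) sg - jP ?l (jm ?l) sg)"
     by (simp only: norm_triangle_ineq)
    also have "... <= A / sg^2 * wt sg + (4 * dl) / sg^2 * wt sg"
     by (intro add_mono jP_bound[OF ka(1) c le A, rule_format, OF sg] Pd sg)
    finally show "norm (jP ?k (jm ?k) sg - jP ?l (jm ?l) sg) <= (A + 4 * dl) / sg^2 * wt sg" by (simp add: add_divide_distrib distrib_right)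
   qed
  qed (use A dl t in auto)
  also have "... <= (A + 4 * dl) / 2 * wt t" using A dl M2 wt_ge_1[OF t] by (intro mult_mono divide_left_mono) auto
  finally show ?thesis by (simp add: add_divide_distrib)
 qed
 have m: "ALL t>=1. norm (jm ?k t - jm ?l t) <= (4 * dl) * wt t"
  using weighted_bound[OF wbounded_diff[OF jm(1)[OF ka(1)] jm(1)[OF ka(2)]] wt_pos D] by simp
 show "norm (jm ?k t - jm ?l t) <= 4 * exp M * \<bar>k - l\<bar>"
  using order_trans[OF m[rule_format, OF t] mult_left_mono[OF wt_le[OF t], of "4 * dl"]] dl by (simp add: dl_def mult_ac)
 have "jp ?k t - jp ?l t = jP ?k (%t. jm ?k t - jm ?l t) t + (jP ?k (jm ?l) t - jP ?l (jm ?l) t)"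
  unfolding P[OF t, symmetric] jp_def by simp
 hence "norm (jp ?k t - jp ?l t) <= norm (jP ?k (%t. jm ?k t - jm ?l t) t) + norm (jP ?k (jm ?l) t - jP ?l (jm ?l) t)"
  by (simp only: norm_triangle_ineq)
 also have "... <= (4 * dl) / t^2 * wt t + (4 * dl) / t^2 * wt t"
  by (intro add_mono jP_bound[OF ka(1) c m, rule_format, OF _ t] Pd t) (use dl in auto)
 also have "... = (8 * dl) / t^2 * wt t" by (simp add: field_simps)
 also have "... <= (8 * dl) / 1 * exp M" using dl t wt_le[OF t] wt_pos[of t]
  by (intro mult_mono divide_left_mono) (auto simp: one_le_power)
 finally show "norm (jp ?k t - jp ?l t) <= 8 * exp M * \<bar>k - l\<bar>" by (simp add: dl_def mult_ac)
qed


end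

section \<open>The Green operator\<close>

lemma exp_kernel_nn_integral:
 assumes al: "al > 0" and r: "r >= 1"
 shows "(\<integral>\<^sup>+t. ennreal (indicator {1..} t * exp (- al * \<bar>r - t\<bar>)) \<partial>lborel) <= ennreal (2 / al)"
proof -
 have "(\<integral>\<^sup>+t. ennreal (indicator {1..} t * exp (- al * \<bar>r - t\<bar>)) \<partial>lborel)
   <= (\<integral>\<^sup>+t. ennreal (exp (- al * (r - t))) * indicator {1..r} t + ennreal (exp (- al * (t - r))) * indicator {r..} t \<partial>lborel)"
  by (intro nn_integral_mono) (auto simp: indicator_def)
 also have "... = (\<integral>\<^sup>+t. ennreal (exp (- al * (r - t))) * indicator {1..r} t \<partial>lborel) + (\<integral>\<^sup>+t. ennreal (exp (- al * (t - r))) * indicator {r..} t \<partial>lborel)"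
  by (intro nn_integral_add) auto
 also have "(\<integral>\<^sup>+t. ennreal (exp (- al * (r - t))) * indicator {1..r} t \<partial>lborel) = ennreal (exp (- al * (r - r)) / al - exp (- al * (r - 1)) / al)"
  by (rule nn_integral_FTC_Icc)
    (use r al in "auto intro!: derivative_eq_intros simp: has_real_derivative_iff_has_vector_derivative[symmetric]")
 also have "(\<integral>\<^sup>+t. ennreal (exp (- al * (t - r))) * indicator {r..} t \<partial>lborel) = ennreal (0 - (- exp (- al * (r - r)) / al))"
 proof (rule nn_integral_FTC_atLeast[where F = "%t. - exp (- al * (t - r)) / al"])
  have "filterlim (%t. - al * (t - r)) at_bot at_top"
   using al by (intro filterlim_tendsto_neg_mult_at_bot[OF tendsto_const] filterlim_tendsto_add_at_top[of "%_. - r", simplified add.commute uminus_add_conv_diff] tendsto_const filterlim_ident) auto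
  hence "((%t. exp (- al * (t - r))) ~~> 0) at_top" by (rule filterlim_compose[OF exp_at_bot])
  hence "((%t. - exp (- al * (t - r)) / al) ~~> - 0 / al) at_top" using al by (intro tendsto_intros) auto
  thus "((%t. - exp (- al * (t - r)) / al) ~~> 0) at_top" by simp
 qed (use al in "auto intro!: derivative_eq_intros")
 also have "ennreal (exp (- al * (r - r)) / al - exp (- al * (r - 1)) / al) + ennreal (0 - (- exp (- al * (r - r)) / al)) <= ennreal (1 / al) + ennreal (1 / al)"
  using al by (intro add_mono ennreal_leI) auto
 also have "... = ennreal (2 / al)" using al by (simp add: ennreal_plus[symmetric] del: ennreal_plus)
 finally show ?thesis .
qed

definition exp_conv :: "real => (real => complex) => real => real" where
 "exp_conv al u r = (LINT t|lborel. exp (- al * \<bar>r - t\<bar>) * norm (zx u t))"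

text \<open>Schur's test on the half line: the kernel has integral at most \<open>2 / al\<close> in
  either variable, and Cauchy-Schwarz followed by Tonelli gives the bound in L^2. This kernel
  dominates the Green function.\<close>

lemma exp_conv:
 assumes al: "al > 0" and m[measurable]: "zx u : bm" and u: "u : L2 HL"
 shows "r >= 1 ==> integrable lborel (%t. exp (- al * \<bar>r - t\<bar>) * norm (zx u t))"
  "exp_conv al u : bm"
  "exp_conv al u : L2 HL" "l2norm HL (exp_conv al u) <= 2 / al * l2norm HL u"
proof -
 define U where "U t = norm (zx u t)" for t
 have U0: "U t >= 0" "t <= 1 ==> U t = 0" for t by (auto simp: U_def zext_def)
 have mm: "(%t. norm (zx u t)) : bm" by measurable
 hence [measurable]: "U : bm" by (simp add: U_def[abs_def])
 have U2: "integrable lborel (%t. (U t)^2)"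
  using L2D(2)[OF u] borel_lebesgue_1d(2)[of "%t. (U t)^2"] by (simp add: U_def)
 have U2i: "(\<integral>\<^sup>+t. ennreal ((U t)^2) \<partial>lborel) = ennreal ((l2norm HL u)^2)"
  unfolding l2norm_square using U2 borel_lebesgue_1d(3)[of "%t. (U t)^2"] by (simp add: nn_integral_eq_integral U_def)
 define K where "K r t = indicator {1..} t * exp (- al * \<bar>r - t\<bar>)" for r t :: real
 have [measurable]: "(%(r, t). K r t) : borel_measurable (borel \<Otimes>\<^sub>M borel)" unfolding K_def by measurable
 have K0: "K r t >= 0" for r t by (simp add: K_def)
 have KU: "K r t * U t = exp (- al * \<bar>r - t\<bar>) * U t" for r t
  using U0(2)[of t] by (cases "t <= 1") (auto simp: K_def)
 have Kr: "(\<integral>\<^sup>+t. ennreal (K r t) \<partial>lborel) <= ennreal (2 / al)" if "r >= 1" for r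
  unfolding K_def by (rule exp_kernel_nn_integral[OF al that])
 define N where "N r = (\<integral>\<^sup>+t. ennreal (K r t * U t) \<partial>lborel)" for r
 have Nsq: "(N r)^2 <= ennreal (2 / al) * (\<integral>\<^sup>+t. ennreal (K r t * (U t)^2) \<partial>lborel)" if "r >= 1" for r
 proof -
  have "N r = (\<integral>\<^sup>+t. ennreal (sqrt (K r t)) * ennreal (sqrt (K r t) * U t) \<partial>lborel)"
   unfolding N_def by (intro nn_integral_cong) (simp add: ennreal_mult[symmetric] U0 K0 mult.assoc[symmetric])
  hence "(N r)^2 <= (\<integral>\<^sup>+t. (ennreal (sqrt (K r t)))^2 \<partial>lborel) * (\<integral>\<^sup>+t. (ennreal (sqrt (K r t) * U t))^2 \<partial>lborel)"
   by (simp only:) (rule Cauchy_Schwarz_nn_integral; unfold K_def; measurable)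
  also have "(\<integral>\<^sup>+t. (ennreal (sqrt (K r t)))^2 \<partial>lborel) = (\<integral>\<^sup>+t. ennreal (K r t) \<partial>lborel)"
   by (intro nn_integral_cong) (simp add: ennreal_power K0)
  also have "(\<integral>\<^sup>+t. (ennreal (sqrt (K r t) * U t))^2 \<partial>lborel) = (\<integral>\<^sup>+t. ennreal (K r t * (U t)^2) \<partial>lborel)"
   by (intro nn_integral_cong) (simp add: ennreal_power K0 U0 power_mult_distrib)
  finally show ?thesis by (rule order_trans) (intro mult_right_mono Kr that, simp)
 qed
 have tot: "(\<integral>\<^sup>+r. indicator {1..} r * (\<integral>\<^sup>+t. ennreal (K r t * (U t)^2) \<partial>lborel) \<partial>lborel) <= ennreal (2 / al) * ennreal ((l2norm HL u)^2)"
 proof -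
  have "(\<integral>\<^sup>+r. indicator {1..} r * (\<integral>\<^sup>+t. ennreal (K r t * (U t)^2) \<partial>lborel) \<partial>lborel) =
    (\<integral>\<^sup>+r. (\<integral>\<^sup>+t. indicator {1..} r * ennreal (K r t * (U t)^2) \<partial>lborel) \<partial>lborel)"
   by (intro nn_integral_cong nn_integral_cmult[symmetric]) (unfold K_def, measurable)
  also have "... = (\<integral>\<^sup>+t. (\<integral>\<^sup>+r. indicator {1..} r * ennreal (K r t * (U t)^2) \<partial>lborel) \<partial>lborel)"
   by (rule lborel_pair.Fubini'[symmetric]) (unfold K_def, measurable)
  also have "... <= (\<integral>\<^sup>+t. ennreal (2 / al) * ennreal ((U t)^2) \<partial>lborel)"
  proof (intro nn_integral_mono)
   fix t :: real
   show "(\<integral>\<^sup>+r. indicator {1..} r * ennreal (K r t * (U t)^2) \<partial>lborel) <= ennreal (2 / al) * ennreal ((U t)^2)"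
   proof (cases "t >= 1")
    case True
    have "(\<integral>\<^sup>+r. indicator {1..} r * ennreal (K r t * (U t)^2) \<partial>lborel) = (\<integral>\<^sup>+r. ennreal (indicator {1..} r * exp (- al * \<bar>t - r\<bar>)) * ennreal ((U t)^2) \<partial>lborel)"
     by (intro nn_integral_cong) (use True in "auto simp: K_def indicator_def ennreal_mult[symmetric] abs_minus_commute")
    also have "... = (\<integral>\<^sup>+r. ennreal (indicator {1..} r * exp (- al * \<bar>t - r\<bar>)) \<partial>lborel) * ennreal ((U t)^2)"
     by (rule nn_integral_multc) measurable
    also have "... <= ennreal (2 / al) * ennreal ((U t)^2)" by (intro mult_right_mono exp_kernel_nn_integral al True) simp
    finally show ?thesis .
   qed (simp add: K_def)
  qed
  also have "... = ennreal (2 / al) * ennreal ((l2norm HL u)^2)" unfolding U2i[symmetric] by (rule nn_integral_cmult) measurable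
  finally show ?thesis .
 qed
 have Uint: "integrable lborel (%t. K r t * U t)" if r: "r >= 1" for r
 proof (rule integrable_mult_square)
  show "K r : borel_measurable lborel" "U : borel_measurable lborel" unfolding K_def by measurable
  have "integrable lborel (K r)"
  proof (rule integrableI_nonneg)
   show "K r : borel_measurable lborel" unfolding K_def by measurable
   show "(\<integral>\<^sup>+t. ennreal (K r t) \<partial>lborel) < \<infinity>" using Kr[OF r] by (rule le_less_trans) simp
  qed (simp add: K0)
  thus "integrable lborel (%t. (K r t)^2)"
  proof (rule Bochner_Integration.integrable_bound)
   have "K r t <= 1" for t using al by (auto simp: K_def indicator_def)
   thus "AE t in lborel. norm ((K r t)^2) <= norm (K r t)"
    using K0 by (auto simp: power2_eq_square intro!: AE_I2 mult_left_le)
  qed (unfold K_def, measurable)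
  show "integrable lborel (%t. (U t)^2)" by (rule U2)
 qed
 show int: "integrable lborel (%t. exp (- al * \<bar>r - t\<bar>) * norm (zx u t))" if "r >= 1"
  using Uint[OF that] unfolding KU by (simp add: U_def)
 have ce: "exp_conv al u r = (LINT t|lborel. K r t * U t)" for r
  unfolding exp_conv_def KU by (simp add: U_def)
 show mc: "exp_conv al u : bm"
  unfolding ce[abs_def] K_def by measurable
 have c0: "exp_conv al u r >= 0" for r unfolding ce by (simp add: K0 U0)
 have cN: "ennreal (exp_conv al u r) = N r" if "r >= 1" for r
  unfolding ce N_def by (rule nn_integral_eq_integral[symmetric, OF Uint[OF that]]) (simp add: K0 U0)
 have mz: "zx (exp_conv al u) : bm" unfolding zext_def using mc by measurable
 have main: "(\<integral>\<^sup>+r. ennreal ((norm (zx (exp_conv al u) r))^2) \<partial>lborel) <= ennreal ((2 / al * l2norm HL u)^2)"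
 proof -
  have "(\<integral>\<^sup>+r. ennreal ((norm (zx (exp_conv al u) r))^2) \<partial>lborel) <=
    (\<integral>\<^sup>+r. ennreal (2 / al) * (indicator {1..} r * (\<integral>\<^sup>+t. ennreal (K r t * (U t)^2) \<partial>lborel)) \<partial>lborel)"
  proof (intro nn_integral_mono)
   fix r :: real
   show "ennreal ((norm (zx (exp_conv al u) r))^2) <= ennreal (2 / al) * (indicator {1..} r * (\<integral>\<^sup>+t. ennreal (K r t * (U t)^2) \<partial>lborel))"
   proof (cases "r > 1")
    case True
    hence "ennreal ((norm (zx (exp_conv al u) r))^2) = (N r)^2"
     using cN[of r] c0[of r] by (simp add: zext_simps ennreal_power[symmetric])
    thus ?thesis using Nsq[of r] True by simp
   qed (simp add: zext_def)
  qed
  also have "... = ennreal (2 / al) * (\<integral>\<^sup>+r. indicator {1..} r * (\<integral>\<^sup>+t. ennreal (K r t * (U t)^2) \<partial>lborel) \<partial>lborel)"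
   by (rule nn_integral_cmult) (unfold K_def, measurable)
  also have "... <= ennreal (2 / al) * (ennreal (2 / al) * ennreal ((l2norm HL u)^2))"
   by (intro mult_left_mono tot) simp
  also have "... = ennreal ((2 / al * l2norm HL u)^2)"
   using al by (simp add: ennreal_mult[symmetric] power2_eq_square mult_ac)
  finally show ?thesis .
 qed
 have i: "integrable lborel (%r. (norm (zx (exp_conv al u) r))^2)"
 proof (rule integrableI_nonneg)
  show "(%r. (norm (zx (exp_conv al u) r))^2) : borel_measurable lborel" using mz by measurable
  show "(\<integral>\<^sup>+r. ennreal ((norm (zx (exp_conv al u) r))^2) \<partial>lborel) < \<infinity>"
   by (rule le_less_trans[OF main]) simp
 qed simp
 have ms: "(%r. (norm (zx (exp_conv al u) r))^2) : bm" using mz by measurable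
 show "exp_conv al u : L2 HL"
  unfolding L2_iff using i borel_lebesgue_1d(1)[OF mz] borel_lebesgue_1d(2)[OF ms] by simp
 have "ennreal ((l2norm HL (exp_conv al u))^2) <= ennreal ((2 / al * l2norm HL u)^2)"
  unfolding l2norm_square borel_lebesgue_1d(3)[OF ms] using main nn_integral_eq_integral[OF i] by simp
 hence "(l2norm HL (exp_conv al u))^2 <= (2 / al * l2norm HL u)^2"
  by (subst (asm) ennreal_le_iff) auto
 thus "l2norm HL (exp_conv al u) <= 2 / al * l2norm HL u"
  by (rule power2_le_imp_le) (use al in simp)
qed

text \<open>Turns the boundary value into the linear bound near \<open>1\<close> on which
  \<open>H10_grad_emb\<close> is based.\<close>

lemma dirichlet_bound:
 fixes v v' :: "real => complex"
 assumes "cts {1..} v" "cts {1..} v'" "!!r. r > 1 ==> (v hvd v' r) (at r)" "v 1 = 0"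
 obtains C where "!!r. 1 < r ==> r <= 3 ==> norm (v r) <= C * (r - 1)"
proof -
 have "bounded (v' ` {1..3})"
  by (intro compact_imp_bounded compact_continuous_image continuous_on_subset[OF assms(2)]) auto
 then obtain C where C: "!!r. r : {1..3} ==> norm (v' r) <= C" unfolding bounded_iff by blast
 show ?thesis
 proof
  fix r :: real assume r: "1 < r" "r <= 3"
  have "EX x:{1<..<r}. norm (v r - v 1) <= norm ((r - 1) *R v' x)"
   by (rule mvt_general[OF r(1)])
     (use r assms(1,3) in "auto simp: has_vector_derivative_def[symmetric] intro: continuous_on_subset")
  then obtain x where x: "1 < x" "x < r" "norm (v r) <= (r - 1) * norm (v' x)" using assms(4) r by auto
  hence "norm (v r) <= (r - 1) * C" using C[of x] r by (auto intro: order_trans mult_left_mono)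
  thus "norm (v r) <= C * (r - 1)" by (simp add: mult.commute)
 qed
qed

text \<open>The value of \<open>d\<close> at \<open>1\<close> is left free on purpose. Off the
  spectrum \<open>d 1 = 0\<close> gives the resolvent; at an eigenvalue, where the Jost solution
  itself vanishes at \<open>1\<close>, any independent \<open>d\<close> solves the equation for data
  orthogonal to it.\<close>

locale green = potential +
 fixes ka :: complex and d d' :: "real => complex" and om :: complex and C :: real
 assumes ka: "Re ka > 0" and d: "solution ka d d'" and om: "om = jost ka 1 * d' 1 - jost' ka 1 * d 1" "om ~= 0"
  and C: "C >= 0" "!!r. r >= 1 ==> norm (jost ka r) <= C * exp (- Re ka * r)" "!!r. r >= 1 ==> norm (jost' ka r) <= C * exp (- Re ka * r)"
   "!!r. r >= 1 ==> norm (d r) <= C * exp (Re ka * r)" "!!r. r >= 1 ==> norm (d' r) <= C * exp (Re ka * r)"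
begin

abbreviation (input) e where "e \<equiv> jost ka"
abbreviation (input) e' where "e' \<equiv> jost' ka"

lemma e_solution: "solution ka e e'" using ka by (intro jost_solution) simp

lemma wronskian: "r >= 1 ==> e r * d' r - e' r * d r = om"
 unfolding om(1) by (rule solution_wronskian[OF e_solution d])

lemma ed:
 "cts {1..} e" "cts {1..} e'" "cts {1..} d" "cts {1..} d'"
 "r > 1 ==> (e hvd e' r) (at r)" "r > 1 ==> (e' hvd (ka^2 - V r) * e r) (at r)"
 "r > 1 ==> (d hvd d' r) (at r)" "r > 1 ==> (d' hvd (ka^2 - V r) * d r) (at r)"
 using e_solution d by (auto simp: solution_def)

lemma ed_borel: "zx e : bm" "zx e' : bm"
 "zx d : bm" "zx d' : bm"
 using ed(1-4) by (auto intro!: borel_zext_continuous intro: continuous_on_subset)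

definition ga :: "(real => complex) => real => complex" where
 "ga u r = (LINT t|lborel. (if t <= r then zx d t * zx u t else 0))"

definition gb :: "(real => complex) => real => complex" where
 "gb u r = (LINT t|lborel. (if r <= t then zx e t * zx u t else 0))"

text \<open>Variation of constants: the Green function is
  \<open>e (max r t) * d (min r t) / om\<close>. In the derivative the contributions of the moving
  end points cancel, which leads to \<open>gv'\<close>.\<close>

definition gv :: "(real => complex) => real => complex" where "gv u r = (e r * ga u r + d r * gb u r) / om"
definition gv' :: "(real => complex) => real => complex" where "gv' u r = (e' r * ga u r + d' r * gb u r) / om"

text \<open>The growth of \<open>d\<close> at the smaller argument is outweighed by the decay of
  \<open>e\<close> at the larger one. \<open>x\<close> and \<open>y\<close> stand for the values at
  \<open>r\<close> of \<open>e\<close> and \<open>d\<close> or of their derivatives, so that one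
  estimate serves both \<open>gv\<close> and \<open>gv'\<close>.\<close>

lemma kernel_bounds:
 assumes "r >= 1" "norm x <= C * exp (- Re ka * r)" "norm y <= C * exp (Re ka * r)"
 shows "norm (if t <= r then x * (zx d t * zx u t) else 0) <= C^2 * (exp (- Re ka * \<bar>r - t\<bar>) * norm (zx u t))"
  "norm (if r <= t then y * (zx e t * zx u t) else 0) <= C^2 * (exp (- Re ka * \<bar>r - t\<bar>) * norm (zx u t))"
proof -
 have 1: "norm (x * (zx d t * zx u t)) <= C^2 * (exp (- Re ka * \<bar>r - t\<bar>) * norm (zx u t))" if "t <= r"
 proof (cases "t > 1")
  case True
  have "norm x * norm (d t) <= (C * exp (- Re ka * r)) * (C * exp (Re ka * t))"
   using assms(2) C(4)[of t] True C(1) by (intro mult_mono) auto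
  also have "... = C^2 * exp (- Re ka * \<bar>r - t\<bar>)" using that by (simp add: power2_eq_square mult_exp_exp algebra_simps)
  finally have "norm x * norm (d t) * norm (u t) <= C^2 * exp (- Re ka * \<bar>r - t\<bar>) * norm (u t)" by (rule mult_right_mono) simp
  thus ?thesis using True by (simp add: zext_simps norm_mult mult.assoc)
 qed (simp add: zext_simps)
 have 2: "norm (y * (zx e t * zx u t)) <= C^2 * (exp (- Re ka * \<bar>r - t\<bar>) * norm (zx u t))" if "r <= t"
 proof (cases "t > 1")
  case True
  have "norm y * norm (e t) <= (C * exp (Re ka * r)) * (C * exp (- Re ka * t))"
   using assms(3) C(2)[of t] True C(1) by (intro mult_mono) auto
  also have "... = C^2 * exp (- Re ka * \<bar>r - t\<bar>)" using that by (simp add: power2_eq_square mult_exp_exp algebra_simps)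
  finally have "norm y * norm (e t) * norm (u t) <= C^2 * exp (- Re ka * \<bar>r - t\<bar>) * norm (u t)" by (rule mult_right_mono) simp
  thus ?thesis using True by (simp add: zext_simps norm_mult mult.assoc)
 qed (simp add: zext_simps)
 show "norm (if t <= r then x * (zx d t * zx u t) else 0) <= C^2 * (exp (- Re ka * \<bar>r - t\<bar>) * norm (zx u t))"
  "norm (if r <= t then y * (zx e t * zx u t) else 0) <= C^2 * (exp (- Re ka * \<bar>r - t\<bar>) * norm (zx u t))"
  using 1 2 by auto
qed

context
 fixes u :: "real => complex"
 assumes m[measurable]: "zx u : bm" and u: "u : L2 HL"
begin

lemma kernel_integrable:
 assumes "r >= 1"
 shows "integrable lborel (%t. if t <= r then zx d t * zx u t else 0)"
  "integrable lborel (%t. if r <= t then zx e t * zx u t else 0)"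
proof -
 note [measurable] = ed_borel
 let ?x = "cx (exp (- Re ka * r))" and ?y = "cx (exp (Re ka * r))"
 note i = exp_conv(1)[OF ka m u assms]
 have C1: "norm x <= C * exp q" if "C ~= 0" "x = C * exp q" for x q using that C(1) by simp
 have kb: "integrable lborel (%t. if t <= r then (C * ?x) * (zx d t * zx u t) else 0)"
  "integrable lborel (%t. if r <= t then (C * ?y) * (zx e t * zx u t) else 0)"
  by (rule Bochner_Integration.integrable_bound[OF integrable_mult_right[OF i, of "C^2"]], measurable,
    rule AE_I2, rule order_trans[OF kernel_bounds(1)[OF assms, of _ 0]], use C(1) in "simp_all add: norm_mult")
    (rule Bochner_Integration.integrable_bound[OF integrable_mult_right[OF i, of "C^2"]], measurable,
    rule AE_I2, rule order_trans[OF kernel_bounds(2)[OF assms, of 0]], use C(1) in "simp_all add: norm_mult")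
 have "C ~= 0"
 proof
  assume "C = 0"
  hence "e 1 = 0" "e' 1 = 0" using C(2)[of 1] C(3)[of 1] by auto
  thus False using om by simp
 qed
 have *: "integrable lborel (%t. if P t then f t else 0)" if "integrable lborel (%t. if P t then z * f t else 0)" "z ~= 0"
  for P and f :: "real => complex" and z
 proof -
  have "integrable lborel (%t. inverse z * (if P t then z * f t else 0))" by (intro integrable_mult_right that)
  moreover have "inverse z * (if P t then z * f t else 0) = (if P t then f t else 0)" for t using that(2) by simp
  ultimately show ?thesis by simp
 qed
 show "integrable lborel (%t. if t <= r then zx d t * zx u t else 0)"
  "integrable lborel (%t. if r <= t then zx e t * zx u t else 0)"
  by (rule *[OF kb(1)] *[OF kb(2)]; use \<open>C ~= 0\<close> in simp)+
qed

lemma gv_bound: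
 assumes "r >= 1" "norm x <= C * exp (- Re ka * r)" "norm y <= C * exp (Re ka * r)"
 shows "norm ((x * ga u r + y * gb u r) / om) <= 2 * C^2 / norm om * exp_conv (Re ka) u r"
proof -
 note i = exp_conv(1)[OF ka m u assms(1)]
 have "x * ga u r = (LINT t|lborel. (if t <= r then x * (zx d t * zx u t) else 0))"
  unfolding ga_def by (subst integral_mult_right_zero[symmetric]) (intro Bochner_Integration.integral_cong, auto)
 also have "norm ... <= (LINT t|lborel. C^2 * (exp (- Re ka * \<bar>r - t\<bar>) * norm (zx u t)))"
  by (rule order_trans[OF integral_norm_bound integral_mono'[OF integrable_mult_right[OF i]]], rule kernel_bounds(1)[OF assms], simp)
 finally have 1: "norm (x * ga u r) <= C^2 * exp_conv (Re ka) u r" by (simp add: exp_conv_def)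
 have "y * gb u r = (LINT t|lborel. (if r <= t then y * (zx e t * zx u t) else 0))"
  unfolding gb_def by (subst integral_mult_right_zero[symmetric]) (intro Bochner_Integration.integral_cong, auto)
 also have "norm ... <= (LINT t|lborel. C^2 * (exp (- Re ka * \<bar>r - t\<bar>) * norm (zx u t)))"
  by (rule order_trans[OF integral_norm_bound integral_mono'[OF integrable_mult_right[OF i]]], rule kernel_bounds(2)[OF assms], simp)
 finally have 2: "norm (y * gb u r) <= C^2 * exp_conv (Re ka) u r" by (simp add: exp_conv_def)
 have "norm (x * ga u r + y * gb u r) <= 2 * C^2 * exp_conv (Re ka) u r"
  using norm_triangle_ineq[of "x * ga u r" "y * gb u r"] 1 2 by linarith
 thus ?thesis by (simp add: norm_divide divide_right_mono)
qed

lemma gv_borel: "zx (gv u) : bm" "zx (gv' u) : bm"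
proof -
 note [measurable] = ed_borel
 have [measurable]: "ga u : bm" "gb u : bm"
  unfolding ga_def[abs_def] gb_def[abs_def] by measurable
 have "zx (gv u) = (%r. (zx e r * ga u r + zx d r * gb u r) / om)"
  "zx (gv' u) = (%r. (zx e' r * ga u r + zx d' r * gb u r) / om)"
  by (auto simp: zext_def gv_def gv'_def indicator_def)
 thus "zx (gv u) : bm" "zx (gv' u) : bm"
  by simp_all
qed

lemma gv_L2:
 "gv u : L2 HL" "gv' u : L2 HL"
 "l2norm HL (gv u) <= (4 * C^2 / (norm om * Re ka)) * l2norm HL u"
 "l2norm HL (gv' u) <= (4 * C^2 / (norm om * Re ka)) * l2norm HL u"
proof -
 let ?K = "2 * C^2 / norm om"
 have K: "?K >= 0" by simp
 note c = exp_conv(3,4)[OF ka m u]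
 have cL: "(%r. ?K * exp_conv (Re ka) u r) : L2 HL" by (rule L2_mult_const[OF c(1)])
 have b0: "norm (gv u r) <= ?K * exp_conv (Re ka) u r" "norm (gv' u r) <= ?K * exp_conv (Re ka) u r" if "r : HL" for r
  using gv_bound[of r "e r" "d r"] gv_bound[of r "e' r" "d' r"] C that by (auto simp: gv_def gv'_def)
 have b: "norm (gv u r) <= norm (?K * exp_conv (Re ka) u r)" "norm (gv' u r) <= norm (?K * exp_conv (Re ka) u r)" if "r : HL" for r
  using order_trans[OF b0(1)[OF that] abs_ge_self] order_trans[OF b0(2)[OF that] abs_ge_self] by simp_all
 show L: "gv u : L2 HL" "gv' u : L2 HL"
  by (rule L2_bound[OF cL borel_lebesgue_1d(1)[OF gv_borel(1)] b(1)] L2_bound[OF cL borel_lebesgue_1d(1)[OF gv_borel(2)] b(2)]; assumption)+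
 have n: "l2norm HL (%r. ?K * exp_conv (Re ka) u r) <= (4 * C^2 / (norm om * Re ka)) * l2norm HL u"
 proof -
  have "l2norm HL (%r. ?K * exp_conv (Re ka) u r) = l2norm HL (%r. cx ?K * cx (exp_conv (Re ka) u r))"
   by (rule l2norm_cong_norm) (simp add: norm_mult norm_divide norm_power abs_mult)
  also have "... = ?K * l2norm HL (%r. cx (exp_conv (Re ka) u r))"
   unfolding l2norm_cmult by (simp add: norm_divide norm_mult norm_power)
  also have "l2norm HL (%r. cx (exp_conv (Re ka) u r)) = l2norm HL (exp_conv (Re ka) u)"
   by (rule l2norm_cong_norm) simp
  also have "?K * l2norm HL (exp_conv (Re ka) u) <= ?K * (2 / Re ka * l2norm HL u)" by (intro mult_left_mono c K)
  finally show ?thesis by simp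
 qed
 show "l2norm HL (gv u) <= (4 * C^2 / (norm om * Re ka)) * l2norm HL u"
  by (rule order_trans[OF l2norm_mono[OF L(1) cL b(1)] n])
 show "l2norm HL (gv' u) <= (4 * C^2 / (norm om * Re ka)) * l2norm HL u"
  by (rule order_trans[OF l2norm_mono[OF L(2) cL b(2)] n])
qed

end

lemma gv_diff:
 assumes "zx u : bm" "u : L2 HL" "zx w : bm" "w : L2 HL" "r >= 1"
 shows "gv u r - gv w r = gv (%t. u t - w t) r" "gv' u r - gv' w r = gv' (%t. u t - w t) r"
proof -
 note i = kernel_integrable[OF assms(1,2,5)] kernel_integrable[OF assms(3,4,5)]
 have "ga u r - ga w r = ga (%t. u t - w t) r"
  unfolding ga_def by (subst Bochner_Integration.integral_diff[symmetric, OF i(1,3)])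
   (intro Bochner_Integration.integral_cong, auto simp: zext_diff right_diff_distrib)
 moreover have "gb u r - gb w r = gb (%t. u t - w t) r"
  unfolding gb_def by (subst Bochner_Integration.integral_diff[symmetric, OF i(2,4)])
   (intro Bochner_Integration.integral_cong, auto simp: zext_diff right_diff_distrib)
 ultimately show "gv u r - gv w r = gv (%t. u t - w t) r" "gv' u r - gv' w r = gv' (%t. u t - w t) r"
  unfolding gv_def gv'_def by (simp_all add: diff_divide_distrib[symmetric] add_divide_distrib[symmetric] algebra_simps flip: \<open>ga u r - ga w r = ga (%t. u t - w t) r\<close>)
qed

text \<open>For continuous data of compact support the formula can be differentiated. Its boundary
  value is a multiple of \<open>d 1 * gb u 1\<close>: the Dirichlet condition holds if
  \<open>d 1 = 0\<close> or if \<open>u\<close> has zero pairing with the Jost solution.\<close>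

lemma gv_classical:
 assumes u: "cts UNIV u" "!!r. r ~: {a..b} ==> u r = 0" "1 < a"
 shows "cts {1..} (gv u)" "cts {1..} (gv' u)"
  "r > 1 ==> (gv u hvd gv' u r) (at r)"
  "r > 1 ==> (gv' u hvd (ka^2 - V r) * gv u r - u r) (at r)"
  "gv u 1 = d 1 * gb u 1 / om"
proof -
 have u1: "u r = 0" if "r <= 1" for r using u(2)[of r] u(3) that by auto
 have uz: "zx u = u" using u1 by (intro ext) (auto simp: zext_def indicator_def)
 have cu: "cts S u" for S using u(1) by (rule continuous_on_subset) simp
 have ub: "u t = 0" if "~ t <= b" for t using u(2)[of t] that by auto
 have cont: "cts {1..} (%t. d t * u t)" "cts {1..} (%t. e t * u t)"
  by (intro continuous_intros ed cu)+
 have "bounded {r. u r ~= 0}" by (rule bounded_support_interval[OF u(2)])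
 have uL: "u : L2 HL"
  by (rule continuous_support_L2[OF u(1) bounded_support_interval[OF u(2)]]) (auto simp: u1)
 have um: "zx u : bm" unfolding uz by (rule borel_measurable_continuous_onI[OF u(1)])
 have i: "set_integrable lborel {1..} (%t. g t * u t)" if "cts {1..} (%t. g t * u t)" for g :: "real => complex"
 proof -
  have "(%t. indicator {1..} t *R (g t * u t)) = (%t. indicator {1..max 1 b} t *R (g t * u t))"
   using ub by (intro ext) (auto simp: indicator_def le_max_iff_disj)
  moreover have "integrable lborel (%t. indicator {1..max 1 b} t *R (g t * u t))"
   by (rule borel_integrable_compact[OF compact_Icc continuous_on_subset[OF that]]) auto
  ultimately show ?thesis by (simp add: set_integrable_def)
 qed
 have gb: "gb u r = (LINT t:{r..}|lborel. e t * u t)" if "r >= 1" for r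
  unfolding gb_def set_lebesgue_integral_def
  by (intro Bochner_Integration.integral_cong) (use that u1 in "auto simp: zext_def indicator_def not_less")
 have ga: "ga u r = (LINT t:{1..}|lborel. d t * u t) - (LINT t:{r..}|lborel. d t * u t)" if "r >= 1" for r
 proof -
  have i1: "set_integrable lborel {1..} (%t. d t * u t)" by (rule i[OF cont(1)])
  have i2: "set_integrable lborel {r..} (%t. d t * u t)" by (rule set_integrable_subset[OF i1]) (use that in auto)
  have "(LINT t:{1..}|lborel. d t * u t) - (LINT t:{r..}|lborel. d t * u t) =
   (LINT t|lborel. indicator {1..} t *R (d t * u t) - indicator {r..} t *R (d t * u t))"
   unfolding set_lebesgue_integral_def using i1 i2 by (intro Bochner_Integration.integral_diff[symmetric]) (auto simp: set_integrable_def)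
  also have "... = ga u r"
   unfolding ga_def
  proof (rule integral_cong_AE)
   show "AE t in lborel. indicator {1..} t *R (d t * u t) - indicator {r..} t *R (d t * u t) = (if t <= r then zx d t * zx u t else 0)"
    using AE_lborel_singleton[of r]
    by eventually_elim (use that u1 in "auto simp: zext_def indicator_def not_less")
  qed (use i1 i2 kernel_integrable(1)[OF um uL that] in "auto simp: set_integrable_def")
  finally show ?thesis ..
 qed
 note T1 = tail_integral_FTC[OF cont(1) i[OF cont(1)]] and T2 = tail_integral_FTC[OF cont(2) i[OF cont(2)]]
 have ca: "cts {1..} (ga u)"
  by (rule continuous_on_eq[of _ "%r. (LINT t:{1..}|lborel. d t * u t) - (LINT t:{r..}|lborel. d t * u t)"])
    (auto intro!: continuous_intros T1(1) simp: ga)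
 have cb: "cts {1..} (gb u)"
  by (rule continuous_on_eq[OF T2(1)]) (auto simp: gb)
 have da: "(ga u hvd d r * u r) (at r)" if "r > 1" for r
 proof -
  have "((%r. (LINT t:{1..}|lborel. d t * u t) - (LINT t:{r..}|lborel. d t * u t)) hvd d r * u r) (at r)"
   using has_vector_derivative_diff[OF has_vector_derivative_const T1(2)[OF that]] by simp
  thus ?thesis
   by (rule has_vector_derivative_transform_within_open[of _ _ _ "{1<..}"]) (use that ga in auto)
 qed
 have db: "(gb u hvd - (e r * u r)) (at r)" if "r > 1" for r
  using T2(2)[OF that] by (rule has_vector_derivative_transform_within_open[of _ _ _ "{1<..}"]) (use that gb in auto)
 show "cts {1..} (gv u)" "cts {1..} (gv' u)"
  unfolding gv_def[abs_def] gv'_def[abs_def] using om(2) by (auto intro!: continuous_intros ed ca cb)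
 show "(gv u hvd gv' u r) (at r)" if r: "r > 1"
 proof -
  have "(gv u hvd ((e r * (d r * u r) + e' r * ga u r) + (d r * - (e r * u r) + d' r * gb u r)) / om) (at r)"
   unfolding gv_def[abs_def]
   by (intro has_vector_derivative_divide has_vector_derivative_add has_vector_derivative_mult ed da db r)
  thus ?thesis by (simp add: gv'_def algebra_simps)
 qed
 show "(gv' u hvd (ka^2 - V r) * gv u r - u r) (at r)" if r: "r > 1"
 proof -
  have *: "(gv' u hvd ((e' r * (d r * u r) + ((ka^2 - V r) * e r) * ga u r) + (d' r * - (e r * u r) + ((ka^2 - V r) * d r) * gb u r)) / om) (at r)"
   unfolding gv'_def[abs_def]
   by (intro has_vector_derivative_divide has_vector_derivative_add has_vector_derivative_mult ed da db r)
  have w: "e r * d' r - e' r * d r = om" using wronskian[of r] r by simp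
  have "((e' r * (d r * u r) + ((ka^2 - V r) * e r) * ga u r) + (d' r * - (e r * u r) + ((ka^2 - V r) * d r) * gb u r))
   = (ka^2 - V r) * (e r * ga u r + d r * gb u r) - (e r * d' r - e' r * d r) * u r" by (simp add: algebra_simps)
  hence "((e' r * (d r * u r) + ((ka^2 - V r) * e r) * ga u r) + (d' r * - (e r * u r) + ((ka^2 - V r) * d r) * gb u r)) / om
    = (ka^2 - V r) * gv u r - u r"
   unfolding w gv_def using om(2) by (simp add: diff_divide_distrib)
  with * show ?thesis by (simp only:)
 qed
 have "ga u 1 = 0" using ga[of 1] by simp
 thus "gv u 1 = d 1 * gb u 1 / om" by (simp add: gv_def)
qed

end

lemma exp_decay_L2:
 fixes v :: "real => complex"
 assumes al: "al > 0" and c: "cts HL v" and b: "!!t. t > 1 ==> norm (v t) <= B * exp (- al * t)"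
 shows "v : L2 HL"
proof -
 note m = borel_zext_continuous[OF c]
 let ?g = "%t. indicator {1..} t * exp (- (2 * al) * \<bar>1 - t\<bar>)"
 have i: "integrable lborel ?g"
 proof (rule integrableI_nonneg)
  show "(\<integral>\<^sup>+t. ennreal (?g t) \<partial>lborel) < \<infinity>"
   using exp_kernel_nn_integral[of "2 * al" 1] al by (auto intro: le_less_trans)
 qed auto
 have "integrable lborel (%t. (norm (zx v t))^2)"
 proof (rule Bochner_Integration.integrable_bound[OF integrable_mult_right[OF i, of "B^2"]])
  show "(%t. (norm (zx v t))^2) : borel_measurable lborel" using m by measurable
  have "(norm (v t))^2 <= B^2 * exp (- (2 * al) * (t - 1))" if "t > 1" for t
  proof -
   have "(norm (v t))^2 <= (B * exp (- al * t))^2" using b[of t] that by (intro power_mono) auto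
   also have "... = B^2 * exp (- (2 * al) * t)" by (simp add: power_mult_distrib exp_of_nat_mult[symmetric] algebra_simps)
   also have "... <= B^2 * exp (- (2 * al) * (t - 1))" using al by (intro mult_left_mono) (auto simp: algebra_simps)
   finally show ?thesis .
  qed
  thus "AE t in lborel. norm ((norm (zx v t))^2) <= norm (B^2 * ?g t)"
   by (intro AE_I2) (auto simp: zext_def indicator_def)
 qed
 thus ?thesis
  unfolding L2_iff using borel_lebesgue_1d(1)[OF m] borel_lebesgue_1d(2)[of "%t. (norm (zx v t))^2"] m by simp
qed

section \<open>The Green operator for square integrable data\<close>

context green
begin

abbreviation (input) "gK \<equiv> 4 * C^2 / (norm om * Re ka)"

text \<open>The second derivative of \<open>gv u\<close>, read off from the equation so that it
  makes sense for every square integrable \<open>u\<close>.\<close>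

definition gw :: "(real => complex) => real => complex" where "gw u r = (ka^2 - V r) * gv u r - u r"

lemma e_L2: "e : L2 HL"
 by (rule exp_decay_L2[OF ka continuous_on_subset[OF ed(1)] C(2)]) auto

lemma gb_eq:
 assumes [measurable]: "zx u : bm"
 shows "gb u 1 = (LINT r:HL|leb. u r * e r)"
proof -
 note [measurable] = ed_borel
 have "gb u 1 = (LINT t|lborel. zx (%r. u r * e r) t)"
  unfolding gb_def by (intro Bochner_Integration.integral_cong) (auto simp: zext_def indicator_def)
 also have "... = (LINT t|leb. zx (%r. u r * e r) t)"
  by (rule borel_lebesgue_1d(3)[symmetric]) (simp add: zext_mult[abs_def])
 finally show ?thesis by (simp add: set_integral_zext)
qed

lemma gw_L2:
 assumes m: "zx u : bm" and u: "u : L2 HL"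
 shows "zx (gw u) : bm" "gw u : L2 HL"
  "l2norm HL (gw u) <= (((norm ka)^2 + M) * gK + 1) * l2norm HL u"
proof -
 let ?c = "cx ((norm ka)^2 + M)"
 have "zx V : bm"
  by (rule borel_zext_continuous[OF continuous_on_subset[OF contV]]) auto
 moreover have "zx (gw u) = (%r. (ka^2 - cx (zx V r)) * zx (gv u) r - zx u r)"
  by (auto simp: zext_def gw_def indicator_def)
 ultimately show mw: "zx (gw u) : bm" using gv_borel(1)[OF m u] m by simp
 have s: "gw u = (%r. (gw u r + u r) - u r)" by simp
 have b: "norm (gw u r + u r) <= norm (?c * gv u r)" if "r : HL" for r
 proof -
  have "norm (ka^2 - cx (V r)) <= (norm ka)^2 + M"
   using norm_triangle_ineq4[of "ka^2" "cx (V r)"] V_bound[of r] that by (simp add: norm_power)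
  also have "... = norm ?c" using M2 by (simp only: norm_of_real abs_of_nonneg add_nonneg_nonneg zero_le_power2)
  finally show ?thesis by (simp add: gw_def norm_mult mult_right_mono)
 qed
 have mz: "zx (%r. gw u r + u r) : bm" unfolding zext_add[abs_def] using mw m by measurable
 note L = L2_bound[OF L2_cmult[OF gv_L2(1)[OF m u]] borel_lebesgue_1d(1)[OF mz] b]
 show "gw u : L2 HL" by (subst s) (rule L2_diff[OF L u])
 have "l2norm HL (gw u) <= l2norm HL (%r. gw u r + u r) + l2norm HL (%r. - u r)"
  using l2norm_triangle[OF L L2_minus[OF u]] by simp
 also have "l2norm HL (%r. gw u r + u r) <= l2norm HL (%r. ?c * gv u r)"
  by (rule l2norm_mono[OF L L2_cmult[OF gv_L2(1)[OF m u]] b])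
 also have "... <= ((norm ka)^2 + M) * (gK * l2norm HL u)"
  unfolding l2norm_cmult norm_of_real using gv_L2(3)[OF m u] M2 by (intro mult_mono) auto
 also have "l2norm HL (%r. - u r) = l2norm HL u" by (rule l2norm_cong_norm) simp
 finally show "l2norm HL (gw u) <= (((norm ka)^2 + M) * gK + 1) * l2norm HL u" by (simp add: algebra_simps)
qed

lemma gv_classical_H10:
 assumes u: "cts UNIV u" "!!r. r ~: {a..b} ==> u r = 0" "1 < a" and ort: "d 1 * gb u 1 = 0"
 shows "H10_grad Omega (emb (gv u)) (egrad (gv u) (gv' u))" "has_weak_laplacian Omega (emb (gv u)) (emb (gw u))"
proof -
 note g = gv_classical[of u a b, OF u]
 have 0: "gv u 1 = 0" using g(5) ort by simp
 have "zx u = u" using u(2,3) by (intro ext) (auto simp: zext_def indicator_def)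
 hence m: "zx u : bm" using borel_measurable_continuous_onI[OF u(1)] by simp
 have L: "u : L2 HL"
  by (rule continuous_support_L2[OF u(1) bounded_support_interval[OF u(2)]]) (use u(2,3) in auto)
 have "cts HL (gw u)" unfolding gw_def[abs_def]
  by (intro continuous_intros continuous_on_subset[OF u(1)] continuous_on_subset[OF g(1)] continuous_on_subset[OF contV]) auto
 moreover obtain B where "!!r. 1 < r ==> r <= 3 ==> norm (gv u r) <= B * (r - 1)"
  using dirichlet_bound[OF g(1,2,3) 0] by blast
 ultimately show "H10_grad Omega (emb (gv u)) (egrad (gv u) (gv' u))" "has_weak_laplacian Omega (emb (gv u)) (emb (gw u))"
  using g(3,4) gv_L2(1,2)[OF m L] by (auto intro!: H10_grad_emb emb_weak_laplacian simp: gw_def)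
qed

text \<open>Density and closedness extend the classical case. The approximants of \<open>u\<close>
  have to keep the boundary condition, so a multiple \<open>c n\<close> of a fixed \<open>et\<close>
  is subtracted; \<open>c n\<close> tends to zero because the pairing with the Jost solution is
  continuous in L^2.\<close>

lemma gv_H10:
 assumes m: "zx u : bm" and u: "u : L2 HL" and ort: "d 1 * gb u 1 = 0"
 shows "emb (gv u) : H10 Omega" "has_weak_laplacian Omega (emb (gv u)) (emb (gw u))" "emb (gw u) : L2 Omega"
  "emb (gv u) : L2 Omega" "l2norm Omega (emb (gv u)) <= gK * l2norm Omega (emb u)"
proof -
 let ?cc = "%w a b. cts UNIV w & 1 < a & (ALL r. r ~: {a..b} --> w r = 0)"
 have ccD: "zx w : bm & w : L2 HL" if "?cc w a b" for w :: "real => complex" and a b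
 proof -
  have "zx w = w" using that by (intro ext) (auto simp: zext_def indicator_def)
  moreover have "w : L2 HL"
   by (rule continuous_support_L2[OF _ bounded_support_interval[of a b]]) (use that in auto)
  ultimately show ?thesis using that borel_measurable_continuous_onI[of w] by simp
 qed
 \<comment> \<open>Either some admissible function has nonzero pairing with the Jost solution and is
   normalised to \<open>1\<close>, or all admissible functions have zero pairing and every
   approximant is good as it is.\<close>
 obtain et a b where et: "?cc et a b" "gb et 1 = 1 | (ALL w a b. ?cc w a b --> gb w 1 = 0)"
 proof (cases "ALL w a b. ?cc w a b --> gb w 1 = 0")
  case True
  thus ?thesis using that[of "%_. 0" 2 3] by auto
 next
  case False
  then obtain w a b where w: "?cc w a b" "gb w 1 ~= 0" by blast
  have wg: "?cc (%r. w r / gb w 1) a b" using w by (auto intro!: continuous_intros)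
  have "gb (%r. w r / gb w 1) 1 = (LINT r:HL|leb. w r * e r) / gb w 1"
   using gb_eq[of "%r. w r / gb w 1"] ccD[OF wg] by simp
  thus ?thesis using that[OF wg] gb_eq[of w] ccD[OF w(1)] w(2) by simp
 qed
 obtain v where v: "!!n. cts UNIV (v n)" "!!n r. r ~: {1 + inverse (real (Suc n))..2 * real (Suc n)} ==> v n r = 0"
  "!!n. v n : L2 HL" "(%n. l2norm HL (%r. v n r - u r)) ---> 0" using HL_L2_approx[OF u] by blast
 define c where "c n = gb (v n) 1 - gb u 1" for n
 define w where "w n r = v n r - c n * et r" for n r
 have vcc: "?cc (v n) (1 + inverse (real (Suc n))) (2 * real (Suc n))" for n using v(1,2)[of n] v(2)[of _ n] by auto
 have wcc: "?cc (w n) (min a (1 + inverse (real (Suc n)))) (max b (2 * real (Suc n)))" for n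
  using vcc[of n] et(1) by (auto simp: w_def min_le_iff_disj le_max_iff_disj intro!: continuous_intros)
 note vD = ccD[OF vcc] and wD = ccD[OF wcc] and etD = ccD[OF et(1)]
 have c0: "c ---> 0"
  using tendsto_diff[OF L2_mult_tendsto[OF v(3) u e_L2 v(4)] tendsto_const[of "gb u 1"]]
  by (simp add: c_def[abs_def] gb_eq vD m)
 have gbw: "d 1 * gb (w n) 1 = 0" for n
 proof (cases "gb et 1 = 1")
  case True
  have "gb (w n) 1 = gb (v n) 1 - c n * gb et 1"
   using L2_mult_integrable[OF v(3) e_L2, of n] L2_mult_integrable[OF etD[THEN conjunct2] e_L2] vD wD etD
   by (subst (1 2 3) gb_eq) (auto simp: w_def left_diff_distrib mult.assoc)
  thus ?thesis using ort True by (simp add: c_def)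
 next
  case False
  hence "gb (w n) 1 = 0" using et(2) wcc[of n] by blast
  thus ?thesis by simp
 qed
 have lw: "(%n. l2norm HL (%r. w n r - u r)) ---> 0"
 proof (rule tendsto_sandwich[OF _ _ tendsto_const[of 0]])
  show "(%n. l2norm HL (%r. v n r - u r) + norm (c n) * l2norm HL et) ---> 0"
   using tendsto_add[OF v(4) tendsto_mult_left_zero[OF tendsto_norm_zero[OF c0], of "l2norm HL et"]] by simp
  have "l2norm HL (%r. w n r - u r) <= l2norm HL (%r. v n r - u r) + norm (c n) * l2norm HL et" for n
   using l2norm_triangle[OF L2_diff[OF v(3)[of n] u] L2_cmult[OF etD[THEN conjunct2], of "- c n"]]
   unfolding l2norm_cmult by (simp add: w_def algebra_simps)
  thus "\<forall>\<^sub>F n in sequentially. l2norm HL (%r. w n r - u r) <= l2norm HL (%r. v n r - u r) + norm (c n) * l2norm HL et"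
   by simp
 qed simp
 have dm: "zx (%r. w n r - u r) : bm" "(%r. w n r - u r) : L2 HL" for n
  unfolding zext_diff[abs_def] using wD[of n] m u by (auto intro: L2_diff)
 have lim: "(%n. l2norm HL (%r. G (w n) r - G u r)) ---> 0"
  if "!!n. l2norm HL (G (%r. w n r - u r)) <= K * l2norm HL (%r. w n r - u r)"
   and "!!n r. r >= 1 ==> G (w n) r - G u r = G (%t. w n t - u t) r" for G :: "(real => complex) => real => complex" and K
 proof (rule tendsto_sandwich[OF _ _ tendsto_const[of 0]])
  have "l2norm HL (%r. G (w n) r - G u r) = l2norm HL (G (%r. w n r - u r))" for n
   by (rule l2norm_cong_norm) (simp add: that(2))
  thus "\<forall>\<^sub>F n in sequentially. l2norm HL (%r. G (w n) r - G u r) <= K * l2norm HL (%r. w n r - u r)"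
   using that(1) by simp
  show "(%n. K * l2norm HL (%r. w n r - u r)) ---> 0" using tendsto_mult_left[OF lw, of K] by simp
 qed simp
 note gd = gv_diff[OF _ _ m u]
 have l1: "(%n. l2norm HL (%r. gv (w n) r - gv u r)) ---> 0" "(%n. l2norm HL (%r. gv' (w n) r - gv' u r)) ---> 0"
  using wD by (auto intro!: lim gv_L2(3,4) dm gd)
 have l2: "(%n. l2norm HL (%r. gw (w n) r - gw u r)) ---> 0"
 proof (rule lim[OF gw_L2(3)[OF dm]])
  show "gw (w n) r - gw u r = gw (%t. w n t - u t) r" if "r >= 1" for n r
   using gd(1)[of "w n" r] wD[of n] that by (simp add: gw_def algebra_simps flip: right_diff_distrib)
 qed
 have cl: "H10_grad Omega (emb (gv (w n))) (egrad (gv (w n)) (gv' (w n)))" "has_weak_laplacian Omega (emb (gv (w n))) (emb (gw (w n)))" for n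
  using gv_classical_H10[OF _ _ _ gbw[of n]] wcc[of n] by blast+
 note gL = gv_L2(1,2)[OF m u] gw_L2(2)[OF m u] and gm = gv_borel[OF m u] gw_L2(1)[OF m u]
 have wL: "gv (w n) : L2 HL" "gv' (w n) : L2 HL" "gw (w n) : L2 HL"
  "zx (gv (w n)) : bm" "zx (gv' (w n)) : bm"
  "zx (gw (w n)) : bm" for n
  using wD[of n] by (auto intro: gv_L2 gw_L2 gv_borel)
 show "emb (gv u) : H10 Omega" unfolding H10_iff
  by (intro exI, rule H10_grad_emb_closed[where V = "%n. gv (w n)" and V' = "%n. gv' (w n)"]) (use gm gL wL l1 cl in auto)
 show E: "emb (gw u) : L2 Omega" "emb (gv u) : L2 Omega" using gL gm by (simp_all add: emb_L2)
 have ll: "(%n. l2norm Omega (%x. emb (G n) x - emb g x)) ---> 0"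
  if "(%n. l2norm HL (%r. G n r - g r)) ---> 0" "!!n. zx (G n) : bm" "zx g : bm"
  for G :: "nat => real => complex" and g
  using tendsto_mult_left[OF that(1), of "sqrt (4 * pi)"] that(2,3)
  by (simp add: emb_L2(2) zext_diff[abs_def] flip: emb_diff)
 show "has_weak_laplacian Omega (emb (gv u)) (emb (gw u))"
  by (rule weak_laplacian_closed[OF cl(2) _ _ E(2,1) ll[OF l1(1) wL(4) gm(1)] ll[OF l2 wL(6) gm(3)]])
    (use wL in "simp_all add: emb_L2")
 show "l2norm Omega (emb (gv u)) <= gK * l2norm Omega (emb u)"
  using mult_left_mono[OF gv_L2(3)[OF m u], of "sqrt (4 * pi)"] by (simp add: emb_L2(2) gm m mult_ac)
qed

end

section \<open>The radial operator: symmetry, resolvent and eigenspaces\<close>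

lemma ae_eq_L2_cong: "ae_eq f g ==> f : L2 Omega ==> g : L2 Omega" "ae_eq f g ==> f : L2 Omega ==> l2norm Omega g = l2norm Omega f"
 for f g :: "real^3 => complex"
 unfolding ae_eq_def by (rule L2_cong_AE; assumption)+

lemma ae_eq_integral:
 fixes f g p :: "real^3 => complex"
 assumes "ae_eq f g" "f : L2 Omega" "p : L2 Omega"
 shows "(LINT x:Omega|leb. p x * f x) = (LINT x:Omega|leb. p x * g x)"
proof -
 note i = L2_mult_integrable[OF assms(3,2)] L2_mult_integrable[OF assms(3) ae_eq_L2_cong(1)[OF assms(1,2)]]
 show ?thesis unfolding set_lebesgue_integral_def
  by (rule integral_cong_AE) (use i assms(1) in "auto simp: set_integrable_def ae_eq_def indicator_def elim!: eventually_mono")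
qed

lemma L2_radial_profile:
 fixes f :: "real^3 => complex"
 assumes f: "f : L2 Omega" "radial f"
 obtains u where "zx u : bm" "u : L2 HL" "ae_eq f (emb u)"
  "emb u : L2 Omega" "l2norm Omega (emb u) = l2norm Omega f"
proof -
 obtain u where u: "u : bm" "!!r. r <= 1 ==> u r = 0" "ae_eq f (emb u)"
  using radial_profile[OF L2D(1)[OF f(1)] f(2)] by blast
 have "zx u = u" using u(2) by (intro ext) (auto simp: zext_def indicator_def)
 thus ?thesis using that[of u] u(1,3) ae_eq_L2_cong[OF u(3) f(1)] emb_L2(1)[of u] by simp
qed

lemma emb_cnj: "emb (%r. cnj (u r)) x = cnj (emb u x)"
 by (simp add: emb_def)

lemma cnj_profile:
 assumes "zx u : bm" "u : L2 HL"
 shows "zx (%r. cnj (u r)) : bm" "(%r. cnj (u r)) : L2 HL"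
proof -
 have "zx (%r. cnj (u r)) = (%r. cnj (zx u r))" by (auto simp: zext_def)
 thus "zx (%r. cnj (u r)) : bm"
  using measurable_compose[OF assms(1) borel_measurable_continuous_onI[OF continuous_on_cnj[OF continuous_on_id]]] by simp
qed (rule L2_linear[OF bounded_linear_cnj assms(2)])

lemma L2_cnj: "f : L2 U ==> (%x. cnj (f x)) : L2 U" for f :: "'a::euclidean_space => complex"
 by (rule L2_linear[OF bounded_linear_cnj])

lemma integral_cnj_l2norm: "(LINT x:U|leb. f x * cnj (f x)) = cx ((l2norm U f)^2)"
 for f :: "'a::euclidean_space => complex"
 unfolding l2norm_square set_lebesgue_integral_def
 by (subst integral_complex_of_real[symmetric], intro Bochner_Integration.integral_cong)
   (auto simp: zext_def indicator_def complex_norm_square simp del: of_real_power)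

text \<open>Vanishing data would make the solution zero, whereas \<open>jm\<close> tends to
  1.\<close>

lemma (in potential) jost_data_nonzero:
 assumes ka: "Re ka >= 0" and s: "s >= 1" and 0: "jost ka s = 0"
 shows "jost' ka s ~= 0"
proof
 assume "jost' ka s = 0"
 hence "jm ka r = 0" if "r >= 1" for r
  using solution_unique(1)[OF jost_solution[OF ka] s 0] that by (simp add: jost_def)
 hence "(jm ka ~~> 0) at_top" by (intro tendsto_eventually) (auto simp: eventually_at_top_linorder)
 thus False using tendsto_unique[OF _ _ jm_tendsto[OF ka], of 0] by simp
qed

text \<open>Only the values in \<open>Omega\<close> are prescribed, since that is where the profile
  of \<open>Q\<close> determines the potential.\<close>

locale schroedinger = potential +
 fixes A :: operator
 assumes A: "x : Omega ==> A f x = - weak_laplacian Omega f x - cx (V (norm x)) * f x"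
begin

lemma A_eq:
 assumes "has_weak_laplacian Omega f w"
 shows "ae_eq (A f) (%x. - w x - cx (V (norm x)) * f x)"
 using weak_laplacian_eq[OF assms] unfolding ae_eq_def by eventually_elim (simp add: A)

lemma V_mult_L2:
 assumes "f : L2 Omega"
 shows "(%x. cx (V (norm x)) * f x) : L2 Omega"
proof (rule L2_bound[OF L2_cmult[OF assms, of "cx M"]])
 have "zx (%r. cx (V r)) : bm"
  by (rule borel_zext_continuous) (intro continuous_intros continuous_on_subset[OF contV], auto)
 hence "(%x::real^3. zx (%r. cx (V r)) (norm x)) : borel_measurable leb"
  by (intro measurable_completion) simp
 hence "zext Omega (%x. cx (V (norm x))) : borel_measurable leb"
  unfolding zext_Omega_norm[of "%r. cx (V r)", symmetric] .
 thus "zext Omega (%x. cx (V (norm x)) * f x) : borel_measurable leb"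
  unfolding zext_mult[abs_def] using L2D(1)[OF assms] by measurable
 show "norm (cx (V (norm x)) * f x) <= norm (cx M * f x)" if "x : Omega" for x
  using V_bound[of "norm x"] that M2 by (auto simp: norm_mult Omega_iff intro!: mult_right_mono)
qed

lemma domainD:
 assumes "f : lin_domain"
 shows "f : H10 Omega" "f : L2 Omega" "radial f" "A f : L2 Omega" "(%x. A f x - z * f x) : L2 Omega"
  "EX w. has_weak_laplacian Omega f w & w : L2 Omega"
proof -
 from assms obtain w where w: "has_weak_laplacian Omega f w" "w : L2 Omega" and f: "f : H10 Omega" "radial f"
  by (auto simp: lin_domain_def)
 show fL: "f : L2 Omega" and "f : H10 Omega" "radial f" using f by (auto simp: H10_def)
 show "EX w. has_weak_laplacian Omega f w & w : L2 Omega" using w by blast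
 have "ae_eq (%x. - w x - cx (V (norm x)) * f x) (A f)" using A_eq[OF w(1)] by (auto simp: ae_eq_def elim: eventually_mono)
 thus "A f : L2 Omega" by (rule ae_eq_L2_cong(1)) (intro L2_diff L2_minus V_mult_L2 w fL)
 thus "(%x. A f x - z * f x) : L2 Omega" by (intro L2_diff L2_cmult fL)
qed

lemma A_symmetric:
 assumes f: "f : lin_domain" and p: "p : lin_domain"
 shows "(LINT x:Omega|leb. p x * A f x) = (LINT x:Omega|leb. f x * A p x)"
proof -
 obtain w v where w: "has_weak_laplacian Omega f w" "w : L2 Omega" and v: "has_weak_laplacian Omega p v" "v : L2 Omega"
  using domainD(6)[OF f] domainD(6)[OF p] by blast
 note fD = domainD[OF f] and pD = domainD[OF p]
 have *: "(LINT x:Omega|leb. p x * A f x) = - (LINT x:Omega|leb. p x * w x) - (LINT x:Omega|leb. p x * (cx (V (norm x)) * f x))"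
  if "p : L2 Omega" "f : lin_domain" "has_weak_laplacian Omega f w" "w : L2 Omega" for p f w
 proof -
  have "(LINT x:Omega|leb. p x * A f x) = (LINT x:Omega|leb. p x * (- w x - cx (V (norm x)) * f x))"
   by (rule ae_eq_integral[OF A_eq[OF that(3)] domainD(4)[OF that(2)] that(1)])
  also have "... = (LINT x:Omega|leb. p x * - w x) - (LINT x:Omega|leb. p x * (cx (V (norm x)) * f x))"
   unfolding right_diff_distrib
   by (intro set_integral_diff L2_mult_integrable V_mult_L2 L2_minus that domainD(2))
  finally show ?thesis by (simp add: set_lebesgue_integral_def)
 qed
 have "(LINT x:Omega|leb. p x * w x) = (LINT x:Omega|leb. f x * v x)"
  by (rule weak_laplacian_symmetric) (use w v fD pD in auto)
 thus ?thesis using *[OF pD(2) f w] *[OF fD(2) p v] by (simp add: mult_ac)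
qed

text \<open>For the bilinear pairing \<open>A - z\<close> is its own transpose, with the same
  complex \<open>z\<close>. Solving the equation for \<open>p\<close> thereby becomes an estimate
  for an arbitrary \<open>f\<close> in the domain.\<close>

lemma A_dual:
 assumes f: "f : lin_domain" and p: "p : lin_domain" and g: "ae_eq (%x. A p x - z * p x) g"
 shows "(LINT x:Omega|leb. f x * g x) = (LINT x:Omega|leb. p x * (A f x - z * f x))"
proof -
 note fD = domainD[OF f] and pD = domainD[OF p]
 have "(LINT x:Omega|leb. f x * g x) = (LINT x:Omega|leb. f x * (A p x - z * p x))"
  by (rule ae_eq_integral[OF g domainD(5)[OF p] fD(2), symmetric])
 also have "... = (LINT x:Omega|leb. f x * A p x) - (LINT x:Omega|leb. f x * (z * p x))"
  unfolding right_diff_distrib by (intro set_integral_diff L2_mult_integrable L2_cmult fD pD)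
 also have "... = (LINT x:Omega|leb. p x * A f x) - (LINT x:Omega|leb. p x * (z * f x))"
  using A_symmetric[OF f p] by (simp add: mult_ac)
 also have "... = (LINT x:Omega|leb. p x * (A f x - z * f x))"
  unfolding right_diff_distrib by (intro set_integral_diff(2)[symmetric] L2_mult_integrable L2_cmult fD pD)
 finally show ?thesis .
qed

lemma emb_in_domain:
 fixes v w u :: "real => complex" and ka :: complex
 assumes "emb v : H10 Omega" "has_weak_laplacian Omega (emb v) (emb w)" "emb w : L2 Omega"
  "!!r. r > 1 ==> w r = (ka^2 - V r) * v r - u r"
 shows "emb v : lin_domain" "ae_eq (%x. A (emb v) x - (- ka\<^sup>2) * emb v x) (emb u)"
proof -
 have "radial (emb v)" unfolding radial_def ae_eq_def emb_def by (rule exI[of _ "%r. v r /\<^sub>R r"]) simp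
 thus "emb v : lin_domain" using assms(1-3) by (auto simp: lin_domain_def)
 show "ae_eq (%x. A (emb v) x - (- ka\<^sup>2) * emb v x) (emb u)"
  using A_eq[OF assms(2)] unfolding ae_eq_def
 proof eventually_elim
  case (elim x)
  show ?case using elim assms(4)[of "norm x"]
   by (auto simp: Omega_iff emb_def scaleR_conv_of_real algebra_simps)
 qed
qed

lemma decaying_eigenfunction:
 fixes v v' :: "real => complex" and ka :: complex
 assumes s: "solution ka v v'" and v1: "v 1 = 0" and al: "al > 0"
  and b: "!!r. r >= 1 ==> norm (v r) <= B * exp (- al * r)" "!!r. r >= 1 ==> norm (v' r) <= B * exp (- al * r)"
 shows "emb v : eigenspace lin_domain A (- ka\<^sup>2)"
proof -
 have c: "cts {1..} v" "cts {1..} v'" and dv: "!!r. r > 1 ==> (v hvd v' r) (at r)"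
   "!!r. r > 1 ==> (v' hvd (ka^2 - V r) * v r) (at r)" using s by (auto simp: solution_def)
 let ?w = "%r. (ka^2 - V r) * v r"
 have ch: "cts HL v" "cts HL v'" using c by (auto intro: continuous_on_subset)
 have cw: "cts HL ?w" by (intro continuous_intros ch(1) continuous_on_subset[OF contV]) auto
 have L: "v : L2 HL" "v' : L2 HL" by (rule exp_decay_L2[OF al ch(1) b(1)] exp_decay_L2[OF al ch(2) b(2)]; simp)+
 have "norm (?w r) <= (((norm ka)^2 + M) * B) * exp (- al * r)" if "r > 1" for r
 proof -
  have "norm (ka^2 - cx (V r)) <= (norm ka)^2 + M"
   using norm_triangle_ineq4[of "ka^2" "cx (V r)"] V_bound[of r] that by (simp add: norm_power)
  hence "norm (?w r) <= ((norm ka)^2 + M) * (B * exp (- al * r))"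
   unfolding norm_mult using b(1)[of r] that by (intro mult_mono) (auto intro: order_trans[OF norm_ge_zero])
  thus ?thesis by (simp add: mult_ac)
 qed
 hence "?w : L2 HL" by (rule exp_decay_L2[OF al cw])
 hence wL: "emb ?w : L2 Omega" using borel_zext_continuous[OF cw] by (simp add: emb_L2)
 obtain D where "!!r. 1 < r ==> r <= 3 ==> norm (v r) <= D * (r - 1)"
  using dirichlet_bound[OF c dv(1) v1] by blast
 hence H: "emb v : H10 Omega" unfolding H10_iff using H10_grad_emb[OF dv cw L] by blast
 have "emb v : lin_domain" "ae_eq (%x. A (emb v) x - (- ka\<^sup>2) * emb v x) (emb (%_. 0))"
  by (rule emb_in_domain[where u = "%_. 0" and ka = ka, OF H emb_weak_laplacian[OF dv cw] wL]; simp)+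
 thus ?thesis unfolding eigenspace_def ae_eq_def by (auto simp: emb_def eq_neg_iff_add_eq_0 elim!: eventually_mono)
qed

lemma eigenvalue_spectrum:
 assumes "z : eigenvalues lin_domain A" shows "z : spectrum lin_domain A"
proof -
 obtain f where f: "f : lin_domain" "ae_eq (A f) (%x. z * f x)" "~ ae_eq f (%x. 0)"
  using assms by (auto simp: eigenvalues_def eigenspace_def)
 have "l2norm Omega (%x. A f x - z * f x) = 0"
  using f(2) domainD(5)[OF f(1), of z] by (subst l2norm_eq_0_iff) (auto simp: ae_eq_def elim!: eventually_mono)
 moreover have "l2norm Omega f ~= 0" using f(3) domainD(2)[OF f(1)] by (simp add: l2norm_eq_0_iff ae_eq_def)
 hence "~ l2norm Omega f <= 0" using l2norm_nonneg[of Omega f] by linarith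
 ultimately show ?thesis using f(1) unfolding spectrum_def resolvent_set_def by (auto intro!: bexI[of _ f])
qed

end

locale green_operator = green + schroedinger
begin

lemma solve:
 assumes "zx u : bm" "u : L2 HL" "d 1 * gb u 1 = 0"
 shows "emb (gv u) : lin_domain" "ae_eq (%x. A (emb (gv u)) x - (- ka\<^sup>2) * emb (gv u) x) (emb u)"
 by (rule emb_in_domain[OF gv_H10(1-3)[OF assms]]; simp add: gw_def)+

text \<open>Surjectivity is the Green operator. The estimate, which contains injectivity, follows by
  duality: with \<open>g\<close> the Green solution for the data \<open>cnj f\<close>, the square of
  the norm of \<open>f\<close> is the pairing of \<open>g\<close> with \<open>A f - z * f\<close>,
  and \<open>g\<close> is bounded by \<open>f\<close>.\<close>

lemma resolvent:
 assumes "d 1 = 0"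
 shows "- ka\<^sup>2 : resolvent_set lin_domain A"
proof -
 have "EX f:lin_domain. ae_eq (%x. A f x - (- ka\<^sup>2) * f x) g" if g: "g : L2_rad" for g
 proof -
  obtain u where u: "zx u : bm" "u : L2 HL" "ae_eq g (emb u)"
   using g L2_radial_profile[of g] by (auto simp: L2_rad_def)
  have ort: "d 1 * gb u 1 = 0" using assms by simp
  have "ae_eq (%x. A (emb (gv u)) x - (- ka\<^sup>2) * emb (gv u) x) g"
   using solve(2)[OF u(1,2) ort] u(3) unfolding ae_eq_def by eventually_elim auto
  thus ?thesis using solve(1)[OF u(1,2) ort] by blast
 qed
 moreover have "l2norm Omega f <= gK * l2norm Omega (%x. A f x - (- ka\<^sup>2) * f x)" if f: "f : lin_domain" for f
 proof -
  let ?g = "%x. A f x - (- ka\<^sup>2) * f x"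
  note fD = domainD[OF f]
  obtain u where u: "zx u : bm" "u : L2 HL" "ae_eq f (emb u)"
   "emb u : L2 Omega" "l2norm Omega (emb u) = l2norm Omega f"
   using L2_radial_profile[OF fD(2,3)] by blast
  let ?u = "%r. cnj (u r)"
  note c = cnj_profile[OF u(1,2)]
  have ort: "d 1 * gb ?u 1 = 0" using assms by simp
  note G = gv_H10[OF c ort] and s = solve[OF c ort]
  have nu: "l2norm Omega (emb ?u) = l2norm Omega f"
   using u(5) l2norm_cong_norm[of Omega "emb ?u" "emb u"] by (simp add: emb_cnj)
  have "ae_eq (emb ?u) (%x. cnj (f x))" using u(3) unfolding ae_eq_def by eventually_elim (simp add: emb_cnj)
  hence "cx ((l2norm Omega f)^2) = (LINT x:Omega|leb. f x * emb ?u x)"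
   using ae_eq_integral[of "emb ?u" "%x. cnj (f x)" f] fD(2) L2_cnj[OF u(4)] by (simp add: integral_cnj_l2norm emb_cnj[abs_def])
  also have "... = (LINT x:Omega|leb. emb (gv ?u) x * ?g x)" by (rule A_dual[OF f s])
  finally have "(l2norm Omega f)^2 = norm (LINT x:Omega|leb. emb (gv ?u) x * ?g x)"
   by (metis norm_of_real abs_of_nonneg zero_le_power2)
  also have "... <= l2norm Omega (emb (gv ?u)) * l2norm Omega ?g" by (rule L2_mult_bound[OF G(4) domainD(5)[OF f]])
  also have "... <= (gK * l2norm Omega f) * l2norm Omega ?g" using G(5) nu by (intro mult_right_mono) auto
  finally have "l2norm Omega f * l2norm Omega f <= (gK * l2norm Omega ?g) * l2norm Omega f" by (simp add: power2_eq_square mult_ac)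
  moreover have "0 <= gK * l2norm Omega ?g" using C(1) ka by simp
  ultimately show ?thesis
   using mult_strict_right_mono[of "gK * l2norm Omega ?g" "l2norm Omega f" "l2norm Omega f"] by linarith
 qed
 ultimately show ?thesis unfolding resolvent_set_def by blast
qed

text \<open>Subtract from \<open>f\<close> its projection onto the Jost eigenfunction. The conjugate
  of the remainder has zero pairing with \<open>e\<close>, hence lies in the range of
  \<open>A - z\<close>; by \<open>A_dual\<close> every eigenfunction has zero pairing with it. So
  the remainder has norm zero.\<close>

lemma eigenspace_span:
 assumes e: "emb e : eigenspace lin_domain A (- ka\<^sup>2)" and f: "f : eigenspace lin_domain A (- ka\<^sup>2)"
 shows "EX c. ae_eq f (%x. c * emb e x)"
proof -
 have dom: "f : lin_domain" "emb e : lin_domain" and ef: "ae_eq (A f) (%x. - ka\<^sup>2 * f x)" "ae_eq (A (emb e)) (%x. - ka\<^sup>2 * emb e x)"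
  using e f by (auto simp: eigenspace_def)
 obtain u where u: "zx u : bm" "u : L2 HL" "ae_eq f (emb u)" "emb u : L2 Omega"
  using L2_radial_profile[OF domainD(2,3)[OF dom(1)]] by blast
 let ?I = "%g. LINT r:HL|leb. g r * e r"
 \<comment> \<open>The conjugate appears because it is the conjugate of the remainder that must have
   zero pairing with \<open>e\<close>. The value 0 covers the case of zero norm without a separate
   argument that \<open>e\<close> is nonzero.\<close>
 define c where "c = (if (l2norm HL e)^2 = 0 then 0 else cnj (?I (%r. cnj (u r))) / (l2norm HL e)^2)"
 let ?ps = "%r. u r - c * e r"
 have ps: "zx ?ps : bm" "?ps : L2 HL"
  unfolding zext_diff[abs_def] zext_cmult[abs_def] using u ed_borel(1) e_L2 by (auto intro: L2_diff L2_cmult)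
 note cu = cnj_profile[OF u(1,2)] and cps = cnj_profile[OF ps]
 have "?I (%r. cnj (?ps r)) = ?I (%r. cnj (u r)) - cnj c * (LINT r:HL|leb. e r * cnj (e r))"
  using L2_mult_integrable[OF cu(2) e_L2] L2_mult_integrable[OF L2_cmult[OF L2_cnj[OF e_L2]] e_L2, of "cnj c"]
  unfolding complex_cnj_diff complex_cnj_mult left_diff_distrib by (subst set_integral_diff(2)) (simp_all add: mult_ac)
 also have "... = 0"
 proof (cases "(l2norm HL e)^2 = 0")
  case True
  hence "norm (?I (%r. cnj (u r))) <= 0" using L2_mult_bound[OF cu(2) e_L2] by simp
  thus ?thesis using True by (simp add: c_def)
 next
  case False
  thus ?thesis unfolding integral_cnj_l2norm by (simp add: c_def)
 qed
 finally have ort: "d 1 * gb (%r. cnj (?ps r)) 1 = 0" using gb_eq[OF cps(1)] by simp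
 note G = gv_H10[OF cps ort] and s = solve[OF cps ort]
 have 0: "(LINT x:Omega|leb. g x * emb (%r. cnj (?ps r)) x) = 0"
  if "g : lin_domain" "ae_eq (A g) (%x. - ka\<^sup>2 * g x)" for g
 proof -
  have "ae_eq (%x. A g x - (- ka\<^sup>2) * g x) (%x. 0)" using that(2) by (auto simp: ae_eq_def elim!: eventually_mono)
  from ae_eq_integral[OF this domainD(5)[OF that(1)] G(4)] show ?thesis
   using A_dual[OF that(1) s] by (simp add: set_lebesgue_integral_def)
 qed
 have EL: "emb ?ps : L2 Omega" using ps by (simp add: emb_L2)
 have EcL: "emb (%r. cnj (?ps r)) : L2 Omega" using cps by (simp add: emb_L2)
 have ee: "emb ?ps = (%x. emb u x - c * emb e x)" by (intro ext) (simp add: emb_def scaleR_conv_of_real algebra_simps)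
 note eL = domainD(2)[OF dom(2)]
 have "cx ((l2norm Omega (emb ?ps))^2) = (LINT x:Omega|leb. emb (%r. cnj (?ps r)) x * emb ?ps x)"
  unfolding integral_cnj_l2norm[symmetric] by (simp only: emb_cnj mult.commute)
 also have "... = (LINT x:Omega|leb. emb (%r. cnj (?ps r)) x * emb u x) - (LINT x:Omega|leb. emb (%r. cnj (?ps r)) x * (c * emb e x))"
  unfolding ee right_diff_distrib by (rule set_integral_diff(2)[OF L2_mult_integrable[OF EcL u(4)] L2_mult_integrable[OF EcL L2_cmult[OF eL]]])
 also have "(LINT x:Omega|leb. emb (%r. cnj (?ps r)) x * emb u x) = (LINT x:Omega|leb. f x * emb (%r. cnj (?ps r)) x)"
  using ae_eq_integral[OF u(3) domainD(2)[OF dom(1)] EcL] by (simp add: mult.commute)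
 also have "... = 0" by (rule 0[OF dom(1) ef(1)])
 also have "(LINT x:Omega|leb. emb (%r. cnj (?ps r)) x * (c * emb e x)) = c * (LINT x:Omega|leb. emb e x * emb (%r. cnj (?ps r)) x)"
  by (simp add: mult_ac)
 also have "(LINT x:Omega|leb. emb e x * emb (%r. cnj (?ps r)) x) = 0" by (rule 0[OF dom(2) ef(2)])
 finally have "l2norm Omega (emb ?ps) = 0" by simp
 hence "ae_eq f (%x. c * emb e x)"
  using u(3) unfolding l2norm_eq_0_iff[OF EL] ae_eq_def by eventually_elim (auto simp: ee)
 thus ?thesis ..
qed

end

section \<open>Eigenvalues off the half line and the Jost function\<close>

context schroedinger
begin

lemma green_operator_exists:
 assumes ka: "Re ka > 0" and om: "jost ka 1 * b - jost' ka 1 * a ~= 0"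
 obtains d d' C where "green_operator V M ka d d' (jost ka 1 * b - jost' ka 1 * a) C A" "d 1 = a"
proof -
 obtain d d' C where d: "solution ka d d'" "d 1 = a" "d' 1 = b"
  and C: "!!r. r >= 1 ==> norm (d r) <= C * exp (Re ka * r)" "!!r. r >= 1 ==> norm (d' r) <= C * exp (Re ka * r)"
  using solution_exists[OF ka] by metis
 define B where "B = 2 * exp M * (1 + norm ka) + \<bar>C\<bar>"
 have n: "0 <= exp M * norm ka" "0 < exp M" by simp_all
 have le: "C <= B" "2 * exp M <= B" "2 * exp M * (1 + norm ka) <= B" "B >= 0"
  unfolding B_def distrib_left using n abs_ge_self[of C] abs_ge_zero[of C] by linarith+
 have up: "x <= B * exp y" if "x <= c * exp y" "c <= B" for x c y using order_trans[OF that(1) mult_right_mono[OF that(2)]] by simp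
 have b: "norm (jost ka r) <= B * exp (- Re ka * r)" "norm (jost' ka r) <= B * exp (- Re ka * r)"
  "norm (d r) <= B * exp (Re ka * r)" "norm (d' r) <= B * exp (Re ka * r)" if "r >= 1" for r
  using up[OF jost_decay(1)[OF _ that] le(2)] up[OF jost_decay(2)[OF _ that] le(3)] up[OF C(1)[OF that] le(1)] up[OF C(2)[OF that] le(1)] ka
  by simp_all
 have "green_operator V M ka d d' (jost ka 1 * b - jost' ka 1 * a) B A"
 proof (intro green_operator.intro green.intro green_axioms.intro)
  show "potential V M" "schroedinger V M A" by unfold_locales
 qed (use ka d om le(4) b in auto)
 thus ?thesis using that d(2) by blast
qed

text \<open>The conjugate function is recorded as well: it belongs to the conjugate eigenvalue, and
  the pairing of the two functions is the squared norm, which later forces the eigenvalue to be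
  real. Continuity excludes that the eigenfunction vanishes almost everywhere.\<close>

lemma jost_eigenfunction:
 assumes ka: "Re ka > 0" and 0: "jost ka 1 = 0"
 shows "emb (jost ka) : eigenspace lin_domain A (- ka\<^sup>2)" "emb (%r. cnj (jost ka r)) : eigenspace lin_domain A (- (cnj ka)\<^sup>2)"
  "~ ae_eq (emb (jost ka)) (%x. 0)"
proof -
 have s: "solution ka (jost ka) (jost' ka)" using ka by (intro jost_solution) simp
 let ?B = "2 * exp M * (1 + norm ka)"
 have b: "norm (jost ka r) <= ?B * exp (- Re ka * r)" "norm (jost' ka r) <= ?B * exp (- Re ka * r)" if "r >= 1" for r
  using jost_decay[of ka r] ka that order_trans[OF jost_decay(1)[of ka r] mult_right_mono[of "2 * exp M" ?B "exp (- Re ka * r)"]] by auto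
 show E: "emb (jost ka) : eigenspace lin_domain A (- ka\<^sup>2)" by (rule decaying_eigenfunction[OF s 0 ka b])
 have "solution (cnj ka) (%r. cnj (jost ka r)) (%r. cnj (jost' ka r))"
  using s unfolding solution_def by (auto intro!: continuous_intros has_vector_derivative_eq_rhs[OF has_vector_derivative_cnj])
 thus "emb (%r. cnj (jost ka r)) : eigenspace lin_domain A (- (cnj ka)\<^sup>2)"
  by (rule decaying_eigenfunction[OF _ _ ka, of _ _ _ ?B]) (use b 0 in auto)
 show "~ ae_eq (emb (jost ka)) (%x. 0)"
 proof
  assume z: "ae_eq (emb (jost ka)) (%x. 0)"
  have c: "cts {1..} (jost ka)" using s by (simp add: solution_def)
  have co: "cts Omega (emb (jost ka))" unfolding emb_def
   by (intro continuous_intros continuous_on_compose2[OF c]) (auto simp: Omega_iff)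
  have "open Omega" by (simp add: Omega_def open_Compl)
  obtain x where x: "x : Omega" "emb (jost ka) x ~= 0"
  proof (rule ccontr)
   assume "~ thesis"
   hence *: "emb (jost ka) x = 0" if "x : Omega" for x using that \<open>!!x. \<lbrakk>x : Omega; emb (jost ka) x ~= 0\<rbrakk> \<Longrightarrow> thesis\<close> by blast
   have "jost ka r = 0" if "r > 1" for r
    using *[of "r *R axis 1 1"] that by (simp add: Omega_iff emb_def norm_axis_1)
   hence "(jm ka ~~> 0) at_top"
    by (intro tendsto_eventually) (auto simp: jost_def eventually_at_top_linorder intro!: exI[of _ 2])
   thus False using tendsto_unique[OF _ _ jm_tendsto[of ka], of 0] ka by simp
  qed
  have o: "open (Omega Int emb (jost ka) -` (- {0}))"
   by (intro continuous_open_preimage[OF co \<open>open Omega\<close>] open_Compl) simp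
  have "{x. ~ (x : Omega --> emb (jost ka) x = 0)} = Omega Int emb (jost ka) -` (- {0})" by auto
  hence "negligible (Omega Int emb (jost ka) -` (- {0}))"
   using z o AE_iff_null_sets[of "Omega Int emb (jost ka) -` (- {0})" leb]
   unfolding ae_eq_def negligible_iff_null_sets by (auto elim!: eventually_mono)
  thus False using open_not_negligible[OF o] x by blast
 qed
qed

lemma eigenvalue_iff:
 assumes ka: "Re ka > 0"
 shows "- ka\<^sup>2 : eigenvalues lin_domain A \<longleftrightarrow> jost ka 1 = 0" "- ka\<^sup>2 : spectrum lin_domain A \<longleftrightarrow> jost ka 1 = 0"
proof -
 have 1: "- ka\<^sup>2 : eigenvalues lin_domain A" if "jost ka 1 = 0"
  using jost_eigenfunction[OF ka that] by (auto simp: eigenvalues_def)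
 have "- ka\<^sup>2 : resolvent_set lin_domain A" if "jost ka 1 ~= 0"
 proof -
  \<comment> \<open>With data \<open>0\<close> and \<open>1\<close> for \<open>d\<close> the
    Wronskian is \<open>jost ka 1\<close> itself.\<close>
  from that have "jost ka 1 * 1 - jost' ka 1 * 0 ~= 0" by simp
  then obtain d d' C where "green_operator V M ka d d' (jost ka 1 * 1 - jost' ka 1 * 0) C A" "d 1 = 0"
   using green_operator_exists[OF ka] by blast
  thus ?thesis by (rule green_operator.resolvent)
 qed
 hence 2: "jost ka 1 = 0" if "- ka\<^sup>2 : spectrum lin_domain A" using that by (auto simp: spectrum_def)
 show "- ka\<^sup>2 : eigenvalues lin_domain A \<longleftrightarrow> jost ka 1 = 0" "- ka\<^sup>2 : spectrum lin_domain A \<longleftrightarrow> jost ka 1 = 0"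
  using 1 2 eigenvalue_spectrum by blast+
qed

text \<open>At a zero of the Jost function the data \<open>1\<close> and \<open>0\<close> for
  \<open>d\<close> give the Wronskian \<open>- jost' ka 1\<close>, which is nonzero by
  \<open>jost_data_nonzero\<close>. Symmetry applied to the eigenfunction and its conjugate gives
  \<open>ka^2 = (cnj ka)^2\<close>, and \<open>Re ka > 0\<close> excludes
  \<open>ka = - cnj ka\<close>.\<close>

lemma eigenvalue_simple:
 assumes ka: "Re ka > 0" and 0: "jost ka 1 = 0"
 shows "dim_at_most 1 (eigenspace lin_domain A (- ka\<^sup>2))" "Im ka = 0"
proof -
 note E = jost_eigenfunction[OF ka 0]
 have "jost ka 1 * 0 - jost' ka 1 * 1 ~= 0" using jost_data_nonzero[OF _ _ 0] ka by simp
 then obtain d d' C where "green_operator V M ka d d' (jost ka 1 * 0 - jost' ka 1 * 1) C A"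
  using green_operator_exists[OF ka] by blast
 from green_operator.eigenspace_span[OF this E(1)] have "EX c. ae_eq f (%x. c * emb (jost ka) x)" if "f : eigenspace lin_domain A (- ka\<^sup>2)" for f
  using that by blast
 thus "dim_at_most 1 (eigenspace lin_domain A (- ka\<^sup>2))"
  using E(1) unfolding dim_at_most_def by (intro exI[of _ "%_. emb (jost ka)"]) (fastforce intro: exI[of _ "%_. c" for c])
 let ?f = "emb (jost ka)" and ?g = "emb (%r. cnj (jost ka r))"
 have D: "?f : lin_domain" "?g : lin_domain" and ef: "ae_eq (A ?f) (%x. - ka\<^sup>2 * ?f x)" "ae_eq (A ?g) (%x. - (cnj ka)\<^sup>2 * ?g x)"
  using E by (auto simp: eigenspace_def)
 note fD = domainD[OF D(1)] and gD = domainD[OF D(2)]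
 have n: "(LINT x:Omega|leb. ?f x * ?g x) = cx ((l2norm Omega ?f)^2)"
  unfolding integral_cnj_l2norm[symmetric] by (simp add: emb_cnj)
 have "l2norm Omega ?f ~= 0" using E(3) fD(2) by (simp add: l2norm_eq_0_iff ae_eq_def)
 moreover have "(LINT x:Omega|leb. ?g x * A ?f x) = - ka\<^sup>2 * (LINT x:Omega|leb. ?f x * ?g x)"
  unfolding ae_eq_integral[OF ef(1) fD(4) gD(2)] by (subst set_integral_mult_right[symmetric]) (simp add: mult_ac)
 moreover have "(LINT x:Omega|leb. ?f x * A ?g x) = - (cnj ka)\<^sup>2 * (LINT x:Omega|leb. ?f x * ?g x)"
  unfolding ae_eq_integral[OF ef(2) gD(4) fD(2)] by (subst set_integral_mult_right[symmetric]) (simp add: mult_ac)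
 ultimately have "ka^2 = (cnj ka)^2" using A_symmetric[OF D] n by auto
 hence "ka = cnj ka | ka = - cnj ka" by (simp add: power2_eq_iff)
 thus "Im ka = 0" using ka by (auto simp: complex_eq_iff)
qed

end

section \<open>Weyl sequences and the shape of the spectrum\<close>

context schroedinger
begin

text \<open>The plane wave \<open>exp (i s r)\<close> is cut off to radii of order \<open>n\<close>,
  over a length of order \<open>n\<close>. Every term of the error contains a derivative of the
  dilated cutoff or the potential at radii of order \<open>n\<close>, hence is of order
  \<open>1 / n\<close>, while the wave has modulus 1 on an interval of length
  \<open>n\<close>.\<close>

lemma weyl_function:
 fixes s :: real
 obtains K where "!!n::nat. 1 <= real n ==> EX v u. emb v : lin_domain & ae_eq (%x. A (emb v) x - (cx s)\<^sup>2 * emb v x) (emb u) &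
  sqrt (4 * pi) * sqrt n <= l2norm Omega (emb v) & l2norm Omega (emb u) <= sqrt (4 * pi) * (K / n * sqrt (5 * n))"
proof -
 have "bounded ((%r. \<bar>cut1 2 r\<bar> + \<bar>cut2 2 r\<bar>) ` {4 / 3..6})"
  using cut_derivatives(2)
  by (intro compact_imp_bounded compact_continuous_image continuous_intros continuous_on_subset[OF cut_derivatives(3)])
    (auto intro!: continuous_at_imp_continuous_on DERIV_isCont)
 then obtain B0 where B0: "ALL x:(%r. \<bar>cut1 2 r\<bar> + \<bar>cut2 2 r\<bar>) ` {4 / 3..6}. norm x <= B0" unfolding bounded_iff by blast
 define B where "B = \<bar>B0\<bar>"
 have B: "B >= 0" "\<bar>cut1 2 r\<bar> <= B * 3" "\<bar>cut2 2 r\<bar> <= B * 9" if "r : {4 / 3..6}" for r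
 proof -
  have "\<bar>cut1 2 r\<bar> + \<bar>cut2 2 r\<bar> <= B" using B0 that by (force simp: B_def)
  thus "\<bar>cut1 2 r\<bar> <= B * 3" "\<bar>cut2 2 r\<bar> <= B * 9" by linarith+
 qed (simp add: B_def)
 have B1: "B >= 0" by (simp add: B_def)
 define K where "K = M + (9 * B + 6 * \<bar>s\<bar> * B)"
 have K: "K >= 0" using B1 M2 by (simp add: K_def)
 let ?ka = "\<i> * cx s"
 show ?thesis
 proof
  fix n :: nat assume n: "1 <= real n"
  define E where "E r = exp (?ka * cx r)" for r
  \<comment> \<open>\<open>cutoff 2\<close> is supported in \<open>{4 / 3..6}\<close> and equals 1
    on \<open>{5 / 3..3}\<close>; its dilation by \<open>n\<close> equals 1 on
    \<open>{2 * n..3 * n}\<close>.\<close>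
  define c c1 c2 where "c r = cutoff 2 (r / n)" and "c1 r = cut1 2 (r / n) / n" and "c2 r = cut2 2 (r / n) / n / n" for r
  define v where "v r = c r *R E r" for r
  define v' where "v' r = c r *R (?ka * E r) + c1 r *R E r" for r
  define v'' where "v'' r = (c r *R (?ka * (?ka * E r)) + c1 r *R (?ka * E r)) + (c1 r *R (?ka * E r) + c2 r *R E r)" for r
  define u where "u r = (?ka^2 - V r) * v r - v'' r" for r
  have dE: "(E hvd ?ka * E r) (at r)" for r
   unfolding E_def[abs_def]
   by (rule has_vector_derivative_eq_rhs, rule has_vector_derivative_real_field) (auto intro!: derivative_eq_intros)
  have dE': "((%r. ?ka * E r) hvd ?ka * (?ka * E r)) (at r)" for r
   by (rule has_vector_derivative_mult_right[OF dE])
  have dn: "((%r. r / n) hrd 1 / n) (at r)" for r using n by (auto intro!: derivative_eq_intros)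
  have dc: "(c hrd c1 r) (at r)" "(c1 hrd c2 r) (at r)" for r
   using DERIV_chain2[OF cut_derivatives(1)[of 2 "r / n"] dn] DERIV_cdivide[OF DERIV_chain2[OF cut_derivatives(2)[of 2 "r / n"] dn], of "real n"]
   by (simp_all add: c_def[abs_def] c1_def[abs_def] c2_def)
  have cE: "cts S E" and cc: "cts S c" "cts S c1" for S
   using dE dc by (auto intro!: continuous_at_imp_continuous_on has_vector_derivative_continuous DERIV_isCont)
  have cc2: "cts S c2" for S unfolding c2_def[abs_def]
   by (intro continuous_intros continuous_on_compose2[OF cut_derivatives(3)[of 2]]) (use n in auto)
  have n0: "real n >= 1" using n by simp
  have out: "r / n ~: {1 + inverse (real (Suc 2))..2 * real (Suc 2)}" if "r ~: {4 / 3 * n..6 * n}" for r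
   using that n0 by (auto simp: field_simps)
  have "C2_profile v v' v'' (4 / 3 * n) (6 * n)"
  proof
   show "(v hvd v' r) (at r)" "(v' hvd v'' r) (at r)" for r
    unfolding v_def[abs_def] v'_def[abs_def] v''_def
    by (intro has_vector_derivative_add has_vector_derivative_scaleR dc dE dE')+
   show "cts UNIV v''" unfolding v''_def[abs_def] by (intro continuous_intros cc cc2 cE)
   show "v r = 0" if "r ~: {4 / 3 * n..6 * n}" for r
    using cutoff_eq_0[OF out[OF that]] by (simp add: v_def c_def)
  qed (use n0 in auto)
  then interpret C2_profile v v' v'' "4 / 3 * n" "6 * n" .
  have u_eq: "u r = - (V r *R v r) - (c1 r *R (2 * ?ka * E r) + c2 r *R E r)" for r
   unfolding u_def v_def v''_def by (simp add: scaleR_conv_of_real algebra_simps power2_eq_square)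
  have h1: "has_weak_laplacian Omega (emb v) (emb v'')"
   by (rule emb_weak_laplacian[OF deriv(1) deriv(2)]) (rule continuous_on_subset[OF cont], simp)
  have h2: "emb v'' : L2 Omega" using L2 borel by (simp add: emb_L2)
  have h3: "emb v : H10 Omega" unfolding H10_iff using H10_grad_emb by blast
  have D: "emb v : lin_domain" "ae_eq (%x. A (emb v) x - (- ?ka\<^sup>2) * emb v x) (emb u)"
   by (rule emb_in_domain[where ka = ?ka and u = u, OF h3 h1 h2]; simp add: u_def)+
  have um: "zx u : bm"
   by (rule borel_zext_continuous)
     (unfold u_def[abs_def], intro continuous_intros continuous_on_subset[OF contV] continuous_on_subset[OF cont_all(1)] continuous_on_subset[OF cont], auto)
  have uL: "u : L2 HL" using ae_eq_L2_cong(1)[OF D(2) domainD(5)[OF D(1)]] um by (simp add: emb_L2)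
  have u0: "u r = 0" if "r ~: {4 / 3 * n..6 * n}" for r
   using supp[OF that] deriv_zero_outside[OF that] by (simp add: u_def)
  have E1: "norm (E r) = 1" for r by (simp add: E_def)
  have "norm (u r) <= K / n" for r
  proof (cases "r : {4 / 3 * n..6 * n}")
   case True
   hence r: "r >= n" "r >= 1" and rn: "r / n : {4 / 3..6}" using n0 by (auto simp: field_simps)
   have "\<bar>V r\<bar> <= M / n"
   proof (rule order_trans[OF V_le[OF r(2)]])
    have "r ^ 1 <= r ^ 6" using r by (intro power_increasing) auto
    thus "M / r ^ 6 <= M / n" using r n0 M2 by (intro divide_left_mono) auto
   qed
   moreover have "norm (v r) <= 1" using cutoff_bounds[of 2 "r / n"] by (simp add: v_def c_def E1)
   ultimately have 1: "norm (V r *R v r) <= M / n * 1" unfolding norm_scaleR by (intro mult_mono) auto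
   have 2: "norm (c1 r *R (2 * ?ka * E r)) <= (B * 3 / n) * (2 * \<bar>s\<bar>)"
   proof -
    have "norm (c1 r *R (2 * ?ka * E r)) = \<bar>cut1 2 (r / n)\<bar> / n * (2 * \<bar>s\<bar>)" by (simp add: norm_mult E1 c1_def)
    thus ?thesis by (simp only:) (intro mult_right_mono divide_right_mono B(2)[OF rn], auto)
   qed
   have "norm (c2 r *R E r) <= B * 9 / n / n" using B(3)[OF rn] by (simp add: E1 c2_def divide_right_mono)
   also have "... <= B * 9 / n / 1" using n0 B1 by (intro divide_left_mono) auto
   finally have 3: "norm (c2 r *R E r) <= B * 9 / n" by simp
   have "norm (u r) <= norm (V r *R v r) + (norm (c1 r *R (2 * ?ka * E r)) + norm (c2 r *R E r))"
    unfolding u_eq by (intro order_trans[OF norm_triangle_ineq4] add_mono norm_triangle_ineq) simp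
   also have "... <= M / n * 1 + ((B * 3 / n) * (2 * \<bar>s\<bar>) + B * 9 / n)" by (intro add_mono 1 2 3)
   also have "... = K / n" by (simp add: K_def add_divide_distrib mult_ac)
   finally show ?thesis .
  qed (use u0 K in simp)
  from l2norm_le[OF uL u0 this] have "l2norm HL u <= K / n * sqrt (6 * n - 4 / 3 * n)" by simp
  also have "... <= K / n * sqrt (5 * n)" using K by (intro mult_left_mono) auto
  finally have upper: "l2norm Omega (emb u) <= sqrt (4 * pi) * (K / n * sqrt (5 * n))" unfolding emb_L2(2)[OF um] by (rule mult_left_mono) simp
  let ?i = "%r::real. 1 * indicator {real (2 * n)..real (3 * n)} r :: real"
  have "(norm (zx ?i r))^2 = indicator {real (2 * n)..real (3 * n)} r" for r
   using n0 by (auto simp: zext_def indicator_def)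
  hence "l2norm HL ?i = sqrt (measure leb {real (2 * n)..real (3 * n)})" by (simp add: l2norm_eq)
  hence "sqrt n = l2norm HL ?i" by simp
  also have "... <= l2norm HL v"
  proof (rule l2norm_mono[OF L2_const_interval L2(1)])
   show "norm (?i r) <= norm (v r)" if "r : HL" for r
    using cutoff_eq_1[of 2 "r / n"] n0 by (auto simp: indicator_def v_def c_def E1 field_simps)
  qed
  finally have "sqrt (4 * pi) * sqrt n <= l2norm Omega (emb v)" by (simp add: emb_L2(2)[OF borel(1)])
  with D upper show "EX v u. emb v : lin_domain & ae_eq (%x. A (emb v) x - (cx s)\<^sup>2 * emb v x) (emb u) &
   sqrt (4 * pi) * sqrt n <= l2norm Omega (emb v) & l2norm Omega (emb u) <= sqrt (4 * pi) * (K / n * sqrt (5 * n))"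
   by (intro exI[of _ v] exI[of _ u]) (simp add: power_mult_distrib)
 qed
qed

text \<open>A resolvent estimate with constant \<open>C\<close>, applied to the functions of
  \<open>weyl_function\<close>, would bound \<open>n\<close> by
  \<open>\<bar>C\<bar> * K * sqrt 5\<close>.\<close>

lemma nonneg_in_spectrum:
 assumes "t >= 0"
 shows "cx t : spectrum lin_domain A"
proof (rule ccontr)
 let ?s = "sqrt t"
 have s: "(cx ?s)^2 = cx t" using assms by (simp flip: of_real_power)
 assume "~ ?thesis"
 then obtain C where C: "!!f. f : lin_domain ==> l2norm Omega f <= C * l2norm Omega (%x. A f x - (cx ?s)\<^sup>2 * f x)"
  unfolding spectrum_def resolvent_set_def s by auto
 obtain K where K: "!!n::nat. 1 <= real n ==> EX v u. emb v : lin_domain & ae_eq (%x. A (emb v) x - (cx ?s)\<^sup>2 * emb v x) (emb u) &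
  sqrt (4 * pi) * sqrt n <= l2norm Omega (emb v) & l2norm Omega (emb u) <= sqrt (4 * pi) * (K / n * sqrt (5 * n))"
  using weyl_function by blast
 have "real n <= \<bar>C\<bar> * K * sqrt 5" if n: "1 <= real n" for n :: nat
 proof -
  obtain v u where v: "emb v : lin_domain" "ae_eq (%x. A (emb v) x - (cx ?s)\<^sup>2 * emb v x) (emb u)"
   "sqrt (4 * pi) * sqrt n <= l2norm Omega (emb v)" "l2norm Omega (emb u) <= sqrt (4 * pi) * (K / n * sqrt (5 * n))"
   using K[OF n] by blast
  have "sqrt (4 * pi) * sqrt n <= C * l2norm Omega (emb u)"
   using v(3) C[OF v(1)] ae_eq_L2_cong(2)[OF v(2) domainD(5)[OF v(1)]] by simp
  also have "... <= \<bar>C\<bar> * l2norm Omega (emb u)" by (intro mult_right_mono) auto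
  also have "... <= \<bar>C\<bar> * (sqrt (4 * pi) * (K / n * sqrt (5 * n)))" by (intro mult_left_mono v(4)) simp
  finally have "(sqrt (4 * pi) * sqrt n) * n <= (sqrt (4 * pi) * sqrt n) * (\<bar>C\<bar> * K * sqrt 5)"
   using n by (simp add: real_sqrt_mult field_simps)
  thus ?thesis using n by (subst (asm) mult_le_cancel_left_pos) auto
 qed
 moreover obtain n :: nat where "real n > max 1 (\<bar>C\<bar> * K * sqrt 5)" using reals_Archimedean2 by blast
 ultimately show False by (metis max_less_iff_conj not_le of_nat_1 of_nat_less_iff less_imp_le)
qed

text \<open>Off the nonnegative half line the principal root of \<open>- z\<close> has positive real
  part, so the Jost criterion applies; by \<open>eigenvalue_simple\<close> the root is real.\<close>

lemma spectrum_outside: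
 assumes z: "z : spectrum lin_domain A" "z ~: cx ` {0..}"
 obtains k where "k > 0" "z = cx (- k\<^sup>2)" "jost (cx k) 1 = 0"
proof -
 let ?ka = "csqrt (- z)"
 have zk: "z = - ?ka\<^sup>2" by simp
 have "Re ?ka ~= 0"
 proof
  assume "Re ?ka = 0"
  hence "z = cx ((Im ?ka)^2)" by (subst zk) (auto simp: complex_eq_iff power2_eq_square)
  with z(2) show False by auto
 qed
 hence k: "Re ?ka > 0" using csqrt_principal[of "- z"] by auto
 have 0: "jost ?ka 1 = 0" using eigenvalue_iff(2)[OF k] z(1) by simp
 have "?ka = cx (Re ?ka)" using eigenvalue_simple(2)[OF k 0] by (simp add: complex_eq_iff)
 thus ?thesis using that[OF k] 0 zk by (metis of_real_minus of_real_power)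
qed

text \<open>Reduces the spectral statements to the zeros of \<open>jost k 1\<close> for
  \<open>k > 0\<close>. Finiteness of these zeros isolates the negative eigenvalues from one
  another, and their negative real part separates them from the half line, no point of which is
  isolated.\<close>

lemma spectral_conclusion:
 assumes fin: "finite {k::real. k > 0 & jost (cx k) 1 = 0}"
 shows "essential_spectrum lin_domain A = cx ` {0..}"
  "card {mu::real. mu < 0 & cx mu : eigenvalues lin_domain A} = card {k::real. k > 0 & jost (cx k) 1 = 0}"
  "mu < 0 ==> cx mu : eigenvalues lin_domain A ==> simple_eigenvalue lin_domain A (cx mu)"
proof -
 let ?Z = "{k::real. k > 0 & jost (cx k) 1 = 0}"
 have ev: "cx (- k\<^sup>2) : eigenvalues lin_domain A \<longleftrightarrow> jost (cx k) 1 = 0" if "k > 0" for k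
  using eigenvalue_iff(1)[of "cx k"] that by simp
 have out: "z : (%k. cx (- k\<^sup>2)) ` ?Z" if "z : spectrum lin_domain A" "z ~: cx ` {0..}" for z
  using spectrum_outside[OF that] by blast
 have dim: "dim_at_most 1 (eigenspace lin_domain A (cx (- k\<^sup>2)))" if "k : ?Z" for k
  using eigenvalue_simple(1)[of "cx k"] that by simp
 show "simple_eigenvalue lin_domain A (cx mu)" if mu: "mu < 0" "cx mu : eigenvalues lin_domain A" for mu
 proof -
  have "cx mu ~: cx ` {0..}" using mu(1) by auto
  then obtain k where "k : ?Z" "cx mu = cx (- k\<^sup>2)" using out[OF eigenvalue_spectrum[OF mu(2)]] by blast
  thus ?thesis using dim[of k] mu(2) by (simp add: simple_eigenvalue_def)
 qed
 have "{mu::real. mu < 0 & cx mu : eigenvalues lin_domain A} = (%k. - k\<^sup>2) ` ?Z" (is "?L = ?R")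
 proof
  show "?R <= ?L" using ev by auto
  show "?L <= ?R"
  proof
   fix mu assume "mu : ?L"
   hence "cx mu ~: cx ` {0..}" "cx mu : spectrum lin_domain A" using eigenvalue_spectrum by auto
   then obtain k where k: "k : ?Z" "cx mu = cx (- k\<^sup>2)" using out by blast
   hence "mu = - k\<^sup>2" unfolding of_real_eq_iff by simp
   thus "mu : ?R" using k(1) by blast
  qed
 qed
 moreover have "inj_on (%k::real. - k\<^sup>2) ?Z" by (auto simp: inj_on_def power2_eq_iff)
 ultimately show "card {mu::real. mu < 0 & cx mu : eigenvalues lin_domain A} = card ?Z" by (simp add: card_image)
 let ?N = "(%k. cx (- k\<^sup>2)) ` ?Z"
 have sp: "spectrum lin_domain A = cx ` {0..} Un ?N"
  using out nonneg_in_spectrum ev eigenvalue_spectrum by auto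
 have iso: "z isolated_in spectrum lin_domain A" if "z : ?N" for z
 proof -
  have "open ({w. Re w < 0} - (?N - {z}))"
   by (intro open_Diff open_halfspace_Re_lt finite_imp_closed finite_Diff finite_imageI fin)
  moreover have "({w. Re w < 0} - (?N - {z})) Int spectrum lin_domain A = {z}"
   unfolding sp using that by auto
  ultimately show ?thesis unfolding isolated_in_def using that sp by blast
 qed
 have noniso: "~ z isolated_in spectrum lin_domain A" if z: "z : cx ` {0..}" for z
 proof
  assume "z isolated_in spectrum lin_domain A"
  then obtain T where T: "open T" "T Int spectrum lin_domain A = {z}" by (auto simp: isolated_in_def)
  obtain t where t: "z = cx t" "t >= 0" using z by auto
  obtain ep where ep: "ep > 0" "ball z ep <= T" using T openE by blast
  have "cx (t + ep / 2) : ball z ep" using ep(1) t by (simp add: dist_norm)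
  moreover have "cx (t + ep / 2) : spectrum lin_domain A" by (rule nonneg_in_spectrum) (use t ep in simp)
  ultimately have "cx (t + ep / 2) = z" using T(2) ep(2) by blast
  thus False using t ep(1) by (simp flip: of_real_add)
 qed
 have "?N <= {z : eigenvalues lin_domain A. z isolated_in spectrum lin_domain A & (EX n. dim_at_most n (eigenspace lin_domain A z))}"
  using ev iso dim by blast
 thus "essential_spectrum lin_domain A = cx ` {0..}"
  unfolding essential_spectrum_def using noniso sp by blast
qed

end

section \<open>Counting zeros by winding\<close>

text \<open>Otherwise consider the first point \<open>u\<close> after \<open>t'\<close> with
  \<open>f u <= c\<close>. There \<open>f\<close> equals \<open>c\<close>, and crossing upwards
  would put smaller values immediately to its left, against the choice of \<open>u\<close>.\<close>

lemma upcrossing_after: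
 fixes f :: "real => real"
 assumes c: "cts {a..b} f" and up: "!!t. t : {a..b} ==> f t = c ==> EX dl>0. ALL s:{a..b}. s ~= t & \<bar>s - t\<bar> < dl --> (f s - c) * (s - t) > 0"
  and t: "t : {a..b}" "f t = c" and s: "t < s" "s <= b"
 shows "f s > c"
proof (rule ccontr)
 assume n: "~ ?thesis"
 obtain dl where dl: "dl > 0" "!!u. u : {a..b} ==> u ~= t ==> \<bar>u - t\<bar> < dl ==> (f u - c) * (u - t) > 0" using up[OF t] by blast
 define t' where "t' = min s (t + dl / 2)"
 have t': "t < t'" "t' <= s" "t' : {a..b}" "f t' > c" using s dl(1) dl(2)[of t'] t by (auto simp: t'_def zero_less_mult_iff min_def split: if_splits)
 define K where "K = {u : {t'..s}. f u <= c}"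
 have cK: "cts {t'..s} f" by (rule continuous_on_subset[OF c]) (use t' t s in auto)
 have "closed K" unfolding K_def by (rule continuous_on_closed_Collect_le[OF cK continuous_on_const]) simp
 moreover have "bounded K" by (rule bounded_subset[of "{t'..s}"]) (auto simp: K_def)
 moreover have "s : K" using n t' by (auto simp: K_def)
 ultimately obtain u where u: "u : K" "!!w. w : K ==> u <= w"
  using compact_attains_inf[of K] by (auto simp: compact_eq_bounded_closed)
 have "t' ~= u" using u(1) t'(4) by (auto simp: K_def)
 have "EX w. t' <= w & w <= u & f w = c"
  by (rule IVT2') (use u(1) t' cK in "auto simp: K_def intro: continuous_on_subset")
 hence fu: "f u = c" using u by (fastforce simp: K_def)
 obtain et where et: "et > 0" "!!w. w : {a..b} ==> w ~= u ==> \<bar>w - u\<bar> < et ==> (f w - c) * (w - u) > 0"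
  using up[OF _ fu] u(1) t' t s by (auto simp: K_def)
 define w where "w = max t' (u - et / 2)"
 have w: "w : {t'..s}" "w < u" "\<bar>w - u\<bar> < et" using et(1) u(1) \<open>t' ~= u\<close> by (auto simp: w_def K_def)
 moreover have "f w < c" using et(2)[of w] w t' t s by (auto simp: zero_less_mult_iff)
 ultimately
 show False using u(2)[of w] by (auto simp: K_def)
qed

lemma upcrossing:
 fixes f :: "real => real"
 assumes c: "cts {a..b} f" and up: "!!t. t : {a..b} ==> f t = c ==> EX dl>0. ALL s:{a..b}. s ~= t & \<bar>s - t\<bar> < dl --> (f s - c) * (s - t) > 0"
  and t: "t : {a..b}" "f t = c" and s: "s : {a..b}" "s ~= t"
 shows "(f s - c) * (s - t) > 0"
proof (cases "t < s")
 case True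
 thus ?thesis using upcrossing_after[OF c up t True] s by auto
next
 case False
 hence st: "s < t" using s by auto
 have "f s < c"
 proof (rule ccontr)
  assume n: "~ ?thesis"
  obtain dl where dl: "dl > 0" "!!u. u : {a..b} ==> u ~= t ==> \<bar>u - t\<bar> < dl ==> (f u - c) * (u - t) > 0" using up[OF t] by blast
  define u where "u = max s (t - dl / 2)"
  have u: "u : {s..<t}" "u : {a..b}" "f u < c" using dl(1) dl(2)[of u] st s t by (auto simp: u_def zero_less_mult_iff max_def split: if_splits)
  have "EX w. s <= w & w <= u & f w = c"
   by (rule IVT2') (use u n s in "auto intro: continuous_on_subset[OF c]")
  then obtain w where "s <= w" "w <= u" "f w = c" by blast
  thus False using upcrossing_after[OF c up, of w t] t u s by auto
 qed
 thus ?thesis using st by (simp add: mult_neg_neg)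
qed

text \<open>\<open>y\<close> vanishes when the angle is a multiple of \<open>pi\<close>, and
  \<open>cross\<close> says that the angle passes each such multiple upwards. It therefore takes
  every multiple between \<open>th a\<close> and \<open>th b\<close> exactly once and no
  other.\<close>

lemma angle_crossing:
 fixes th rh x y :: "real => real"
 assumes ab: "a <= b" and c: "cts {a..b} th" and rh: "!!t. t : {a..b} ==> rh t > 0"
  and xy: "!!t. t : {a..b} ==> x t = rh t * cos (th t)" "!!t. t : {a..b} ==> y t = rh t * sin (th t)"
  and ends: "y a ~= 0" "y b ~= 0"
  and cross: "!!t. t : {a..b} ==> y t = 0 ==> EX dl>0. ALL s:{a..b}. s ~= t & \<bar>s - t\<bar> < dl --> x t * y s * (s - t) > 0"
 shows "finite {t : {a..b}. y t = 0}" "int (card {t : {a..b}. y t = 0}) = \<lfloor>th b / pi\<rfloor> - \<lfloor>th a / pi\<rfloor>"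
proof -
 have y0: "y t = 0 \<longleftrightarrow> sin (th t) = 0" if "t : {a..b}" for t using xy(2)[OF that] rh[OF that] by simp
 have up: "EX dl>0. ALL s:{a..b}. s ~= t & \<bar>s - t\<bar> < dl --> (th s - of_int n * pi) * (s - t) > 0"
  if t: "t : {a..b}" and tht: "th t = of_int n * pi" for t and n :: int
 proof -
  have s0: "sin (th t) = 0" unfolding sin_zero_iff_int2 using tht by blast
  obtain dl where dl: "dl > 0" "ALL s:{a..b}. s ~= t & \<bar>s - t\<bar> < dl --> x t * y s * (s - t) > 0" using cross[OF t] y0[OF t] s0 by auto
  obtain et where et: "et > 0" "ALL s:{a..b}. dist s t < et --> dist (th s) (th t) < pi"
   using c t pi_gt_zero unfolding continuous_on_iff by blast
  have "(th s - of_int n * pi) * (s - t) > 0" if s: "s : {a..b}" "s ~= t" "\<bar>s - t\<bar> < min dl et" for s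
  proof -
   \<comment> \<open>Within half a turn the sine of the increment has the sign of the increment;
     this turns the condition on \<open>x\<close> and \<open>y\<close> into one on the
     angle.\<close>
   let ?u = "th s - th t"
   have "\<bar>?u\<bar> < pi" using et s by (auto simp: dist_real_def)
   have "0 < x t * y s * (s - t)" using dl s by auto
   also have "... = (rh t * rh s) * (sin ?u * (s - t))" using xy s t s0 by (simp add: sin_diff)
   finally have 1: "sin ?u * (s - t) > 0" using zero_less_mult_pos[OF _ mult_pos_pos[OF rh[OF t] rh[OF s(1)]]] by blast
   have "sin ?u <= 0" if "?u <= 0"
   proof -
    have "0 <= sin (- ?u)" by (rule sin_ge_zero) (use that \<open>\<bar>?u\<bar> < pi\<close> in auto)
    thus ?thesis unfolding sin_minus by linarith
   qed
   moreover have "sin ?u >= 0" if "?u >= 0" using sin_ge_zero[of ?u] that \<open>\<bar>?u\<bar> < pi\<close> by simp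
   ultimately have "?u * (s - t) > 0" using 1 unfolding zero_less_mult_iff by force
   thus ?thesis by (simp add: tht)
  qed
  thus ?thesis using dl(1) et(1) by (intro exI[of _ "min dl et"]) auto
 qed
 have U: "(th s - of_int n * pi) * (s - t) > 0"
  if "t : {a..b}" "th t = of_int n * pi" "s : {a..b}" "s ~= t" for s t and n :: int
  by (rule upcrossing[OF c up that])
 let ?Z = "{t : {a..b}. y t = 0}" and ?n = "%t. \<lfloor>th t / pi\<rfloor>"
 have Zn: "th t = of_int (?n t) * pi" if "t : ?Z" for t
  using y0[of t] that unfolding sin_zero_iff_int2 by auto
 have nonint: "th a ~= of_int n * pi" "th b ~= of_int n * pi" for n :: int
  using y0[of a] y0[of b] ends ab unfolding sin_zero_iff_int2 by auto
 have lev: "th a < of_int n * pi & of_int n * pi < th b" if "t : {a..b}" "th t = of_int n * pi" for t n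
 proof -
  have "t ~= a" "t ~= b" using nonint that by auto
  thus ?thesis using U[OF that, of a] U[OF that, of b] that(1) ab
   by (auto simp: zero_less_mult_iff)
 qed
 have fl: "of_int n * pi < z \<longleftrightarrow> n <= \<lfloor>z / pi\<rfloor>" "z < of_int n * pi \<longleftrightarrow> \<lfloor>z / pi\<rfloor> < n" if "!!m. z ~= of_int m * pi" for z and n :: int
  using that[of n] by (auto simp: le_floor_iff pos_le_divide_eq floor_less_iff pos_divide_less_eq)
 \<comment> \<open>If the angle ended below a multiple of \<open>pi\<close> from above, it would
   take this value in between, contrary to \<open>lev\<close>.\<close>
 have le: "?n a <= ?n b"
 proof (rule ccontr)
  assume "~ ?thesis"
  hence "th b < of_int (?n a) * pi" "of_int (?n a) * pi < th a" using fl nonint by auto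
  moreover from this have "EX t. a <= t & t <= b & th t = of_int (?n a) * pi" by (intro IVT2' c ab) auto
  ultimately show False using lev by force
 qed
 have "bij_betw ?n ?Z {?n a + 1..?n b}"
 proof (rule bij_betwI')
  fix t assume t: "t : ?Z"
  thus "?n t : {?n a + 1..?n b}" using lev[of t "?n t"] Zn[OF t] t unfolding fl(2)[OF nonint(1)] fl(1)[OF nonint(2)] by simp
  fix s assume s: "s : ?Z"
  show "(?n t = ?n s) = (t = s)"
   using U[of t "?n t" s] Zn[OF t] Zn[OF s] t s by force
 next
  fix n assume "n : {?n a + 1..?n b}"
  hence "th a < of_int n * pi" "of_int n * pi < th b" using fl nonint by auto
  hence "EX t. a <= t & t <= b & th t = of_int n * pi" by (intro IVT' c ab) auto
  then obtain t where t: "t : {a..b}" "th t = of_int n * pi" by auto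
  have "t : ?Z" using y0[OF t(1)] t unfolding sin_zero_iff_int2 by auto
  thus "EX t:?Z. n = ?n t" using t(2) by auto
 qed
 thus "finite ?Z" "int (card ?Z) = ?n b - ?n a"
  using bij_betw_finite[of ?n ?Z] bij_betw_same_card[of ?n ?Z] le by auto
qed

text \<open>Provides the hypothesis \<open>cross\<close> of \<open>angle_crossing\<close> from the
  sign of a derivative.\<close>

lemma simple_zero_sign:
 fixes f :: "real => real"
 assumes d: "(f hrd D) (at t)" and D: "D * x > 0" and 0: "f t = 0"
 shows "EX dl>0. ALL s:S. s ~= t & \<bar>s - t\<bar> < dl --> x * f s * (s - t) > 0"
proof -
 have "((%s. f s / (s - t)) ~~> D) (at t)" using d 0 by (simp add: has_field_derivative_iff)
 hence "((%s. f s / (s - t) * x) ~~> D * x) (at t)" by (rule tendsto_mult_right)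
 hence "eventually (%s. f s / (s - t) * x > 0) (at t)" using D by (rule order_tendstoD(1))
 then obtain dl where dl: "dl > 0" "!!s. s ~= t ==> dist s t < dl ==> f s / (s - t) * x > 0" by (auto simp: eventually_at)
 have "x * f s * (s - t) > 0" if "s ~= t" "\<bar>s - t\<bar> < dl" for s
 proof -
  have "x * f s * (s - t) = (f s / (s - t) * x) * ((s - t) * (s - t))" using that by simp
  moreover have "(s - t) * (s - t) > 0" using that by (auto simp: zero_less_mult_iff)
  ultimately show ?thesis using dl(2)[of s] that by (simp only: dist_real_def) (rule mult_pos_pos, auto)
 qed
 thus ?thesis using dl(1) by blast
qed

lemma continuous_on_lipschitz_prod:
 fixes f :: "real => real => real"
 assumes l: "!!k l t. k : S ==> l : S ==> t : T ==> \<bar>f k t - f l t\<bar> <= L * \<bar>k - l\<bar>" and c: "!!k. k : S ==> cts T (f k)"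
 shows "cts (S \<times> T) (%(k, t). f k t)"
 unfolding continuous_on_def
proof (clarify)
 fix k t assume k: "k : S" and t: "t : T"
 let ?F = "at (k, t) within S \<times> T"
 have 1: "((%p. L * \<bar>fst p - k\<bar>) ~~> L * \<bar>k - k\<bar>) ?F"
  by (intro tendsto_intros tendsto_eq_intros) (auto intro: tendsto_eq_rhs[OF tendsto_fst[OF tendsto_ident_at]])
 have "cts (S \<times> T) (%p. f k (snd p))"
  by (rule continuous_on_compose2[OF c[OF k]]) (auto intro: continuous_intros)
 hence 2: "((%p. f k (snd p)) ~~> f k t) ?F" using k t unfolding continuous_on_def by force
 have "((%p. (case p of (k, t) => f k t) - f k (snd p)) ~~> 0) ?F"
 proof (rule Lim_null_comparison)
  show "\<forall>\<^sub>F p in ?F. norm ((case p of (k, t) => f k t) - f k (snd p)) <= L * \<bar>fst p - k\<bar>"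
   unfolding eventually_at_filter using l k by (auto intro!: always_eventually)
 qed (use 1 in simp)
 from tendsto_add[OF this 2] show "((%(k, t). f k t) ~~> f k t) ?F" by (simp add: case_prod_unfold)
qed

section \<open>Zeros of the real Jost functions in both variables\<close>

context potential
begin

definition em :: "real => real => real" where "em k r = Re (jm (cx k) r)"
definition ep :: "real => real => real" where "ep k r = Re (jp (cx k) r)"
definition ej :: "real => real => real" where "ej k r = exp (- k * r) * em k r"
definition ej' :: "real => real => real" where "ej' k r = exp (- k * r) * (ep k r - k * em k r)"

lemma jost_real:
 assumes "k >= 0" "r >= 1"
 shows "jm (cx k) r = cx (em k r)" "jp (cx k) r = cx (ep k r)"
  "jost (cx k) r = cx (ej k r)" "jost' (cx k) r = cx (ej' k r)"
proof -
 show 1: "jm (cx k) r = cx (em k r)" "jp (cx k) r = cx (ep k r)"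
  using jm_real[OF assms] by (auto simp: em_def ep_def Reals_def)
 have "exp (- cx k * cx r) = cx (exp (- k * r))" by (simp add: exp_of_real[symmetric])
 thus "jost (cx k) r = cx (ej k r)" "jost' (cx k) r = cx (ej' k r)"
  by (simp_all add: jost_def jost'_def ej_def ej'_def 1)
qed

lemma jost_zero_iff: "k >= 0 ==> r >= 1 ==> jost (cx k) r = 0 \<longleftrightarrow> em k r = 0"
 by (simp add: jost_real ej_def)

lemma em_facts:
 assumes k: "k >= 0"
 shows "cts {1..} (em k)" "cts {1..} (ep k)" "cts {1..} (ej k)" "cts {1..} (ej' k)"
  "r > 1 ==> (em k hrd ep k r) (at r)" "r > 1 ==> (ej k hrd ej' k r) (at r)"
  "r > 1 ==> (ej' k hrd (k^2 - V r) * ej k r) (at r)"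
  "r >= 1 ==> em k r = 0 ==> ep k r ~= 0" "r >= 1 ==> \<bar>em k r - 1\<bar> <= wt r - 1"
proof -
 let ?k = "cx k"
 have k': "Re ?k >= 0" using k by simp
 show c: "cts {1..} (em k)" "cts {1..} (ep k)"
  unfolding em_def[abs_def] ep_def[abs_def] by (intro continuous_intros jm_bound(1)[OF k'] jp_facts(1)[OF k'])+
 show "cts {1..} (ej k)" "cts {1..} (ej' k)"
  unfolding ej_def[abs_def] ej'_def[abs_def] by (intro continuous_intros c)+
 have j: "(jost ?k hvd jost' ?k r) (at r)" "(jost' ?k hvd (?k^2 - V r) * jost ?k r) (at r)" if "r > 1" for r
  using jost_solution[OF k'] that by (auto simp: solution_def)
 note Re = bounded_linear.has_vector_derivative[OF bounded_linear_Re]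
 have tr: "(f hrd Re D) (at r)" if "(F hvd D) (at r)" "r > 1" "!!s. s > 1 ==> Re (F s) = f s" for f F D r
  unfolding has_real_derivative_iff_has_vector_derivative
  by (rule has_vector_derivative_transform_within_open[OF Re[OF that(1)], of "{1<..}"]) (use that in auto)
 show "(em k hrd ep k r) (at r)" if "r > 1"
  using tr[OF jp_facts(4)[OF k' that] that, of "em k"] by (simp add: em_def ep_def)
 show "(ej k hrd ej' k r) (at r)" if "r > 1"
  using tr[OF j(1)[OF that] that, of "ej k"] that k by (simp add: jost_real)
 show "(ej' k hrd (k^2 - V r) * ej k r) (at r)" if "r > 1"
  using tr[OF j(2)[OF that] that, of "ej' k"] that k by (simp add: jost_real flip: of_real_power of_real_diff of_real_mult)
 show "ep k r ~= 0" if "r >= 1" "em k r = 0"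
  using jost_data_nonzero[OF k' that(1)] that k by (simp add: jost_real ej_def ej'_def)
 show "\<bar>em k r - 1\<bar> <= wt r - 1" if "r >= 1"
  using jp_facts(5)[OF k' that] abs_Re_le_cmod[of "jm ?k r - 1"] by (simp add: em_def)
qed

lemma em_lipschitz:
 assumes "k >= 0" "l >= 0" "t >= 1"
 shows "\<bar>em k t - em l t\<bar> <= 4 * exp M * \<bar>k - l\<bar>" "\<bar>ep k t - ep l t\<bar> <= 8 * exp M * \<bar>k - l\<bar>"
 using jm_lipschitz[OF assms] abs_Re_le_cmod[of "jm k t - jm l t"] abs_Re_le_cmod[of "jp k t - jp l t"]
 by (simp_all add: em_def ep_def)

lemma em_continuous:
 assumes "S <= {0..}"
 shows "cts (S \<times> {1..R}) (%(k, r). em k r)" "cts (S \<times> {1..R}) (%(k, r). ep k r)"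
 by (rule continuous_on_lipschitz_prod[OF em_lipschitz(1)] continuous_on_lipschitz_prod[OF em_lipschitz(2)];
   use assms in "auto intro: continuous_on_subset[OF em_facts(1)] continuous_on_subset[OF em_facts(2)]")+

lemma em_near_1:
 obtains R where "R > 1" "!!k r. k >= 0 ==> r >= R ==> \<bar>em k r - 1\<bar> <= 1 / 2"
proof -
 have "eventually (%r. wt r < 3 / 2 & r > 1) at_top"
  using order_tendstoD(2)[OF wt_tendsto, of "3 / 2"] eventually_gt_at_top[of 1] by (auto intro: eventually_conj)
 then obtain R where R: "!!r. r >= R ==> wt r < 3 / 2 & r > 1" by (auto simp: eventually_at_top_linorder)
 have "\<bar>em k r - 1\<bar> <= 1 / 2" if "k >= 0" "r >= R" for k r using em_facts(9)[OF that(1), of r] R[OF that(2)] by linarith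
 thus ?thesis using that[of R] R[of R] by blast
qed

lemma em_ge_half:
 obtains R where "R > 1" "!!k r. k >= 0 ==> r >= R ==> em k r >= 1 / 2"
proof -
 obtain R where R: "R > 1" "!!k r. k >= 0 ==> r >= R ==> \<bar>em k r - 1\<bar> <= 1 / 2" using em_near_1 by blast
 show ?thesis
 proof
  show "em k r >= 1 / 2" if "k >= 0" "r >= R" for k r using R(2)[OF that] by linarith
 qed (rule R(1))
qed

text \<open>For large \<open>k\<close> the coefficient \<open>k^2 - V\<close> is nonnegative. Beyond
  a zero of \<open>ej\<close> the product \<open>ej * ej'\<close> increases from zero, so
  \<open>ej^2\<close> cannot decrease, which contradicts its exponential decay.\<close>

lemma em_nonzero:
 assumes k: "k > 0" "k^2 >= M" and r: "r >= 1"
 shows "em k r ~= 0"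
proof
 assume z: "em k r = 0"
 have k0: "k >= 0" using k by simp
 obtain R where R: "R > 1" "!!k r. k >= 0 ==> r >= R ==> \<bar>em k r - 1\<bar> <= 1 / 2" using em_near_1 by blast
 have h: "1 / 2 <= em k t" "em k t <= 3 / 2" if "t >= R" for t using R(2)[OF k0 that] by linarith+
 have c: "cts {a..b} (ej k)" "cts {a..b} (ej' k)" if "a >= 1" for a b
  by (rule continuous_on_subset[OF em_facts(3)[OF k0]] continuous_on_subset[OF em_facts(4)[OF k0]]; use that in auto)+
 have g: "ej k t * ej' k t >= 0" if "t > r" for t
 proof -
  have "ej k r * ej' k r <= ej k t * ej' k t"
  proof (rule DERIV_nonneg_imp_increasing_open[OF less_imp_le[OF that]])
   fix x assume "r < x" "x < t"
   hence x: "x > 1" using r by simp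
   have "((%t. ej k t * ej' k t) hrd (k^2 - V x) * (ej k x)^2 + (ej' k x)^2) (at x)"
    by (rule DERIV_cong[OF DERIV_mult[OF em_facts(6)[OF k0 x] em_facts(7)[OF k0 x]]]) (simp add: power2_eq_square algebra_simps)
   moreover have "k^2 - V x >= 0" using V_bound[of x] x k by linarith
   ultimately show "EX y. ((%t. ej k t * ej' k t) hrd y) (at x) & 0 <= y" by (intro exI conjI) (assumption, simp)
  qed (intro continuous_intros c r)
  thus ?thesis using z by (simp add: ej_def)
 qed
 \<comment> \<open>Over the distance \<open>5 / k\<close> the squared exponential drops by the
   factor \<open>exp 10 >= 11\<close>, while \<open>em\<close> stays between \<open>1 / 2\<close>
   and \<open>3 / 2\<close>; monotonicity would give \<open>11 / 4 <= 9 / 4\<close>.\<close>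
 define s t where "s = max R (r + 1)" and "t = s + 5 / k"
 have st: "s < t" "s > r" "s >= R" "t >= R"
 proof -
  have "5 / k > 0" "s > r" "s >= R" using k by (auto simp: s_def)
  thus "s < t" "s > r" "s >= R" "t >= R" unfolding t_def by linarith+
 qed
 have "(ej k s)^2 <= (ej k t)^2"
 proof (rule DERIV_nonneg_imp_increasing_open[OF less_imp_le[OF st(1)]])
  fix x assume x: "s < x" "x < t"
  hence "((%t. (ej k t)^2) hrd 2 * (ej k x * ej' k x)) (at x)"
   using st R(1) by (intro DERIV_cong[OF DERIV_power[OF em_facts(6)[OF k0]]]) auto
  moreover have "2 * (ej k x * ej' k x) >= 0" using g[of x] x st by simp
  ultimately show "EX y. ((%t. (ej k t)^2) hrd y) (at x) & 0 <= y" by blast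
 qed (use st R(1) in "intro continuous_intros c, simp")
 moreover have sq: "(ej k x)^2 = exp (- 2 * (k * x)) * (em k x)^2" for x
  by (simp add: ej_def power_mult_distrib exp_of_nat_mult[symmetric] mult_ac)
 moreover have "exp (- 2 * (k * s)) = exp (- 2 * (k * t)) * exp 10" using k by (simp add: exp_add[symmetric] t_def algebra_simps)
 ultimately have "exp (- 2 * (k * t)) * (exp 10 * (em k s)^2) <= exp (- 2 * (k * t)) * (em k t)^2" by (simp add: mult_ac)
 hence "exp 10 * (em k s)^2 <= (em k t)^2" by (subst (asm) mult_le_cancel_left_pos) auto
 moreover have "(em k t)^2 <= (3 / 2)^2" "(1 / 2)^2 <= (em k s)^2" using h[OF st(3)] h[OF st(4)] by (intro power_mono; simp)+
 moreover have "11 * (1 / 2)^2 <= exp 10 * (em k s)^2"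
  using exp_ge_add_one_self[of "10::real"] calculation(3) by (intro mult_mono) auto
 ultimately show False by (simp add: power2_eq_square)
qed

text \<open>Monotonicity in the spectral parameter by a Wronskian identity. \<open>F\<close> has the
  derivative \<open>(k^2 - k0^2) * ej k0 * ej k\<close>, vanishes at infinity and equals
  \<open>- ej' k0 1 * ej k 1\<close> at \<open>1\<close>. On \<open>{1..R}\<close> the integral of
  the product is positive for \<open>k\<close> near \<open>k0\<close>, being so at
  \<open>k0\<close>; the tail has a sign of its own.\<close>

lemma em_crossing:
 assumes k0: "k0 > 0" "em k0 1 = 0"
 shows "EX dl>0. ALL k:{0..K}. k ~= k0 & \<bar>k - k0\<bar> < dl --> (ep k0 1 - k0 * em k0 1) * em k 1 * (k - k0) > 0"
proof -
 obtain R where R: "R > 1" "!!k r. k >= 0 ==> r >= R ==> em k r >= 1 / 2" using em_ge_half by blast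
 have k0': "k0 >= 0" using k0 by simp
 let ?I = "%k. integral {1..R} (%r. ej k0 r * ej k r)"
 have cc: "cts ({0..} \<times> {1..R}) (%p. ej k0 (snd p) * ej (fst p) (snd p))"
 proof -
  have "cts ({0..} \<times> {1..R}) (%p. em (fst p) (snd p))" using em_continuous(1)[of "{0..}" R] by (simp add: case_prod_unfold)
  thus ?thesis
   unfolding ej_def by (intro continuous_intros continuous_on_compose2[OF em_facts(1)[OF k0']]) auto
 qed
 hence cI: "cts {0..} ?I"
  using integral_continuous_on_param[of "{0..}" 1 R "%k r. ej k0 r * ej k r"] by (simp add: case_prod_unfold)
 have cr: "cts {1..R} (%r. ej k0 r * ej k r)" if "k >= 0" for k
  by (intro continuous_intros continuous_on_subset[OF em_facts(3)]) (use that k0' in auto)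
 have "?I k0 > 0"
 proof -
  have i: "(%r. ej k0 r * ej k0 r) integrable_on {1..R}" by (rule integrable_continuous_real[OF cr[OF k0']])
  have "?I k0 >= 0" by (rule integral_nonneg[OF i]) simp
  moreover have "?I k0 ~= 0"
  proof
   assume "?I k0 = 0"
   hence "((%r. ej k0 r * ej k0 r) has_integral 0) (cbox 1 R)" using integrable_integral[OF i] by simp
   from has_integral_0_cbox_imp_0[OF _ _ this, of R] have "ej k0 R = 0" using cr[OF k0'] R(1) by simp
   thus False using R(2)[OF k0' order_refl] by (simp add: ej_def)
  qed
  ultimately show ?thesis by simp
 qed
 hence "eventually (%k. ?I k > 0) (at k0 within {0..})"
  using cI k0' unfolding continuous_on_def by (intro order_tendstoD(1)) auto
 then obtain dl where dl: "dl > 0" "!!k. k >= 0 ==> k ~= k0 ==> dist k k0 < dl ==> ?I k > 0" by (auto simp: eventually_at)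
 have "(ep k0 1 - k0 * em k0 1) * em k 1 * (k - k0) > 0" if k: "k : {0..K}" "k ~= k0" "\<bar>k - k0\<bar> < dl" for k
 proof -
  have k': "k >= 0" using k by simp
  define F where "F r = ej k0 r * ej' k r - ej' k0 r * ej k r" for r
  have cF: "cts {1..} F" unfolding F_def[abs_def] by (intro continuous_intros em_facts k' k0')
  have dF: "(F hrd (k^2 - k0\<^sup>2) * (ej k0 r * ej k r)) (at r)" if "r > 1" for r
   unfolding F_def[abs_def]
   by (rule DERIV_cong[OF DERIV_diff[OF DERIV_mult[OF em_facts(6)[OF k0' that] em_facts(7)[OF k' that]]
      DERIV_mult[OF em_facts(7)[OF k0' that] em_facts(6)[OF k' that]]]]) (simp add: algebra_simps)
  have F0: "(F ~~> 0) at_top"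
  proof (rule Lim_null_comparison)
   let ?B = "%k. 2 * exp M * (1 + k)"
   have b: "\<bar>ej l r\<bar> <= ?B l * 1" "\<bar>ej' l r\<bar> <= ?B l * 1" "\<bar>ej k0 r\<bar> <= ?B k0 * exp (- k0 * r)" "\<bar>ej' k0 r\<bar> <= ?B k0 * exp (- k0 * r)"
    if "l >= 0" "r >= 1" for l r
   proof -
    have *: "\<bar>ej l r\<bar> <= ?B l * exp (- l * r)" "\<bar>ej' l r\<bar> <= ?B l * exp (- l * r)" if "l >= 0" for l
    proof -
     have "2 * exp M * exp (- l * r) <= ?B l * exp (- l * r)" using that by (intro mult_right_mono) auto
     moreover have "\<bar>ej l r\<bar> <= 2 * exp M * exp (- l * r)" "\<bar>ej' l r\<bar> <= ?B l * exp (- l * r)"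
      using jost_decay[of "cx l" r] that \<open>r >= 1\<close> by (simp_all add: jost_real)
     ultimately show "\<bar>ej l r\<bar> <= ?B l * exp (- l * r)" "\<bar>ej' l r\<bar> <= ?B l * exp (- l * r)" by linarith+
    qed
    have "?B l * exp (- l * r) <= ?B l * 1" using that by (intro mult_left_mono) auto
    thus "\<bar>ej l r\<bar> <= ?B l * 1" "\<bar>ej' l r\<bar> <= ?B l * 1" "\<bar>ej k0 r\<bar> <= ?B k0 * exp (- k0 * r)" "\<bar>ej' k0 r\<bar> <= ?B k0 * exp (- k0 * r)"
     using *[OF that(1)] *[OF k0'] by linarith+
   qed
   have "norm (F r) <= (?B k0 * ?B k * 2) * exp (- k0 * r)" if "r >= 1" for r
   proof -
    have "norm (F r) <= \<bar>ej k0 r\<bar> * \<bar>ej' k r\<bar> + \<bar>ej' k0 r\<bar> * \<bar>ej k r\<bar>" unfolding F_def by (simp flip: abs_mult)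
    also have "... <= (?B k0 * exp (- k0 * r)) * (?B k * 1) + (?B k0 * exp (- k0 * r)) * (?B k * 1)"
     using k0' k' by (intro add_mono mult_mono b(1,2)[OF k' that] b(3,4)[OF k' that]) auto
    finally show ?thesis by (simp add: algebra_simps)
   qed
   thus "eventually (%r. norm (F r) <= (?B k0 * ?B k * 2) * exp (- k0 * r)) at_top"
    by (auto simp: eventually_at_top_linorder)
   have "((%r. exp (- k0 * r)) ~~> 0) at_top"
    using k0 by (intro filterlim_compose[OF exp_at_bot] filterlim_tendsto_neg_mult_at_bot[OF tendsto_const] filterlim_ident) auto
   thus "((%r. (?B k0 * ?B k * 2) * exp (- k0 * r)) ~~> 0) at_top" by (rule tendsto_mult_right_zero)
  qed
  have pos: "ej k0 r * ej k r > 0" if "r >= R" for r using R(2)[OF k' that] R(2)[OF k0' that] by (simp add: ej_def)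
  \<comment> \<open>Beyond \<open>R\<close> both functions are positive whatever \<open>k\<close>
    is, so the sign of the tail is known without any smallness of \<open>k - k0\<close>.\<close>
  have FR: "F R * (k - k0) <= 0"
  proof -
   have s: "(k^2 - k0\<^sup>2) * (k - k0) >= 0"
   proof -
    have "(k^2 - k0\<^sup>2) * (k - k0) = (k + k0) * (k - k0)^2" by (simp add: power2_eq_square algebra_simps)
    thus ?thesis using k' k0' by simp
   qed
   have "F R * (k - k0) <= F r * (k - k0)" if "r >= R" for r
   proof (rule DERIV_nonneg_imp_nondecreasing[OF that])
    fix t assume t: "R <= t" "t <= r"
    hence "t > 1" using R(1) by simp
    have "((%r. F r * (k - k0)) hrd (k^2 - k0\<^sup>2) * (ej k0 t * ej k t) * (k - k0)) (at t)"
     by (rule DERIV_cmult_right[OF dF[OF \<open>t > 1\<close>]])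
    moreover have "(k^2 - k0\<^sup>2) * (ej k0 t * ej k t) * (k - k0) >= 0"
     using mult_nonneg_nonneg[OF s less_imp_le[OF pos[OF t(1)]]] by (simp add: mult_ac)
    ultimately show "EX y. ((%r. F r * (k - k0)) hrd y) (at t) & 0 <= y" by blast
   qed
   thus ?thesis
    using tendsto_mult_left_zero[OF F0, of "k - k0"]
    by (intro tendsto_lowerbound[of "%r. F r * (k - k0)" 0 at_top]) (auto simp: eventually_at_top_linorder)
  qed
  have "((%r. (k^2 - k0\<^sup>2) * (ej k0 r * ej k r)) has_integral F R - F 1) {1..R}"
   by (rule fundamental_theorem_of_calculus_interior)
     (use R(1) dF in "auto intro: continuous_on_subset[OF cF] simp: has_real_derivative_iff_has_vector_derivative")
  from integral_unique[OF this] have "F R - F 1 = (k^2 - k0\<^sup>2) * ?I k" by simp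
  moreover have "F 1 = - (ej' k0 1 * ej k 1)" using k0(2) by (simp add: F_def ej_def)
  ultimately have X: "ej' k0 1 * ej k 1 = (k^2 - k0\<^sup>2) * ?I k - F R" by linarith
  have "ej' k0 1 * ej k 1 * (k - k0) = (k^2 - k0\<^sup>2) * ?I k * (k - k0) - F R * (k - k0)" unfolding X by (rule left_diff_distrib)
  moreover have "(k^2 - k0\<^sup>2) * ?I k * (k - k0) > 0"
  proof -
   have "(k^2 - k0\<^sup>2) * ?I k * (k - k0) = (k + k0) * (k - k0)^2 * ?I k" by (simp add: power2_eq_square algebra_simps)
   moreover have "(k + k0) * (k - k0)^2 > 0" using k k' k0 by (intro mult_pos_pos) auto
   moreover have "?I k > 0" using dl(2)[OF k' k(2)] k(3) by (simp add: dist_real_def)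
   ultimately show ?thesis by (simp only: mult_pos_pos)
  qed
  ultimately have "ej' k0 1 * ej k 1 * (k - k0) > 0" using FR by linarith
  hence "(exp (- k0) * exp (- k)) * ((ep k0 1 - k0 * em k0 1) * em k 1 * (k - k0)) > 0"
   by (simp add: ej_def ej'_def mult_ac)
  thus ?thesis by (rule zero_less_mult_pos) simp
 qed
 thus ?thesis using dl(1) by blast
qed

text \<open>Since \<open>em\<close> and \<open>ep\<close> have no common zero and the rectangle is
  contractible, a continuous angle of \<open>(x, em)\<close> exists on it. On the sides
  \<open>k = K\<close> and \<open>r = R\<close> there are no zeros, so the floor of the angle over
  \<open>pi\<close> agrees at all corners but \<open>(0, 1)\<close>. The two sides that issue from
  this corner hence carry equally many zeros, one counting in \<open>r\<close>, the other in
  \<open>k\<close>.\<close>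

lemma eigenvalue_count:
 assumes e1: "jost 0 1 ~= 0"
 shows "finite {k::real. k > 0 & jost (cx k) 1 = 0}"
  "card {k::real. k > 0 & jost (cx k) 1 = 0} = card {r. r > 1 & jost 0 r = 0}"
proof -
 obtain R where R: "R > 1" "!!k r. k >= 0 ==> r >= R ==> em k r >= 1 / 2" using em_ge_half by blast
 \<comment> \<open>As \<open>K >= 1\<close>, every \<open>k >= K\<close> satisfies
   \<open>k^2 >= K >= M\<close>, which \<open>em_nonzero\<close> asks for.\<close>
 define K where "K = 1 + M"
 have K: "K > 0" using M2 by (simp add: K_def)
 have KR: "em k r ~= 0" if "k >= K" "r >= 1" for k r
 proof (rule em_nonzero[OF _ _ that(2)])
  have "K * 1 <= k * k" using that K M2 by (intro mult_mono) (auto simp: K_def)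
  thus "k^2 >= M" by (simp add: K_def power2_eq_square)
 qed (use that K in simp)
 let ?S = "{0..K} \<times> {1..R}"
 \<comment> \<open>This is \<open>ej'\<close> without its exponential factor; at a zero of
   \<open>em\<close> it reduces to \<open>ep\<close>.\<close>
 define x where "x k r = ep k r - k * em k r" for k r
 let ?Z = "%p. Complex (x (fst p) (snd p)) (em (fst p) (snd p))"
 have "cts ?S (%p. em (fst p) (snd p))" "cts ?S (%p. ep (fst p) (snd p))"
  using em_continuous[of "{0..K}" R] by (simp_all add: case_prod_unfold)
 hence Z1: "cts ?S ?Z" unfolding x_def Complex_eq by (intro continuous_intros)
 have Z2: "contractible ?S" by (intro convex_imp_contractible convex_Times) auto
 have Z3: "?Z p ~= 0" if "p : ?S" for p
  using em_facts(8)[of "fst p" "snd p"] that by (auto simp: complex_eq_iff x_def)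
 obtain g where g: "cts ?S g" "!!p. p : ?S ==> ?Z p = exp (g p)"
  by (rule continuous_logarithm_on_contractible[OF Z1 Z2 Z3]) blast+
 define th where "th k r = Im (g (k, r))" for k r
 have xy: "x k r = exp (Re (g (k, r))) * cos (th k r)" "em k r = exp (Re (g (k, r))) * sin (th k r)" if "k : {0..K}" "r : {1..R}" for k r
  using arg_cong[OF g(2)[of "(k, r)"], of Re] arg_cong[OF g(2)[of "(k, r)"], of Im] that by (simp_all add: Re_exp Im_exp th_def)
 have c: "cts {0..K} (%k. th k r)" if "r : {1..R}" for r
  unfolding th_def by (intro continuous_intros continuous_on_compose2[OF g(1)]) (use that in auto)
 have c': "cts {1..R} (th k)" if "k : {0..K}" for k
  unfolding th_def[abs_def] by (intro continuous_intros continuous_on_compose2[OF g(1)]) (use that in auto)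
 have m1: "1 : {1..R}" and mR: "R : {1..R}" and m0: "0 : {0..K}" and mK: "K : {0..K}" using R(1) K by auto
 have eR: "em k R > 0" if "k >= 0" for k using R(2)[OF that order_refl] by linarith
 have nR: "em k R ~= 0" if "k >= 0" for k using eR[OF that] by simp
 have nK: "em K r ~= 0" if "r >= 1" for r using KR[OF order_refl that] .
 have e01: "em 0 1 ~= 0" using e1 jost_zero_iff[of 0 1] by simp
 let ?f = "%k r. \<lfloor>th k r / pi\<rfloor>"
 have 1: "int (card {r : {1..R}. em 0 r = 0}) = ?f 0 R - ?f 0 1"
 proof (rule angle_crossing(2)[where x = "x 0" and rh = "%r. exp (Re (g (0, r)))"])
  fix t assume t: "t : {1..R}" "em 0 t = 0"
  hence "t > 1" using e01 by (cases "t = 1") auto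
  have "ep 0 t * x 0 t > 0" using em_facts(8)[of 0 t] t by (auto simp: x_def zero_less_mult_iff)
  from simple_zero_sign[OF em_facts(5)[OF order_refl \<open>t > 1\<close>] this t(2), of "{1..R}"]
  show "EX dl>0. ALL s:{1..R}. s ~= t & \<bar>s - t\<bar> < dl --> 0 < x 0 t * em 0 s * (s - t)" .
 qed (use R(1) e01 eR[of 0] xy[OF m0] c'[OF m0] in "force+")
 have 2: "finite {k : {0..K}. em k 1 = 0}" "int (card {k : {0..K}. em k 1 = 0}) = ?f K 1 - ?f 0 1"
 proof -
  have cross: "EX dl>0. ALL s:{0..K}. s ~= t & \<bar>s - t\<bar> < dl --> 0 < x t 1 * em s 1 * (s - t)" if "t : {0..K}" "em t 1 = 0" for t
  proof -
   have "t > 0" using e01 that by (cases "t = 0") auto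
   thus ?thesis using em_crossing[of t K] that by (simp add: x_def)
  qed
  have "finite {k : {0..K}. em k 1 = 0} & int (card {k : {0..K}. em k 1 = 0}) = ?f K 1 - ?f 0 1"
   by (intro conjI angle_crossing[where x = "%k. x k 1" and rh = "%k. exp (Re (g (k, 1)))" and th = "%k. th k 1"]
     exp_gt_zero less_imp_le[OF K] c[OF m1] xy[OF _ m1] e01 nK cross order_refl)
  thus "finite {k : {0..K}. em k 1 = 0}" "int (card {k : {0..K}. em k 1 = 0}) = ?f K 1 - ?f 0 1" by blast+
 qed
 have 3: "int (card {k : {0..K}. em k R = 0}) = ?f K R - ?f 0 R"
  by (intro angle_crossing(2)[where x = "%k. x k R" and rh = "%k. exp (Re (g (k, R)))" and th = "%k. th k R"]
     exp_gt_zero less_imp_le[OF K] c[OF mR] xy[OF _ mR]) (auto simp: nR less_imp_le[OF K])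
 have 30: "{k : {0..K}. em k R = 0} = {}" using nR by auto
 have 4: "int (card {r : {1..R}. em K r = 0}) = ?f K R - ?f K 1"
  by (intro angle_crossing(2)[where x = "x K" and rh = "%r. exp (Re (g (K, r)))" and th = "th K"]
     exp_gt_zero less_imp_le[OF R(1)] c'[OF mK] xy[OF mK]) (use R(1) in "auto simp: nK")
 have 40: "{r : {1..R}. em K r = 0} = {}" using nK by auto
 have A: "{k : {0..K}. em k 1 = 0} = {k::real. k > 0 & jost (cx k) 1 = 0}"
 proof (intro set_eqI iffI)
  fix k assume "k : {k : {0..K}. em k 1 = 0}"
  thus "k : {k. k > 0 & jost (cx k) 1 = 0}" using e01 by (cases "k = 0") (auto simp: jost_zero_iff)
 next
  fix k assume "k : {k. k > 0 & jost (cx k) 1 = 0}"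
  thus "k : {k : {0..K}. em k 1 = 0}" using KR[of k 1] by (cases "k <= K") (auto simp: jost_zero_iff)
 qed
 have "{r : {1..R}. em 0 r = 0} = {r. r > 1 & jost 0 r = 0}"
 proof (intro set_eqI iffI)
  fix r assume "r : {r : {1..R}. em 0 r = 0}"
  thus "r : {r. r > 1 & jost 0 r = 0}" using e01 jost_zero_iff[of 0 r] by (cases "r = 1") auto
 next
  fix r assume "r : {r. r > 1 & jost 0 r = 0}"
  thus "r : {r : {1..R}. em 0 r = 0}" using R(2)[of 0 r] jost_zero_iff[of 0 r] by (cases "r <= R") auto
 qed
 thus "finite {k::real. k > 0 & jost (cx k) 1 = 0}"
  "card {k::real. k > 0 & jost (cx k) 1 = 0} = card {r. r > 1 & jost 0 r = 0}"
  using 1 2 3[unfolded 30] 4[unfolded 40] unfolding A by auto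
qed

end

section \<open>Regularity of radial weak solutions\<close>

lemma constant_outside:
 fixes f :: "real => complex"
 assumes "!!r. (f hvd f' r) (at r)" "convex S" "!!r. r : S ==> f' r = 0" "s : S" "r : S"
 shows "f r = f s"
 using has_vector_derivative_zero_constant[OF assms(2), of f] assms by (metis has_vector_derivative_at_within)

text \<open>A second order du Bois-Reymond lemma. Let \<open>u\<close> be \<open>ps\<close> minus
  its projection onto the affine functions for the weight \<open>B\<close>. Then
  \<open>f = B * cnj u\<close> is orthogonal to the affine functions and vanishes at both ends, so
  it is the second derivative of an admissible profile. Testing with this profile gives a zero
  integral of \<open>B * |u|^2\<close>.\<close>

lemma annihilator_affine:
 fixes ps :: "real => complex"
 assumes c: "cts UNIV ps" and ab: "1 < a" "a < b"
  and w: "!!v v' v''. C2_profile v v' v'' a b ==> integral {a..b} (%r. v'' r * ps r) = 0"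
 shows "EX al be :: complex. ALL r:{a<..<b}. ps r = al + be * r"
proof -
 define B where "B r = max 0 ((r - a) * (b - r))" for r :: real
 have B0: "B r >= 0" "r : {a<..<b} ==> B r > 0" "r ~: {a<..<b} ==> B r = 0" for r
  using ab by (auto simp: B_def max_def not_less mult_le_0_iff zero_le_mult_iff)
 have cB: "cts S B" for S unfolding B_def[abs_def] by (intro continuous_intros)
 have c': "cts S ps" for S using c by (rule continuous_on_subset) simp
 let ?J = "integral {a..b}"
 have pos: "?J (%r. B r * (f r)^2) > 0" if "cts {a..b} f" "EX r:{a<..<b}. f r ~= 0" for f :: "real => real"
 proof -
  have cf: "cts {a..b} (%r. B r * (f r)^2)" by (intro continuous_intros cB that)
  have "?J (%r. B r * (f r)^2) >= 0" by (intro integral_nonneg integrable_continuous_real cf) (simp add: B0)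
  moreover have "?J (%r. B r * (f r)^2) ~= 0"
  proof
   assume "?J (%r. B r * (f r)^2) = 0"
   hence "ALL r:{a..b}. B r * (f r)^2 = 0" using integral_eq_0_iff[OF cf] B0(1) ab by simp
   thus False using that(2) B0(2) by force
  qed
  ultimately show ?thesis by simp
 qed
 define b0 where "b0 = ?J (%r. B r * 1^2)"
 have b0: "b0 > 0" unfolding b0_def by (rule pos) (use dense[OF ab(2)] in auto)
 \<comment> \<open>The centre of mass for the weight \<open>B\<close>, which makes
   \<open>r - mu\<close> orthogonal to the constants.\<close>
 define mu where "mu = ?J (%r. B r * r) / b0"
 define s where "s = ?J (%r. B r * (r - mu)^2)"
 have s: "s > 0" unfolding s_def
 proof (rule pos)
  obtain r1 where r1: "a < r1" "r1 < b" using dense ab by blast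
  moreover obtain r2 where "a < r2" "r2 < r1" using dense r1 by blast
  ultimately show "EX r:{a<..<b}. r - mu ~= 0" by (cases "r1 = mu") (auto intro: bexI[of _ r1] bexI[of _ r2])
 qed (intro continuous_intros)
 let ?B = "%r. cx (B r)"
 define p where "p r = cx (r - mu)" for r
 have cp: "cts S p" for S unfolding p_def[abs_def] by (intro continuous_intros)
 define al where "al = ?J (%r. ?B r * ps r) / b0"
 define be where "be = ?J (%r. ?B r * (p r * ps r)) / s"
 define u where "u r = ps r - al - be * p r" for r
 define f where "f r = ?B r * cnj (u r)" for r
 have cu: "cts S u" for S unfolding u_def[abs_def] by (intro continuous_intros c' cp)
 have cf: "cts S f" for S unfolding f_def[abs_def] by (intro continuous_intros cu cB)
 note ci = integrable_continuous_real
 have J: "?J (%r. cx (h r)) = cx (?J h)" if "cts {a..b} h" for h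
  by (rule integral_unique has_integral_of_real integrable_integral ci that)+
 have p0: "?J (%r. ?B r * p r) = 0"
 proof -
  have "?J (%r. ?B r * p r) = cx (?J (%r. B r * (r - mu)))" unfolding p_def
   by (subst J[symmetric]) (auto intro!: continuous_intros cB)
  also have "?J (%r. B r * (r - mu)) = ?J (%r. B r * r) - ?J (%r. mu * (B r * 1^2))"
   by (subst integral_diff[symmetric]) (auto intro!: continuous_intros ci cB simp: algebra_simps)
  also have "... = 0" using b0 unfolding integral_mult_right b0_def[symmetric] by (simp add: mu_def)
  finally show ?thesis by simp
 qed
 have b0c: "?J ?B = b0" by (subst J) (auto intro: cB simp: b0_def)
 have sc: "?J (%r. ?B r * (p r * p r)) = s"
 proof -
  have "cts {a..b} (%r. B r * (r - mu)^2)" by (intro continuous_intros cB)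
  from J[OF this] show ?thesis by (simp add: s_def p_def power2_eq_square)
 qed
 have split: "?J (%r. ?B r * (q r * u r)) = ?J (%r. ?B r * (q r * ps r)) - al * ?J (%r. ?B r * q r) - be * ?J (%r. ?B r * (q r * p r))"
  if "cts {a..b} q" for q
 proof -
  have "?J (%r. ?B r * (q r * u r)) = ?J (%r. ?B r * (q r * ps r) - al * (?B r * q r) - be * (?B r * (q r * p r)))"
   by (simp add: u_def algebra_simps)
  also have "... = ?J (%r. ?B r * (q r * ps r)) - ?J (%r. al * (?B r * q r)) - ?J (%r. be * (?B r * (q r * p r)))"
   by (subst integral_diff, (intro ci continuous_intros that cB c' cp)+)+ simp
  finally show ?thesis by simp
 qed
 have o: "?J (%r. ?B r * u r) = 0" "?J (%r. ?B r * (p r * u r)) = 0"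
  using split[of "%_. 1", OF continuous_on_const] split[of p, OF cp] b0 s by (simp_all add: b0c sc p0 al_def be_def)
 have f0: "?J f = 0" "?J (%r. p r * f r) = 0"
  using arg_cong[OF o(1), of cnj] arg_cong[OF o(2), of cnj] by (simp_all add: f_def[abs_def] p_def integral_cnj mult_ac)
 obtain v' where v': "!!x. (v' hvd f x) (at x)" "v' a = 0" using antiderivative_exists[OF cf] by blast
 have cv': "cts S v'" for S using v'(1) by (auto intro!: continuous_at_imp_continuous_on has_vector_derivative_continuous)
 obtain v where v: "!!x. (v hvd v' x) (at x)" "v a = 0" using antiderivative_exists[OF cv'] by blast
 have fo: "f r = 0" if "r : {..a} | r : {b..}" for r using B0(3)[of r] that by (auto simp: f_def)
 have b': "v' b = 0"
  using fundamental_theorem_of_calculus[of a b v' f] v' ab f0(1) by (auto simp: has_vector_derivative_at_within dest!: integral_unique)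
 have vb: "v b = 0"
 proof -
  have dp: "(p hvd 1) (at r)" for r
   using has_vector_derivative_of_real[OF DERIV_diff[OF DERIV_ident DERIV_const]] by (simp add: p_def[abs_def])
  have "((%r. p r * v' r - v r) hvd p r * f r) (at r)" for r
   by (rule has_vector_derivative_eq_rhs[OF has_vector_derivative_diff[OF has_vector_derivative_mult[OF dp v'(1)] v(1)]]) simp
  hence "((%r. p r * f r) has_integral (p b * v' b - v b) - (p a * v' a - v a)) {a..b}"
   using ab by (intro fundamental_theorem_of_calculus) (auto simp: has_vector_derivative_at_within)
  from integral_unique[OF this] show ?thesis using f0(2) b' v'(2) v(2) by simp
 qed
 have v'o: "v' r = 0" if "r : {..a} | r : {b..}" for r
  using that constant_outside[OF v'(1), of "{..a}" a r] constant_outside[OF v'(1), of "{b..}" b r] fo v'(2) b' by auto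
 have vo: "v r = 0" if "r : {..a} | r : {b..}" for r
  using that constant_outside[OF v(1), of "{..a}" a r] constant_outside[OF v(1), of "{b..}" b r] v'o v(2) vb by auto
 have "C2_profile v v' f a b" by unfold_locales (use v v' cf ab vo in auto)
 from w[OF this] have "?J (%r. f r * ps r) = 0" .
 moreover have "?J (%r. f r * ps r) = ?J (%r. f r * u r + al * f r + be * (p r * f r))"
  by (rule integral_cong) (simp add: u_def algebra_simps)
 moreover have "... = ?J (%r. f r * u r) + al * ?J f + be * ?J (%r. p r * f r)"
  by (subst integral_add, (intro ci continuous_intros cf cu cp)+)+ simp
 ultimately have "?J (%r. f r * u r) = 0" using f0 by simp
 moreover have "f r * u r = cx (B r * (norm (u r))^2)" for r
  by (simp add: f_def complex_norm_square mult_ac del: of_real_power)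
 ultimately have "cx (?J (%r. B r * (norm (u r))^2)) = 0"
  by (subst J[symmetric]) (auto intro!: continuous_intros cB cu)
 hence "~ ?J (%r. B r * (norm (u r))^2) > 0" by simp
 hence "ps r = (al - be * mu) + be * r" if "r : {a<..<b}" for r
  using pos[of "%r. norm (u r)"] cu that by (force intro: continuous_on_norm simp: u_def p_def algebra_simps)
 thus ?thesis by blast
qed

text \<open>With \<open>G\<close> a second primitive of \<open>g\<close>, the difference
  \<open>ph - G\<close> annihilates all second derivatives of compactly supported profiles and is
  therefore affine. Extending by the value at \<open>1\<close> keeps the functions continuous on the
  whole line.\<close>

lemma radial_weak_solution_C2:
 fixes ph g :: "real => complex"
 assumes c: "cts {1..} ph" "cts {1..} g" and w: "has_weak_laplacian Omega (emb ph) (emb g)"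
 obtains ph' where "cts {1..} ph'" "!!r. r > 1 ==> (ph hvd ph' r) (at r)"
  "!!r. r > 1 ==> (ph' hvd g r) (at r)"
proof -
 let ?ex = "%f r. f (max 1 r)"
 have ex: "cts UNIV (?ex f)" if "cts {1..} f" for f :: "real => complex"
  by (rule continuous_on_compose2[OF that]) (auto intro: continuous_intros)
 obtain G' where G': "!!x. (G' hvd ?ex g x) (at x)" using antiderivative_exists[OF ex[OF c(2)]] by blast
 have cG': "cts S G'" for S using G' by (auto intro!: continuous_at_imp_continuous_on has_vector_derivative_continuous)
 obtain G where G: "!!x. (G hvd G' x) (at x)" using antiderivative_exists[OF cG'] by blast
 have cG: "cts S G" for S using G by (auto intro!: continuous_at_imp_continuous_on has_vector_derivative_continuous)
 define ps where "ps r = ?ex ph r - G r" for r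
 have cps: "cts UNIV ps" unfolding ps_def[abs_def] by (intro continuous_intros ex c cG)
 have ch: "cts HL g" by (rule continuous_on_subset[OF c(2)]) auto
 have wG: "has_weak_laplacian Omega (emb G) (emb g)"
  by (rule emb_weak_laplacian[OF G _ ch], rule has_vector_derivative_eq_rhs[OF G']) (auto simp: max_def)
 have aff: "EX al be :: complex. ALL r:{a<..<b}. ps r = al + be * r" if ab: "1 < a" "a < b" for a b
 proof (rule annihilator_affine[OF cps ab])
  fix v v' v'' assume "C2_profile v v' v'' a b"
  then interpret C2_profile v v' v'' a b .
  have e: "(LINT x:Omega|leb. emb v'' x * emb f x) = 4 * pi * integral {a..b} (%r. v'' r * f r)" if "cts {1..} f" for f
  proof -
   have cvf: "cts {a..b} (%r. v'' r * f r)"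
    by (intro continuous_intros continuous_on_subset[OF cont] continuous_on_subset[OF that]) (use ab in auto)
   have "(LINT r:HL|lborel. v'' r * f r) = (LINT r:{a..b}|lborel. v'' r * f r)"
    unfolding set_lebesgue_integral_def
    by (intro Bochner_Integration.integral_cong) (use ab deriv_zero_outside in "auto simp: indicator_def")
   also have "... = integral {a..b} (%r. v'' r * f r)"
    by (rule set_borel_integral_eq_integral(2)[OF borel_integrable_atLeastAtMost'[OF cvf]])
   finally show ?thesis
    using emb_pairing[OF borel(3) borel_zext_continuous[OF continuous_on_subset[OF that]]] by (simp add: subset_eq)
  qed
  have "4 * cx pi * integral {a..b} (%r. v'' r * ph r) = 4 * cx pi * integral {a..b} (%r. v'' r * G r)"
   using weak_laplacian_radial_test[OF w] weak_laplacian_radial_test[OF wG] e[OF c(1)] e[OF cG] by simp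
  hence "integral {a..b} (%r. v'' r * ph r) = integral {a..b} (%r. v'' r * G r)" by simp
  moreover have "integral {a..b} (%r. v'' r * ps r) = integral {a..b} (%r. v'' r * ph r - v'' r * G r)"
   by (rule integral_cong) (use ab in "auto simp: ps_def algebra_simps max_def")
  moreover have "... = integral {a..b} (%r. v'' r * ph r) - integral {a..b} (%r. v'' r * G r)"
   by (intro integral_diff integrable_continuous_real continuous_intros continuous_on_subset[OF cont] cG continuous_on_subset[OF c(1)])
     (use ab in auto)
  ultimately show "integral {a..b} (%r. v'' r * ps r) = 0" by simp
 qed
 \<comment> \<open>The affine functions found on different intervals are the same: each interval
   used below contains \<open>2\<close> and \<open>3\<close>, and the values there determine the
   function.\<close>
 define be where "be = ps 3 - ps 2"
 have ph: "ph r = G r + (ps 2 + be * (cx r - 2))" if r: "r > 1" for r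
 proof -
  have "1 < (1 + min r 2) / 2" "(1 + min r 2) / 2 < max r 3 + 1" using r by auto
  from aff[OF this] obtain al gm :: complex where A: "ALL s:{(1 + min r 2) / 2<..<max r 3 + 1}. ps s = al + gm * s" by blast
  have "ps 2 = al + gm * 2" "ps 3 = al + gm * 3" "ps r = al + gm * r"
   using bspec[OF A, of 2] bspec[OF A, of 3] bspec[OF A, of r] r by (auto simp: min_def max_def split: if_splits)
  hence "ps r = ps 2 + be * (cx r - 2)" by (simp add: be_def algebra_simps)
  thus ?thesis using r by (simp add: ps_def max_def algebra_simps)
 qed
 show ?thesis
 proof
  show "cts {1..} (%r. G' r + be)" by (intro continuous_intros cG')
  show "(ph hvd G' r + be) (at r)" if "r > 1" for r
  proof (rule has_vector_derivative_transform_within_open[of "%r. G r + (ps 2 + be * (cx r - 2))" _ _ "{1<..}"])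
   show "((%r. G r + (ps 2 + be * (cx r - 2))) hvd G' r + be) (at r)"
    by (rule has_vector_derivative_eq_rhs[OF has_vector_derivative_add[OF G]])
      (rule has_vector_derivative_real_field, auto intro!: derivative_eq_intros)
  qed (use that ph in auto)
  show "((%r. G' r + be) hvd g r) (at r)" if "r > 1" for r
   using has_vector_derivative_add[OF G'[of r] has_vector_derivative_const[of be]] that by (simp add: max_def)
 qed
qed

text \<open>\<open>radial\<close> speaks of almost all points only. A rotation \<open>T\<close>
  preserves norms and null sets, so \<open>h\<close> and \<open>h\<close> composed with
  \<open>T\<close> agree almost everywhere, and by continuity everywhere in
  \<open>Omega\<close>.\<close>

lemma continuous_radial:
 fixes h :: "real^3 => complex"
 assumes c: "cts (closure Omega) h" and r: "radial h" and x: "x : Omega"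
 shows "h x = h (norm x *R axis 1 1)"
proof -
 have o: "open Omega" by (simp add: Omega_def open_Compl)
 have ch: "cts Omega h" by (rule continuous_on_subset[OF c closure_subset])
 have "norm x = norm (norm x *R axis 1 1 :: real^3)" by (simp add: norm_axis_1)
 then obtain T :: "real^3 => real^3" where T: "orthogonal_transformation T" "T x = norm x *R axis 1 1"
  by (rule orthogonal_transformation_exists)
 have lT: "linear T" and nT: "norm (T y) = norm y" for y
  using T(1) orthogonal_transformation by blast+
 obtain p where p: "AE y in leb. y : Omega --> h y = p (norm y)" using r by (auto simp: radial_def ae_eq_def)
 let ?N = "{y : Omega. h y ~= p (norm y)}"
 from p obtain N where N: "N : null_sets leb" "{y : space leb. ~ (y : Omega --> h y = p (norm y))} <= N"
  unfolding eventually_ae_filter by blast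
 moreover have "?N <= {y : space leb. ~ (y : Omega --> h y = p (norm y))}" by auto
 ultimately have neg: "negligible ?N" using negligible_iff_null_sets negligible_subset by blast
 let ?D = "{y : Omega. h y ~= h (T y)}"
 have "T -` ?N = inv T ` ?N" by (rule bij_vimage_eq_inv_image) (rule orthogonal_transformation_bij[OF T(1)])
 moreover have "linear (inv T)" using orthogonal_transformation_inv[OF T(1)] orthogonal_transformation by blast
 hence "negligible (inv T ` ?N)"
  by (intro negligible_differentiable_image_negligible[OF order_refl neg] linear_imp_differentiable_on)
 ultimately have "negligible (T -` ?N)" by simp
 hence "negligible (?N Un T -` ?N)" using neg by (simp add: negligible_Un)
 moreover have "?D <= ?N Un T -` ?N" using nT by (auto simp: Omega_iff)
 ultimately have nD: "negligible ?D" by (rule negligible_subset)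
 have cD: "cts Omega (%y. h y - h (T y))"
  by (intro continuous_intros ch continuous_on_compose2[OF ch] linear_continuous_on linear_conv_bounded_linear[THEN iffD1] lT)
    (auto simp: Omega_iff nT)
 have "open (Omega Int (%y. h y - h (T y)) -` (- {0}))" by (rule continuous_open_preimage[OF cD o open_Compl[OF closed_singleton]])
 moreover have "Omega Int (%y. h y - h (T y)) -` (- {0}) = ?D" by auto
 ultimately have "?D = {}" using open_not_negligible[of ?D] nD by auto
 thus ?thesis using x T(2) by auto
qed

text \<open>\<open>weak_laplacian\<close> is a choice that is meaningful once some weak Laplacian
  exists; the sum of the pure second derivatives is one.\<close>

lemma H2_weak_laplacian:
 fixes f :: "'a::euclidean_space => 'b::euclidean_space"
 assumes "f : H2_loc_closure U"
 shows "has_weak_laplacian U f (weak_laplacian U f)"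
proof -
 obtain g :: "'a => 'a => 'b" and w where g: "!!b. b : Basis ==> has_weak_partial U b f (g b)"
  "!!b. b : Basis ==> has_weak_partial U b (g b) (w b b)" using assms unfolding H2_loc_closure_def by blast
 let ?w = "%x. SUM b:Basis. w b b x"
 have lf: "loc_integrable U f" using g(1)[OF SOME_Basis] by (simp add: has_weak_partial_def)
 have lw: "loc_integrable U (w b b)" if "b : Basis" for b using g(2)[OF that] by (simp add: has_weak_partial_def)
 have lw': "loc_integrable U ?w"
  unfolding loc_integrable_def set_integrable_def scaleR_sum_right
  by (intro allI impI Bochner_Integration.integrable_sum) (use lw in "auto simp: loc_integrable_def set_integrable_def")
 have "(LINT x|leb. lap ph x *R f x) = (LINT x|leb. ph x *R ?w x)" if ph: "ph : test_functions U" for ph :: "'a => real"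
 proof -
  note tp = test_partial_deriv[OF ph]
  have "(LINT x|leb. pd b (pd b ph) x *R f x) = (LINT x|leb. ph x *R w b b x)" if b: "b : Basis" for b
  proof -
   have "(LINT x:U|leb. pd b (pd b ph) x *R f x) = - (LINT x:U|leb. pd b ph x *R g b x)"
    using g(1)[OF b] tp[OF b] by (simp add: has_weak_partial_def)
   also have "... = (LINT x:U|leb. ph x *R w b b x)" using g(2)[OF b] ph by (simp add: has_weak_partial_def)
   finally show ?thesis
    using test_functionD(7)[OF test_partial_deriv[OF tp[OF b] b]] test_functionD(7)[OF ph] by (simp add: test_set_integral)
  qed
  thus ?thesis
   unfolding lap_def scaleR_sum_left scaleR_sum_right
   by (subst (1 2) Bochner_Integration.integral_sum)
     (auto intro!: test_loc_integrable[OF _ lf] test_loc_integrable[OF ph] test_partial_deriv tp lw)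
 qed
 hence "has_weak_laplacian U f ?w" unfolding has_weak_laplacian_iff using lf lw' by blast
 thus ?thesis unfolding weak_laplacian_def by (rule someI[of "has_weak_laplacian U f"])
qed

section \<open>Absence of zero energy states\<close>

context schroedinger
begin

text \<open>Reduction of order: by the Wronskian identity the quotient of a second solution by the
  Jost solution has the derivative \<open>1 / em^2\<close>, up to the constant \<open>w\<close>, and
  \<open>em <= 3 / 2\<close> bounds it below by \<open>4 / 9\<close>.\<close>

lemma solution_grows:
 assumes s: "solution 0 ph ph'" and 0: "ph 1 = 0" and w: "jost 0 1 * ph' 1 ~= 0"
 obtains c R where "c > 0" "R > 1" "!!r. r >= R ==> norm (ph r) >= c * r"
proof -
 define w where "w = jost 0 1 * ph' 1"
 obtain R where R1: "R > 1" "!!k r. k >= 0 ==> r >= R ==> \<bar>em k r - 1\<bar> <= 1 / 2" using em_near_1 by blast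
 have R: "R > 1" "em 0 r >= 1 / 2" "em 0 r <= 3 / 2" if "r >= R" for r using R1(1) R1(2)[OF order_refl that] by linarith+
 have e: "jost 0 r = cx (em 0 r)" "jost' 0 r = cx (ep 0 r)" if "r >= 1" for r
  using jost_real(3,4)[of 0 r] that by (simp_all add: ej_def ej'_def)
 have wr: "em 0 r * Re (ph' r / w) - ep 0 r * Re (ph r / w) = 1" if "r >= 1" for r
 proof -
  have "jost 0 r * ph' r - jost' 0 r * ph r = w"
   using solution_wronskian[OF jost_solution s that] 0 by (simp add: w_def)
  hence "cx (em 0 r) * (ph' r / w) - cx (ep 0 r) * (ph r / w) = 1"
   using assms(3) that by (simp add: e w_def diff_divide_distrib[symmetric])
  from arg_cong[OF this, of Re] show ?thesis by (simp del: times_divide_eq_right)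
 qed
 define f where "f r = Re (ph r / w) / em 0 r" for r
 have df: "(f hrd 1 / (em 0 r)^2) (at r)" if "r >= R" for r
 proof -
  have r: "r > 1" and e0: "em 0 r ~= 0" using that R1(1) R(2)[OF that] by auto
  have "(ph hvd ph' r) (at r)" using s r by (simp add: solution_def)
  from bounded_linear.has_vector_derivative[OF bounded_linear_Re has_vector_derivative_divide[OF this, of w]]
  have "((%r. Re (ph r / w)) hrd Re (ph' r / w)) (at r)" by (simp add: has_real_derivative_iff_has_vector_derivative)
  from DERIV_quotient[OF this em_facts(5)[OF order_refl r] e0]
  have "(f hrd (Re (ph' r / w) * em 0 r - ep 0 r * Re (ph r / w)) / (em 0 r)^2) (at r)"
   unfolding f_def[abs_def] by (simp add: power2_eq_square numeral_2_eq_2)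
  thus ?thesis using wr[of r] r by (simp add: mult.commute)
 qed
 have fg: "f R - 4 / 9 * R <= f r - 4 / 9 * r" if "r >= R" for r
 proof (rule DERIV_nonneg_imp_nondecreasing[OF that])
  fix t assume t: "R <= t" "t <= r"
  have "(em 0 t)^2 <= (3 / 2)^2" using R(2,3)[OF t(1)] by (intro power_mono) auto
  hence "1 / (em 0 t)^2 - 4 / 9 * 1 >= 0" using R(2)[OF t(1)] by (simp add: field_simps power2_eq_square)
  moreover have "((%r. f r - 4 / 9 * r) hrd 1 / (em 0 t)^2 - 4 / 9 * 1) (at t)"
   by (intro DERIV_diff df t DERIV_cmult DERIV_ident)
  ultimately show "EX y. ((%r. f r - 4 / 9 * r) hrd y) (at t) & 0 <= y" by blast
 qed
 \<comment> \<open>For \<open>r >= R'\<close> the constant \<open>f R - 4 / 9 * R\<close> is at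
   least \<open>- r / 6\<close>, and \<open>4 / 9 - 1 / 6 >= 1 / 4\<close>.\<close>
 define R' where "R' = max R (6 * (\<bar>f R\<bar> + R))"
 show ?thesis
 proof
  show "norm w / 8 > 0" "R' > 1" using w R1(1) by (auto simp: w_def R'_def)
  fix r assume r: "r >= R'"
  hence "r >= R" "6 * (\<bar>f R\<bar> + R) <= r" by (auto simp: R'_def)
  hence "f r >= r / 4" using fg[OF \<open>r >= R\<close>] R1(1) abs_ge_minus_self[of "f R"] by argo
  hence "(r / 4) * (1 / 2) <= f r * em 0 r"
   using R(2)[OF \<open>r >= R\<close>] \<open>r >= R\<close> R1(1) by (intro mult_mono) auto
  also have "f r * em 0 r = Re (ph r / w)" using R(2)[OF \<open>r >= R\<close>] by (simp add: f_def)
  finally have "norm (ph r / w) >= r / 8" using complex_Re_le_cmod[of "ph r / w"] by linarith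
  thus "norm (ph r) >= norm w / 8 * r" using w by (simp add: norm_divide w_def field_simps)
 qed
qed

text \<open>The profile of \<open>h\<close> solves the equation at energy zero with
  \<open>ph 1 = 0\<close>. If its slope at \<open>1\<close> is nonzero, it is independent of the
  Jost solution because \<open>jost 0 1\<close> is nonzero, and grows linearly, too fast for the
  weighted integrability. With slope zero it vanishes.\<close>

lemma no_zero_energy_state:
 assumes e1: "jost 0 1 ~= 0" and h: "radial h" "h : H2_loc_closure Omega"
  "(%x. h x /\<^sub>R sqrt (1 + (norm x)^2)) : L2 Omega" "ae_eq (A h) (%x. 0)"
  and h': "cts (closure Omega) h'" "ae_eq h h'" "ALL x:frontier Omega. h' x = 0"
 shows "ae_eq h (%x. 0)"
proof -
 let ?a = "axis 1 1 :: real^3"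
 have cl: "closure Omega = {x. norm x >= 1}" and fr: "frontier Omega = {x. norm x = 1}"
  by (auto simp: Omega_def closure_complement frontier_complement interior_cball frontier_cball not_less)
 define ph where "ph r = r *R h' (r *R ?a)" for r
 have cph: "cts {1..} ph" unfolding ph_def[abs_def]
  by (intro continuous_intros continuous_on_compose2[OF h'(1)]) (auto simp: cl norm_axis_1)
 have ph1: "ph 1 = 0" using h'(3) by (simp add: ph_def fr norm_axis_1)
 obtain p where "ae_eq h (%x. p (norm x))" using h(1) by (auto simp: radial_def)
 hence "ae_eq h' (%x. p (norm x))" using h'(2) unfolding ae_eq_def by eventually_elim auto
 hence rh': "radial h'" by (auto simp: radial_def)
 have hph: "emb ph x = h' x" if "x : Omega" for x
 proof -
  have "norm x ~= 0" using that by (auto simp: Omega_iff)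
  thus ?thesis using continuous_radial[OF h'(1) rh' that] by (simp add: emb_def ph_def)
 qed
 let ?g = "%r. (0^2 - cx (V r)) * ph r"
 have "has_weak_laplacian Omega (emb ph) (emb ?g)"
 proof (rule has_weak_laplacian_cong_AE[OF H2_weak_laplacian[OF h(2)]])
  show "AE x in leb. x : Omega --> h x = emb ph x" using h'(2) unfolding ae_eq_def by eventually_elim (simp add: hph)
  show "AE x in leb. x : Omega --> weak_laplacian Omega h x = emb ?g x"
   using h'(2) h(4) unfolding ae_eq_def
  proof eventually_elim
   case (elim x)
   have "emb ?g x = - cx (V (norm x)) * emb ph x" by (simp add: emb_def scaleR_conv_of_real)
   moreover have "weak_laplacian Omega h x = - cx (V (norm x)) * h x" if "x : Omega"
   proof -
    have "- weak_laplacian Omega h x - cx (V (norm x)) * h x = 0" using elim A[OF that, of h] that by simp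
    thus ?thesis by algebra
   qed
   ultimately show ?case using elim hph[of x] by auto
  qed
 qed
 moreover have "cts {1..} ?g" by (intro continuous_intros cph contV)
 ultimately obtain ph' where ph': "cts {1..} ph'" "!!r. r > 1 ==> (ph hvd ph' r) (at r)"
  "!!r. r > 1 ==> (ph' hvd ?g r) (at r)" using radial_weak_solution_C2[OF cph] by blast
 have s: "solution 0 ph ph'" using cph ph' by (simp add: solution_def)
 have "ph' 1 = 0"
 proof (rule ccontr)
  assume "ph' 1 ~= 0"
  then obtain c R where c: "c > 0" "R > 1" "!!r. r >= R ==> norm (ph r) >= c * r" using solution_grows[OF s ph1] e1 by auto
  let ?u = "%r. ph r /\<^sub>R sqrt (1 + r^2)"
  have m: "zx ?u : bm"
  proof (rule borel_zext_continuous)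
   have "sqrt (1 + r^2) ~= 0" for r :: real by (smt (verit) real_sqrt_eq_0_iff zero_le_power2)
   thus "cts HL ?u" by (intro continuous_intros continuous_on_subset[OF cph]) auto
  qed
  have "ae_eq (%x. h x /\<^sub>R sqrt (1 + (norm x)^2)) (emb ?u)"
   using h'(2) unfolding ae_eq_def by eventually_elim (auto simp: hph[symmetric] emb_def mult.commute)
  hence uL: "?u : L2 HL" using ae_eq_L2_cong(1)[OF _ h(3)] emb_L2(1)[OF m] by simp
  \<comment> \<open>On \<open>{R..R + n}\<close> the weighted profile has modulus at least
    \<open>c / 2\<close>, since \<open>sqrt (1 + r^2) <= 2 * r\<close>; the norm would exceed every
    bound.\<close>
  have "c / 2 * sqrt n <= l2norm HL ?u" for n :: nat
  proof -
   let ?i = "%r::real. c / 2 * indicator {R..R + n} r :: real"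
   have "(norm (zx ?i r))^2 = (c / 2)^2 * indicator {R..R + n} r" for r
    using c(1,2) by (auto simp: zext_def indicator_def)
   hence "l2norm HL ?i = c / 2 * sqrt n" using c(1) by (simp add: l2norm_eq real_sqrt_mult)
   moreover have "l2norm HL ?i <= l2norm HL ?u"
   proof (rule l2norm_mono[OF L2_const_interval uL])
    fix r :: real assume "r : HL"
    show "norm (?i r) <= norm (?u r)"
    proof (cases "r : {R..R + n}")
     case True
     hence r: "r >= R" "r > 1" using c(2) by auto
     have "1 <= r^2" using r by (simp add: one_le_power)
     hence "sqrt (1 + r^2) <= sqrt ((2 * r)^2)" by (intro real_sqrt_le_mono) (simp add: power_mult_distrib)
     hence q: "sqrt (1 + r^2) <= 2 * r" using r unfolding real_sqrt_abs by simp
     have q0: "sqrt (1 + r^2) > 0" by (simp add: add_pos_nonneg)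
     have "c / 2 * sqrt (1 + r^2) <= c / 2 * (2 * r)" using q c(1) by (intro mult_left_mono) auto
     also have "... <= norm (ph r)" using c(3)[OF r(1)] by simp
     finally have "c / 2 <= norm (ph r) / sqrt (1 + r^2)" using q0 by (simp add: pos_le_divide_eq)
     moreover have "norm (?u r) = norm (ph r) / sqrt (1 + r^2)" using q0 by (simp add: divide_inverse mult.commute)
     ultimately show ?thesis using True c(1) by simp
    qed simp
   qed
   ultimately show ?thesis by simp
  qed
  hence b: "sqrt n <= l2norm HL ?u / (c / 2)" for n :: nat using c(1) by (simp add: pos_le_divide_eq mult.commute)
  obtain n :: nat where "real n > (l2norm HL ?u / (c / 2))^2" using reals_Archimedean2 by blast
  hence "sqrt n > l2norm HL ?u / (c / 2)" by (rule real_less_rsqrt)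
  thus False using b[of n] by linarith
 qed
 hence "ph r = 0" if "r >= 1" for r using solution_unique(1)[OF s order_refl ph1 _ that] by simp
 hence "h' x = 0" if "x : Omega" for x using hph[OF that] that by (simp add: emb_def Omega_iff)
 thus ?thesis using h'(2) unfolding ae_eq_def by (auto elim!: eventually_mono)
qed

end

section \<open>The stationary profile\<close>

text \<open>If \<open>f'\<close> exceeded the bound at \<open>r0\<close>, integrating the estimate
  for \<open>f''\<close> would keep \<open>f'\<close> above a positive constant, and
  \<open>f\<close> could not converge. The other sign follows from \<open>- f\<close>.\<close>

lemma derivative_decay:
 fixes f f' f'' :: "real => real"
 assumes d: "!!r. r > 1 ==> (f hrd f' r) (at r)" "!!r. r > 1 ==> (f' hrd f'' r) (at r)"
  and b: "!!r. r > 1 ==> \<bar>f'' r\<bar> <= D / r ^ 3" and lim: "(f ~~> l) at_top" and r0: "r0 > 1"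
 shows "\<bar>f' r0\<bar> <= D / 2 / r0^2"
proof -
 have *: "g' r0 <= D / 2 / r0^2"
  if d: "!!r. r > 1 ==> (g hrd g' r) (at r)" "!!r. r > 1 ==> (g' hrd g'' r) (at r)"
  and b: "!!r. r > 1 ==> \<bar>g'' r\<bar> <= D / r ^ 3" and lim: "(g ~~> l) at_top" for g g' g'' :: "real => real" and l
 proof (rule ccontr)
  assume n: "~ ?thesis"
  define ep where "ep = g' r0 - D / 2 / r0^2"
  have D: "D >= 0" using order_trans[OF abs_ge_zero b[OF r0]] r0 by (simp add: zero_le_divide_iff)
  have g': "g' r >= ep" if "r >= r0" for r
  proof -
   have "g' r0 - D / 2 / r0^2 <= g' r - D / 2 / r^2"
   proof (rule DERIV_nonneg_imp_nondecreasing[OF that])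
    fix t assume "r0 <= t" "t <= r"
    hence t: "t > 1" using r0 by simp
    have "((%r. g' r - D / 2 / r^2) hrd g'' t + D / t ^ 3) (at t)"
     using t by (auto intro!: derivative_eq_intros d simp: power2_eq_square power3_eq_cube field_simps)
    moreover have "g'' t + D / t ^ 3 >= 0" using b[OF t] by linarith
    ultimately show "EX y. ((%r. g' r - D / 2 / r^2) hrd y) (at t) & 0 <= y" by blast
   qed
   moreover have "D / 2 / r^2 >= 0" using D by simp
   ultimately show ?thesis by (simp add: ep_def)
  qed
  have up: "g r0 - ep * r0 <= g r - ep * r" if "r >= r0" for r
  proof (rule DERIV_nonneg_imp_nondecreasing[OF that])
   fix t assume "r0 <= t" "t <= r"
   hence "((%r. g r - ep * r) hrd g' t - ep * 1) (at t) & g' t - ep * 1 >= 0"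
    using g'[of t] r0 by (auto intro!: DERIV_diff d DERIV_cmult_Id)
   thus "EX y. ((%r. g r - ep * r) hrd y) (at t) & 0 <= y" by blast
  qed
  have "ep > 0" using n by (simp add: ep_def)
  hence "filterlim (%r. (g r0 - ep * r0) + ep * r) at_top at_top"
   by (intro filterlim_tendsto_add_at_top[OF tendsto_const] filterlim_tendsto_pos_mult_at_top[OF tendsto_const] filterlim_ident)
  hence "filterlim g at_top at_top"
   by (rule filterlim_at_top_mono) (use up in "auto simp: eventually_at_top_linorder algebra_simps intro!: exI[of _ r0]")
  thus False using lim not_tendsto_and_filterlim_at_infinity[of at_top g l] filterlim_at_top_imp_at_infinity by auto
 qed
 have "f' r0 <= D / 2 / r0^2" by (rule *[OF d b lim])
 moreover have "- f' r0 <= D / 2 / r0^2"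
  by (rule *[of "%r. - f r" "%r. - f' r" "%r. - f'' r" "- l"]) (use d b lim in "auto intro!: DERIV_minus tendsto_minus")
 ultimately show ?thesis by linarith
qed

text \<open>Adding \<open>pi / 2\<close> passes the next multiple of \<open>pi\<close> exactly in
  the second and fourth quadrant, where sine times cosine is negative. This compares the counts of
  zeros of sine and cosine.\<close>

lemma half_turn_floor:
 assumes "sin th * cos th ~= 0"
 shows "\<lfloor>(th + pi / 2) / pi\<rfloor> = \<lfloor>th / pi\<rfloor> + (if sin th * cos th > 0 then 0 else 1)"
proof -
 define n where "n = \<lfloor>th / pi\<rfloor>"
 define u where "u = th - of_int n * pi"
 have "of_int n <= th / pi" "th / pi < of_int n + 1" unfolding n_def by linarith+
 hence u: "0 <= u" "u < pi" by (simp_all add: u_def field_simps)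
 have "sin (2 * u) = sin (2 * th)"
  using sin_int_2pin[of n] cos_int_2pin[of n] by (simp add: u_def sin_diff right_diff_distrib mult_ac)
 hence s: "sin (2 * u) = 2 * (sin th * cos th)" by (simp add: sin_double)
 have "sin th * cos th > 0 \<longleftrightarrow> u < pi / 2"
 proof
  assume "sin th * cos th > 0"
  hence "sin (2 * u) > 0" using s by simp
  thus "u < pi / 2" using sin_le_zero[of "2 * u"] u by (cases "u < pi / 2") auto
 next
  assume "u < pi / 2"
  hence "sin (2 * u) >= 0" using u by (intro sin_ge_zero) auto
  hence "sin th * cos th >= 0" using s by linarith
  thus "sin th * cos th > 0" using assms by (simp add: less_le del: mult_eq_0_iff)
 qed
 moreover have "(th + pi / 2) / pi = of_int n + (u + pi / 2) / pi" by (simp add: u_def field_simps)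
 ultimately show ?thesis
  using u unfolding n_def[symmetric] by (auto simp: floor_eq_iff field_simps)
qed

locale stationary_profile =
 fixes m :: nat and y y' :: "real => real" and l :: real
 assumes m: "m >= 3" and cont: "cts {1..} y" "cts {1..} y'"
  and dy: "!!r. r > 1 ==> (y hrd y' r) (at r)"
  and dy': "!!r. r > 1 ==> (y' hrd - (y r ^ (2 * m + 1) / r ^ (2 * m))) (at r)"
  and y1: "y 1 = 0" and lim: "(y ~~> l) at_top" and l: "l > 0"
begin

definition V where "V r = real (2 * m + 1) * (y r / r) ^ (2 * m)"
text \<open>The scaling exponent: along with \<open>y\<close> also
  \<open>t powr (- c) * y (t * r)\<close> solves the nonlinear equation, and \<open>W\<close> is its
  derivative in \<open>t\<close> at \<open>t = 1\<close>.\<close>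

definition c where "c = 1 - 1 / real m"
definition W where "W r = r * y' r - c * y r"
definition y2 where "y2 r = - (y r ^ (2 * m + 1) / r ^ (2 * m))"
definition W' where "W' r = r * y2 r + (1 - c) * y' r"

text \<open>The sign of \<open>1 - 2 * c\<close> gives the monotonicity of the energy in
  \<open>W_zero_sign\<close>.\<close>

lemma c_bounds: "0 < c" "c < 1" "1 - 2 * c < 0" and c_eq: "c * m = real m - 1"
 using m by (auto simp: c_def field_simps)

lemma y_bounded: obtains Y where "Y >= 1" "!!r. r >= 1 ==> \<bar>y r\<bar> <= Y"
proof -
 have "eventually (%r. \<bar>y r\<bar> < \<bar>l\<bar> + 1) at_top" using tendsto_rabs[OF lim] by (rule order_tendstoD(2)) simp
 then obtain R where R: "!!r. r >= R ==> \<bar>y r\<bar> < \<bar>l\<bar> + 1" by (auto simp: eventually_at_top_linorder)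
 have "bounded (y ` {1..R})" by (intro compact_imp_bounded compact_continuous_image continuous_on_subset[OF cont(1)]) auto
 then obtain B where B: "ALL x:y ` {1..R}. norm x <= B" unfolding bounded_iff by blast
 have B': "\<bar>y r\<bar> <= B" if "r : {1..R}" for r using B that by auto
 have "\<bar>y r\<bar> <= max 1 (max B (\<bar>l\<bar> + 1))" if "r >= 1" for r
  using R[of r] B'[of r] that by (cases "r <= R") (auto simp: le_max_iff_disj)
 thus ?thesis using that[of "max 1 (max B (\<bar>l\<bar> + 1))"] by auto
qed

text \<open>\<open>y\<close> is bounded, and \<open>m >= 3\<close> turns the decay
  \<open>t^(-2m)\<close> into the sixth power; the maximum with 2 meets the lower bound on the
  constant.\<close>

lemma potential_V: obtains M where "potential V M"
proof -
 obtain Y where Y: "Y >= 1" "!!r. r >= 1 ==> \<bar>y r\<bar> <= Y" using y_bounded by blast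
 have "potential V (max 2 (real (2 * m + 1) * Y ^ (2 * m)))"
 proof
  show "cts {1..} V" unfolding V_def[abs_def] by (intro continuous_intros cont) auto
  fix t :: real assume t: "t >= 1"
  have "\<bar>V t\<bar> = real (2 * m + 1) * \<bar>y t\<bar> ^ (2 * m) / t ^ (2 * m)" using t by (simp add: V_def abs_mult power_abs power_divide)
  also have "... <= real (2 * m + 1) * Y ^ (2 * m) / t ^ 6"
   using t m Y by (intro frac_le mult_left_mono power_mono power_increasing) auto
  also have "... <= max 2 (real (2 * m + 1) * Y ^ (2 * m)) / t ^ 6" using t by (intro divide_right_mono) auto
  finally show "\<bar>V t\<bar> <= max 2 (real (2 * m + 1) * Y ^ (2 * m)) / t ^ 6" .
 qed simp
 thus ?thesis using that by blast
qed

lemma y2_bound: obtains D where "!!r. r >= 1 ==> \<bar>y2 r\<bar> <= D / r ^ 3"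
proof -
 obtain Y where Y: "Y >= 1" "!!r. r >= 1 ==> \<bar>y r\<bar> <= Y" using y_bounded by blast
 have "\<bar>y2 r\<bar> <= Y ^ (2 * m + 1) / r ^ 3" if "r >= 1" for r
 proof -
  have "\<bar>y2 r\<bar> = \<bar>y r\<bar> ^ (2 * m + 1) / r ^ (2 * m)" using that by (simp add: y2_def abs_mult power_abs)
  also have "... <= Y ^ (2 * m + 1) / r ^ 3" using that m Y by (intro frac_le power_mono power_increasing) auto
  finally show ?thesis .
 qed
 thus ?thesis using that by blast
qed

text \<open>\<open>y\<close> solves a linear equation with the bounded coefficient
  \<open>- (y / r)^(2m)\<close>. With vanishing data it would be zero beyond \<open>r0\<close>,
  against its positive limit.\<close>

lemma nondegenerate:
 assumes "r0 >= 1" "y r0 = 0" shows "y' r0 ~= 0"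
proof
 assume 0: "y' r0 = 0"
 obtain Y where Y: "Y >= 1" "!!r. r >= 1 ==> \<bar>y r\<bar> <= Y" using y_bounded by blast
 have oR: "((%x. cx (f x)) hvd cx D) F" if "(f hvd D) F" for f D F
  by (rule bounded_linear.has_vector_derivative[OF bounded_linear_of_real that])
 have "y r = 0" if r: "r >= r0" for r
 proof -
  have "cx (y r) = 0"
  proof (rule linear_ode_unique(1)[of 1 r "%r. cx (y r)" "%r. cx (y' r)" "%r. - cx ((y r / r) ^ (2 * m))" "Y ^ (2 * m)" r0 r])
   show "cts {1..r} (%r. cx (y r))" "cts {1..r} (%r. cx (y' r))"
    by (intro continuous_intros continuous_on_subset[OF cont(1)] continuous_on_subset[OF cont(2)]; auto)+
   fix s :: real assume s: "1 < s" "s < r"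
   show "((%r. cx (y r)) hvd cx (y' s)) (at s)"
    using oR dy[OF s(1)] by (simp add: has_real_derivative_iff_has_vector_derivative)
   have "cx (- (y s ^ (2 * m + 1) / s ^ (2 * m))) = - cx ((y s / s) ^ (2 * m)) * cx (y s)"
    by (simp add: power_divide)
   thus "((%r. cx (y' r)) hvd - cx ((y s / s) ^ (2 * m)) * cx (y s)) (at s)"
    using oR[OF dy'[OF s(1), unfolded has_real_derivative_iff_has_vector_derivative]] by (simp only:)
   have "norm (- cx ((y s / s) ^ (2 * m))) = (\<bar>y s\<bar> / s) ^ (2 * m)" using s by (simp add: norm_power norm_divide)
   also have "... <= (Y / 1) ^ (2 * m)" using Y(2)[of s] s Y(1) by (intro power_mono frac_le) auto
   finally show "norm (- cx ((y s / s) ^ (2 * m))) <= Y ^ (2 * m)" by simp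
  qed (use assms 0 r in auto)
  thus ?thesis by simp
 qed
 hence "(y ~~> 0) at_top" by (intro tendsto_eventually) (auto simp: eventually_at_top_linorder)
 thus False using tendsto_unique[OF _ lim] l by simp
qed

text \<open>The limits rest on \<open>r * y'\<close> tending to zero, by
  \<open>derivative_decay\<close>. They say that \<open>W\<close> is the solution that stays bounded
  at infinity, as the Jost solution does.\<close>

lemma W_facts:
 "cts {1..} W" "cts {1..} W'" "r > 1 ==> (W hrd W' r) (at r)"
 "r > 1 ==> (W' hrd - V r * W r) (at r)" "W 1 ~= 0"
 "(W ~~> - c * l) at_top" "(W' ~~> 0) at_top"
proof -
 have cy2: "cts {1..} y2" unfolding y2_def[abs_def] by (intro continuous_intros cont) auto
 show "cts {1..} W" "cts {1..} W'"
  unfolding W_def[abs_def] W'_def[abs_def] by (intro continuous_intros cont cy2)+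
 show "W 1 ~= 0" using nondegenerate[of 1] y1 by (simp add: W_def)
 show "(W hrd W' r) (at r)" if r: "r > 1"
  unfolding W_def[abs_def] W'_def
  by (rule DERIV_cong[OF DERIV_diff[OF DERIV_mult[OF DERIV_ident dy'[OF r]] DERIV_cmult[OF dy[OF r]]]]) (simp add: y2_def algebra_simps)
 show "(W' hrd - V r * W r) (at r)" if r: "r > 1"
 proof -
  obtain j where j: "2 * m = Suc j" using m by (cases "2 * m") auto
  have rj: "r ^ j ~= 0" "r ~= 0" using r by auto
  have dp: "((%r. y r ^ (2 * m + 1)) hrd real (2 * m + 1) * y r ^ (2 * m) * y' r) (at r)"
   by (rule DERIV_cong[OF DERIV_power[OF dy[OF r]]]) simp
  have dr: "((%r. r ^ (2 * m)) hrd real (2 * m) * r ^ j) (at r)"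
   by (rule DERIV_cong[OF DERIV_pow]) (simp add: j)
  have "(y2 hrd - ((real (2 * m + 1) * y r ^ (2 * m) * y' r * r ^ (2 * m) - y r ^ (2 * m + 1) * (real (2 * m) * r ^ j)) / (r ^ (2 * m) * r ^ (2 * m)))) (at r)"
   unfolding y2_def[abs_def] by (intro DERIV_minus DERIV_divide dp dr) (use r in simp)
  moreover have "- ((real (2 * m + 1) * y r ^ (2 * m) * y' r * r ^ (2 * m) - y r ^ (2 * m + 1) * (real (2 * m) * r ^ j)) / (r ^ (2 * m) * r ^ (2 * m)))
   = (real (2 * m) * (y r ^ (2 * m + 1) / r ^ (2 * m)) - real (2 * m + 1) * (y r ^ (2 * m) / r ^ (2 * m)) * (r * y' r)) / r"
   using rj unfolding j by (simp add: field_simps)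
  ultimately have d3: "(y2 hrd (real (2 * m) * (y r ^ (2 * m + 1) / r ^ (2 * m)) - real (2 * m + 1) * (y r ^ (2 * m) / r ^ (2 * m)) * (r * y' r)) / r) (at r)"
   by (simp only:)
  show ?thesis unfolding W'_def[abs_def]
  proof (rule DERIV_cong[OF DERIV_add[OF DERIV_mult[OF DERIV_ident d3] DERIV_cmult[OF dy'[OF r]]]])
   define p where "p = y r ^ (2 * m) / r ^ (2 * m)"
   have p: "y r ^ (2 * m + 1) / r ^ (2 * m) = p * y r" "V r = real (2 * m + 1) * p" "y2 r = - (p * y r)"
    by (simp_all add: p_def V_def y2_def power_divide)
   \<comment> \<open>Here the scaling exponent matters: the coefficient of \<open>p * y r\<close> on
     the left is \<open>2 * m - 2 + c\<close>, and it has to be \<open>(2 * m + 1) * c\<close> to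
     produce \<open>- V r * W r\<close>.\<close>
   have "real (2 * m + 1) * c = 2 * (c * m) + c" by (simp add: algebra_simps)
   hence k: "real (2 * m + 1) * c = 2 * real m - 2 + c" unfolding c_eq by simp
   have "(1 * y2 r + (real (2 * m) * (p * y r) - real (2 * m + 1) * p * (r * y' r)) / r * r) + (1 - c) * - (p * y r) =
    (real (2 * m + 1) * c) * p * y r - real (2 * m + 1) * p * (r * y' r)"
   proof -
    have rr: "x / r * r = x" for x using r by simp
    show ?thesis unfolding k rr p by (simp add: algebra_simps)
   qed
   thus "(1 * y2 r + (real (2 * m) * (y r ^ (2 * m + 1) / r ^ (2 * m)) - real (2 * m + 1) * (y r ^ (2 * m) / r ^ (2 * m)) * (r * y' r)) / r * r) + (1 - c) * - (y r ^ (2 * m + 1) / r ^ (2 * m)) = - V r * W r"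
    unfolding p p_def[symmetric] W_def by (simp add: algebra_simps)
  qed
 qed
 obtain D where D: "!!r. r >= 1 ==> \<bar>y2 r\<bar> <= D / r ^ 3" using y2_bound by blast
 have by': "\<bar>y' r\<bar> <= D / 2 / r^2" if "r > 1" for r
  by (rule derivative_decay[OF dy dy' _ lim that]) (use D in "auto simp: y2_def")
 have inv: "((%r. K / r) ~~> 0) at_top" for K :: real
  by (intro tendsto_divide_0[OF tendsto_const] filterlim_at_top_imp_at_infinity filterlim_ident)
 have t1: "((%r. r * y' r) ~~> 0) at_top"
 proof (rule Lim_null_comparison[OF _ inv])
  have "\<bar>r * y' r\<bar> <= D / 2 / r" if "r > 1" for r
   using mult_left_mono[OF by'[OF that], of r] that by (simp add: abs_mult power2_eq_square)
  thus "\<forall>\<^sub>F r in at_top. norm (r * y' r) <= (D / 2) / r" unfolding real_norm_def by (rule eventually_mono[OF eventually_gt_at_top])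
 qed
 have t2: "((%r. r * y2 r) ~~> 0) at_top"
 proof (rule Lim_null_comparison[OF _ inv])
  have "\<bar>r * y2 r\<bar> <= D / r" if "r > 1" for r
  proof -
   have "\<bar>y2 r\<bar> * r <= D / r ^ 3 * r" using D[of r] that by (intro mult_right_mono) auto
   also have "... = D / r / r" using that by (simp add: power3_eq_cube)
   also have "... <= D / r / 1" using that order_trans[OF abs_ge_zero D[of r]] by (intro divide_left_mono) (auto simp: zero_le_divide_iff)
   finally show ?thesis using that by (simp add: abs_mult mult.commute)
  qed
  thus "\<forall>\<^sub>F r in at_top. norm (r * y2 r) <= D / r" unfolding real_norm_def by (rule eventually_mono[OF eventually_gt_at_top])
 qed
 have t3: "(y' ~~> 0) at_top"
 proof (rule Lim_null_comparison[OF _ tendsto_norm_zero[OF t1]])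
  have "\<bar>y' r\<bar> <= \<bar>r * y' r\<bar>" if "r > 1" for r using that mult_right_mono[of 1 r "\<bar>y' r\<bar>"] by (simp add: abs_mult)
  thus "\<forall>\<^sub>F r in at_top. norm (y' r) <= norm (r * y' r)" unfolding real_norm_def by (rule eventually_mono[OF eventually_gt_at_top])
 qed
 show "(W ~~> - c * l) at_top" using tendsto_diff[OF t1 tendsto_mult_left[OF lim, of c]] by (simp add: W_def[abs_def])
 show "(W' ~~> 0) at_top" using tendsto_add[OF t2 tendsto_mult_left[OF t3, of "1 - c"]] by (simp add: W'_def[abs_def])
qed

text \<open>With \<open>y = r powr c * z (ln r)\<close> the equation becomes autonomous,
  \<open>z'' + (2c - 1) z' - c (1 - c) z + z^(2m+1) = 0\<close>, and
  \<open>W = r powr c * z'\<close>. \<open>F\<close> is \<open>r powr (2 * c)\<close> times the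
  energy of \<open>z\<close>, which is damped and tends to zero, hence nonnegative. At a zero of
  \<open>W\<close> this bounds \<open>N\<close> below, and \<open>N\<close> decides the sign of
  \<open>W' * y\<close>.\<close>

lemma W_zero_sign:
 assumes r0: "r0 > 1" and W0: "W r0 = 0"
 shows "W' r0 * - y r0 > 0"
proof -
 define N where "N r = y r ^ (2 * m + 2) / r ^ (2 * m) * r^2" for r
 define F where "F r = (W r)^2 / 2 - c * (1 - c) * (y r)^2 / 2 + N r / (2 * real m + 2)" for r
 have yy: "r * y' r = W r + c * y r" for r by (simp add: W_def)
 have dF: "(F hrd (2 * c * F r + (1 - 2 * c) * (W r)^2) / r) (at r)" if r: "r > 1" for r
 proof -
  obtain j where j: "2 * m = Suc j" using m by (cases "2 * m") auto
  have rj: "r ^ j ~= 0" "r ~= 0" using r by auto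
  define p where "p = y r ^ (2 * m) / r ^ (2 * m)"
  have Np: "N r = p * (y r)^2 * r^2" by (simp add: N_def p_def power_add power2_eq_square)
  have y2p: "y2 r = - (p * y r)" by (simp add: p_def y2_def)
  have dp: "((%r. y r ^ (2 * m + 2)) hrd real (2 * m + 2) * y r ^ (2 * m + 1) * y' r) (at r)"
   by (rule DERIV_cong[OF DERIV_power[OF dy[OF r]]]) simp
  have dr: "((%r. r ^ (2 * m)) hrd real (2 * m) * r ^ j) (at r)"
   by (rule DERIV_cong[OF DERIV_pow]) (simp add: j)
  have dN: "(N hrd (real (2 * m + 2) * (p * y r * r * (r * y' r)) - (2 * real m - 2) * (p * (y r)^2 * r)) ) (at r)"
   unfolding N_def[abs_def]
  proof (rule DERIV_cong[OF DERIV_mult[OF DERIV_divide[OF dp dr] DERIV_pow]])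
   show "(real (2 * m + 2) * y r ^ (2 * m + 1) * y' r * r ^ (2 * m) - y r ^ (2 * m + 2) * (real (2 * m) * r ^ j)) / (r ^ (2 * m) * r ^ (2 * m)) * r^2
     + real 2 * r ^ (2 - Suc 0) * (y r ^ (2 * m + 2) / r ^ (2 * m)) = real (2 * m + 2) * (p * y r * r * (r * y' r)) - (2 * real m - 2) * (p * (y r)^2 * r)"
   proof -
    have e: "real (2 * m) = 2 * real m" by simp
    have 1: "y r ^ (2 * m + 2) = y r ^ (2 * m) * (y r)^2" "y r ^ (2 * m + 1) = y r ^ (2 * m) * y r" by (simp_all add: power_add power2_eq_square)
    show ?thesis unfolding 1 p_def e using rj unfolding j by (simp add: field_simps power2_eq_square)
   qed
  qed (use r in simp)
  have "(F hrd (2 * W r * W' r / 2 - c * (1 - c) * (2 * y r * y' r) / 2 +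
   (real (2 * m + 2) * (p * y r * r * (r * y' r)) - (2 * real m - 2) * (p * (y r)^2 * r)) / (2 * real m + 2))) (at r)"
   unfolding F_def[abs_def]
   by (intro DERIV_add DERIV_diff DERIV_cdivide DERIV_cmult dN; rule DERIV_cong[OF DERIV_power[OF W_facts(3)[OF r]]] DERIV_cong[OF DERIV_power[OF dy[OF r]]]; simp)
  moreover have "2 * W r * W' r / 2 - c * (1 - c) * (2 * y r * y' r) / 2 +
   (real (2 * m + 2) * (p * y r * r * (r * y' r)) - (2 * real m - 2) * (p * (y r)^2 * r)) / (2 * real m + 2) = (2 * c * F r + (1 - 2 * c) * (W r)^2) / r"
  proof -
   have a: "r * W' r = - (p * y r) * r^2 + (1 - c) * (W r + c * y r)"
    unfolding W'_def y2p yy[symmetric] by (simp add: algebra_simps power2_eq_square)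
   have m2: "2 * real m + 2 ~= 0" by simp
   let ?P = "p * (y r)^2 * r^2"
   have q: "(2 * real m - 2) / (2 * real m + 2) + 2 * c / (2 * real m + 2) = c"
    unfolding add_divide_distrib[symmetric] nonzero_divide_eq_eq[OF m2] using c_eq by (simp add: algebra_simps)
   have "(2 * W r * W' r / 2 - c * (1 - c) * (2 * y r * y' r) / 2 +
    (real (2 * m + 2) * (p * y r * r * (r * y' r)) - (2 * real m - 2) * (p * (y r)^2 * r)) / (2 * real m + 2)) * r
    = W r * (r * W' r) - c * (1 - c) * y r * (r * y' r) + p * y r * r^2 * (r * y' r) - (2 * real m - 2) / (2 * real m + 2) * ?P"
    using m2 by (simp add: field_simps power2_eq_square)
   also have "... = (1 - c) * (W r)^2 - c\<^sup>2 * (1 - c) * (y r)^2 + (c - (2 * real m - 2) / (2 * real m + 2)) * ?P"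
    unfolding a yy by (simp add: algebra_simps power2_eq_square)
   also have "c - (2 * real m - 2) / (2 * real m + 2) = 2 * c / (2 * real m + 2)" using q by linarith
   also have "(1 - c) * (W r)^2 - c\<^sup>2 * (1 - c) * (y r)^2 + 2 * c / (2 * real m + 2) * ?P = 2 * c * F r + (1 - 2 * c) * (W r)^2"
    unfolding F_def Np by (simp add: diff_divide_distrib add_divide_distrib algebra_simps power2_eq_square)
   finally show ?thesis by (rule eq_divide_imp[OF rj(2)])
  qed
  ultimately show ?thesis by (simp only:)
 qed
 have cF: "cts {r0..R} F" for R
  by (intro continuous_at_imp_continuous_on ballI DERIV_isCont[OF dF]) (use r0 in auto)
 have mono: "F R * exp (- (2 * c * ln R)) <= F r0 * exp (- (2 * c * ln r0))" if "R >= r0" for R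
 proof (rule energy_monotone[OF order_refl that order_refl cF])
  show "cts {r0..R} (%r. 2 * c * ln r)" by (intro continuous_intros) (use r0 in auto)
  fix r assume r: "r0 < r" "r < R"
  hence r1: "r > 1" using r0 by simp
  show "(F hrd (2 * c * F r + (1 - 2 * c) * (W r)^2) / r) (at r)" by (rule dF[OF r1])
  show "((%r. 2 * c * ln r) hrd 2 * c / r) (at r)" using r1 by (auto intro!: derivative_eq_intros)
  have "(1 - 2 * c) * (W r)^2 / r <= 0" using c_bounds(3) r1 by (intro divide_nonpos_pos mult_nonpos_nonneg) auto
  thus "(2 * c * F r + (1 - 2 * c) * (W r)^2) / r <= 2 * c / r * F r" by (simp add: add_divide_distrib)
 qed
 have "eventually (%r. \<bar>W r\<bar> < \<bar>- c * l\<bar> + 1) at_top" using tendsto_rabs[OF W_facts(6)] by (rule order_tendstoD(2)) simp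
 have "((%R. F R * exp (- (2 * c * ln R))) ~~> 0) at_top"
 proof -
  have "((%r. y r ^ (2 * m + 2) / r ^ (2 * m - 2)) ~~> 0) at_top"
  proof (rule tendsto_divide_0[OF tendsto_power[OF lim]])
   show "filterlim (%r::real. r ^ (2 * m - 2)) at_infinity at_top"
    by (intro filterlim_at_top_imp_at_infinity filterlim_pow_at_top filterlim_ident) (use m in simp)
  qed
  moreover have "eventually (%r. y r ^ (2 * m + 2) / r ^ (2 * m - 2) = N r) at_top"
  proof (use eventually_gt_at_top[of 0] in eventually_elim)
   case (elim r)
   have "2 * m - 2 + 2 = 2 * m" using m by simp
   hence "r ^ (2 * m) = r ^ (2 * m - 2) * r^2" by (metis power_add)
   thus ?case using elim by (simp add: N_def)
  qed
  ultimately have N0: "(N ~~> 0) at_top" by (rule Lim_transform_eventually)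
  have "(F ~~> (- c * l)^2 / 2 - c * (1 - c) * l^2 / 2 + 0 / (2 * real m + 2)) at_top"
   unfolding F_def[abs_def] by (intro tendsto_intros W_facts(6) lim N0) auto
  moreover have "((%R. exp (- (2 * c * ln R))) ~~> 0) at_top"
  proof (rule filterlim_compose[OF exp_at_bot])
   have "filterlim (%R. - (2 * c) * ln R) at_bot at_top"
    by (rule filterlim_tendsto_neg_mult_at_bot[OF tendsto_const _ ln_at_top]) (use c_bounds in simp)
   thus "filterlim (%R. - (2 * c * ln R)) at_bot at_top" by simp
  qed
  ultimately show ?thesis using tendsto_mult by fastforce
 qed
 hence "0 <= F r0 * exp (- (2 * c * ln r0))"
  by (rule tendsto_upperbound) (use mono in "auto simp: eventually_at_top_linorder")
 hence F0: "F r0 >= 0" by (simp add: zero_le_mult_iff)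
 have y0: "y r0 ~= 0" using nondegenerate[of r0] W0 r0 by (auto simp: W_def)
 hence cy: "c * (1 - c) * (y r0)^2 > 0" using c_bounds by simp
 \<comment> \<open>At a zero of \<open>W\<close> nonnegativity of \<open>F\<close> is exactly this;
   since \<open>y r0\<close> is nonzero, the factor \<open>m + 1\<close> makes the comparison that
   follows strict.\<close>
 have "N r0 >= (real m + 1) * (c * (1 - c) * (y r0)^2)" using F0 W0 by (simp add: F_def field_simps)
 moreover have "(real m + 1) * (c * (1 - c) * (y r0)^2) > 1 * (c * (1 - c) * (y r0)^2)" using m cy by (intro mult_strict_right_mono) auto
 ultimately have gt: "N r0 > c * (1 - c) * (y r0)^2" by linarith
 have "r0 * (W' r0 * - y r0) = N r0 - (1 - c) * (r0 * y' r0) * y r0"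
  by (simp add: W'_def y2_def N_def power_add power2_eq_square algebra_simps)
 also have "... = N r0 - c * (1 - c) * (y r0)^2" unfolding yy W0 by (simp add: power2_eq_square)
 finally have "r0 * (W' r0 * - y r0) > 0" using gt by simp
 thus ?thesis by (rule zero_less_mult_pos) (use r0 in simp)
qed

end

section \<open>Zeros of the scaling function and of the Jost solution\<close>

context stationary_profile
begin

text \<open>The angle of \<open>(W, y)\<close> increases at zeros of \<open>y\<close>, where
  \<open>y' * W = r * (y')^2\<close>, and at zeros of \<open>W\<close> by
  \<open>W_zero_sign\<close>. Zeros of \<open>W\<close> are counted by the angle shifted by
  \<open>pi / 2\<close>. Just after \<open>1\<close> the functions \<open>y\<close> and
  \<open>W\<close> have equal signs, near infinity opposite ones; by \<open>half_turn_floor\<close>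
  the shift contributes exactly one more zero.\<close>

lemma W_zero_count:
 assumes fin: "finite {r. r > 1 & y r = 0}"
 shows "card {r. r > 1 & W r = 0} = card {r. r > 1 & y r = 0} + 1"
proof -
 let ?s = "y' 1"
 have s0: "?s ~= 0" using nondegenerate[of 1] y1 by simp
 \<comment> \<open>\<open>a\<close> lies before all zeros in \<open>{1<..}\<close>: up to
   \<open>a\<close> both functions have the sign of \<open>y' 1\<close>.\<close>
 obtain a where a: "a > 1" "!!r. 1 < r ==> r <= a ==> y r * ?s > 0 & W r * ?s > 0"
 proof -
  have W1: "W 1 = ?s" by (simp add: W_def y1)
  have ev: "eventually (%r. f r * ?s > 0) (at 1 within {1..})" if "cts {1..} f" "f 1 = ?s" for f :: "real => real"
  proof -
   have "((%r. f r * ?s) ~~> f 1 * ?s) (at 1 within {1..})" using that(1)[unfolded continuous_on_def, THEN bspec, of 1] by (intro tendsto_mult_right) auto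
   thus ?thesis by (rule order_tendstoD(1)) (use s0 that(2) in "auto simp: zero_less_mult_iff")
  qed
  have "eventually (%r. y' r * ?s > 0 & W r * ?s > 0) (at 1 within {1..})"
   using ev[OF cont(2)] ev[OF W_facts(1) W1] by (simp add: eventually_conj)
  then obtain dl where dl: "dl > 0" "!!r. r > 1 ==> dist r 1 < dl ==> y' r * ?s > 0 & W r * ?s > 0"
   by (auto simp: eventually_at)
  have "y r * ?s > 0" if r: "1 < r" "r < 1 + dl" for r
  proof -
   have d: "y differentiable (at x)" if "1 < x" for x using dy[OF that] real_differentiable_def by blast
   obtain D z where z: "1 < z" "z < r" "(y hrd D) (at z)" "y r - y 1 = (r - 1) * D"
    using MVT[OF r(1), of y] continuous_on_subset[OF cont(1), of "{1..r}"] d by auto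
   hence "y r = (r - 1) * y' z" using DERIV_unique[OF z(3) dy[OF z(1)]] y1 by simp
   note z = z(1,2) this
   have "y' z * ?s > 0" using dl(2)[of z] z r by (auto simp: dist_real_def)
   moreover have "y r * ?s = (r - 1) * (y' z * ?s)" using z by simp
   ultimately show ?thesis using r by (simp only: mult_pos_pos diff_gt_0_iff_gt)
  qed
  thus ?thesis using that[of "1 + dl / 2"] dl by (auto simp: dist_real_def)
 qed
 obtain R where R: "R > a" "!!r. r >= R ==> y r > 0 & W r < 0"
 proof -
  have "eventually (%r. y r > 0 & W r < 0) at_top"
   using order_tendstoD(1)[OF lim l] order_tendstoD(2)[OF W_facts(6), of 0] c_bounds l by (auto intro!: eventually_conj simp: mult_pos_pos)
  then obtain R0 where "!!r. r >= R0 ==> y r > 0 & W r < 0" by (auto simp: eventually_at_top_linorder)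
  thus ?thesis using that[of "max R0 (a + 1)"] by auto
 qed
 have cZ: "cts {a..R} (%r. Complex (W r) (y r))" unfolding Complex_eq
  by (intro continuous_intros continuous_on_subset[OF W_facts(1)] continuous_on_subset[OF cont(1)]) (use a in auto)
 have nz: "Complex (W r) (y r) ~= 0" if "r : {a..R}" for r
  using nondegenerate[of r] that a by (auto simp: complex_eq_iff W_def)
 obtain g where g: "cts {a..R} g" "!!r. r : {a..R} ==> Complex (W r) (y r) = exp (g r)"
  by (rule continuous_logarithm_on_contractible[OF cZ convex_imp_contractible nz]) auto
 define th where "th r = Im (g r)" for r
 let ?rh = "%r. exp (Re (g r))"
 have cth: "cts {a..R} th" unfolding th_def[abs_def] by (intro continuous_intros g(1))
 have xy: "W r = ?rh r * cos (th r)" "y r = ?rh r * sin (th r)" if "r : {a..R}" for r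
  using arg_cong[OF g(2)[OF that], of Re] arg_cong[OF g(2)[OF that], of Im] by (simp_all add: Re_exp Im_exp th_def)
 have aR: "a <= R" "a : {a..R}" "R : {a..R}" using R(1) by auto
 have ya: "y a ~= 0" "W a ~= 0" "y R ~= 0" "W R ~= 0" using a(2)[OF a(1) order_refl] R(2)[OF order_refl] by auto
 have 1: "int (card {t : {a..R}. y t = 0}) = \<lfloor>th R / pi\<rfloor> - \<lfloor>th a / pi\<rfloor>"
 proof (rule angle_crossing(2)[OF aR(1) cth exp_gt_zero xy(1) xy(2) ya(1) ya(3)])
  fix t assume t: "t : {a..R}" "y t = 0"
  hence t1: "t > 1" using a by auto
  have "y' t * W t = t * (y' t)^2" using t by (simp add: W_def power2_eq_square)
  hence "y' t * W t > 0" using nondegenerate[of t] t t1 by simp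
  from simple_zero_sign[OF dy[OF t1] this t(2)]
  show "EX dl>0. ALL s:{a..R}. s ~= t & \<bar>s - t\<bar> < dl --> W t * y s * (s - t) > 0" .
 qed
 have 2: "int (card {t : {a..R}. W t = 0}) = \<lfloor>(th R + pi / 2) / pi\<rfloor> - \<lfloor>(th a + pi / 2) / pi\<rfloor>"
 proof (rule angle_crossing(2)[OF aR(1) _ exp_gt_zero _ _ ya(2) ya(4)])
  show "cts {a..R} (%r. th r + pi / 2)" by (intro continuous_intros cth)
  show "- y t = ?rh t * cos (th t + pi / 2)" "W t = ?rh t * sin (th t + pi / 2)" if "t : {a..R}" for t
   using xy[OF that] by (simp_all add: cos_add sin_add)
  fix t assume t: "t : {a..R}" "W t = 0"
  hence t1: "t > 1" using a by auto
  from simple_zero_sign[OF W_facts(3)[OF t1] W_zero_sign[OF t1 t(2)] t(2)]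
  show "EX dl>0. ALL s:{a..R}. s ~= t & \<bar>s - t\<bar> < dl --> - y t * W s * (s - t) > 0" .
 qed
 have sc: "y r * W r = (?rh r)^2 * (sin (th r) * cos (th r))" if "r : {a..R}" for r
  using xy[OF that] by (simp add: power2_eq_square)
 have "(y a * ?s) * (W a * ?s) > 0" using a(2)[OF a(1) order_refl] mult_pos_pos[of "y a * ?s" "W a * ?s"] by simp
 hence "?s^2 * (y a * W a) > 0" by (simp add: power2_eq_square mult_ac)
 hence "y a * W a > 0" by (rule zero_less_mult_pos) (use s0 in simp)
 hence A: "sin (th a) * cos (th a) > 0" unfolding sc[OF aR(2)] by (rule zero_less_mult_pos) simp
 have "0 < - (y R * W R)" using R(2)[OF order_refl] by (simp add: mult_pos_neg)
 hence "0 < (?rh R)^2 * - (sin (th R) * cos (th R))" unfolding sc[OF aR(3)] by simp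
 hence B: "- (sin (th R) * cos (th R)) > 0" by (rule zero_less_mult_pos) simp
 have f: "\<lfloor>(th a + pi / 2) / pi\<rfloor> = \<lfloor>th a / pi\<rfloor>" "\<lfloor>(th R + pi / 2) / pi\<rfloor> = \<lfloor>th R / pi\<rfloor> + 1"
  using half_turn_floor[OF less_imp_neq[OF A, symmetric]] half_turn_floor[OF less_imp_neq[of "sin (th R) * cos (th R)" 0]] A B
  by simp_all
 have in1: "r : {a..R}" if "r > 1" "y r = 0 | W r = 0" for r
 proof (rule ccontr)
  assume "r ~: {a..R}"
  hence "r <= a | r >= R" by auto
  thus False using a(2)[of r] R(2)[of r] that by auto
 qed
 have "{t : {a..R}. y t = 0} = {r. r > 1 & y r = 0}" "{t : {a..R}. W t = 0} = {r. r > 1 & W r = 0}"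
  using in1 a(1) by (auto simp del: atLeastAtMost_iff) auto
 thus ?thesis using 1 2 unfolding f by simp
qed

text \<open>At energy zero the Wronskian of the Jost solution and \<open>W\<close> is constant, and
  it tends to zero because both functions have limits while \<open>jp 0\<close> and
  \<open>W'\<close> tend to zero. So the two are proportional.\<close>

lemma jost_zeros:
 assumes "potential V M"
 shows "potential.jost V M 0 1 ~= 0" "r > 1 ==> potential.jost V M 0 r = 0 \<longleftrightarrow> W r = 0"
proof -
 interpret potential V M by (rule assms)
 have oR: "((%x. cx (f x)) hvd cx D) (at r)" if "(f hrd D) (at r)" for f D r
  using bounded_linear.has_vector_derivative[OF bounded_linear_of_real] that by (simp add: has_real_derivative_iff_has_vector_derivative)
 have s: "solution 0 (%r. cx (W r)) (%r. cx (W' r))"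
  unfolding solution_def using oR[OF W_facts(3)] oR[OF W_facts(4)] by (auto intro!: continuous_intros W_facts(1,2))
 note js = jost_solution[of 0, simplified]
 let ?F = "%r. jost 0 r * W' r - jost' 0 r * W r"
 have const: "?F r = ?F 1" if "r >= 1" for r by (rule solution_wronskian[OF js s that])
 have j0: "jost 0 = jm 0" "jost' 0 = jp 0" by (auto simp: jost_def jost'_def)
 have "(jp 0 ~~> 0) at_top"
 proof (rule Lim_null_comparison)
  show "\<forall>\<^sub>F r in at_top. norm (jp 0 r) <= 2 * exp M / r"
   using eventually_ge_at_top[of 1]
  proof eventually_elim
   case (elim r)
   have "norm (jp 0 r) <= 2 / r^2 * wt r" using jp_facts(2)[of 0 r] elim by simp
   also have "... <= 2 / r * exp M" using elim wt_le[OF elim] by (intro mult_mono divide_left_mono) (auto simp: power2_eq_square mult_le_cancel_left1 intro: order_trans[OF _ less_imp_le[OF wt_pos]])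
   finally show ?case by simp
  qed
  show "((%r. 2 * exp M / r) ~~> 0) at_top"
   by (intro tendsto_divide_0[OF tendsto_const] filterlim_at_top_imp_at_infinity filterlim_ident)
 qed
 hence "(?F ~~> 1 * cx 0 - 0 * cx (- c * l)) at_top"
  unfolding j0 by (intro tendsto_intros jm_tendsto W_facts(6,7)) auto
 moreover have "(?F ~~> ?F 1) at_top"
  by (rule tendsto_eventually, rule eventually_mono[OF eventually_ge_at_top[of 1] const])
 ultimately have F1: "?F 1 = 0" using tendsto_unique[of at_top ?F "?F 1" 0] by simp
 have F: "jost 0 r * W' r = jost' 0 r * W r" if "r >= 1" for r using const[OF that] F1 by simp
 show "jost 0 1 ~= 0" using F[of 1] jost_data_nonzero[of 0 1] W_facts(5) by auto
 show "jost 0 r = 0 \<longleftrightarrow> W r = 0" if "r > 1"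
 proof
  assume "jost 0 r = 0"
  thus "W r = 0" using F[of r] jost_data_nonzero[of 0 r] that by auto
 next
  assume "W r = 0"
  moreover have "W' r ~= 0" using W_zero_sign[OF that \<open>W r = 0\<close>] by auto
  ultimately show "jost 0 r = 0" using F[of r] that by auto
 qed
qed

end

section \<open>The profile of the given stationary solution and the conclusion\<close>

lemma has_weak_laplacian_of_real:
 assumes "has_weak_laplacian U f w"
 shows "has_weak_laplacian U (%x. cx (f x)) (%x. cx (w x))"
proof -
 have *: "(LINT x|leb. a x *R cx (h x)) = cx (LINT x|leb. a x *R h x)" for a h :: "'a => real"
  by (simp add: scaleR_conv_of_real flip: of_real_mult integral_complex_of_real)
 show ?thesis using assms unfolding has_weak_laplacian_iff *
  by (auto intro: loc_integrable_linear[OF bounded_linear_of_real])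
qed

lemma Qk_profile:
 assumes m: "m > 2" and Q: "is_Qk m k Q"
 obtains y y' l where "stationary_profile m y y' l" "!!x. x : Omega ==> Q x = y (norm x) / norm x"
  "finite {r. r > 1 & y r = 0}" "card {r. r > 1 & y r = 0} = k"
proof -
 obtain q l where q: "!!x. x : Omega ==> Q x = q (norm x)" "finite {r. r > 1 & q r = 0}" "card {r. r > 1 & q r = 0} = k"
  "l > 0" "((%r. r * q r) ~~> l) at_top" and S: "stationary_solution m Q" using Q by (auto simp: is_Qk_def)
 have cQ: "cts (closure Omega) Q" and wQ: "has_weak_laplacian Omega Q (%x. - (Q x ^ (2 * m + 1)))"
  and bQ: "ALL x:frontier Omega. Q x = 0" using S by (auto simp: stationary_solution_def)
 let ?a = "axis 1 1 :: real^3"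
 have cl: "closure Omega = {x. norm x >= 1}" and fr: "frontier Omega = {x. norm x = 1}"
  by (auto simp: Omega_def closure_complement frontier_complement interior_cball frontier_cball not_less)
 \<comment> \<open>Read off from \<open>Q\<close> along an axis, so that \<open>y\<close> inherits
   continuity up to \<open>1\<close>; the function \<open>q\<close> is tied to \<open>Q\<close> in
   \<open>Omega\<close> only.\<close>
 define y where "y r = r * Q (r *R ?a)" for r
 have cy: "cts {1..} y" unfolding y_def[abs_def]
  by (intro continuous_intros continuous_on_compose2[OF cQ]) (auto simp: cl norm_axis_1)
 have yq: "y r = r * q r" if "r > 1" for r using q(1)[of "r *R ?a"] that by (simp add: y_def Omega_iff norm_axis_1)
 have Qy: "Q x = y (norm x) / norm x" if "x : Omega" for x using q(1)[OF that] yq[of "norm x"] that by (cases "x = 0") (auto simp: Omega_iff)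
 let ?ph = "%r. cx (y r)" and ?g = "%r. cx (- (y r ^ (2 * m + 1) / r ^ (2 * m)))"
 have "has_weak_laplacian Omega (emb ?ph) (emb ?g)"
 proof (rule has_weak_laplacian_cong_AE[OF has_weak_laplacian_of_real[OF wQ]])
  show "AE x in leb. x : Omega --> cx (Q x) = emb ?ph x"
   by (intro AE_I2) (simp add: Qy emb_def scaleR_conv_of_real divide_inverse mult.commute)
  show "AE x in leb. x : Omega --> cx (- (Q x ^ (2 * m + 1))) = emb ?g x"
   by (intro AE_I2) (auto simp: Qy emb_def scaleR_conv_of_real power_divide divide_inverse power_mult_distrib power_inverse mult_ac)
 qed
 moreover have "cts {1..} ?ph" "cts {1..} ?g" by (intro continuous_intros cy; auto)+
 ultimately obtain ph' where ph': "cts {1..} ph'" "!!r. r > 1 ==> (?ph hvd ph' r) (at r)"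
  "!!r. r > 1 ==> (ph' hvd ?g r) (at r)" using radial_weak_solution_C2[of ?ph ?g] by blast
 note Re = bounded_linear.has_vector_derivative[OF bounded_linear_Re]
 have "stationary_profile m y (%r. Re (ph' r)) l"
 proof
  show "cts {1..} (%r. Re (ph' r))" by (intro continuous_intros ph'(1))
  show "(y hrd Re (ph' r)) (at r)" if "r > 1" for r
   using Re[OF ph'(2)[OF that]] by (simp add: has_real_derivative_iff_has_vector_derivative)
  show "((%r. Re (ph' r)) hrd - (y r ^ (2 * m + 1) / r ^ (2 * m))) (at r)" if "r > 1" for r
   using Re[OF ph'(3)[OF that]] unfolding has_real_derivative_iff_has_vector_derivative Re_complex_of_real .
  show "y 1 = 0" using bQ by (simp add: y_def fr norm_axis_1)
  show "(y ~~> l) at_top"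
   by (rule Lim_transform_eventually[OF q(5)]) (rule eventually_mono[OF eventually_gt_at_top[of 1]], simp add: yq)
 qed (use m cy q(4) in auto)
 moreover have "{r. r > 1 & y r = 0} = {r. r > 1 & q r = 0}" using yq by auto
 ultimately show ?thesis using that Qy q(2,3) by simp
qed

theorem theorem1p2:
  fixes m k :: nat and Q :: "real^3 \<Rightarrow> real"
  assumes "m > 2"
    and "is_Qk m k Q"
  shows "essential_spectrum lin_domain (lin_op m Q) = complex_of_real ` {0..} \<and>
         (\<nexists>h. zero_energy_state m Q h) \<and>
         card {\<mu>::real. \<mu> < 0 \<and> complex_of_real \<mu> \<in> eigenvalues lin_domain (lin_op m Q)} = k + 1 \<and>
         (\<forall>\<mu>::real. \<mu> < 0 \<and> complex_of_real \<mu> \<in> eigenvalues lin_domain (lin_op m Q) \<longrightarrow>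
            simple_eigenvalue lin_domain (lin_op m Q) (complex_of_real \<mu>))"
proof -
 obtain y y' l where p: "stationary_profile m y y' l" and Qy: "!!x. x : Omega ==> Q x = y (norm x) / norm x"
  and fin: "finite {r. r > 1 & y r = 0}" and card: "card {r. r > 1 & y r = 0} = k"
  using Qk_profile[OF assms] by blast
 interpret stationary_profile m y y' l by (rule p)
 obtain M where M: "potential V M" using potential_V by blast
 interpret schroedinger V M "lin_op m Q"
 proof (intro schroedinger.intro schroedinger_axioms.intro M)
  show "lin_op m Q f x = - weak_laplacian Omega f x - cx (V (norm x)) * f x" if "x : Omega" for x f
   by (simp add: lin_op_def V_def Qy[OF that])
 qed
 note j = jost_zeros[OF M]
 have "{r. r > 1 & jost 0 r = 0} = {r. r > 1 & W r = 0}" using j(2) by blast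
 hence n: "card {ka::real. ka > 0 & jost (cx ka) 1 = 0} = k + 1"
  using eigenvalue_count(2)[OF j(1)] W_zero_count[OF fin] card by simp
 note sp = spectral_conclusion[OF eigenvalue_count(1)[OF j(1)]]
 have "~ zero_energy_state m Q h" for h
  using no_zero_energy_state[OF j(1)] unfolding zero_energy_state_def by blast
 thus ?thesis using sp n by simp
qed

end
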